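(* Let $Z_1^{(0)},Z_2^{(0)},\dots$ be i.i.d. from a distribution $D_{Z^{(0)}}$, with $Z_i^{(0)}=(Y_i,X_i)$. Fix a test point $x$ and let $\tilde F^{(0)}(x)=\binom{n}{k_n}^{-1}\sum_{|I|=k_n}T(x;Z^{(0)}_I)$ and $\tilde F^{(1)}(x)=\binom{n}{k_n}^{-1}\sum_{|I|=k_n}T(x;\check Z^{(1)}_I)$ be the first and second stage random forests constructed on all possible subsets $I\subseteq[n]$ of size $k_n$, with the noise-free residual data $\check Z^{(1)}$ and other notation as in the context. Assume: (1) $\mathbb E[T(x;Z^{(0)}_1,\dots,Z^{(0)}_{k_n})]=\mathbb E[T(x;\check Z^{(1)}_1,\dots,\check Z^{(1)}_{k_n})]=0$; (2) there is $C<\infty$ with $\mathbb E\,T^4(x;Z_1,\dots,Z_{k_n})\le C$ for all $x$ and $n$, both for $Z=Z^{(0)}$ and $Z=\check Z^{(1)}$; (3) $\lim_{n\to\infty}\zeta^{(0)}_{1,k_n}/\zeta^{(1)}_{1,k_n}\in(0,\infty)$; (4) $\dfrac{\hat F^{(1)}(x)-\check F^{(1)}(x)}{\sqrt{\mathrm{var}(\hat F^{(1)}(x))}}\to 0$ in probability; (5) for $j=0,1$, with $T^{(j)}_{1,k_n}(z)=\mathbb E[T(x;z,Z^{(j)}_2,\dots,Z^{(j)}_{k_n})]$ (where $Z^{(1)}$ means $\check Z^{(1)}$), for all $\delta>0$, $\lim_{n\to\infty}\frac1{\zeta^{(j)}_{1,k_n}}\mathbb E\left[(T^{(j)}_{1,k_n}(Z^{(j)}_1))^2\,\mathbf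 1\{|T^{(j)}_{1,k_n}(Z_1^{(j)})|>\delta\sqrt{n\,\zeta^{(j)}_{1,k_n}}\}\right]=0$; (6) $k_n,B_n\to\infty$, $k_n/n\to0$, $n/B_n\to0$, and $\lim_{n\to\infty}\frac{k_n\zeta^{(0)}_{1,k_n}}{\zeta^{(0)}_{k_n,k_n}}\ne0$, $\lim_{n\to\infty}\frac{k_n\zeta^{(1)}_{1,k_n}}{\zeta^{(1)}_{k_n,k_n}}\neq0$. Then, for some sequence of $2\times2$ covariance matrices $\Sigma_n$, $$\Sigma_n^{-1/2}\begin{pmatrix}\tilde F^{(0)}(x)\\ \tilde F^{(1)}(x)\end{pmatrix}\xrightarrow{\ \mathcal D\ }\mathcal N(\mathbf 0,\mathbf I_2),$$ and $\Sigma_n$ is consistently estimated (in the sense that $\Sigma_n^{-1}\hat\Sigma_{IJ}\to\mathbf I_2$ in probability) by the infinitesimal Jackknife covariance matrix estimator $$\hat\Sigma_{IJ}=\sum_{i=1}^n\begin{pmatrix}\mathrm{cov}_*[N^{(0)}_{i,b},T^{(0)}_b(x)]\\ \mathrm{cov}_*[N^{(1)}_{i,b},T^{(1)}_b(x)]\end{pmatrix}\begin{pmatrix}\mathrm{cov}_*[N^{(0)}_{i,b},T^{(0)}_b(x)]\\ \mathrm{cov}_*[N^{(1)}_{i,b},T^{(1)}_b(x)]\end{pmatrix}^\top.$$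
   Context: Data: $Z_i^{(0)}=(Y_i,X_i)$, $i=1,\dots,n$, where $Y_i$ is a real response and $X_i$ a covariate vector. $T(x;z_1,\dots,z_k)$ is the tree function: a real-valued function, symmetric in the data points, giving the prediction at $x$ of a tree trained on $z_1,\dots,z_k$. For $I\subseteq[n]=\{1,\dots,n\}$, $|I|=k$, $T(x;Z_I)$ is $T$ evaluated at $(Z_i)_{i\in I}$. Weighted forests: for $j=0,1$, $(w_I^{(j)})_{|I|=k_n}$ are i.i.d. over $I$, independent of the data, equal to $\binom{n}{k_n}/B_n$ with probability $B_n/\binom{n}{k_n}$ and $0$ otherwise; the two families are independent of each other. $\hat F^{(0)}(x)=\binom{n}{k_n}^{-1}\sum_{|I|=k_n}w_I^{(0)}T(x;Z_I^{(0)})$; $\hat F^{(1)}(x)=\binom{n}{k_n}^{-1}\sum_{|I|=k_n}w_I^{(1)}T(x;Z_I^{(1)})$ with actual residuals $Z_i^{(1)}=(Y_i-\hat F^{(0)}(X_i),X_i)$; $\check F^{(1)}(x)=\binom{n}{k_n}^{-1}\sum_{|I|=k_n}w_I^{(1)}T(x;\check Z_I^{(1)})$ with noise-free residuals $\check Z_i^{(1)}=(Y_i-m_n(X_i),X_i)$, $m_n(u)=\mathbb E[\hat F^{(0)}(u)]$ (a deterministic function, so $\check Z_i^{(1)}$ is a fixed function of $Z_i^{(0)}$). Quantities $\zeta$: $\zeta^{(j)}_{1,k}=\mathrm{var}\big(T^{(j)}_{1,k}(Z_1^{(j)})\big)$ and $\zeta^{(j)}_{k,k}=\mathrm{var}\big(T(x;Z^{(j)}_1,\dots,Z^{(j)}_k)\big)$,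 where $Z^{(1)}$ stands for $\check Z^{(1)}$; $\zeta^{(j)}_{1,k_n}>0$ is assumed. Estimator: in stage $j\in\{0,1\}$, subsets $I_1^{(j)},\dots,I_{B_n}^{(j)}$ of $[n]$ of size $k_n$ are drawn independently and uniformly at random, independently of the data and of the other stage. $T_b^{(0)}(x)=T(x;Z^{(0)}_{I_b^{(0)}})$, $T_b^{(1)}(x)=T(x;\check Z^{(1)}_{I_b^{(1)}})$, $N_{i,b}^{(j)}=\mathbf 1\{i\in I_b^{(j)}\}$, and $\mathrm{cov}_*$ is the empirical covariance over $b=1,\dots,B_n$.
   Formalization: Added assumption: the correlation of the two complete forests at x is bounded in absolute value by some r < 1 for all large n; without it the claim fails, e.g. when trees ignore the responses, so that both forests coincide and no invertible normalisation gives N(0, I_2). *)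

theory Defs
  imports "HOL-Probability.Probability" "HOL-Library.Ramsey"
begin

section \<open>Moments and modes of convergence\<close>

definition expec :: "'w measure \<Rightarrow> ('w \<Rightarrow> real) \<Rightarrow> real" where
  "expec M U = (\<integral>\<omega>. U \<omega> \<partial>M)"

definition cov :: "'w measure \<Rightarrow> ('w \<Rightarrow> real) \<Rightarrow> ('w \<Rightarrow> real) \<Rightarrow> real" where
  "cov M U V = expec M (\<lambda>\<omega>. (U \<omega> - expec M U) * (V \<omega> - expec M V))"

abbreviation var :: "'w measure \<Rightarrow> ('w \<Rightarrow> real) \<Rightarrow> real" where
  "var M U \<equiv> cov M U U"

definition tendsto_in_prob ::
    "'w measure \<Rightarrow> (nat \<Rightarrow> 'w \<Rightarrow> 'b::metric_space) \<Rightarrow> 'b \<Rightarrow> bool" where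
  "tendsto_in_prob M U c \<longleftrightarrow>
     (\<forall>\<epsilon>>0. (\<lambda>n. measure M {\<omega> \<in> space M. dist (U n \<omega>) c > \<epsilon>}) \<longlonglongrightarrow> 0)"

text \<open>The library's \<open>weak_conv\<close> only covers laws on the real line, so weak convergence on
  other spaces is defined through bounded continuous test functions.\<close>

definition tendsto_in_distribution ::
    "'w measure \<Rightarrow> (nat \<Rightarrow> 'w \<Rightarrow> 'b::topological_space) \<Rightarrow> 'b measure \<Rightarrow> bool" where
  "tendsto_in_distribution M U N \<longleftrightarrow>
     (\<forall>f :: 'b \<Rightarrow> real. continuous_on UNIV f \<longrightarrow> bounded (range f) \<longrightarrow>
        (\<lambda>n. \<integral>v. f v \<partial>distr M borel (U n)) \<longlonglongrightarrow> (\<integral>v. f v \<partial>N))"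

definition std_normal_vec :: "(real ^ 'n) measure" where
  "std_normal_vec = density lborel (\<lambda>v. ennreal (\<Prod>i\<in>UNIV. std_normal_density (v $ i)))"

section \<open>Covariance matrices\<close>

definition pos_semidef :: "real ^ 'n ^ 'n \<Rightarrow> bool" where
  "pos_semidef A \<longleftrightarrow> transpose A = A \<and> (\<forall>v. v \<bullet> (A *v v) \<ge> 0)"

definition mat_sqrt :: "real ^ 'n ^ 'n \<Rightarrow> real ^ 'n ^ 'n" where
  "mat_sqrt A = (THE R. pos_semidef R \<and> R ** R = A)"

definition outer :: "real ^ 'n \<Rightarrow> real ^ 'n \<Rightarrow> real ^ 'n ^ 'n" where
  "outer u v = (\<chi> i j. u $ i * v $ j)"

section \<open>Trees and forests\<close>

text \<open>A tree function is symmetric in its data points, so it takes a multiset of data points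
  \<open>(response, covariate)\<close>; the size of the multiset is the number \<open>k\<close> of arguments.\<close>

type_synonym 'a tree_fun = "'a \<Rightarrow> (real \<times> 'a) multiset \<Rightarrow> real"

definition measurable_tree :: "'a::euclidean_space tree_fun \<Rightarrow> bool" where
  "measurable_tree T \<longleftrightarrow>
     (\<forall>m::nat. (\<lambda>(u, z). T u {#z i. i \<in># mset_set {1..m}#})
            \<in> borel_measurable (borel \<Otimes>\<^sub>M Pi\<^sub>M {1..m} (\<lambda>_. borel)))"

definition tree_on :: "'a tree_fun \<Rightarrow> 'a \<Rightarrow> (nat \<Rightarrow> real \<times> 'a) \<Rightarrow> nat set \<Rightarrow> real" where
  "tree_on T u z I = T u {#z i. i \<in># mset_set I#}"

definition weighted_forest ::
    "'a tree_fun \<Rightarrow> nat \<Rightarrow> nat \<Rightarrow> (nat set \<Rightarrow> real) \<Rightarrow> (nat \<Rightarrow> real \<times> 'a) \<Rightarrow> 'a \<Rightarrow> real" where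
  "weighted_forest T n k w z u =
     (\<Sum>I\<in>nsets {1..n} k. w I * tree_on T u z I) / real (n choose k)"

definition full_forest ::
    "'a tree_fun \<Rightarrow> nat \<Rightarrow> nat \<Rightarrow> (nat \<Rightarrow> real \<times> 'a) \<Rightarrow> 'a \<Rightarrow> real" where
  "full_forest T n k z u = (\<Sum>I\<in>nsets {1..n} k. tree_on T u z I) / real (n choose k)"

definition residual :: "('a \<Rightarrow> real) \<Rightarrow> real \<times> 'a \<Rightarrow> real \<times> 'a" where
  "residual f z = (fst z - f (snd z), snd z)"

text \<open>In what follows \<open>k n\<close> is the subsample size, \<open>Z i\<close> is the \<open>i\<close>-th original data point,
  and \<open>w j n I\<close> is the random weight of the subset \<open>I\<close> in the stage-\<open>j\<close> forest on \<open>n\<close> points.\<close>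

definition Fhat0 :: "'a tree_fun \<Rightarrow> (nat \<Rightarrow> nat) \<Rightarrow> (nat \<Rightarrow> nat \<Rightarrow> nat set \<Rightarrow> 'w \<Rightarrow> real) \<Rightarrow>
    (nat \<Rightarrow> 'w \<Rightarrow> real \<times> 'a) \<Rightarrow> nat \<Rightarrow> 'a \<Rightarrow> 'w \<Rightarrow> real" where
  "Fhat0 T k w Z n u \<omega> = weighted_forest T n (k n) (\<lambda>I. w 0 n I \<omega>) (\<lambda>i. Z i \<omega>) u"

definition mean_Fhat0 :: "'w measure \<Rightarrow> 'a tree_fun \<Rightarrow> (nat \<Rightarrow> nat) \<Rightarrow>
    (nat \<Rightarrow> nat \<Rightarrow> nat set \<Rightarrow> 'w \<Rightarrow> real) \<Rightarrow> (nat \<Rightarrow> 'w \<Rightarrow> real \<times> 'a) \<Rightarrow> nat \<Rightarrow> 'a \<Rightarrow> real" where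
  "mean_Fhat0 M T k w Z n u = expec M (Fhat0 T k w Z n u)"

text \<open>Training data of stage \<open>j\<close>: the original data for \<open>j = 0\<close> and the noise-free residuals
  for \<open>j = 1\<close>.\<close>

definition stage_data :: "'w measure \<Rightarrow> 'a tree_fun \<Rightarrow> (nat \<Rightarrow> nat) \<Rightarrow>
    (nat \<Rightarrow> nat \<Rightarrow> nat set \<Rightarrow> 'w \<Rightarrow> real) \<Rightarrow> (nat \<Rightarrow> 'w \<Rightarrow> real \<times> 'a) \<Rightarrow>
    nat \<Rightarrow> nat \<Rightarrow> nat \<Rightarrow> 'w \<Rightarrow> real \<times> 'a" where
  "stage_data M T k w Z j n i \<omega> =
     (if j = 0 then Z i \<omega> else residual (mean_Fhat0 M T k w Z n) (Z i \<omega>))"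

definition Fhat1 :: "'a tree_fun \<Rightarrow> (nat \<Rightarrow> nat) \<Rightarrow> (nat \<Rightarrow> nat \<Rightarrow> nat set \<Rightarrow> 'w \<Rightarrow> real) \<Rightarrow>
    (nat \<Rightarrow> 'w \<Rightarrow> real \<times> 'a) \<Rightarrow> nat \<Rightarrow> 'a \<Rightarrow> 'w \<Rightarrow> real" where
  "Fhat1 T k w Z n u \<omega> =
     weighted_forest T n (k n) (\<lambda>I. w 1 n I \<omega>)
       (\<lambda>i. residual (\<lambda>v. Fhat0 T k w Z n v \<omega>) (Z i \<omega>)) u"

definition Fcheck1 :: "'w measure \<Rightarrow> 'a tree_fun \<Rightarrow> (nat \<Rightarrow> nat) \<Rightarrow>
    (nat \<Rightarrow> nat \<Rightarrow> nat set \<Rightarrow> 'w \<Rightarrow> real) \<Rightarrow> (nat \<Rightarrow> 'w \<Rightarrow> real \<times> 'a) \<Rightarrow>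
    nat \<Rightarrow> 'a \<Rightarrow> 'w \<Rightarrow> real" where
  "Fcheck1 M T k w Z n u \<omega> =
     weighted_forest T n (k n) (\<lambda>I. w 1 n I \<omega>) (\<lambda>i. stage_data M T k w Z 1 n i \<omega>) u"

definition Ftilde :: "'w measure \<Rightarrow> 'a tree_fun \<Rightarrow> (nat \<Rightarrow> nat) \<Rightarrow>
    (nat \<Rightarrow> nat \<Rightarrow> nat set \<Rightarrow> 'w \<Rightarrow> real) \<Rightarrow> (nat \<Rightarrow> 'w \<Rightarrow> real \<times> 'a) \<Rightarrow>
    nat \<Rightarrow> nat \<Rightarrow> 'a \<Rightarrow> 'w \<Rightarrow> real" where
  "Ftilde M T k w Z j n u \<omega> = full_forest T n (k n) (\<lambda>i. stage_data M T k w Z j n i \<omega>) u"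

section \<open>Projections and variance components of a tree\<close>

text \<open>Here \<open>V 1, V 2, \<dots>\<close> are the random training points and \<open>k\<close> is a fixed subsample size.\<close>

definition tree_proj :: "'w measure \<Rightarrow> 'a tree_fun \<Rightarrow> 'a \<Rightarrow> nat \<Rightarrow> (nat \<Rightarrow> 'w \<Rightarrow> real \<times> 'a) \<Rightarrow>
    real \<times> 'a \<Rightarrow> real" where
  "tree_proj M T u k V z =
     expec M (\<lambda>\<omega>. T u (add_mset z {#V i \<omega>. i \<in># mset_set {2..k}#}))"

definition zeta_one :: "'w measure \<Rightarrow> 'a tree_fun \<Rightarrow> 'a \<Rightarrow> nat \<Rightarrow> (nat \<Rightarrow> 'w \<Rightarrow> real \<times> 'a) \<Rightarrow>
    real" where
  "zeta_one M T u k V = var M (\<lambda>\<omega>. tree_proj M T u k V (V 1 \<omega>))"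

definition zeta_full :: "'w measure \<Rightarrow> 'a tree_fun \<Rightarrow> 'a \<Rightarrow> nat \<Rightarrow> (nat \<Rightarrow> 'w \<Rightarrow> real \<times> 'a) \<Rightarrow>
    real" where
  "zeta_full M T u k V = var M (\<lambda>\<omega>. tree_on T u (\<lambda>i. V i \<omega>) {1..k})"

section \<open>Random weights and random subsamples\<close>

text \<open>The library's \<open>indep_var\<close> needs both random variables to have the same value type.\<close>

definition indep_rvs :: "'w measure \<Rightarrow> 'b measure \<Rightarrow> ('w \<Rightarrow> 'b) \<Rightarrow> 'c measure \<Rightarrow> ('w \<Rightarrow> 'c) \<Rightarrow>
    bool" where
  "indep_rvs M N U N' U' \<longleftrightarrow>
     U \<in> measurable M N \<and> U' \<in> measurable M N' \<and>
     prob_space.indep_set M {U -` A \<inter> space M |A. A \<in> sets N} {U' -` A \<inter> space M |A. A \<in> sets N'}"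

text \<open>Weights for sample size \<open>n\<close>. The two stages are indexed jointly, so that the
  \<open>indep_vars\<close> condition covers independence within and between the two families; the last
  condition is independence from the data \<open>Z 1, \<dots>, Z n\<close>. The two point probabilities add up
  to \<open>1\<close> and force \<open>1 \<le> B \<le> n choose k\<close>.\<close>

definition forest_weights :: "'w measure \<Rightarrow> (nat \<Rightarrow> 'w \<Rightarrow> real \<times> 'a::euclidean_space) \<Rightarrow>
    nat \<Rightarrow> nat \<Rightarrow> nat \<Rightarrow> (nat \<Rightarrow> nat set \<Rightarrow> 'w \<Rightarrow> real) \<Rightarrow> bool" where
  "forest_weights M Z n k B w \<longleftrightarrow>
     prob_space.indep_vars M (\<lambda>_. borel) (\<lambda>(j, I). w j I) ({0, 1} \<times> nsets {1..n} k) \<and>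
     (\<forall>j\<in>{0, 1}. \<forall>I\<in>nsets {1..n} k.
        measure M {\<omega> \<in> space M. w j I \<omega> = real (n choose k) / real B}
          = real B / real (n choose k) \<and>
        measure M {\<omega> \<in> space M. w j I \<omega> = 0} = 1 - real B / real (n choose k)) \<and>
     indep_rvs M
       (Pi\<^sub>M {1..n} (\<lambda>_. borel)) (\<lambda>\<omega>. \<lambda>i\<in>{1..n}. Z i \<omega>)
       (Pi\<^sub>M ({0, 1} \<times> nsets {1..n} k) (\<lambda>_. borel))
       (\<lambda>\<omega>. \<lambda>(j, I)\<in>{0, 1} \<times> nsets {1..n} k. w j I \<omega>)"

definition uniform_draws :: "'w measure \<Rightarrow> (nat \<Rightarrow> 'w \<Rightarrow> real \<times> 'a::euclidean_space) \<Rightarrow>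
    nat \<Rightarrow> nat \<Rightarrow> nat \<Rightarrow> (nat \<Rightarrow> nat \<Rightarrow> 'w \<Rightarrow> nat set) \<Rightarrow> bool" where
  "uniform_draws M Z n k B S \<longleftrightarrow>
     prob_space.indep_vars M (\<lambda>_. count_space UNIV) (\<lambda>(j, b). S j b) ({0, 1} \<times> {1..B}) \<and>
     (\<forall>j\<in>{0, 1}. \<forall>b\<in>{1..B}.
        distr M (count_space UNIV) (S j b) = measure_pmf (pmf_of_set (nsets {1..n} k))) \<and>
     indep_rvs M
       (Pi\<^sub>M {1..n} (\<lambda>_. borel)) (\<lambda>\<omega>. \<lambda>i\<in>{1..n}. Z i \<omega>)
       (Pi\<^sub>M ({0, 1} \<times> {1..B}) (\<lambda>_. count_space UNIV))
       (\<lambda>\<omega>. \<lambda>(j, b)\<in>{0, 1} \<times> {1..B}. S j b \<omega>)"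

section \<open>The infinitesimal jackknife\<close>

definition emp_mean :: "nat \<Rightarrow> (nat \<Rightarrow> real) \<Rightarrow> real" where
  "emp_mean B f = (\<Sum>b = 1..B. f b) / real B"

definition emp_cov :: "nat \<Rightarrow> (nat \<Rightarrow> real) \<Rightarrow> (nat \<Rightarrow> real) \<Rightarrow> real" where
  "emp_cov B f g = (\<Sum>b = 1..B. (f b - emp_mean B f) * (g b - emp_mean B g)) / real B"

text \<open>\<open>S j b\<close> is the \<open>b\<close>-th subsample of stage \<open>j\<close>, and \<open>z j\<close> is the training data of stage \<open>j\<close>.\<close>

definition jackknife_cov :: "'a tree_fun \<Rightarrow> 'a \<Rightarrow> nat \<Rightarrow> (nat \<Rightarrow> nat set) \<Rightarrow>
    (nat \<Rightarrow> real \<times> 'a) \<Rightarrow> nat \<Rightarrow> real" where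
  "jackknife_cov T u B S z i =
     emp_cov B (\<lambda>b. of_bool (i \<in> S b)) (\<lambda>b. tree_on T u z (S b))"

definition jackknife_matrix :: "'a tree_fun \<Rightarrow> 'a \<Rightarrow> nat \<Rightarrow> nat \<Rightarrow> (nat \<Rightarrow> nat \<Rightarrow> nat set) \<Rightarrow>
    (nat \<Rightarrow> nat \<Rightarrow> real \<times> 'a) \<Rightarrow> real ^ 2 ^ 2" where
  "jackknife_matrix T u n B S z =
     (\<Sum>i = 1..n.
        let c = vector [jackknife_cov T u B (S 0) (z 0) i, jackknife_cov T u B (S 1) (z 1) i]
        in outer c c)"

end

theory Submission
  imports Defs
begin

text \<open>The covariance of a symmetric kernel evaluated on two subsamples depends only on the size \<open>d\<close> of
  their overlap. The finite differences at \<open>0\<close> of this function of \<open>d\<close> are, up to a binomial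
  factor, the variances in the Hoeffding decomposition, hence nonnegative. Consequently
  \<open>k * \<zeta>\<^sub>1 \<le> \<zeta>\<^sub>k\<close>, the complete forest differs from its projection \<open>(k / n) * (\<Sum>i. T\<^sub>1 (Z i))\<close> by at
  most \<open>(k / n)\<^sup>2 * \<zeta>\<^sub>k\<close> in mean square, and the vector of jackknife covariances differs from
  \<open>(k / n) * T\<^sub>1 (Z i)\<close>, \<open>i = 1, \<dots>, n\<close>, by at most \<open>(8 * k / B + 6 * (k / n)\<^sup>2) * \<zeta>\<^sub>k\<close>; both errors
  are negligible against the variance \<open>k\<^sup>2 * \<zeta>\<^sub>1 / n\<close> of the projection.

  Accordingly \<open>\<Sigma> n\<close> is the covariance matrix of the two projections: its standard deviations are
  \<open>k * sqrt (\<zeta>\<^sub>1 / n)\<close>, and its correlation is that of the two functions \<open>T\<^sub>1\<close> at a single data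
  point, which the nondegeneracy assumption keeps away from \<open>1\<close> and \<open>-1\<close>. Asymptotic normality is
  the Lindeberg theorem for linear combinations of the two standardised functions, and consistency
  of the jackknife is the weak law of large numbers for their products, proved by truncation.

  Convergence in law in the plane follows from convergence of characteristic functions:
  bounded continuous functions are approximated on large cubes by trigonometric polynomials, and
  second moments give tightness.\<close>


section \<open>Overlaps of random subsets\<close>

text \<open>The variance components of order \<open>j \<ge> 2\<close> are never constructed: no
  conditional expectation beyond the first-order projection appears. Only their sign matters, and it
  follows from the nonnegativity of the second moment of an alternating combination of kernels over
  many disjoint completions. Another obstacle is that hardly anything converges except the ratios
  named in the hypotheses: kernels, residual map and the correlation of the two projections all vary
  with \<open>n\<close>. Estimates are therefore proved with explicit errors at fixed
  \<open>n\<close>. The coefficients in the Cramer-Wold argument vary with \<open>n\<close> too;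
  they are chosen so that the variance of the combination is exactly the squared norm of
  \<open>t\<close>, which gives a fixed limit although \<open>\<Sigma> n\<close> need not have one.
  The products in the law of large numbers have no uniformly bounded second moment, only the
  Lindeberg condition for each factor; hence the truncation at the scale \<open>sqrt n\<close>. The
  second stage needs no separate theory because its residuals are a deterministic function of one
  data point.\<close>

primrec fdiff :: "nat \<Rightarrow> (nat \<Rightarrow> real) \<Rightarrow> nat \<Rightarrow> real" where
  "fdiff 0 g a = g a"
| "fdiff (Suc j) g a = fdiff j g (Suc a) - fdiff j g a"

lemma sum_choose_Suc:
  fixes f :: "nat \<Rightarrow> real"
  shows "(\<Sum>j\<le>Suc d. real (Suc d choose j) * f j)
    = (\<Sum>j\<le>d. real (d choose j) * f j) + (\<Sum>j\<le>d. real (d choose j) * f (Suc j))"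
proof -
  have "(\<Sum>j\<le>Suc d. real (Suc d choose j) * f j)
     = f 0 + (\<Sum>j\<le>d. real (Suc d choose Suc j) * f (Suc j))"
    by (simp only: sum.atMost_Suc_shift) simp
  also have "(\<Sum>j\<le>d. real (Suc d choose Suc j) * f (Suc j))
     = (\<Sum>j\<le>d. real (d choose j) * f (Suc j)) + (\<Sum>j\<le>d. real (d choose Suc j) * f (Suc j))"
    by (simp add: sum.distrib algebra_simps)
  also have "f 0 + (\<dots>) = (\<Sum>j\<le>Suc d. real (d choose j) * f j) + (\<Sum>j\<le>d. real (d choose j) * f (Suc j))"
    by (simp only: sum.atMost_Suc_shift) simp
  also have "(\<Sum>j\<le>Suc d. real (d choose j) * f j) = (\<Sum>j\<le>d. real (d choose j) * f j)"
    by simp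
  finally show ?thesis .
qed

text \<open>Newton's forward difference formula, by Pascal's rule. It expands a function of the
  overlap \<open>d\<close> in the polynomials \<open>d choose j\<close>, whose averages over pairs
  of random subsets have a closed form.\<close>

lemma newton_forward: "g (a + d) = (\<Sum>j\<le>d. real (d choose j) * fdiff j g a)"
proof (induction d arbitrary: a)
  case (Suc d)
  have "g (a + Suc d) = (\<Sum>j\<le>d. real (d choose j) * fdiff j g (Suc a))"
    using Suc.IH[of "Suc a"] by simp
  also have "\<dots> = (\<Sum>j\<le>d. real (d choose j) * fdiff j g a) + (\<Sum>j\<le>d. real (d choose j) * fdiff (Suc j) g a)"
    by (simp add: sum.distrib[symmetric] algebra_simps)
  also have "\<dots> = (\<Sum>j\<le>Suc d. real (Suc d choose j) * fdiff j g a)"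
    by (rule sum_choose_Suc[symmetric])
  finally show ?case .
qed simp

lemma sum_Pow_insert:
  fixes f :: "'b set \<Rightarrow> real"
  assumes "finite U" "x \<notin> U"
  shows "(\<Sum>u\<in>Pow (insert x U). f u) = (\<Sum>u\<in>Pow U. f u + f (insert x u))"
proof -
  have "(\<Sum>u\<in>Pow (insert x U). f u) = (\<Sum>u\<in>Pow U. f u) + (\<Sum>u\<in>insert x ` Pow U. f u)"
    using assms by (subst Pow_insert, subst sum.union_disjoint) auto
  also have "(\<Sum>u\<in>insert x ` Pow U. f u) = (\<Sum>u\<in>Pow U. f (insert x u))"
    using assms by (subst sum.reindex) (auto simp: inj_on_def)
  finally show ?thesis by (simp add: sum.distrib)
qed

text \<open>The iterated difference is a product of factors (shift minus identity), one for each
  element of \<open>U\<close>; a subset \<open>u\<close> selects the factors that contribute the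
  identity, which explains the sign.\<close>

lemma fdiff_Pow:
  assumes "finite U"
  shows "(\<Sum>u\<in>Pow U. (-1) ^ card u * g (a + (card U - card u))) = fdiff (card U) g a"
  using assms
proof (induction U arbitrary: a rule: finite_induct)
  case (insert x U)
  have [simp]: "finite u" "x \<notin> u" "card u \<le> card U" if "u \<in> Pow U" for u
    using that insert by (auto intro: finite_subset card_mono)
  have "(\<Sum>u\<in>Pow (insert x U). (-1) ^ card u * g (a + (card (insert x U) - card u)))
    = (\<Sum>u\<in>Pow U. (-1) ^ card u * g (Suc a + (card U - card u)) - (-1) ^ card u * g (a + (card U - card u)))"
    using insert.hyps by (subst sum_Pow_insert) (auto intro!: sum.cong simp: Suc_diff_le)
  also have "\<dots> = fdiff (card U) g (Suc a) - fdiff (card U) g a"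
    by (simp only: sum_subtractf insert.IH)
  finally show ?case using insert.hyps by simp
qed simp

section \<open>Counting pairs of subsets by their intersection\<close>

lemma card_nsets_superset:
  assumes "finite N" "A \<subseteq> N" "card A \<le> k"
  shows "card {I \<in> nsets N k. A \<subseteq> I} = (card N - card A) choose (k - card A)"
proof -
  have fA: "finite A" using assms finite_subset by blast
  have "bij_betw (\<lambda>J. J \<union> A) (nsets (N - A) (k - card A)) {I \<in> nsets N k. A \<subseteq> I}"
  proof (rule bij_betwI[where g = "\<lambda>I. I - A"])
    show "(\<lambda>J. J \<union> A) \<in> nsets (N - A) (k - card A) \<rightarrow> {I \<in> nsets N k. A \<subseteq> I}"
    proof
      fix J assume J: "J \<in> nsets (N - A) (k - card A)"
      then have "card (J \<union> A) = card J + card A"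
        using fA by (intro card_Un_disjoint) (auto simp: nsets_def)
      then show "J \<union> A \<in> {I \<in> nsets N k. A \<subseteq> I}"
        using J assms fA by (auto simp: nsets_def)
    qed
    show "(\<lambda>I. I - A) \<in> {I \<in> nsets N k. A \<subseteq> I} \<rightarrow> nsets (N - A) (k - card A)"
      using assms fA by (auto simp: nsets_def card_Diff_subset)
  qed (use fA in \<open>auto simp: nsets_def\<close>)
  then have "card {I \<in> nsets N k. A \<subseteq> I} = card (nsets (N - A) (k - card A))"
    by (rule bij_betw_same_card[symmetric])
  also have "\<dots> = (card N - card A) choose (k - card A)"
    using assms fA by (simp add: card_Diff_subset)
  finally show ?thesis .
qed

text \<open>\<open>card (I \<inter> J) choose j\<close> counts the \<open>j\<close>-subsets
  contained in both sets. Summing over these subsets \<open>A\<close> last decouples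
  \<open>I\<close> and \<open>J\<close>: each \<open>A\<close> contributes the square of the number
  of \<open>k\<close>-subsets containing it.\<close>

lemma sum_choose_inter:
  fixes N :: "nat set"
  assumes N: "finite N" and jk: "j \<le> k"
  shows "(\<Sum>I\<in>nsets N k. \<Sum>J\<in>nsets N k. real (card (I \<inter> J) choose j))
    = real (card N choose j) * (real ((card N - j) choose (k - j)))\<^sup>2"
proof -
  have fin: "finite (nsets N i)" for i using N by (simp add: finite_imp_finite_nsets)
  have *: "real (card (I \<inter> J) choose j) = (\<Sum>A\<in>nsets N j. of_bool (A \<subseteq> I) * of_bool (A \<subseteq> J))"
    if "I \<in> nsets N k" for I J
  proof -
    have "(\<Sum>A\<in>nsets N j. of_bool (A \<subseteq> I) * of_bool (A \<subseteq> J)) = (\<Sum>A\<in>nsets N j. if A \<subseteq> I \<inter> J then 1 else 0 :: real)"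
      by (intro sum.cong) auto
    also have "\<dots> = real (card {A \<in> nsets N j. A \<subseteq> I \<inter> J})"
      using fin by (simp add: sum.If_cases Int_def)
    also have "{A \<in> nsets N j. A \<subseteq> I \<inter> J} = nsets (I \<inter> J) j"
      using that by (auto simp: nsets_def)
    finally show ?thesis by simp
  qed
  have "(\<Sum>I\<in>nsets N k. \<Sum>J\<in>nsets N k. real (card (I \<inter> J) choose j))
    = (\<Sum>I\<in>nsets N k. \<Sum>J\<in>nsets N k. \<Sum>A\<in>nsets N j. of_bool (A \<subseteq> I) * of_bool (A \<subseteq> J))"
    using * by (intro sum.cong refl) blast
  also have "\<dots> = (\<Sum>I\<in>nsets N k. \<Sum>A\<in>nsets N j. \<Sum>J\<in>nsets N k. of_bool (A \<subseteq> I) * of_bool (A \<subseteq> J))"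
    by (intro sum.cong refl sum.swap)
  also have "\<dots> = (\<Sum>A\<in>nsets N j. \<Sum>I\<in>nsets N k. \<Sum>J\<in>nsets N k. of_bool (A \<subseteq> I) * of_bool (A \<subseteq> J))"
    by (rule sum.swap)
  also have "\<dots> = (\<Sum>A\<in>nsets N j. (\<Sum>I\<in>nsets N k. of_bool (A \<subseteq> I))\<^sup>2)"
    by (simp add: power2_eq_square sum_product)
  also have "\<dots> = (\<Sum>A\<in>nsets N j. (real ((card N - j) choose (k - j)))\<^sup>2)"
  proof (intro sum.cong refl arg_cong[where f = "\<lambda>x. x\<^sup>2"])
    fix A assume A: "A \<in> nsets N j"
    have "(\<Sum>I\<in>nsets N k. of_bool (A \<subseteq> I)) = (\<Sum>I\<in>nsets N k. if A \<subseteq> I then 1 else 0 :: real)"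
      by (intro sum.cong) auto
    also have "\<dots> = real (card {I \<in> nsets N k. A \<subseteq> I})"
      using fin by (simp add: sum.If_cases Int_def)
    also have "\<dots> = real ((card N - j) choose (k - j))"
      using card_nsets_superset[OF N, of A k] A jk by (auto simp: nsets_def)
    finally show "(\<Sum>I\<in>nsets N k. of_bool (A \<subseteq> I)) = real ((card N - j) choose (k - j))" .
  qed
  finally show ?thesis by simp
qed

text \<open>The expectation of \<open>f\<close> at the overlap of two independent uniform
  \<open>k\<close>-subsets of \<open>{1..n}\<close>, that is, at a hypergeometric variable. The
  binomials \<open>d choose j\<close> are its natural test functions.\<close>

definition overlap_mean :: "nat \<Rightarrow> nat \<Rightarrow> (nat \<Rightarrow> real) \<Rightarrow> real" where
  "overlap_mean n k f =
     (\<Sum>I\<in>nsets {1..n} k. \<Sum>J\<in>nsets {1..n} k. f (card (I \<inter> J))) / (real (n choose k))\<^sup>2"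

lemma overlap_mean_choose:
  assumes "j \<le> k" "k \<le> n"
  shows "overlap_mean n k (\<lambda>d. real (d choose j)) = (real (k choose j))\<^sup>2 / real (n choose j)"
proof -
  have "real (n choose k) * real (k choose j) = real (n choose j) * real ((n - j) choose (k - j))"
    using choose_mult[of j k n] assms by (metis of_nat_mult)
  moreover have "real (n choose k) > 0" "real (n choose j) > 0" using assms by auto
  ultimately have K: "real (k choose j) = real (n choose j) * real ((n - j) choose (k - j)) / real (n choose k)"
    by (simp add: field_simps)
  show ?thesis
    unfolding overlap_mean_def using sum_choose_inter[of "{1..n}" j k] assms
    by (simp add: K power2_eq_square)
qed

lemma overlap_mean_choose_0: "j > k \<Longrightarrow> overlap_mean n k (\<lambda>d. real (d choose j)) = 0"
  unfolding overlap_mean_def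
proof -
  assume "j > k"
  then have "card (I \<inter> J) choose j = 0" if "I \<in> nsets {1..n} k" for I J :: "nat set"
    using that by (intro binomial_eq_0) (auto simp: nsets_def intro!: le_less_trans[OF card_mono[of I "I \<inter> J"]])
  then have "(\<Sum>I\<in>nsets {1..n} k. \<Sum>J\<in>nsets {1..n} k. real (card (I \<inter> J) choose j)) = 0"
    by (intro sum.neutral ballI) (auto simp only: of_nat_0)
  then show "(\<Sum>I\<in>nsets {1..n} k. \<Sum>J\<in>nsets {1..n} k. real (card (I \<inter> J) choose j)) / (real (n choose k))\<^sup>2 = 0"
    by simp
qed

lemma overlap_mean_linear:
  "overlap_mean n k (\<lambda>d. \<Sum>j\<in>A. c j * f j d) = (\<Sum>j\<in>A. c j * overlap_mean n k (f j))"
proof -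
  have "(\<Sum>I\<in>nsets {1..n} k. \<Sum>J\<in>nsets {1..n} k. \<Sum>j\<in>A. c j * f j (card (I \<inter> J)))
     = (\<Sum>j\<in>A. \<Sum>I\<in>nsets {1..n} k. \<Sum>J\<in>nsets {1..n} k. c j * f j (card (I \<inter> J)))"
    by (subst sum.swap, subst sum.swap, intro sum.cong refl sum.swap)
  then show ?thesis
    unfolding overlap_mean_def by (simp add: sum_divide_distrib sum_distrib_left)
qed

lemma overlap_mean_cong:
  assumes "\<And>d. d \<le> k \<Longrightarrow> f d = g d"
  shows "overlap_mean n k f = overlap_mean n k g"
  unfolding overlap_mean_def
  by (intro arg_cong2[where f = "(/)"] sum.cong refl assms)
     (auto simp: nsets_def intro: card_mono)

text \<open>For \<open>j \<le> k\<close> the quotient is the product of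
  \<open>(k - i) / (n - i)\<close> over \<open>i < j\<close>, and each factor is at most
  \<open>k / n\<close>.\<close>

lemma choose_ratio_le:
  assumes "k \<le> n" "n > 0"
  shows "real (k choose j) / real (n choose j) \<le> (real k / real n) ^ j"
proof (induction j)
  case (Suc j)
  show ?case
  proof (cases "Suc j \<le> k")
    case True
    have rec: "real (m choose Suc j) = real (m choose j) * real (m - j) / real (Suc j)" for m
    proof -
      have "Suc j * (m choose Suc j) = (m choose j) * (m - j)"
        by (metis binomial_absorb_comp binomial_absorption mult.commute)
      then have "real (Suc j) * real (m choose Suc j) = real (m choose j) * real (m - j)"
        by (metis of_nat_mult)
      then show ?thesis by (simp add: field_simps del: of_nat_Suc)
    qed
    have "real (k choose Suc j) / real (n choose Suc j)
      = (real (k choose j) / real (n choose j)) * (real (k - j) / real (n - j))"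
      by (simp add: rec field_simps del: of_nat_Suc)
    also have "\<dots> \<le> (real k / real n) ^ j * (real k / real n)"
    proof (intro mult_mono Suc.IH)
      show "real (k - j) / real (n - j) \<le> real k / real n"
      proof -
        have "real j * real k \<le> real j * real n" using assms by (intro mult_left_mono) auto
        then show ?thesis using assms True by (simp add: field_simps of_nat_diff)
      qed
    qed auto
    finally show ?thesis by (simp add: mult_ac)
  qed (simp add: binomial_eq_0)
qed simp

text \<open>The sequence \<open>j * q ^ j\<close> decreases from \<open>j = 2\<close> on once
  \<open>q \<le> 1 / 2\<close>. This absorbs the factor \<open>j\<close> produced by the centred
  overlap, uniformly in \<open>j\<close>.\<close>

lemma mult_power_le_2:
  fixes q :: real
  assumes "0 \<le> q" "2 * q \<le> 1" "2 \<le> j"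
  shows "real j * q ^ j \<le> 2 * q\<^sup>2"
proof -
  obtain i where i: "j = i + 2" using assms(3) by (metis add.commute le_Suc_ex)
  have "real (i + 2) * q ^ i \<le> 2"
  proof (induction i)
    case (Suc i)
    have "real (Suc i + 2) * q ^ Suc i = (real (i + 2) * q ^ i) * q + q ^ Suc i" by (simp add: algebra_simps)
    also have "\<dots> \<le> 2 * (1/2) + 1"
    proof (intro add_mono mult_mono Suc)
      show "q ^ Suc i \<le> 1" using assms by (intro power_le_one) auto
    qed (use assms in auto)
    finally show ?case by simp
  qed simp
  then have "(real (i + 2) * q ^ i) * q\<^sup>2 \<le> 2 * q\<^sup>2" by (rule mult_right_mono) simp
  then show ?thesis unfolding i power_add by (simp only: mult.assoc)
qed

text \<open>The centring is the mean overlap. It arises because the centred inclusion indicators of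
  \<open>I\<close> and \<open>J\<close>, multiplied and summed over all points, give the overlap
  minus this constant. The product \<open>d * (d choose j)\<close> is resolved into
  \<open>d choose j\<close> and \<open>d choose Suc j\<close>, so that the uncentred moments
  suffice.\<close>

lemma overlap_mean_centred_choose:
  assumes j: "1 \<le> j" "j \<le> k" and k: "2 * k \<le> n"
  shows "overlap_mean n k (\<lambda>d. (real d - (real k)\<^sup>2 / real n) * real (d choose j))
    = (real (k choose j))\<^sup>2 / real (n choose j) * (real j * (real n - real k)\<^sup>2 / (real n * (real n - real j)))"
proof -
  let ?e = "\<lambda>j. (real (k choose j))\<^sup>2 / real (n choose j)"
  have pos: "real n > 0" "real n - real j > 0" and kn: "k \<le> n" and jn: "j \<le> n" using j k by auto
  \<comment> \<open>The formula is also used for \<open>j = k\<close>, where the average and the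
    factor \<open>k - j\<close> both vanish.\<close>
  have e': "overlap_mean n k (\<lambda>d. real (d choose Suc j)) = ?e j * (real k - real j)\<^sup>2 / ((real j + 1) * (real n - real j))"
  proof (cases "Suc j \<le> k")
    case True
    have rec: "real (m choose Suc j) = real (m choose j) * (real m - real j) / (real j + 1)" if "j \<le> m" for m
    proof -
      have "Suc j * (m choose Suc j) = (m choose j) * (m - j)"
        by (metis binomial_absorb_comp binomial_absorption mult.commute)
      then have "real (Suc j) * real (m choose Suc j) = real (m choose j) * real (m - j)"
        by (metis of_nat_mult)
      then show ?thesis using that by (simp add: field_simps of_nat_diff)
    qed
    have *: "(A * x / c)\<^sup>2 / (b * y / c) = A\<^sup>2 / b * x\<^sup>2 / (c * y)"
      if "c > 0" "y > 0" "b > 0" for A x y b c :: real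
      using that by (simp add: power2_eq_square divide_simps)
    show ?thesis
      unfolding overlap_mean_choose[OF True kn] rec[OF j(2)] rec[OF jn]
      by (rule *) (use pos jn in auto)
  next
    case False
    then show ?thesis using j by (subst overlap_mean_choose_0) (auto)
  qed
  have id: "(real d - (real k)\<^sup>2 / real n) * real (d choose j)
      = (\<Sum>i\<in>{j, Suc j}. (if i = j then real j - (real k)\<^sup>2 / real n else real j + 1) * real (d choose i))" for d
  proof -
    have "Suc j * (d choose Suc j) + j * (d choose j) = d * (d choose j)"
    proof (cases "j \<le> d")
      case True
      have "Suc j * (d choose Suc j) = (d - j) * (d choose j)"
        by (metis binomial_absorb_comp binomial_absorption)
      then show ?thesis using True by (metis add_mult_distrib le_add_diff_inverse2)
    qed (simp add: binomial_eq_0)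
    then have "real d * real (d choose j) = real (Suc j) * real (d choose Suc j) + real j * real (d choose j)"
      by (metis of_nat_add of_nat_mult)
    then show ?thesis by (simp add: algebra_simps)
  qed
  have "overlap_mean n k (\<lambda>d. (real d - (real k)\<^sup>2 / real n) * real (d choose j))
     = (real j - (real k)\<^sup>2 / real n) * ?e j
       + (real j + 1) * (?e j * (real k - real j)\<^sup>2 / ((real j + 1) * (real n - real j)))"
    unfolding id overlap_mean_linear
    by (subst sum.insert) (use j k e' overlap_mean_choose[of j k n] in \<open>auto\<close>)
  also have "(real j + 1) * (?e j * (real k - real j)\<^sup>2 / ((real j + 1) * (real n - real j)))
      = ?e j * ((real k - real j)\<^sup>2 / (real n - real j))"
    by (simp del: of_nat_Suc)
  also have "(real j - (real k)\<^sup>2 / real n) * ?e j + ?e j * ((real k - real j)\<^sup>2 / (real n - real j))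
      = ?e j * (real j - (real k)\<^sup>2 / real n + (real k - real j)\<^sup>2 / (real n - real j))"
    by (simp only: distrib_left mult.commute)
  \<comment> \<open>The three terms combine into a multiple of a square, so all weights in the
    centred expansion are nonnegative.\<close>
  also have "real j - (real k)\<^sup>2 / real n + (real k - real j)\<^sup>2 / (real n - real j)
     = real j * (real n - real k)\<^sup>2 / (real n * (real n - real j))"
    using pos by (simp add: field_simps power2_eq_square)
  finally show ?thesis .
qed

text \<open>In the Newton expansion of \<open>g\<close> at \<open>0\<close> the term
  \<open>j = 1\<close> is the main one. For \<open>j \<ge> 2\<close> the mean of
  \<open>d choose j\<close> is at most \<open>(k / n)\<^sup>2 * (k choose j)\<close>; summed against
  the nonnegative differences this is at most \<open>(k / n)\<^sup>2 * g k\<close>, by the same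
  expansion at \<open>d = k\<close>. The weights of the centred version are larger by a factor of at
  most \<open>j\<close>, which costs a factor \<open>2\<close> in the end.\<close>

lemma overlap_mean_bounds:
  assumes V: "\<And>j. 2 \<le> j \<Longrightarrow> j \<le> k \<Longrightarrow> fdiff j g 0 \<ge> 0" and g0: "g 0 = 0" and g1: "g 1 \<ge> 0"
    and k: "1 \<le> k" "2 * k \<le> n"
  shows "overlap_mean n k g \<le> (real k)\<^sup>2 / real n * g 1 + (real k / real n)\<^sup>2 * g k" (is ?A)
    and "overlap_mean n k (\<lambda>d. (real d - (real k)\<^sup>2 / real n) * g d)
      \<le> (real k)\<^sup>2 / real n * (1 - real k / real n) * g 1 + 2 * (real k / real n)\<^sup>2 * g k" (is ?B)
proof -
  let ?e = "\<lambda>j. (real (k choose j))\<^sup>2 / real (n choose j)"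
  define v where "v j = fdiff j g 0" for j
  have g: "g d = (\<Sum>j\<in>{1..k}. v j * real (d choose j))" if "d \<le> k" for d
  proof -
    have "g d = (\<Sum>j\<le>d. real (d choose j) * v j)" using newton_forward[of g 0 d] by (simp add: v_def)
    also have "\<dots> = (\<Sum>j\<le>k. real (d choose j) * v j)"
      using that by (intro sum.mono_neutral_left) (auto simp: binomial_eq_0)
    also have "\<dots> = (\<Sum>j\<in>{1..k}. real (d choose j) * v j)"
      using g0 by (intro sum.mono_neutral_right) (auto simp: v_def not_less_eq_eq)
    finally show ?thesis by (simp add: mult.commute)
  qed
  have v1: "v (Suc 0) = g (Suc 0)" using g0 by (simp add: v_def)
  have q: "0 \<le> real k / real n" "2 * (real k / real n) \<le> 1" using k by (auto simp: field_simps)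
  \<comment> \<open>One factor \<open>k choose j\<close> is kept for resummation; the other one,
    divided by \<open>n choose j\<close>, supplies the small power of \<open>k / n\<close>.\<close>
  have e_le: "real j * ?e j \<le> 2 * (real k / real n)\<^sup>2 * real (k choose j)" if "2 \<le> j" for j
  proof -
    have "real j * ?e j = real j * (real (k choose j) / real (n choose j)) * real (k choose j)"
      by (simp add: power2_eq_square)
    also have "\<dots> \<le> real j * (real k / real n) ^ j * real (k choose j)"
      using k by (intro mult_right_mono mult_left_mono choose_ratio_le) auto
    also have "\<dots> \<le> 2 * (real k / real n)\<^sup>2 * real (k choose j)"
      using q that by (intro mult_right_mono mult_power_le_2) auto
    finally show ?thesis .
  qed
  have split: "{Suc 0..k} = insert (Suc 0) {2..k}" using k by auto
  have gk: "(\<Sum>j\<in>{2..k}. v j * real (k choose j)) \<le> g k"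
    using g[of k] v1 g1 by (simp add: split)
  have v_nn: "v j \<ge> 0" if "j \<in> {2..k}" for j using V[of j] that by (simp add: v_def)
  have "overlap_mean n k g = overlap_mean n k (\<lambda>d. \<Sum>j\<in>{1..k}. v j * real (d choose j))"
    by (intro overlap_mean_cong g)
  also have "\<dots> = (\<Sum>j\<in>{1..k}. v j * ?e j)"
    unfolding overlap_mean_linear using k by (intro sum.cong refl) (auto simp: overlap_mean_choose)
  also have "\<dots> = v 1 * ?e 1 + (\<Sum>j\<in>{2..k}. v j * ?e j)"
    by (simp add: split)
  also have "(\<Sum>j\<in>{2..k}. v j * ?e j) \<le> (\<Sum>j\<in>{2..k}. v j * ((real k / real n)\<^sup>2 * real (k choose j)))"
  proof (intro sum_mono mult_left_mono v_nn)
    fix j assume j: "j \<in> {2..k}"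
    have "2 * ?e j \<le> real j * ?e j" using j by (intro mult_right_mono) auto
    then show "?e j \<le> (real k / real n)\<^sup>2 * real (k choose j)" using e_le[of j] j by simp
  qed auto
  also have "\<dots> = (real k / real n)\<^sup>2 * (\<Sum>j\<in>{2..k}. v j * real (k choose j))"
    by (simp add: sum_distrib_left mult_ac)
  also have "\<dots> \<le> (real k / real n)\<^sup>2 * g k" by (intro mult_left_mono gk) auto
  finally show ?A by (simp add: v1 mult.commute)

  let ?m = "(real k)\<^sup>2 / real n"
  let ?c = "\<lambda>j. real j * (real n - real k)\<^sup>2 / (real n * (real n - real j))"
  have "overlap_mean n k (\<lambda>d. (real d - ?m) * g d)
      = overlap_mean n k (\<lambda>d. \<Sum>j\<in>{1..k}. v j * ((real d - ?m) * real (d choose j)))"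
    by (intro overlap_mean_cong) (simp add: g sum_distrib_left mult_ac)
  also have "\<dots> = (\<Sum>j\<in>{1..k}. v j * (?e j * ?c j))"
    unfolding overlap_mean_linear using k
    by (intro sum.cong refl) (auto simp: overlap_mean_centred_choose)
  also have "\<dots> = v 1 * (?e 1 * ?c 1) + (\<Sum>j\<in>{2..k}. v j * (?e j * ?c j))"
    by (simp add: split)
  also have "(\<Sum>j\<in>{2..k}. v j * (?e j * ?c j)) \<le> (\<Sum>j\<in>{2..k}. v j * (2 * (real k / real n)\<^sup>2 * real (k choose j)))"
  proof (intro sum_mono mult_left_mono v_nn)
    fix j assume j: "j \<in> {2..k}"
    have "(real n - real k)\<^sup>2 \<le> real n * (real n - real j)"
      unfolding power2_eq_square using j k by (intro mult_mono) auto
    then have "(real n - real k)\<^sup>2 / (real n * (real n - real j)) \<le> 1"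
      using j k by (simp add: divide_le_eq)
    then have "real j * ((real n - real k)\<^sup>2 / (real n * (real n - real j))) \<le> real j * 1"
      by (rule mult_left_mono) simp
    then have "?c j \<le> real j" by simp
    then have "?e j * ?c j \<le> ?e j * real j" by (intro mult_left_mono) auto
    also have "\<dots> \<le> 2 * (real k / real n)\<^sup>2 * real (k choose j)" using e_le[of j] j by (simp add: mult.commute)
    finally show "?e j * ?c j \<le> \<dots>" .
  qed auto
  also have "\<dots> = 2 * (real k / real n)\<^sup>2 * (\<Sum>j\<in>{2..k}. v j * real (k choose j))"
    by (simp add: sum_distrib_left mult_ac)
  also have "\<dots> \<le> 2 * (real k / real n)\<^sup>2 * g k" by (intro mult_left_mono gk) auto
  \<comment> \<open>For \<open>j = 1\<close> the weight is at most \<open>1 - k / n\<close> because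
    \<open>n - k \<le> n - 1\<close>.\<close>
  also have "v 1 * (?e 1 * ?c 1) \<le> v 1 * (?m * (1 - real k / real n))"
  proof (intro mult_left_mono)
    have n: "real n > 0" "real n - 1 > 0" using k by auto
    have "?c 1 \<le> 1 - real k / real n"
    proof -
      have "(real n - real k)\<^sup>2 \<le> (real n - 1) * (real n - real k)"
        unfolding power2_eq_square using k by (intro mult_right_mono) auto
      then have "(real n - real k)\<^sup>2 / (real n - 1) / real n \<le> (real n - real k) / real n"
        using n by (intro divide_right_mono) (simp_all add: divide_le_eq mult.commute)
      then show ?thesis using n by (simp add: diff_divide_distrib mult.commute)
    qed
    then have "?e 1 * ?c 1 \<le> ?e 1 * (1 - real k / real n)" by (intro mult_left_mono) auto
    then show "?e 1 * ?c 1 \<le> ?m * (1 - real k / real n)" by simp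
  qed (use v1 g1 in auto)
  finally show ?B by (simp add: v1 mult_ac)
qed

section \<open>Independent, identically distributed samples\<close>

lemma L2_mult_integrable:
  fixes f g :: "'w \<Rightarrow> real"
  assumes [measurable]: "f \<in> borel_measurable M" "g \<in> borel_measurable M"
    and "integrable M (\<lambda>x. (f x)\<^sup>2)" "integrable M (\<lambda>x. (g x)\<^sup>2)"
  shows "integrable M (\<lambda>x. f x * g x)"
proof (rule Bochner_Integration.integrable_bound)
  show "integrable M (\<lambda>x. (f x)\<^sup>2 + (g x)\<^sup>2)" using assms by simp
  have "\<bar>a * b\<bar> \<le> a\<^sup>2 + b\<^sup>2" for a b :: real
  proof -
    have "2 * (\<bar>a\<bar> * \<bar>b\<bar>) \<le> a\<^sup>2 + b\<^sup>2" using sum_squares_bound[of "\<bar>a\<bar>" "\<bar>b\<bar>"] by simp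
    moreover have "0 \<le> \<bar>a\<bar> * \<bar>b\<bar>" by simp
    ultimately show ?thesis unfolding abs_mult by linarith
  qed
  then show "AE x in M. norm (f x * g x) \<le> norm ((f x)\<^sup>2 + (g x)\<^sup>2)" by simp
qed simp

lemma L2_sum_integrable:
  fixes X :: "'i \<Rightarrow> 'w \<Rightarrow> real"
  assumes "\<And>i. i \<in> A \<Longrightarrow> X i \<in> borel_measurable M" "\<And>i. i \<in> A \<Longrightarrow> integrable M (\<lambda>x. (X i x)\<^sup>2)"
  shows "integrable M (\<lambda>x. (\<Sum>i\<in>A. c i * X i x)\<^sup>2)"
proof -
  have "integrable M (\<lambda>x. \<Sum>i\<in>A. \<Sum>j\<in>A. (c i * c j) * (X i x * X j x))"
    using assms by (intro Bochner_Integration.integrable_sum integrable_mult_right L2_mult_integrable)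
  then show ?thesis by (simp add: power2_eq_square sum_product mult_ac)
qed

lemma L2_diff_integrable:
  fixes f g :: "'w \<Rightarrow> real"
  assumes [measurable]: "f \<in> borel_measurable M" "g \<in> borel_measurable M"
    and "integrable M (\<lambda>x. (f x)\<^sup>2)" "integrable M (\<lambda>x. (g x)\<^sup>2)"
  shows "integrable M (\<lambda>x. (f x - g x)\<^sup>2)"
proof -
  have "integrable M (\<lambda>x. (f x)\<^sup>2 + (g x)\<^sup>2 - 2 * (f x * g x))"
    using assms by (intro Bochner_Integration.integrable_add Bochner_Integration.integrable_diff
      integrable_mult_right L2_mult_integrable) auto
  then show ?thesis by (simp add: power2_diff mult_ac)
qed

context prob_space
begin

lemma L2_sum_product:
  fixes X :: "'i \<Rightarrow> 'a \<Rightarrow> real" and Y :: "'j \<Rightarrow> 'a \<Rightarrow> real"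
  assumes "\<And>i. i \<in> A \<Longrightarrow> X i \<in> borel_measurable M" "\<And>i. i \<in> A \<Longrightarrow> integrable M (\<lambda>x. (X i x)\<^sup>2)"
    and "\<And>i. i \<in> B \<Longrightarrow> Y i \<in> borel_measurable M" "\<And>i. i \<in> B \<Longrightarrow> integrable M (\<lambda>x. (Y i x)\<^sup>2)"
  shows "expectation (\<lambda>x. (\<Sum>i\<in>A. c i * X i x) * (\<Sum>j\<in>B. d j * Y j x))
    = (\<Sum>i\<in>A. \<Sum>j\<in>B. c i * d j * expectation (\<lambda>x. X i x * Y j x))"
proof -
  have "expectation (\<lambda>x. (\<Sum>i\<in>A. c i * X i x) * (\<Sum>j\<in>B. d j * Y j x))
      = expectation (\<lambda>x. \<Sum>i\<in>A. \<Sum>j\<in>B. (c i * d j) * (X i x * Y j x))"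
    by (simp add: sum_product mult_ac)
  also have "\<dots> = (\<Sum>i\<in>A. \<Sum>j\<in>B. c i * d j * expectation (\<lambda>x. X i x * Y j x))"
    using assms by (simp add: L2_mult_integrable)
  finally show ?thesis .
qed

text \<open>The joint law of independent variables is the product of their laws, so Fubini's theorem
  applies. The inner expectation with \<open>X \<omega>'\<close> frozen plays the role of the
  conditional expectation given \<open>X\<close>. The almost sure integrability of the sections is
  what permits Jensen's inequality under the inner expectation.\<close>

lemma indep_var_Fubini:
  fixes f :: "'b \<times> 'b \<Rightarrow> real"
  assumes ind: "indep_var S X T Y" and f[measurable]: "f \<in> borel_measurable (S \<Otimes>\<^sub>M T)"
    and int: "integrable M (\<lambda>\<omega>. f (X \<omega>, Y \<omega>))"
  shows "integrable M (\<lambda>\<omega>'. expectation (\<lambda>\<omega>. f (X \<omega>', Y \<omega>)))"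
    and "expectation (\<lambda>\<omega>. f (X \<omega>, Y \<omega>)) = expectation (\<lambda>\<omega>'. expectation (\<lambda>\<omega>. f (X \<omega>', Y \<omega>)))"
    and "AE \<omega>' in M. integrable M (\<lambda>\<omega>. f (X \<omega>', Y \<omega>))"
proof -
  have X[measurable]: "random_variable S X" and Y[measurable]: "random_variable T Y"
    using ind by (auto simp: indep_var_eq)
  interpret X: prob_space "distr M S X" by (rule prob_space_distr) (rule X)
  interpret Y: prob_space "distr M T Y" by (rule prob_space_distr) (rule Y)
  interpret XY: pair_prob_space "distr M S X" "distr M T Y" ..
  have eq: "distr M S X \<Otimes>\<^sub>M distr M T Y = distr M (S \<Otimes>\<^sub>M T) (\<lambda>\<omega>. (X \<omega>, Y \<omega>))"
    using ind by (simp add: indep_var_distribution_eq)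
  have int': "integrable (distr M S X \<Otimes>\<^sub>M distr M T Y) f"
    unfolding eq using int by (subst integrable_distr_eq) auto
  have sub: "x \<in> space S \<Longrightarrow> (\<lambda>y. f (x, y)) \<in> borel_measurable T" for x
    by measurable
  have inner: "(\<integral>y. f (X \<omega>', y) \<partial>distr M T Y) = expectation (\<lambda>\<omega>. f (X \<omega>', Y \<omega>))" if "\<omega>' \<in> space M" for \<omega>'
    using measurable_space[OF X that] by (subst integral_distr) (auto intro: sub)
  have m: "(\<lambda>x. \<integral>y. f (x, y) \<partial>distr M T Y) \<in> borel_measurable S"
  proof -
    have "(\<lambda>(x, y). f (x, y)) \<in> borel_measurable (S \<Otimes>\<^sub>M distr M T Y)" by simp
    then show ?thesis by (rule Y.borel_measurable_lebesgue_integral)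
  qed
  have "integrable (distr M S X) (\<lambda>x. \<integral>y. f (x, y) \<partial>distr M T Y)"
    using XY.integrable_fst'[OF int'] .
  then have "integrable M (\<lambda>\<omega>'. \<integral>y. f (X \<omega>', y) \<partial>distr M T Y)"
    using m by (subst (asm) integrable_distr_eq) auto
  then show "integrable M (\<lambda>\<omega>'. expectation (\<lambda>\<omega>. f (X \<omega>', Y \<omega>)))"
    by (subst (asm) Bochner_Integration.integrable_cong[OF refl inner])
  have "expectation (\<lambda>\<omega>. f (X \<omega>, Y \<omega>)) = integral\<^sup>L (distr M S X \<Otimes>\<^sub>M distr M T Y) f"
    unfolding eq by (subst integral_distr) auto
  also have "\<dots> = (\<integral>x. \<integral>y. f (x, y) \<partial>distr M T Y \<partial>distr M S X)"
    using XY.integral_fst'[OF int'] by simp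
  also have "\<dots> = expectation (\<lambda>\<omega>'. \<integral>y. f (X \<omega>', y) \<partial>distr M T Y)"
    using m by (subst integral_distr) auto
  also have "\<dots> = expectation (\<lambda>\<omega>'. expectation (\<lambda>\<omega>. f (X \<omega>', Y \<omega>)))"
    by (intro Bochner_Integration.integral_cong refl inner)
  finally show "expectation (\<lambda>\<omega>. f (X \<omega>, Y \<omega>)) = expectation (\<lambda>\<omega>'. expectation (\<lambda>\<omega>. f (X \<omega>', Y \<omega>)))" .
  have "AE x in distr M S X. integrable (distr M T Y) (\<lambda>y. f (x, y))"
    using XY.AE_integrable_fst'[OF int'] .
  then have "AE \<omega>' in M. integrable (distr M T Y) (\<lambda>y. f (X \<omega>', y))"
    by (rule AE_distrD[OF X])
  then show "AE \<omega>' in M. integrable M (\<lambda>\<omega>. f (X \<omega>', Y \<omega>))"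
  proof (rule AE_mp, intro AE_I2 impI)
    fix \<omega>' assume "\<omega>' \<in> space M" "integrable (distr M T Y) (\<lambda>y. f (X \<omega>', y))"
    then show "integrable M (\<lambda>\<omega>. f (X \<omega>', Y \<omega>))"
      using measurable_space[OF X] by (subst (asm) integrable_distr_eq) (auto intro: sub)
  qed
qed

lemma expectation_square_le:
  fixes X :: "'a \<Rightarrow> real"
  assumes "X \<in> borel_measurable M" "integrable M (\<lambda>x. (X x)\<^sup>2)"
  shows "(expectation X)\<^sup>2 \<le> expectation (\<lambda>x. (X x)\<^sup>2)"
  using variance_eq[of X] variance_positive[of X] square_integrable_imp_integrable[of X] assms by simp

end

text \<open>Bijections of the three regions \<open>A \<inter> B\<close>, \<open>A - B\<close> and
  \<open>B - A\<close> are glued together. The result is the renaming of data points that carries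
  one pair of subsamples to another with the same overlap.\<close>

lemma ex_bij_betw_pair:
  assumes "finite A" "finite B" "finite A'" "finite B'"
    and "card A = card A'" "card B = card B'" "card (A \<inter> B) = card (A' \<inter> B')"
  shows "\<exists>\<pi>. inj_on \<pi> (A \<union> B) \<and> \<pi> ` A = A' \<and> \<pi> ` B = B'"
proof -
  have c: "card (X - Y) = card X - card (X \<inter> Y)" if "finite X" for X Y :: "'c set"
    using that by (rule card_Diff_subset_Int[OF finite_Int[OF disjI1]])
  have "card (A - B) = card (A' - B')" using assms by (simp add: card_Diff_subset_Int)
  moreover have "card (B - A) = card (B' - A')"
    using assms by (simp add: card_Diff_subset_Int Int_commute)
  ultimately obtain f g h where f: "bij_betw f (A \<inter> B) (A' \<inter> B')" and g: "bij_betw g (A - B) (A' - B')"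
    and h: "bij_betw h (B - A) (B' - A')"
    using assms by (metis finite_Diff finite_Int finite_same_card_bij)
  define \<pi> where "\<pi> x = (if x \<in> A then if x \<in> B then f x else g x else h x)" for x
  have "bij_betw \<pi> (A \<inter> B) (A' \<inter> B')" using f by (rule bij_betw_cong[THEN iffD1, rotated]) (auto simp: \<pi>_def)
  moreover have "bij_betw \<pi> (A - B) (A' - B')" using g by (rule bij_betw_cong[THEN iffD1, rotated]) (auto simp: \<pi>_def)
  moreover have "bij_betw \<pi> (B - A) (B' - A')" using h by (rule bij_betw_cong[THEN iffD1, rotated]) (auto simp: \<pi>_def)
  ultimately have b: "\<pi> ` (A \<inter> B) = A' \<inter> B'" "\<pi> ` (A - B) = A' - B'" "\<pi> ` (B - A) = B' - A'"
    and i: "inj_on \<pi> (A \<inter> B)" "inj_on \<pi> (A - B)" "inj_on \<pi> (B - A)"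
    by (auto simp: bij_betw_def)
  have U: "A \<union> B = (A \<inter> B) \<union> ((A - B) \<union> (B - A))" by auto
  have "inj_on \<pi> (A \<union> B)"
    unfolding U inj_on_Un using i b by (auto simp del: Un_Diff_Int) blast+
  moreover have "\<pi> ` A = A'" using b by (metis Un_Diff_Int image_Un)
  moreover have "\<pi> ` B = B'" using b by (metis Un_Diff_Int image_Un Int_commute)
  ultimately show ?thesis by blast
qed

locale iid_sample = prob_space M for M :: "'w measure" +
  fixes Z :: "nat \<Rightarrow> 'w \<Rightarrow> 'e::topological_space" and D :: "'e measure"
  assumes indep_Z: "indep_vars (\<lambda>_. borel) Z {1..}"
    and distr_Z: "i \<ge> 1 \<Longrightarrow> distr M borel (Z i) = D"
begin

lemma Z_measurable: "i \<ge> 1 \<Longrightarrow> Z i \<in> borel_measurable M"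
  using indep_Z by (auto simp: indep_vars_def)

lemma restrict_measurable:
  assumes "\<pi> ` A \<subseteq> {1..}"
  shows "(\<lambda>\<omega>. \<lambda>i\<in>A. Z (\<pi> i) \<omega>) \<in> measurable M (Pi\<^sub>M A (\<lambda>_. borel))"
  using assms by (intro measurable_restrict Z_measurable) auto

lemma distr_restrict:
  assumes "A \<subseteq> {1..}"
  shows "distr M (Pi\<^sub>M A (\<lambda>_. borel)) (\<lambda>\<omega>. \<lambda>i\<in>A. Z i \<omega>) = Pi\<^sub>M A (\<lambda>_. D)"
proof (cases "A = {}")
  \<comment> \<open>The empty index set occurs for \<open>k = 1\<close>, when a tree has no data
    points besides the one held fixed. It is checked directly on the one-point product
    space.\<close>
  case True
  have "distr M (Pi\<^sub>M {} (\<lambda>_. borel)) (\<lambda>\<omega>. \<lambda>i\<in>{}. Z i \<omega>) = Pi\<^sub>M {} (\<lambda>_. D)"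
  proof (rule measure_eqI)
    show "sets (distr M (Pi\<^sub>M {} (\<lambda>_. borel)) (\<lambda>\<omega>. \<lambda>i\<in>{}. Z i \<omega>)) = sets (Pi\<^sub>M {} (\<lambda>_. D))"
      by (simp add: PiM_empty sets_PiM_empty)
    fix X assume "X \<in> sets (distr M (Pi\<^sub>M {} (\<lambda>_. borel)) (\<lambda>\<omega>. \<lambda>i\<in>{}. Z i \<omega>))"
    then have X: "X \<in> {{}, {\<lambda>_. undefined}}" by (simp add: sets_PiM_empty)
    have "(\<lambda>\<omega>. \<lambda>i\<in>{}. Z i \<omega>) -` {\<lambda>_. undefined} \<inter> space M = space M"
      by (auto simp: restrict_def)
    moreover have "(\<lambda>\<omega>. \<lambda>i\<in>{}. Z i \<omega>) \<in> measurable M (Pi\<^sub>M {} (\<lambda>_. borel))"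
      by (intro measurable_restrict) auto
    ultimately show "emeasure (distr M (Pi\<^sub>M {} (\<lambda>_. borel)) (\<lambda>\<omega>. \<lambda>i\<in>{}. Z i \<omega>)) X = emeasure (Pi\<^sub>M {} (\<lambda>_. D)) X"
      using X by (auto simp: emeasure_distr emeasure_space_1 sets_PiM_empty)
  qed
  then show ?thesis using True by simp
next
  case False
  have "distr M (Pi\<^sub>M A (\<lambda>_. borel)) (\<lambda>\<omega>. \<lambda>i\<in>A. Z i \<omega>) = Pi\<^sub>M A (\<lambda>i. distr M borel (Z i))"
    using indep_vars_subset[OF indep_Z assms] False assms
    by (subst (asm) indep_vars_iff_distr_eq_PiM') (auto intro!: Z_measurable)
  also have "\<dots> = Pi\<^sub>M A (\<lambda>_. D)"
    using assms by (intro PiM_cong) (auto intro!: distr_Z)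
  finally show ?thesis .
qed

lemma sets_D: "sets D = sets borel" and prob_space_D: "prob_space D"
  using distr_Z[of 1] prob_space_distr[OF Z_measurable[of 1]] by auto

lemma distr_reindex:
  assumes "inj_on \<pi> A" "\<pi> ` A \<subseteq> {1..}"
  shows "distr M (Pi\<^sub>M A (\<lambda>_. borel)) (\<lambda>\<omega>. \<lambda>i\<in>A. Z (\<pi> i) \<omega>) = Pi\<^sub>M A (\<lambda>_. D)"
proof -
  have sets: "sets (Pi\<^sub>M A (\<lambda>_. D)) = sets (Pi\<^sub>M A (\<lambda>_. borel))"
    by (intro sets_PiM_cong) (auto simp: sets_D)
  have "Pi\<^sub>M A (\<lambda>_. D) = distr (Pi\<^sub>M (\<pi> ` A) (\<lambda>_. D)) (Pi\<^sub>M A (\<lambda>_. D)) (\<lambda>z. \<lambda>n\<in>A. z (\<pi> n))"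
    by (rule distr_PiM_reindex[symmetric]) (use assms prob_space_D in auto)
  also have "\<dots> = distr (distr M (Pi\<^sub>M (\<pi> ` A) (\<lambda>_. borel)) (\<lambda>\<omega>. \<lambda>i\<in>\<pi> ` A. Z i \<omega>)) (Pi\<^sub>M A (\<lambda>_. borel)) (\<lambda>z. \<lambda>n\<in>A. z (\<pi> n))"
    unfolding distr_restrict[OF assms(2)] by (intro distr_cong sets refl)
  also have "\<dots> = distr M (Pi\<^sub>M A (\<lambda>_. borel)) (\<lambda>\<omega>. \<lambda>n\<in>A. (\<lambda>i\<in>\<pi> ` A. Z i \<omega>) (\<pi> n))"
    by (subst distr_distr)
       (use assms in \<open>auto simp: comp_def intro!: measurable_restrict Z_measurable measurable_component_singleton\<close>)
  also have "(\<lambda>\<omega>. \<lambda>n\<in>A. (\<lambda>i\<in>\<pi> ` A. Z i \<omega>) (\<pi> n)) = (\<lambda>\<omega>. \<lambda>i\<in>A. Z (\<pi> i) \<omega>)"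
    by (auto simp: fun_eq_iff)
  finally show ?thesis ..
qed

text \<open>Restricted to \<open>A\<close>, the sample and its renamed version both have the law
  \<open>Pi\<^sub>M A (\<lambda>_. D)\<close>.\<close>

lemma exchangeable:
  fixes \<Phi> :: "(nat \<Rightarrow> 'e) \<Rightarrow> real"
  assumes \<pi>: "inj_on \<pi> A" "\<pi> ` A \<subseteq> {1..}" and A: "A \<subseteq> {1..}"
    and [measurable]: "\<Phi> \<in> borel_measurable (Pi\<^sub>M A (\<lambda>_. borel))"
  shows "expectation (\<lambda>\<omega>. \<Phi> (\<lambda>i\<in>A. Z (\<pi> i) \<omega>)) = expectation (\<lambda>\<omega>. \<Phi> (\<lambda>i\<in>A. Z i \<omega>))"
    and "integrable M (\<lambda>\<omega>. \<Phi> (\<lambda>i\<in>A. Z (\<pi> i) \<omega>)) = integrable M (\<lambda>\<omega>. \<Phi> (\<lambda>i\<in>A. Z i \<omega>))"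
proof -
  have m1: "(\<lambda>\<omega>. \<lambda>i\<in>A. Z (\<pi> i) \<omega>) \<in> measurable M (Pi\<^sub>M A (\<lambda>_. borel))"
    using \<pi> by (intro restrict_measurable)
  have m2: "(\<lambda>\<omega>. \<lambda>i\<in>A. Z i \<omega>) \<in> measurable M (Pi\<^sub>M A (\<lambda>_. borel))"
    using restrict_measurable[of "\<lambda>x. x" A] A by simp
  have eq: "distr M (Pi\<^sub>M A (\<lambda>_. borel)) (\<lambda>\<omega>. \<lambda>i\<in>A. Z (\<pi> i) \<omega>) = distr M (Pi\<^sub>M A (\<lambda>_. borel)) (\<lambda>\<omega>. \<lambda>i\<in>A. Z i \<omega>)"
    using distr_reindex[OF \<pi>] distr_restrict[OF A] by simp
  show "expectation (\<lambda>\<omega>. \<Phi> (\<lambda>i\<in>A. Z (\<pi> i) \<omega>)) = expectation (\<lambda>\<omega>. \<Phi> (\<lambda>i\<in>A. Z i \<omega>))"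
    using integral_distr[OF m1, of \<Phi>] integral_distr[OF m2, of \<Phi>] eq by simp
  show "integrable M (\<lambda>\<omega>. \<Phi> (\<lambda>i\<in>A. Z (\<pi> i) \<omega>)) = integrable M (\<lambda>\<omega>. \<Phi> (\<lambda>i\<in>A. Z i \<omega>))"
    using integrable_distr_eq[OF m1, of \<Phi>] integrable_distr_eq[OF m2, of \<Phi>] eq by simp
qed

text \<open>The values are in a Banach space so that the lemma serves both real scores and complex
  exponentials.\<close>

lemma identical:
  fixes \<phi> :: "'e \<Rightarrow> 'z::{banach,second_countable_topology}"
  assumes "i \<ge> 1" "\<phi> \<in> borel_measurable borel"
  shows "expectation (\<lambda>\<omega>. \<phi> (Z i \<omega>)) = expectation (\<lambda>\<omega>. \<phi> (Z 1 \<omega>))"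
    and "integrable M (\<lambda>\<omega>. \<phi> (Z i \<omega>)) \<longleftrightarrow> integrable M (\<lambda>\<omega>. \<phi> (Z 1 \<omega>))"
proof -
  have "expectation (\<lambda>\<omega>. \<phi> (Z i \<omega>)) = integral\<^sup>L D \<phi>" "integrable M (\<lambda>\<omega>. \<phi> (Z i \<omega>)) \<longleftrightarrow> integrable D \<phi>" if "i \<ge> 1" for i
    using integral_distr[OF Z_measurable[OF that] assms(2)] integrable_distr_eq[OF Z_measurable[OF that] assms(2)] distr_Z[OF that] by simp_all
  then show "expectation (\<lambda>\<omega>. \<phi> (Z i \<omega>)) = expectation (\<lambda>\<omega>. \<phi> (Z 1 \<omega>))"
    "integrable M (\<lambda>\<omega>. \<phi> (Z i \<omega>)) \<longleftrightarrow> integrable M (\<lambda>\<omega>. \<phi> (Z 1 \<omega>))" using assms by simp_all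
qed

end

section \<open>Symmetric kernels and their projections\<close>

locale kernel_sample = iid_sample M Z D
  for M :: "'w measure" and Z :: "nat \<Rightarrow> 'w \<Rightarrow> 'e::topological_space" and D +
  fixes h :: "'e multiset \<Rightarrow> real" and k :: nat
  assumes k_pos: "1 \<le> k"
    and h_measurable: "(\<lambda>z. h (image_mset z (mset_set {1..k}))) \<in> borel_measurable (Pi\<^sub>M {1..k} (\<lambda>_. borel))"
    and h_L2: "integrable M (\<lambda>\<omega>. (h {#Z i \<omega>. i \<in># mset_set {1..k}#})\<^sup>2)"
    and h_centred: "expectation (\<lambda>\<omega>. h {#Z i \<omega>. i \<in># mset_set {1..k}#}) = 0"
begin

definition U :: "nat set \<Rightarrow> 'w \<Rightarrow> real" where
  "U I \<omega> = h {#Z i \<omega>. i \<in># mset_set I#}"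

text \<open>A concrete pair of subsamples with \<open>d \<le> k\<close> common points, namely the
  last \<open>d\<close> points of \<open>{1..k}\<close>; by \<open>U_pair\<close> any other pair
  with this overlap gives the same value. Since the kernel is centred, the second moment is a
  covariance.\<close>

definition overlap_cov :: "nat \<Rightarrow> real" where
  "overlap_cov d = expectation (\<lambda>\<omega>. U {1..k} \<omega> * U {Suc k - d..2 * k - d} \<omega>)"

definition index_set :: "nat set \<Rightarrow> bool" where
  "index_set I \<longleftrightarrow> I \<subseteq> {1..} \<and> finite I \<and> card I = k"

lemma index_set_nsets: "I \<in> nsets {1..n} k \<Longrightarrow> index_set I"
  by (auto simp: index_set_def nsets_def)

lemma kernel_measurable_subset:
  assumes "finite I" "card I = k" "I \<subseteq> N"
  shows "(\<lambda>z. h (image_mset z (mset_set I))) \<in> borel_measurable (Pi\<^sub>M N (\<lambda>_. borel))"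
proof -
  obtain b where b: "bij_betw b {1..k} I" using assms by (metis finite_same_card_bij card_atLeastAtMost diff_Suc_1 finite_atLeastAtMost)
  have *: "(image_mset z (mset_set I)) = image_mset (\<lambda>l\<in>{1..k}. z (b l)) (mset_set {1..k})" for z
  proof -
    have "image_mset (\<lambda>l\<in>{1..k}. z (b l)) (mset_set {1..k}) = {#z (b i). i \<in># mset_set {1..k}#}"
      by (intro image_mset_cong) auto
    also have "\<dots> = {#z j. j \<in># {#b i. i \<in># mset_set {1..k}#}#}" by (simp add: multiset.map_comp comp_def)
    also have "{#b i. i \<in># mset_set {1..k}#} = mset_set I"
      using b by (simp add: image_mset_mset_set bij_betw_def)
    finally show ?thesis ..
  qed
  have "(\<lambda>z. h (image_mset (\<lambda>l\<in>{1..k}. z (b l)) (mset_set {1..k}))) \<in> borel_measurable (Pi\<^sub>M N (\<lambda>_. borel))"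
  proof (rule measurable_compose[OF _ h_measurable])
    show "(\<lambda>z. \<lambda>l\<in>{1..k}. z (b l)) \<in> measurable (Pi\<^sub>M N (\<lambda>_. borel)) (Pi\<^sub>M {1..k} (\<lambda>_. borel))"
      using b assms by (intro measurable_restrict measurable_component_singleton) (auto simp: bij_betw_def)
  qed
  moreover have "(\<lambda>z. h (image_mset z (mset_set I))) = (\<lambda>z. h (image_mset (\<lambda>l\<in>{1..k}. z (b l)) (mset_set {1..k})))"
    by (rule ext, rule arg_cong[where f = h]) (rule *)
  ultimately show ?thesis by (simp only:)
qed

lemma U_restrict:
  assumes "finite I" "I \<subseteq> N"
  shows "h (image_mset (\<lambda>i\<in>N. Z (\<pi> i) \<omega>) (mset_set I)) = h {#Z (\<pi> i) \<omega>. i \<in># mset_set I#}"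
  using assms by (intro arg_cong[where f = h] image_mset_cong) auto

lemma U_image:
  assumes "inj_on \<pi> I"
  shows "h {#Z (\<pi> i) \<omega>. i \<in># mset_set I#} = U (\<pi> ` I) \<omega>"
  unfolding U_def by (simp add: image_mset_mset_set[symmetric] assms multiset.map_comp comp_def)

lemma U_measurable:
  assumes "index_set I"
  shows "U I \<in> borel_measurable M"
proof -
  have "(\<lambda>\<omega>. h (image_mset (\<lambda>i\<in>I. Z i \<omega>) (mset_set I))) \<in> borel_measurable M"
    by (rule measurable_compose[OF restrict_measurable[of "\<lambda>x. x" I] kernel_measurable_subset[of I I]])
       (use assms in \<open>auto simp: index_set_def\<close>)
  then show ?thesis
    using assms U_restrict[of I I "\<lambda>x. x"] by (simp add: U_def[abs_def] index_set_def)
qed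

text \<open>A renaming of the data points carries \<open>I'\<close> to \<open>I\<close> and
  \<open>J'\<close> to \<open>J\<close>, and the law of an i.i.d. sample is invariant under
  it.\<close>

lemma U_pair:
  assumes IJ: "index_set I" "index_set J" and IJ': "index_set I'" "index_set J'"
    and c: "card (I \<inter> J) = card (I' \<inter> J')"
  shows "expectation (\<lambda>\<omega>. U I \<omega> * U J \<omega>) = expectation (\<lambda>\<omega>. U I' \<omega> * U J' \<omega>)"
    and "integrable M (\<lambda>\<omega>. U I \<omega> * U J \<omega>) = integrable M (\<lambda>\<omega>. U I' \<omega> * U J' \<omega>)"
proof -
  have "\<exists>\<pi>. inj_on \<pi> (I' \<union> J') \<and> \<pi> ` I' = I \<and> \<pi> ` J' = J"
    using assms by (intro ex_bij_betw_pair) (auto simp: index_set_def)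
  then obtain \<pi> where \<pi>: "inj_on \<pi> (I' \<union> J')" "\<pi> ` I' = I" "\<pi> ` J' = J" by blast
  let ?N = "I' \<union> J'"
  define \<Phi> where "\<Phi> z = h (image_mset z (mset_set I')) * h (image_mset z (mset_set J'))" for z
  have m: "\<Phi> \<in> borel_measurable (Pi\<^sub>M ?N (\<lambda>_. borel))"
    unfolding \<Phi>_def using IJ' by (intro borel_measurable_times kernel_measurable_subset) (auto simp: index_set_def)
  have 1: "\<Phi> (\<lambda>i\<in>?N. Z (\<pi> i) \<omega>) = U I \<omega> * U J \<omega>" for \<omega>
    using IJ' \<pi> U_restrict[of I' ?N \<pi>] U_restrict[of J' ?N \<pi>] U_image[of \<pi> I'] U_image[of \<pi> J']
    by (simp add: \<Phi>_def index_set_def inj_on_Un)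
  have 2: "\<Phi> (\<lambda>i\<in>?N. Z i \<omega>) = U I' \<omega> * U J' \<omega>" for \<omega>
    using IJ' U_restrict[of I' ?N "\<lambda>x. x"] U_restrict[of J' ?N "\<lambda>x. x"]
    by (simp add: \<Phi>_def index_set_def U_def)
  have N: "?N \<subseteq> {1..}" "\<pi> ` ?N \<subseteq> {1..}" using assms \<pi> by (auto simp: index_set_def image_Un)
  show "expectation (\<lambda>\<omega>. U I \<omega> * U J \<omega>) = expectation (\<lambda>\<omega>. U I' \<omega> * U J' \<omega>)"
    using exchangeable(1)[OF \<pi>(1) N(2,1) m] unfolding 1 2 .
  show "integrable M (\<lambda>\<omega>. U I \<omega> * U J \<omega>) = integrable M (\<lambda>\<omega>. U I' \<omega> * U J' \<omega>)"
    using exchangeable(2)[OF \<pi>(1) N(2,1) m] unfolding 1 2 .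
qed

lemma index_set_1k: "index_set {1..k}"
  by (auto simp: index_set_def)

lemma U_L2:
  assumes "index_set I"
  shows "integrable M (\<lambda>\<omega>. (U I \<omega>)\<^sup>2)"
  using U_pair(2)[OF assms assms index_set_1k index_set_1k] h_L2 assms
  by (simp add: power2_eq_square U_def index_set_def)

lemma overlap_cov:
  assumes "index_set I" "index_set J"
  shows "expectation (\<lambda>\<omega>. U I \<omega> * U J \<omega>) = overlap_cov (card (I \<inter> J))"
proof -
  let ?d = "card (I \<inter> J)"
  have d: "?d \<le> k" using assms card_mono[of I "I \<inter> J"] by (auto simp: index_set_def)
  then have "{1..k} \<inter> {Suc k - ?d..2 * k - ?d} = {Suc k - ?d..k}" by auto
  then show ?thesis
    unfolding overlap_cov_def using assms d
    by (intro U_pair(1) index_set_1k) (auto simp: index_set_def)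
qed

text \<open>The first-order Hoeffding projection: the expectation of the kernel with one of its
  points fixed at \<open>z\<close>. No mean is subtracted because the kernel is centred.\<close>

definition proj :: "'e \<Rightarrow> real" where
  "proj z = expectation (\<lambda>\<omega>. h (add_mset z {#Z i \<omega>. i \<in># mset_set {2..k}#}))"

lemma kernel_add_measurable:
  fixes A B N :: "nat set"
  assumes "finite A" "card A = k - 1" "i \<notin> A" "i \<in> N" "A \<subseteq> B"
  shows "(\<lambda>(y, z). h (add_mset (y i) (image_mset z (mset_set A))))
     \<in> borel_measurable (Pi\<^sub>M N (\<lambda>_. borel) \<Otimes>\<^sub>M Pi\<^sub>M B (\<lambda>_. borel))"
proof -
  let ?P = "Pi\<^sub>M N (\<lambda>_. borel) \<Otimes>\<^sub>M Pi\<^sub>M B (\<lambda>_. borel) :: ((nat \<Rightarrow> 'e) \<times> (nat \<Rightarrow> 'e)) measure"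
  have "(\<lambda>p. \<lambda>l\<in>insert i A. if l = i then fst p i else snd p l) \<in> measurable ?P (Pi\<^sub>M (insert i A) (\<lambda>_. borel))"
  proof (rule measurable_restrict)
    fix l assume l: "l \<in> insert i A"
    show "(\<lambda>p. if l = i then fst p i else snd p l) \<in> borel_measurable ?P"
    proof (cases "l = i")
      case True
      then show ?thesis using assms measurable_compose[OF measurable_fst measurable_component_singleton[of i N]] by auto
    next
      case False
      then show ?thesis using l assms measurable_compose[OF measurable_snd measurable_component_singleton[of l B]] by auto
    qed
  qed
  then have "(\<lambda>p. h (image_mset (\<lambda>l\<in>insert i A. if l = i then fst p i else snd p l) (mset_set (insert i A))))
      \<in> borel_measurable ?P"
    by (rule measurable_compose[OF _ kernel_measurable_subset]) (use assms k_pos in auto)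
  moreover have "image_mset (\<lambda>l\<in>insert i A. if l = i then fst p i else snd p l) (mset_set (insert i A))
      = add_mset (fst p i) (image_mset (snd p) (mset_set A))" for p :: "(nat \<Rightarrow> 'e) \<times> (nat \<Rightarrow> 'e)"
  proof -
    have "image_mset (\<lambda>l\<in>insert i A. if l = i then fst p i else snd p l) (mset_set A) = (image_mset (snd p) (mset_set A))"
      using assms by (intro image_mset_cong) auto
    then show ?thesis using assms by simp
  qed
  ultimately show ?thesis by (simp add: case_prod_beta)
qed

lemma kernel_section_measurable:
  fixes A B :: "nat set"
  assumes "finite A" "card A = k - 1" "A \<subseteq> B"
  shows "(\<lambda>z. h (add_mset y (image_mset z (mset_set A)))) \<in> borel_measurable (Pi\<^sub>M B (\<lambda>_. borel))"
proof -
  \<comment> \<open>A dummy index outside \<open>A\<close> carries the fixed point \<open>y\<close>,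
    so that joint measurability can be used.\<close>
  obtain i where i: "i \<notin> A" using assms(1) ex_new_if_finite infinite_UNIV_nat by blast
  have "(\<lambda>z. (\<lambda>l\<in>{i}. y, z)) \<in> measurable (Pi\<^sub>M B (\<lambda>_. borel)) (Pi\<^sub>M {i} (\<lambda>_. borel) \<Otimes>\<^sub>M Pi\<^sub>M B (\<lambda>_. borel))"
    by (intro measurable_Pair measurable_ident measurable_const) (auto simp: space_PiM)
  from measurable_compose[OF this kernel_add_measurable[of A i "{i}" B]] show ?thesis
    using assms i by simp
qed

lemma proj_eq:
  assumes "finite A" "card A = k - 1" "A \<subseteq> {1..}"
  shows "expectation (\<lambda>\<omega>. h (add_mset y {#Z l \<omega>. l \<in># mset_set A#})) = proj y"
proof -
  have "card {2..k} = card A" using assms by simp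
  then obtain \<pi> where \<pi>: "bij_betw \<pi> {2..k} A"
    using finite_same_card_bij[OF finite_atLeastAtMost assms(1)] by blast
  define \<Phi> where "\<Phi> z = h (add_mset y (image_mset z (mset_set {2..k})))" for z :: "nat \<Rightarrow> 'e"
  have m: "\<Phi> \<in> borel_measurable (Pi\<^sub>M {2..k} (\<lambda>_. borel))"
    unfolding \<Phi>_def by (rule kernel_section_measurable) auto
  have 1: "\<Phi> (\<lambda>i\<in>{2..k}. Z (\<pi> i) \<omega>) = h (add_mset y {#Z l \<omega>. l \<in># mset_set A#})" for \<omega>
  proof -
    have "image_mset (\<lambda>i\<in>{2..k}. Z (\<pi> i) \<omega>) (mset_set {2..k}) = {#Z (\<pi> l) \<omega>. l \<in># mset_set {2..k}#}"
      by (intro image_mset_cong) auto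
    also have "\<dots> = {#Z l \<omega>. l \<in># {#\<pi> i. i \<in># mset_set {2..k}#}#}" by (simp add: multiset.map_comp comp_def)
    also have "{#\<pi> i. i \<in># mset_set {2..k}#} = mset_set A"
      using \<pi> by (simp add: image_mset_mset_set bij_betw_def)
    finally show ?thesis by (simp only: \<Phi>_def)
  qed
  have 2: "\<Phi> (\<lambda>i\<in>{2..k}. Z i \<omega>) = h (add_mset y {#Z l \<omega>. l \<in># mset_set {2..k}#})" for \<omega>
    unfolding \<Phi>_def by (intro arg_cong[where f = h] arg_cong[where f = "add_mset y"] image_mset_cong) auto
  show ?thesis
    using exchangeable(1)[OF _ _ _ m, of \<pi>] \<pi> assms unfolding 1 2 proj_def
    by (auto simp: bij_betw_def)
qed

lemma proj_measurable: "proj \<in> borel_measurable borel"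
proof -
  have D: "sets (distr M (Pi\<^sub>M {2..k} (\<lambda>_. borel)) (\<lambda>\<omega>. \<lambda>i\<in>{2..k}. Z i \<omega>)) = sets (Pi\<^sub>M {2..k} (\<lambda>_. borel))" by simp
  have rm: "(\<lambda>\<omega>. \<lambda>i\<in>{2..k}. Z i \<omega>) \<in> measurable M (Pi\<^sub>M {2..k} (\<lambda>_. borel))"
    using restrict_measurable[of "\<lambda>x. x" "{2..k}"] by auto
  interpret P: prob_space "distr M (Pi\<^sub>M {2..k} (\<lambda>_. borel)) (\<lambda>\<omega>. \<lambda>i\<in>{2..k}. Z i \<omega>)"
    by (rule prob_space_distr[OF rm])
  have eq: "proj y = (\<integral>z. h (add_mset y (image_mset z (mset_set {2..k}))) \<partial>distr M (Pi\<^sub>M {2..k} (\<lambda>_. borel)) (\<lambda>\<omega>. \<lambda>i\<in>{2..k}. Z i \<omega>))" for y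
  proof -
    have "h (add_mset y (image_mset (\<lambda>i\<in>{2..k}. Z i \<omega>) (mset_set {2..k}))) = h (add_mset y {#Z l \<omega>. l \<in># mset_set {2..k}#})" for \<omega>
      by (intro arg_cong[where f = h] arg_cong[where f = "add_mset y"] image_mset_cong) auto
    then show ?thesis
      unfolding proj_def by (subst integral_distr[OF rm kernel_section_measurable]) auto
  qed
  have "(\<lambda>p. (\<lambda>l\<in>{1::nat}. fst p, snd p)) \<in> measurable (borel \<Otimes>\<^sub>M Pi\<^sub>M {2..k} (\<lambda>_. borel))
      (Pi\<^sub>M {1} (\<lambda>_. borel) \<Otimes>\<^sub>M Pi\<^sub>M {2..k} (\<lambda>_. borel :: 'e measure))"
    by (intro measurable_Pair measurable_restrict measurable_fst measurable_snd)
  from measurable_compose[OF this kernel_add_measurable[of "{2..k}" 1 "{1}" "{2..k}"]]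
  have "(\<lambda>(y, z). h (add_mset y (image_mset z (mset_set {2..k})))) \<in> borel_measurable (borel \<Otimes>\<^sub>M Pi\<^sub>M {2..k} (\<lambda>_. borel))"
    by (simp add: case_prod_beta)
  then have "(\<lambda>y. \<integral>z. h (add_mset y (image_mset z (mset_set {2..k}))) \<partial>distr M (Pi\<^sub>M {2..k} (\<lambda>_. borel)) (\<lambda>\<omega>. \<lambda>i\<in>{2..k}. Z i \<omega>)) \<in> borel_measurable borel"
    by (intro P.borel_measurable_lebesgue_integral) (simp add: measurable_cong_sets[OF sets_pair_measure_cong[OF refl D] refl])
  then show ?thesis by (simp add: eq[abs_def])
qed

lemma proj_component:
  assumes "l \<in> A"
  shows "(\<lambda>z. proj (z l)) \<in> borel_measurable (Pi\<^sub>M A (\<lambda>_. borel))"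
  by (rule measurable_compose[where g = proj, OF measurable_component_singleton[OF assms]]) (rule proj_measurable)

definition pr :: "nat \<Rightarrow> 'w \<Rightarrow> real" where
  "pr i \<omega> = proj (Z i \<omega>)"

lemma pr_measurable: "i \<ge> 1 \<Longrightarrow> pr i \<in> borel_measurable M"
  unfolding pr_def[abs_def] by (rule measurable_compose[OF Z_measurable proj_measurable])

lemma U_insert:
  assumes "finite A" "i \<notin> A"
  shows "U (insert i A) \<omega> = h (add_mset (Z i \<omega>) {#Z l \<omega>. l \<in># mset_set A#})"
  using assms by (simp add: U_def)

text \<open>Integrating out the points of \<open>A\<close>, on which \<open>\<Phi>\<close> does not
  depend, turns the kernel into its projection at \<open>Z i\<close>. Since \<open>\<Phi>\<close>
  may involve \<open>Z i\<close> and further points outside \<open>A\<close>, this one identity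
  yields the mean of the projection, its covariances with kernels, and the covariance of two kernels
  that share at most one point.\<close>

lemma proj_Fubini:
  fixes \<Phi> :: "(nat \<Rightarrow> 'e) \<Rightarrow> real"
  assumes A: "finite A" "card A = k - 1" "A \<subseteq> {1..}" and N: "N \<subseteq> {1..}" "i \<in> N" "N \<inter> A = {}"
    and [measurable]: "\<Phi> \<in> borel_measurable (Pi\<^sub>M N (\<lambda>_. borel))"
    and int: "integrable M (\<lambda>\<omega>. U (insert i A) \<omega> * \<Phi> (\<lambda>l\<in>N. Z l \<omega>))"
  shows "expectation (\<lambda>\<omega>. U (insert i A) \<omega> * \<Phi> (\<lambda>l\<in>N. Z l \<omega>)) = expectation (\<lambda>\<omega>. pr i \<omega> * \<Phi> (\<lambda>l\<in>N. Z l \<omega>))"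
proof -
  let ?X = "\<lambda>\<omega>. \<lambda>l\<in>N. Z l \<omega>" and ?Y = "\<lambda>\<omega>. \<lambda>l\<in>A. Z l \<omega>"
  define f where "f = (\<lambda>(y, z). h (add_mset (y i) (image_mset z (mset_set A))) * \<Phi> y)"
  have iA: "i \<notin> A" using N by auto
  have ind: "indep_var (Pi\<^sub>M N (\<lambda>_. borel)) ?X (Pi\<^sub>M A (\<lambda>_. borel)) ?Y"
    by (rule indep_var_restrict[OF indep_Z]) (use A N in auto)
  have "(\<lambda>p. h (add_mset (fst p i) (image_mset (snd p) (mset_set A))) * \<Phi> (fst p)) \<in> borel_measurable (Pi\<^sub>M N (\<lambda>_. borel) \<Otimes>\<^sub>M Pi\<^sub>M A (\<lambda>_. borel))"
    using kernel_add_measurable[of A i N A] A N iA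
    by (intro borel_measurable_times) (auto simp: case_prod_beta)
  then have f: "f \<in> borel_measurable (Pi\<^sub>M N (\<lambda>_. borel) \<Otimes>\<^sub>M Pi\<^sub>M A (\<lambda>_. borel))"
    by (simp add: f_def case_prod_beta)
  have restrict: "h (add_mset y (image_mset (?Y \<omega>) (mset_set A))) = h (add_mset y {#Z l \<omega>. l \<in># mset_set A#})" for y \<omega>
    using A by (intro arg_cong[where f = h] arg_cong[where f = "add_mset y"] image_mset_cong) auto
  have fXY: "f (?X \<omega>', ?Y \<omega>) = h (add_mset (Z i \<omega>') {#Z l \<omega>. l \<in># mset_set A#}) * \<Phi> (?X \<omega>')" for \<omega>' \<omega>
    using N restrict by (simp add: f_def)
  have "integrable M (\<lambda>\<omega>. f (?X \<omega>, ?Y \<omega>))"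
    using int unfolding fXY U_insert[OF A(1) iA] .
  from indep_var_Fubini(2)[OF ind f this]
  show ?thesis
    unfolding fXY U_insert[OF A(1) iA] by (simp add: proj_eq[OF A] pr_def)
qed

text \<open>Jensen's inequality inside the inner expectation: the squared projection is almost
  surely at most the projection of the squared kernel, which is integrable by Fubini's
  theorem.\<close>

lemma pr_L2:
  assumes i: "i \<ge> 1"
  shows "integrable M (\<lambda>\<omega>. (pr i \<omega>)\<^sup>2)"
proof -
  \<comment> \<open>The \<open>k - 1\<close> indices following \<open>i\<close>; by
    \<open>proj_eq\<close> the choice does not matter.\<close>
  define A where "A = {i + 1..<i + k}"
  have A: "finite A" "card A = k - 1" "A \<subseteq> {1..}" and iA: "i \<notin> A" by (auto simp: A_def)
  have I: "index_set (insert i A)" using A iA i k_pos by (auto simp: index_set_def)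
  let ?X = "\<lambda>\<omega>. \<lambda>l\<in>{i}. Z l \<omega>" and ?Y = "\<lambda>\<omega>. \<lambda>l\<in>A. Z l \<omega>"
  define f where "f = (\<lambda>(y, z). (h (add_mset (y i) (image_mset z (mset_set A))))\<^sup>2)"
  have ind: "indep_var (Pi\<^sub>M {i} (\<lambda>_. borel)) ?X (Pi\<^sub>M A (\<lambda>_. borel)) ?Y"
    by (rule indep_var_restrict[OF indep_Z]) (use A i iA in auto)
  have "(\<lambda>p. (h (add_mset (fst p i) (image_mset (snd p) (mset_set A))))\<^sup>2) \<in> borel_measurable (Pi\<^sub>M {i} (\<lambda>_. borel) \<Otimes>\<^sub>M Pi\<^sub>M A (\<lambda>_. borel))"
    using kernel_add_measurable[of A i "{i}" A] A iA
    by (intro borel_measurable_power) (auto simp: case_prod_beta)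
  then have f: "f \<in> borel_measurable (Pi\<^sub>M {i} (\<lambda>_. borel) \<Otimes>\<^sub>M Pi\<^sub>M A (\<lambda>_. borel))"
    by (simp add: f_def case_prod_beta)
  have restrict: "h (add_mset y (image_mset (?Y \<omega>) (mset_set A))) = h (add_mset y {#Z l \<omega>. l \<in># mset_set A#})" for y \<omega>
    using A by (intro arg_cong[where f = h] arg_cong[where f = "add_mset y"] image_mset_cong) auto
  have fXY: "f (?X \<omega>', ?Y \<omega>) = (h (add_mset (Z i \<omega>') {#Z l \<omega>. l \<in># mset_set A#}))\<^sup>2" for \<omega>' \<omega>
    using restrict by (simp add: f_def)
  have int: "integrable M (\<lambda>\<omega>. f (?X \<omega>, ?Y \<omega>))"
    using U_L2[OF I] unfolding fXY U_insert[OF A(1) iA] .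
  note F = indep_var_Fubini[OF ind f int, unfolded fXY]
  have ms: "(\<lambda>\<omega>. h (add_mset y {#Z l \<omega>. l \<in># mset_set A#})) \<in> borel_measurable M" for y
  proof -
    have "(\<lambda>\<omega>. h (add_mset y (image_mset (?Y \<omega>) (mset_set A)))) \<in> borel_measurable M"
      by (rule measurable_compose[OF restrict_measurable[of "\<lambda>x. x" A] kernel_section_measurable[of A A]]) (use A in auto)
    then show ?thesis by (simp only: restrict)
  qed
  show ?thesis
  proof (rule Bochner_Integration.integrable_bound[OF F(1)])
    show "(\<lambda>\<omega>. (pr i \<omega>)\<^sup>2) \<in> borel_measurable M" using pr_measurable[OF i] by simp
    show "AE \<omega>' in M. norm ((pr i \<omega>')\<^sup>2) \<le> norm (expectation (\<lambda>\<omega>. (h (add_mset (Z i \<omega>') {#Z l \<omega>. l \<in># mset_set A#}))\<^sup>2))"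
      using F(3)
    proof (rule AE_mp, intro AE_I2 impI)
      fix \<omega>' assume "integrable M (\<lambda>\<omega>. (h (add_mset (Z i \<omega>') {#Z l \<omega>. l \<in># mset_set A#}))\<^sup>2)"
      then have "(expectation (\<lambda>\<omega>. h (add_mset (Z i \<omega>') {#Z l \<omega>. l \<in># mset_set A#})))\<^sup>2
         \<le> expectation (\<lambda>\<omega>. (h (add_mset (Z i \<omega>') {#Z l \<omega>. l \<in># mset_set A#}))\<^sup>2)"
        by (intro expectation_square_le ms)
      then show "norm ((pr i \<omega>')\<^sup>2) \<le> norm (expectation (\<lambda>\<omega>. (h (add_mset (Z i \<omega>') {#Z l \<omega>. l \<in># mset_set A#}))\<^sup>2))"
        by (simp add: proj_eq[OF A] pr_def)
    qed
  qed
qed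

definition proj_var :: real where
  "proj_var = expectation (\<lambda>\<omega>. (pr 1 \<omega>)\<^sup>2)"

lemma pr_square: "i \<ge> 1 \<Longrightarrow> expectation (\<lambda>\<omega>. (pr i \<omega>)\<^sup>2) = proj_var"
  unfolding proj_var_def pr_def using proj_measurable by (intro identical(1)) auto

lemma U_centred:
  assumes I: "index_set I"
  shows "expectation (U I) = 0"
proof -
  obtain \<pi> where \<pi>: "bij_betw \<pi> {1..k} I" using I unfolding index_set_def
    by (metis finite_same_card_bij card_atLeastAtMost diff_Suc_1 finite_atLeastAtMost)
  have "expectation (\<lambda>\<omega>. h (image_mset (\<lambda>i\<in>{1..k}. Z (\<pi> i) \<omega>) (mset_set {1..k})))
      = expectation (\<lambda>\<omega>. h (image_mset (\<lambda>i\<in>{1..k}. Z i \<omega>) (mset_set {1..k})))"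
    by (rule exchangeable(1)[OF _ _ _ h_measurable]) (use \<pi> I in \<open>auto simp: bij_betw_def index_set_def\<close>)
  then show ?thesis
    using U_restrict[of "{1..k}" "{1..k}" \<pi>] U_restrict[of "{1..k}" "{1..k}" "\<lambda>x. x"] U_image[of \<pi> "{1..k}"] \<pi> h_centred
    by (simp add: bij_betw_def)
qed

lemma pr_centred:
  assumes i: "i \<ge> 1"
  shows "expectation (pr i) = 0"
proof -
  define A where "A = {i + 1..<i + k}"
  have A: "finite A" "card A = k - 1" "A \<subseteq> {1..}" and iA: "{i} \<inter> A = {}" by (auto simp: A_def)
  have I: "index_set (insert i A)" using A iA i k_pos by (auto simp: index_set_def)
  have "expectation (\<lambda>\<omega>. U (insert i A) \<omega> * 1) = expectation (\<lambda>\<omega>. pr i \<omega> * 1)"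
    using proj_Fubini[OF A, of "{i}" i "\<lambda>_. 1"] i iA square_integrable_imp_integrable[OF U_measurable[OF I] U_L2[OF I]]
    by auto
  then show ?thesis using U_centred[OF I] by simp
qed

lemma pr_orthogonal:
  assumes "i \<ge> 1" "l \<ge> 1" "i \<noteq> l"
  shows "expectation (\<lambda>\<omega>. pr l \<omega> * pr i \<omega>) = 0"
proof -
  have "indep_var borel ((\<lambda>z. proj (z l)) \<circ> (\<lambda>\<omega>. \<lambda>j\<in>{l}. Z j \<omega>)) borel ((\<lambda>z. proj (z i)) \<circ> (\<lambda>\<omega>. \<lambda>j\<in>{i}. Z j \<omega>))"
    using assms
    by (intro indep_var_compose[OF indep_var_restrict[OF indep_Z]]
      proj_component) auto
  then have "indep_var borel (pr l) borel (pr i)" by (simp add: comp_def pr_def[abs_def])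
  then have "expectation (\<lambda>\<omega>. pr l \<omega> * pr i \<omega>) = expectation (pr l) * expectation (pr i)"
    by (rule indep_var_lebesgue_integral)
       (use square_integrable_imp_integrable[OF pr_measurable pr_L2] assms in auto)
  then show ?thesis using pr_centred assms by simp
qed

lemma U_pr:
  assumes I: "index_set I" and i: "i \<ge> 1"
  shows "expectation (\<lambda>\<omega>. U I \<omega> * pr i \<omega>) = (if i \<in> I then proj_var else 0)"
proof -
  have "I \<noteq> {}" using I k_pos by (auto simp: index_set_def)
  then obtain l0 where l0: "l0 \<in> I" by blast
  \<comment> \<open>If \<open>i\<close> is in the subsample, it is the point that is kept. Otherwise
    all points but an arbitrary one are integrated out, and the two projections that remain are
    orthogonal.\<close>
  define l where "l = (if i \<in> I then i else l0)"
  have l: "l \<in> I" "i \<in> I \<Longrightarrow> l = i" using l0 by (auto simp: l_def)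
  define A where "A = I - {l}"
  have A: "finite A" "card A = k - 1" "A \<subseteq> {1..}" "insert l A = I" using I l by (auto simp: A_def index_set_def)
  have l1: "l \<ge> 1" using I l by (auto simp: index_set_def)
  have int: "integrable M (\<lambda>\<omega>. U I \<omega> * pr i \<omega>)"
    using I i by (intro L2_mult_integrable U_measurable pr_measurable U_L2 pr_L2)
  have "(\<lambda>z. proj (z i)) \<in> borel_measurable (Pi\<^sub>M {l, i} (\<lambda>_. borel))"
    by (rule proj_component) simp
  from proj_Fubini[OF A(1-3) _ _ _ this, of l]
  have "expectation (\<lambda>\<omega>. U I \<omega> * pr i \<omega>) = expectation (\<lambda>\<omega>. pr l \<omega> * pr i \<omega>)"
    using l l1 i A int by (auto simp: pr_def A_def)
  also have "\<dots> = (if i \<in> I then proj_var else 0)"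
    using l l1 i pr_square[OF i] pr_orthogonal[of i l] by (auto simp: power2_eq_square)
  finally show ?thesis .
qed

text \<open>Overlap \<open>0\<close> or \<open>1\<close> means that the subsamples share at most one
  point, which may be taken to be \<open>1\<close>. Integrating out the points
  \<open>2, ..., k\<close> of the first subsample leaves its projection at \<open>Z 1\<close>, and
  \<open>U_pr\<close> evaluates the rest.\<close>

lemma overlap_cov_0: "overlap_cov 0 = 0" and overlap_cov_1: "overlap_cov 1 = proj_var"
proof -
  have *: "overlap_cov d = expectation (\<lambda>\<omega>. U {1..k} \<omega> * U J \<omega>)"
    if "index_set J" "card ({1..k} \<inter> J) = d" for J d
    unfolding overlap_cov[OF index_set_1k that(1)] that(2) ..
  have **: "expectation (\<lambda>\<omega>. U {1..k} \<omega> * U J \<omega>) = expectation (\<lambda>\<omega>. U J \<omega> * pr 1 \<omega>)"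
    if J: "index_set J" "{1..k} \<inter> J \<subseteq> {1}" for J
  proof -
    have 1: "{1..k} = insert 1 {2..k}" using k_pos by auto
    define \<Phi> where "\<Phi> z = h (image_mset z (mset_set J))" for z
    have m: "\<Phi> \<in> borel_measurable (Pi\<^sub>M (insert 1 J) (\<lambda>_. borel))"
      unfolding \<Phi>_def using J by (intro kernel_measurable_subset) (auto simp: index_set_def)
    have \<Phi>: "\<Phi> (\<lambda>l\<in>insert 1 J. Z l \<omega>) = U J \<omega>" for \<omega>
      using U_restrict[of J "insert 1 J" "\<lambda>x. x" \<omega>] J(1) by (simp only: \<Phi>_def U_def index_set_def subset_insertI)
    have "expectation (\<lambda>\<omega>. U (insert 1 {2..k}) \<omega> * \<Phi> (\<lambda>l\<in>insert 1 J. Z l \<omega>)) = expectation (\<lambda>\<omega>. pr 1 \<omega> * \<Phi> (\<lambda>l\<in>insert 1 J. Z l \<omega>))"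
    proof (rule proj_Fubini[OF _ _ _ _ _ _ m])
      show "integrable M (\<lambda>\<omega>. U (insert 1 {2..k}) \<omega> * \<Phi> (\<lambda>l\<in>insert 1 J. Z l \<omega>))"
        unfolding \<Phi> 1[symmetric] using J index_set_1k by (intro L2_mult_integrable U_measurable U_L2)
      have "x \<notin> J" if "x \<in> {2..k}" for x using subsetD[OF J(2), of x] that by auto
      then show "insert 1 J \<inter> {2..k} = {}" by auto
      show "insert 1 J \<subseteq> {1..}" using J(1) by (simp add: index_set_def)
    qed auto
    then show ?thesis by (simp only: \<Phi> 1[symmetric] mult.commute)
  qed
  let ?J0 = "{k + 1..2 * k}" and ?J1 = "insert 1 {k + 2..2 * k}"
  have J: "index_set ?J0" "index_set ?J1"
    using k_pos by (simp_all add: index_set_def)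
  have "{1..k} \<inter> {k + 2..2 * k} = {}" by (simp add: disjoint_iff del: Int_atLeastAtMost)
  then have I: "{1..k} \<inter> ?J1 = {1}" using k_pos by (simp add: Int_insert_right del: Int_atLeastAtMost)
  have I0: "{1..k} \<inter> ?J0 = {}" by (simp add: disjoint_iff del: Int_atLeastAtMost)
  have "overlap_cov 0 = expectation (\<lambda>\<omega>. U {1..k} \<omega> * U ?J0 \<omega>)"
    by (rule *[OF J(1)]) (simp only: I0 card.empty)
  also have "\<dots> = expectation (\<lambda>\<omega>. U ?J0 \<omega> * pr 1 \<omega>)"
    by (rule **[OF J(1)]) (simp only: I0 empty_subsetI)
  also have "\<dots> = 0" by (subst U_pr[OF J(1)]) (use k_pos in auto)
  finally show "overlap_cov 0 = 0" .
  have "overlap_cov 1 = expectation (\<lambda>\<omega>. U {1..k} \<omega> * U ?J1 \<omega>)"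
    by (rule *[OF J(2)]) (simp only: I card_1_singleton_iff, simp)
  also have "\<dots> = expectation (\<lambda>\<omega>. U ?J1 \<omega> * pr 1 \<omega>)"
    by (rule **[OF J(2)]) (simp only: I order_refl)
  also have "\<dots> = proj_var" by (subst U_pr[OF J(2)]) auto
  finally show "overlap_cov 1 = proj_var" .
qed

end

section \<open>Nonnegativity of the Hoeffding variances\<close>

definition sym_diff :: "'i set \<Rightarrow> 'i set \<Rightarrow> 'i set" where
  "sym_diff s t = (s - t) \<union> (t - s)"

lemma minus_one_power_card:
  assumes "finite U" "s \<subseteq> U"
  shows "(-1::real) ^ card s = (\<Prod>l\<in>U. if l \<in> s then -1 else 1)"
  using assms by (simp add: prod.If_cases Int_absorb1)

text \<open>For fixed \<open>s\<close> the substitution \<open>u = sym_diff s t\<close> is an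
  involution on the subsets of \<open>U\<close> that turns the product of the two signs into the
  sign of \<open>u\<close>. The inner sum is then a difference of order \<open>card U\<close> that
  does not depend on \<open>s\<close>, and there are \<open>2 ^ card U\<close> choices of
  \<open>s\<close>.\<close>

lemma sum_Pow_sym_diff:
  fixes g :: "nat \<Rightarrow> real"
  assumes U: "finite U"
  shows "(\<Sum>s\<in>Pow U. \<Sum>t\<in>Pow U. (-1) ^ card s * (-1) ^ card t * g (card U - card (sym_diff s t)))
    = 2 ^ card U * fdiff (card U) g 0"
proof -
  have "(\<Sum>t\<in>Pow U. (-1) ^ card s * (-1) ^ card t * g (card U - card (sym_diff s t))) = fdiff (card U) g 0"
    if s: "s \<in> Pow U" for s
  proof -
    have "(\<Sum>t\<in>Pow U. (-1) ^ card s * (-1) ^ card t * g (card U - card (sym_diff s t)))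
        = (\<Sum>u\<in>Pow U. (-1) ^ card u * g (0 + (card U - card u)))"
    proof (rule sum.reindex_bij_witness[where i = "sym_diff s" and j = "sym_diff s"])
      fix t assume t: "t \<in> Pow U"
      have "sym_diff s t \<subseteq> U" using s t by (auto simp: sym_diff_def)
      then have "(-1::real) ^ card (sym_diff s t) = (\<Prod>l\<in>U. if l \<in> sym_diff s t then -1 else 1)"
        by (rule minus_one_power_card[OF U])
      also have "\<dots> = (\<Prod>l\<in>U. (if l \<in> s then -1 else 1) * (if l \<in> t then -1 else 1))"
        by (intro prod.cong) (auto simp: sym_diff_def)
      also have "\<dots> = (-1) ^ card s * (-1) ^ card t"
        using s t by (simp add: prod.distrib minus_one_power_card[OF U])
      finally show "(-1) ^ card (sym_diff s t) * g (0 + (card U - card (sym_diff s t)))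
          = (-1) ^ card s * (-1) ^ card t * g (card U - card (sym_diff s t))" by simp
    qed (use s in \<open>auto simp: sym_diff_def\<close>)
    also have "\<dots> = fdiff (card U) g 0" by (rule fdiff_Pow[OF U])
    finally show ?thesis .
  qed
  then show ?thesis using U by (simp add: card_Pow)
qed

context kernel_sample
begin

text \<open>The form is the second moment of the combination of the \<open>U (I a)\<close> with
  coefficients \<open>c a\<close>.\<close>

lemma overlap_cov_nonneg_form:
  assumes fin: "finite A" and I: "\<And>a. a \<in> A \<Longrightarrow> index_set (I a)"
  shows "0 \<le> (\<Sum>a\<in>A. \<Sum>b\<in>A. c a * c b * overlap_cov (card (I a \<inter> I b)))"
proof -
  have "0 \<le> expectation (\<lambda>\<omega>. (\<Sum>a\<in>A. c a * U (I a) \<omega>) * (\<Sum>b\<in>A. c b * U (I b) \<omega>))"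
    by (intro integral_nonneg_AE AE_I2) simp
  also have "\<dots> = (\<Sum>a\<in>A. \<Sum>b\<in>A. c a * c b * overlap_cov (card (I a \<inter> I b)))"
    using I by (subst L2_sum_product) (auto intro!: U_measurable U_L2 sum.cong simp: overlap_cov)
  finally show ?thesis .
qed

text \<open>Averaging over \<open>m\<close> disjoint completions \<open>W r\<close> of the selector sets \<open>X s\<close> isolates, up to a
  term of order \<open>1 / m\<close>, the variance of the \<open>j\<close>-th term of the Hoeffding decomposition.\<close>

lemma fdiff_overlap_cov_nonneg:
  assumes j: "j \<le> k"
  shows "0 \<le> fdiff j overlap_cov 0"
proof -
  \<comment> \<open>Each \<open>l < j\<close> has two private copies, \<open>2 * l + 1\<close> and
    \<open>2 * l + 2\<close>, and \<open>s\<close> decides which one is selected. Hence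
    \<open>X s\<close> and \<open>X t\<close> meet exactly in the positions where \<open>s\<close>
    and \<open>t\<close> agree.\<close>
  define f where "f s l = (if l \<in> s then 2 * l + 2 else 2 * l + 1)" for s and l :: nat
  define X where "X s = f s ` {..<j}" for s
  \<comment> \<open>Consecutive blocks of length \<open>k - j\<close> beyond \<open>2 * j\<close>,
    each of which completes every selector set to a subsample of size \<open>k\<close>. Distinct
    blocks are disjoint; for \<open>j = k\<close> all blocks are empty.\<close>
  define W where "W r = {2 * j + 1 + r * (k - j)..<2 * j + 1 + Suc r * (k - j)}" for r
  define P where "P = Pow {..<j}"
  have fin: "finite P" by (simp add: P_def)
  have f_eq: "f s l = f t l' \<longleftrightarrow> l = l' \<and> (l \<in> s \<longleftrightarrow> l \<in> t)" for s t l l'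
    by (auto simp: f_def) presburger+
  have inj: "inj_on (f s) A" for s A by (auto simp: inj_on_def f_eq)
  have X_sub: "X s \<subseteq> {1..2 * j}" for s by (auto simp: X_def f_def)
  have card_X: "card (X s) = j" for s by (simp add: X_def card_image inj)
  have finX: "finite (X s)" for s by (simp add: X_def)
  have XX: "card (X s \<inter> X t) = j - card (sym_diff s t)" if "s \<in> P" "t \<in> P" for s t
  proof -
    have "X s \<inter> X t = f s ` ({..<j} - sym_diff s t)"
      by (auto simp: X_def f_eq sym_diff_def image_iff)
    then have "card (X s \<inter> X t) = card ({..<j} - sym_diff s t)" by (simp add: card_image inj)
    also have "\<dots> = j - card (sym_diff s t)"
      using that by (subst card_Diff_subset) (auto simp: P_def sym_diff_def intro: finite_subset)
    finally show ?thesis .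
  qed
  have XW: "X s \<inter> W r = {}" for s r using X_sub[of s] by (auto simp: W_def)
  have WW: "W r \<inter> W r' = {}" if "r \<noteq> r'" for r r'
  proof -
    have *: "W r \<inter> W r' = {}" if "r < r'" for r r'
    proof -
      have "Suc r * (k - j) \<le> r' * (k - j)" using that by (intro mult_right_mono) auto
      then show ?thesis by (auto simp: W_def)
    qed
    show ?thesis using that *[of r r'] *[of r' r] by (cases "r < r'") (auto simp: Int_commute)
  qed
  have card_W: "card (W r) = k - j" and finW: "finite (W r)" for r by (simp_all add: W_def)
  have ind: "index_set (X s \<union> W r)" for s r
    unfolding index_set_def using X_sub[of s] finX XW[of s r] j card_X card_W
    by (subst card_Un_disjoint) (auto simp: W_def)
  have ov: "card ((X s \<union> W r) \<inter> (X t \<union> W r')) = j - card (sym_diff s t) + (if r = r' then k - j else 0)"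
    if "s \<in> P" "t \<in> P" for s t r r'
  proof -
    have "(X s \<union> W r) \<inter> (X t \<union> W r') = (X s \<inter> X t) \<union> (W r \<inter> W r')"
      using XW[of s r'] XW[of t r] by blast
    moreover have "card ((X s \<inter> X t) \<union> (W r \<inter> W r')) = card (X s \<inter> X t) + card (W r \<inter> W r')"
      using XW[of s r] by (intro card_Un_disjoint) (auto simp only: finX finW finite_Int)
    ultimately have "card ((X s \<union> W r) \<inter> (X t \<union> W r')) = card (X s \<inter> X t) + card (W r \<inter> W r')"
      by simp
    then show ?thesis using WW[of r r'] card_W XX[OF that] by auto
  qed
  define \<sigma> where "\<sigma> s t = (-1) ^ card s * (-1::real) ^ card t" for s t :: "nat set"
  define A where "A = (\<Sum>s\<in>P. \<Sum>t\<in>P. \<sigma> s t * overlap_cov (j - card (sym_diff s t)))"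
  define C where "C = (\<Sum>s\<in>P. \<Sum>t\<in>P. \<sigma> s t * overlap_cov (j - card (sym_diff s t) + (k - j)))"
  \<comment> \<open>With \<open>n + 1\<close> completions, each ordered pair of distinct ones
    contributes \<open>A\<close> to the quadratic form and each of the \<open>n + 1\<close> equal
    pairs contributes \<open>C\<close>. Dividing by \<open>n + 1\<close> leaves
    \<open>n * A + C\<close>.\<close>
  have AC: "0 \<le> real n * A + C" for n
  proof -
    define m where "m = Suc n"
    have inner: "(\<Sum>r<m. \<Sum>r'<m. \<sigma> s t * overlap_cov (card ((X s \<union> W r) \<inter> (X t \<union> W r'))))
        = \<sigma> s t * (real m * real n * overlap_cov (j - card (sym_diff s t)) + real m * overlap_cov (j - card (sym_diff s t) + (k - j)))"
      if st: "s \<in> P" "t \<in> P" for s t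
    proof -
      let ?a = "overlap_cov (j - card (sym_diff s t))" and ?b = "overlap_cov (j - card (sym_diff s t) + (k - j))"
      have "(\<Sum>r'<m. \<sigma> s t * overlap_cov (card ((X s \<union> W r) \<inter> (X t \<union> W r')))) = \<sigma> s t * (real n * ?a + ?b)"
        if "r < m" for r
      proof -
        have "(\<Sum>r'<m. \<sigma> s t * overlap_cov (card ((X s \<union> W r) \<inter> (X t \<union> W r'))))
            = (\<Sum>r'<m. \<sigma> s t * ?a + (if r' = r then \<sigma> s t * (?b - ?a) else 0))"
          using ov[OF st] by (intro sum.cong refl) (auto simp: algebra_simps)
        also have "\<dots> = real m * (\<sigma> s t * ?a) + \<sigma> s t * (?b - ?a)"
          using that by (simp add: sum.distrib)
        also have "\<dots> = \<sigma> s t * (real n * ?a + ?b)" by (simp add: m_def algebra_simps)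
        finally show ?thesis .
      qed
      then have "(\<Sum>r<m. \<Sum>r'<m. \<sigma> s t * overlap_cov (card ((X s \<union> W r) \<inter> (X t \<union> W r'))))
          = real m * (\<sigma> s t * (real n * ?a + ?b))" by simp
      then show ?thesis by (simp add: algebra_simps)
    qed
    have "0 \<le> (\<Sum>a\<in>P \<times> {..<m}. \<Sum>b\<in>P \<times> {..<m}. (-1) ^ card (fst a) * (-1) ^ card (fst b)
        * overlap_cov (card ((X (fst a) \<union> W (snd a)) \<inter> (X (fst b) \<union> W (snd b)))))"
      using fin ind by (intro overlap_cov_nonneg_form) auto
    also have "\<dots> = (\<Sum>s\<in>P. \<Sum>r<m. \<Sum>t\<in>P. \<Sum>r'<m. \<sigma> s t * overlap_cov (card ((X s \<union> W r) \<inter> (X t \<union> W r'))))"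
      by (simp add: sum.cartesian_product' \<sigma>_def)
    also have "\<dots> = (\<Sum>s\<in>P. \<Sum>t\<in>P. \<Sum>r<m. \<Sum>r'<m. \<sigma> s t * overlap_cov (card ((X s \<union> W r) \<inter> (X t \<union> W r'))))"
      by (intro sum.cong refl sum.swap)
    also have "\<dots> = (\<Sum>s\<in>P. \<Sum>t\<in>P. \<sigma> s t * (real m * real n * overlap_cov (j - card (sym_diff s t)) + real m * overlap_cov (j - card (sym_diff s t) + (k - j))))"
      using inner by (intro sum.cong refl) auto
    also have "\<dots> = real m * (real n * A + C)"
      by (simp add: A_def C_def sum_distrib_left sum.distrib[symmetric] algebra_simps)
    finally show ?thesis by (simp add: m_def zero_le_mult_iff)
  qed
  \<comment> \<open>The bound holds for every \<open>n\<close> with \<open>A\<close> and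
    \<open>C\<close> fixed, so a negative \<open>A\<close> is refuted by taking enough
    completions.\<close>
  have "A \<ge> 0"
  proof (rule ccontr)
    assume "\<not> A \<ge> 0"
    then obtain n where "C < real n * (- A)" using reals_Archimedean3[of "- A"] by auto
    then show False using AC[of n] by simp
  qed
  moreover have "A = 2 ^ j * fdiff j overlap_cov 0"
    using sum_Pow_sym_diff[of "{..<j}" overlap_cov] by (simp add: A_def P_def \<sigma>_def)
  ultimately have "2 ^ j * 0 \<le> 2 ^ j * fdiff j overlap_cov 0" by simp
  then show ?thesis by (rule mult_left_le_imp_le) simp
qed

lemma proj_var_nonneg: "0 \<le> proj_var"
  unfolding proj_var_def by simp

text \<open>Newton's formula at \<open>d = k\<close>, with all terms except the one for
  \<open>j = 1\<close> dropped; the dropped terms are nonnegative.\<close>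

lemma overlap_cov_mono_proj: "real k * proj_var \<le> overlap_cov k"
proof -
  have "overlap_cov k = (\<Sum>j\<le>k. real (k choose j) * fdiff j overlap_cov 0)"
    using newton_forward[of overlap_cov 0 k] by simp
  also have "\<dots> \<ge> (\<Sum>j\<in>{1}. real (k choose j) * fdiff j overlap_cov 0)"
    using k_pos by (intro sum_mono2) (auto intro!: mult_nonneg_nonneg fdiff_overlap_cov_nonneg)
  finally show ?thesis using overlap_cov_0 overlap_cov_1 by simp
qed

lemma overlap_cov_bounds:
  assumes kn: "2 * k \<le> n"
  shows "overlap_mean n k overlap_cov \<le> (real k)\<^sup>2 / real n * proj_var + (real k / real n)\<^sup>2 * overlap_cov k"
    and "overlap_mean n k (\<lambda>d. (real d - (real k)\<^sup>2 / real n) * overlap_cov d)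
      \<le> (real k)\<^sup>2 / real n * (1 - real k / real n) * proj_var + 2 * (real k / real n)\<^sup>2 * overlap_cov k"
proof -
  have "0 \<le> overlap_cov 1" unfolding overlap_cov_1 by (rule proj_var_nonneg)
  note b = overlap_mean_bounds[of k overlap_cov n, OF _ overlap_cov_0 this k_pos kn, unfolded overlap_cov_1]
  show "overlap_mean n k overlap_cov \<le> (real k)\<^sup>2 / real n * proj_var + (real k / real n)\<^sup>2 * overlap_cov k"
    by (rule b(1)) (rule fdiff_overlap_cov_nonneg)
  show "overlap_mean n k (\<lambda>d. (real d - (real k)\<^sup>2 / real n) * overlap_cov d)
      \<le> (real k)\<^sup>2 / real n * (1 - real k / real n) * proj_var + 2 * (real k / real n)\<^sup>2 * overlap_cov k"
    by (rule b(2)) (rule fdiff_overlap_cov_nonneg)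
qed

section \<open>Linearisation of the complete forest and of the ideal jackknife\<close>

definition forest_mean :: "nat \<Rightarrow> 'w \<Rightarrow> real" where
  "forest_mean n \<omega> = (\<Sum>I\<in>nsets {1..n} k. U I \<omega>) / real (n choose k)"

definition centred_incl :: "nat \<Rightarrow> nat \<Rightarrow> nat set \<Rightarrow> real" where
  "centred_incl n i I = of_bool (i \<in> I) - real k / real n"

text \<open>The covariance, over a uniformly drawn subset with the data held fixed, of the inclusion
  of \<open>i\<close> and the tree value: the quantity that the jackknife covariance estimates from
  finitely many draws.\<close>

definition ideal_jackknife :: "nat \<Rightarrow> nat \<Rightarrow> 'w \<Rightarrow> real" where
  "ideal_jackknife n i \<omega> = (\<Sum>I\<in>nsets {1..n} k. centred_incl n i I * U I \<omega>) / real (n choose k)"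

lemma finite_nsets: "finite (nsets {1..n::nat} k)"
  by (rule finite_imp_finite_nsets) (rule finite_atLeastAtMost)

lemma mean_inclusion:
  assumes "i \<in> {1..n}" "k \<le> n"
  shows "(\<Sum>I\<in>nsets {1..n} k. of_bool (i \<in> I)) / real (n choose k) = real k / real n"
proof -
  have "(\<Sum>I\<in>nsets {1..n} k. of_bool (i \<in> I)) = (\<Sum>I\<in>nsets {1..n} k. if {i} \<subseteq> I then 1 else 0 :: real)"
    by (intro sum.cong) auto
  also have "\<dots> = real (card {I \<in> nsets {1..n} k. {i} \<subseteq> I})"
    using sum.inter_filter[OF finite_nsets[of n], of "\<lambda>_. 1::real" "\<lambda>I. {i} \<subseteq> I"] by simp
  also have "card {I \<in> nsets {1..n} k. {i} \<subseteq> I} = (n - 1) choose (k - 1)"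
    using card_nsets_superset[of "{1..n}" "{i}" k] assms k_pos by simp
  also have "real ((n - 1) choose (k - 1)) / real (n choose k) = real k / real n"
  proof -
    have "k * (n choose k) = n * ((n - 1) choose (k - 1))"
      using binomial_absorption[of "k - 1" n] k_pos by simp
    then have "real k * real (n choose k) = real n * real ((n - 1) choose (k - 1))" by (metis of_nat_mult)
    then show ?thesis using assms k_pos by (simp add: field_simps)
  qed
  finally show ?thesis .
qed

lemma forest_mean_measurable: "forest_mean n \<in> borel_measurable M"
  unfolding forest_mean_def[abs_def]
  by (intro borel_measurable_divide borel_measurable_sum U_measurable borel_measurable_const index_set_nsets)

lemma ideal_jackknife_measurable: "ideal_jackknife n i \<in> borel_measurable M"
  unfolding ideal_jackknife_def[abs_def]
  by (intro borel_measurable_divide borel_measurable_sum borel_measurable_times U_measurable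
      borel_measurable_const index_set_nsets)

lemma forest_mean_L2: "integrable M (\<lambda>\<omega>. (forest_mean n \<omega>)\<^sup>2)"
proof -
  have "integrable M (\<lambda>\<omega>. (\<Sum>I\<in>nsets {1..n} k. (1 / real (n choose k)) * U I \<omega>)\<^sup>2)"
    by (intro L2_sum_integrable U_measurable U_L2 index_set_nsets)
  then show ?thesis by (simp add: forest_mean_def sum_divide_distrib)
qed

lemma ideal_jackknife_L2: "integrable M (\<lambda>\<omega>. (ideal_jackknife n i \<omega>)\<^sup>2)"
proof -
  have "integrable M (\<lambda>\<omega>. (\<Sum>I\<in>nsets {1..n} k. (centred_incl n i I / real (n choose k)) * U I \<omega>)\<^sup>2)"
    by (intro L2_sum_integrable U_measurable U_L2 index_set_nsets)
  then show ?thesis by (simp add: ideal_jackknife_def sum_divide_distrib)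
qed

lemma overlap_form:
  "expectation (\<lambda>\<omega>. ((\<Sum>I\<in>nsets {1..n} k. a I * U I \<omega>) / real (n choose k)) * ((\<Sum>I\<in>nsets {1..n} k. a I * U I \<omega>) / real (n choose k)))
    = (\<Sum>I\<in>nsets {1..n} k. \<Sum>J\<in>nsets {1..n} k. a I * a J * overlap_cov (card (I \<inter> J))) / (real (n choose k))\<^sup>2"
proof -
  have "expectation (\<lambda>\<omega>. (\<Sum>I\<in>nsets {1..n} k. a I * U I \<omega>) * (\<Sum>J\<in>nsets {1..n} k. a J * U J \<omega>))
      = (\<Sum>I\<in>nsets {1..n} k. \<Sum>J\<in>nsets {1..n} k. a I * a J * overlap_cov (card (I \<inter> J)))"
    by (subst L2_sum_product)
       (auto intro!: U_measurable U_L2 index_set_nsets sum.cong simp: overlap_cov[OF index_set_nsets index_set_nsets])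
  then show ?thesis by (simp add: power2_eq_square)
qed

lemma expectation_U_pr_sum:
  assumes "i \<ge> 1"
  shows "expectation (\<lambda>\<omega>. ((\<Sum>I\<in>nsets {1..n} k. a I * U I \<omega>) / real (n choose k)) * pr i \<omega>)
    = (\<Sum>I\<in>nsets {1..n} k. a I * of_bool (i \<in> I)) * proj_var / real (n choose k)"
proof -
  have "expectation (\<lambda>\<omega>. (\<Sum>I\<in>nsets {1..n} k. a I * U I \<omega>) * (\<Sum>l\<in>{i}. 1 * pr l \<omega>))
      = (\<Sum>I\<in>nsets {1..n} k. \<Sum>l\<in>{i}. a I * 1 * expectation (\<lambda>\<omega>. U I \<omega> * pr l \<omega>))"
    using assms by (intro L2_sum_product) (auto intro!: U_measurable U_L2 index_set_nsets pr_measurable pr_L2)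
  also have "\<dots> = (\<Sum>I\<in>nsets {1..n} k. a I * of_bool (i \<in> I)) * proj_var"
    using assms by (auto simp: sum_distrib_right U_pr[OF index_set_nsets] intro!: sum.cong)
  finally show ?thesis by simp
qed

lemma expectation_diff_square:
  fixes f g :: "'w \<Rightarrow> real"
  assumes "f \<in> borel_measurable M" "g \<in> borel_measurable M"
    "integrable M (\<lambda>x. (f x)\<^sup>2)" "integrable M (\<lambda>x. (g x)\<^sup>2)"
  shows "expectation (\<lambda>x. (f x - g x)\<^sup>2)
    = expectation (\<lambda>x. f x * f x) - 2 * expectation (\<lambda>x. f x * g x) + expectation (\<lambda>x. g x * g x)"
proof -
  have "expectation (\<lambda>x. (f x - g x)\<^sup>2) = expectation (\<lambda>x. f x * f x - 2 * (f x * g x) + g x * g x)"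
    by (intro Bochner_Integration.integral_cong refl) (simp add: power2_eq_square algebra_simps)
  also have "\<dots> = expectation (\<lambda>x. f x * f x) - 2 * expectation (\<lambda>x. f x * g x) + expectation (\<lambda>x. g x * g x)"
    using assms(3,4) L2_mult_integrable[OF assms] by (simp add: power2_eq_square)
  finally show ?thesis .
qed

text \<open>The Hajek projection of the complete forest. Each point lies in a fraction
  \<open>k / n\<close> of all subsamples, which gives the factor.\<close>

definition hajek :: "nat \<Rightarrow> 'w \<Rightarrow> real" where
  "hajek n \<omega> = (\<Sum>i=1..n. real k / real n * pr i \<omega>)"

lemma hajek_measurable: "hajek n \<in> borel_measurable M"
  unfolding hajek_def[abs_def] by (intro borel_measurable_sum borel_measurable_times pr_measurable) auto

lemma hajek_L2: "integrable M (\<lambda>\<omega>. (hajek n \<omega>)\<^sup>2)"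
  unfolding hajek_def[abs_def] by (intro L2_sum_integrable pr_measurable pr_L2) auto

text \<open>The inner product of the forest with its projection equals that of the projection with
  itself, so the mean square error is the difference of the two second moments. The leading term of
  the overlap expansion is exactly the second moment of the projection and cancels.\<close>

lemma forest_mean_hajek:
  assumes kn: "2 * k \<le> n"
  shows "expectation (\<lambda>\<omega>. (forest_mean n \<omega> - hajek n \<omega>)\<^sup>2) \<le> (real k / real n)\<^sup>2 * overlap_cov k"
proof -
  have n: "n > 0" "k \<le> n" using kn k_pos by auto
  have FF: "expectation (\<lambda>\<omega>. forest_mean n \<omega> * forest_mean n \<omega>) = overlap_mean n k overlap_cov"
    using overlap_form[where n = n and a = "\<lambda>_. 1"] by (simp add: forest_mean_def overlap_mean_def)
  have Fp: "expectation (\<lambda>\<omega>. forest_mean n \<omega> * pr i \<omega>) = real k / real n * proj_var" if "i \<in> {1..n}" for i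
  proof -
    have "expectation (\<lambda>\<omega>. forest_mean n \<omega> * pr i \<omega>) = (\<Sum>I\<in>nsets {1..n} k. of_bool (i \<in> I)) * proj_var / real (n choose k)"
      using expectation_U_pr_sum[where i = i and n = n and a = "\<lambda>_. 1"] that by (simp add: forest_mean_def)
    also have "\<dots> = (\<Sum>I\<in>nsets {1..n} k. of_bool (i \<in> I)) / real (n choose k) * proj_var" by simp
    finally show ?thesis unfolding mean_inclusion[OF that n(2)] .
  qed
  have FH: "expectation (\<lambda>\<omega>. forest_mean n \<omega> * hajek n \<omega>) = (real k)\<^sup>2 / real n * proj_var"
  proof -
    have "expectation (\<lambda>\<omega>. (\<Sum>l\<in>{0::nat}. 1 * forest_mean n \<omega>) * hajek n \<omega>) = (\<Sum>l\<in>{0::nat}. \<Sum>i=1..n. 1 * (real k / real n) * expectation (\<lambda>\<omega>. forest_mean n \<omega> * pr i \<omega>))"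
      unfolding hajek_def by (intro L2_sum_product) (auto intro!: forest_mean_measurable forest_mean_L2 pr_measurable pr_L2)
    then have "expectation (\<lambda>\<omega>. forest_mean n \<omega> * hajek n \<omega>) = (\<Sum>i=1..n. real k / real n * (real k / real n * proj_var))"
      using Fp by simp
    then show ?thesis using n by (simp add: power2_eq_square)
  qed
  have HH: "expectation (\<lambda>\<omega>. hajek n \<omega> * hajek n \<omega>) = (real k)\<^sup>2 / real n * proj_var"
  proof -
    have "expectation (\<lambda>\<omega>. hajek n \<omega> * hajek n \<omega>) = (\<Sum>i=1..n. \<Sum>l=1..n. real k / real n * (real k / real n) * expectation (\<lambda>\<omega>. pr i \<omega> * pr l \<omega>))"
      unfolding hajek_def by (intro L2_sum_product) (auto intro!: pr_measurable pr_L2)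
    also have "\<dots> = (\<Sum>i=1..n. \<Sum>l=1..n. if l = i then real k / real n * (real k / real n) * proj_var else 0)"
      using pr_square pr_orthogonal by (intro sum.cong refl) (auto simp: power2_eq_square)
    also have "\<dots> = (real k)\<^sup>2 / real n * proj_var" using n by (simp add: power2_eq_square)
    finally show ?thesis .
  qed
  have "expectation (\<lambda>\<omega>. (forest_mean n \<omega> - hajek n \<omega>)\<^sup>2) = overlap_mean n k overlap_cov - (real k)\<^sup>2 / real n * proj_var"
    using expectation_diff_square[OF forest_mean_measurable hajek_measurable forest_mean_L2 hajek_L2] FF FH HH by simp
  also have "\<dots> \<le> (real k / real n)\<^sup>2 * overlap_cov k"
    using overlap_cov_bounds(1)[OF kn] by simp
  finally show ?thesis .
qed

text \<open>Summed over \<open>i\<close>, the products of centred inclusions depend on the two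
  subsets only through the centred overlap, so the total second moment is the centred overlap
  average bounded before. In the constant \<open>3\<close>, the share \<open>2\<close> comes from
  the orders \<open>j \<ge> 2\<close>; the share \<open>1\<close> bounds what is left of order one,
  by \<open>overlap_cov_mono_proj\<close>.\<close>

lemma ideal_jackknife_pr:
  assumes kn: "2 * k \<le> n"
  shows "(\<Sum>i=1..n. expectation (\<lambda>\<omega>. (ideal_jackknife n i \<omega> - real k / real n * pr i \<omega>)\<^sup>2)) \<le> 3 * (real k / real n)\<^sup>2 * overlap_cov k"
proof -
  have n: "n > 0" "k \<le> n" using kn k_pos by auto
  let ?q = "real k / real n" and ?N = "nsets {1..n} k"
  have CC: "(\<Sum>i=1..n. expectation (\<lambda>\<omega>. ideal_jackknife n i \<omega> * ideal_jackknife n i \<omega>))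
      = overlap_mean n k (\<lambda>d. (real d - (real k)\<^sup>2 / real n) * overlap_cov d)"
  proof -
    have s: "(\<Sum>i=1..n. centred_incl n i I * centred_incl n i J) = real (card (I \<inter> J)) - (real k)\<^sup>2 / real n"
      if "I \<in> ?N" "J \<in> ?N" for I J
    proof -
      have c: "(\<Sum>i=1..n. of_bool (i \<in> K)) = real (card K)" if "K \<subseteq> {1..n}" for K
        using that by (simp add: of_bool_def sum.If_cases Int_absorb1)
      have "(\<Sum>i=1..n. centred_incl n i I * centred_incl n i J)
          = (\<Sum>i=1..n. of_bool (i \<in> I \<inter> J) - ?q * of_bool (i \<in> I) - ?q * of_bool (i \<in> J) + ?q * ?q)"
        by (intro sum.cong refl) (auto simp: centred_incl_def algebra_simps)
      also have "\<dots> = (\<Sum>i=1..n. of_bool (i \<in> I \<inter> J)) - ?q * (\<Sum>i=1..n. of_bool (i \<in> I)) - ?q * (\<Sum>i=1..n. of_bool (i \<in> J)) + real n * (?q * ?q)"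
        by (simp only: sum.distrib sum_subtractf sum_distrib_left[symmetric]) simp
      also have "\<dots> = real (card (I \<inter> J)) - ?q * real k - ?q * real k + real n * (?q * ?q)"
        using that by (subst (1 2 3) c) (auto simp: nsets_def)
      also have "\<dots> = real (card (I \<inter> J)) - (real k)\<^sup>2 / real n"
        using n by (simp add: power2_eq_square)
      finally show ?thesis .
    qed
    have "(\<Sum>i=1..n. expectation (\<lambda>\<omega>. ideal_jackknife n i \<omega> * ideal_jackknife n i \<omega>))
        = (\<Sum>i=1..n. \<Sum>I\<in>?N. \<Sum>J\<in>?N. centred_incl n i I * centred_incl n i J * overlap_cov (card (I \<inter> J))) / (real (n choose k))\<^sup>2"
      unfolding ideal_jackknife_def overlap_form by (simp add: sum_divide_distrib)
    also have "(\<Sum>i=1..n. \<Sum>I\<in>?N. \<Sum>J\<in>?N. centred_incl n i I * centred_incl n i J * overlap_cov (card (I \<inter> J)))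
        = (\<Sum>I\<in>?N. \<Sum>i=1..n. \<Sum>J\<in>?N. centred_incl n i I * centred_incl n i J * overlap_cov (card (I \<inter> J)))"
      by (rule sum.swap)
    also have "\<dots> = (\<Sum>I\<in>?N. \<Sum>J\<in>?N. \<Sum>i=1..n. centred_incl n i I * centred_incl n i J * overlap_cov (card (I \<inter> J)))"
      by (intro sum.cong refl sum.swap)
    also have "\<dots> = (\<Sum>I\<in>?N. \<Sum>J\<in>?N. (real (card (I \<inter> J)) - (real k)\<^sup>2 / real n) * overlap_cov (card (I \<inter> J)))"
      using s by (intro sum.cong refl) (simp add: sum_distrib_right[symmetric])
    finally show ?thesis by (simp add: overlap_mean_def)
  qed
  have Cp: "expectation (\<lambda>\<omega>. ideal_jackknife n i \<omega> * (?q * pr i \<omega>)) = ?q * (?q * (1 - ?q) * proj_var)" if i: "i \<in> {1..n}" for i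
  proof -
    have "expectation (\<lambda>\<omega>. ideal_jackknife n i \<omega> * pr i \<omega>)
        = (\<Sum>I\<in>?N. centred_incl n i I * of_bool (i \<in> I)) * proj_var / real (n choose k)"
      unfolding ideal_jackknife_def using expectation_U_pr_sum[where i = i and n = n and a = "centred_incl n i"] i by simp
    also have "(\<Sum>I\<in>?N. centred_incl n i I * of_bool (i \<in> I)) = (1 - ?q) * (\<Sum>I\<in>?N. of_bool (i \<in> I))"
      unfolding sum_distrib_left by (intro sum.cong refl) (auto simp: centred_incl_def)
    also have "\<dots> * proj_var / real (n choose k) = (1 - ?q) * ((\<Sum>I\<in>?N. of_bool (i \<in> I)) / real (n choose k)) * proj_var"
      by simp
    also have "\<dots> = ?q * (1 - ?q) * proj_var" unfolding mean_inclusion[OF i n(2)] by simp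
    finally show ?thesis by (simp add: mult.left_commute)
  qed
  have pp: "expectation (\<lambda>\<omega>. (?q * pr i \<omega>) * (?q * pr i \<omega>)) = ?q\<^sup>2 * proj_var" if i: "i \<in> {1..n}" for i
  proof -
    have "expectation (\<lambda>\<omega>. (?q * pr i \<omega>) * (?q * pr i \<omega>)) = expectation (\<lambda>\<omega>. ?q\<^sup>2 * (pr i \<omega>)\<^sup>2)"
      by (simp add: power2_eq_square mult_ac)
    then show ?thesis using pr_square[of i] i by simp
  qed
  have "expectation (\<lambda>\<omega>. (ideal_jackknife n i \<omega> - ?q * pr i \<omega>)\<^sup>2)
      = expectation (\<lambda>\<omega>. ideal_jackknife n i \<omega> * ideal_jackknife n i \<omega>) - 2 * (?q * (?q * (1 - ?q) * proj_var)) + ?q\<^sup>2 * proj_var"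
    if i: "i \<in> {1..n}" for i
  proof -
    have "(\<lambda>\<omega>. ?q * pr i \<omega>) \<in> borel_measurable M" "integrable M (\<lambda>\<omega>. (?q * pr i \<omega>)\<^sup>2)"
      using i pr_measurable[of i] pr_L2[of i] by (auto simp: power_mult_distrib power_divide)
    then show ?thesis
      using expectation_diff_square[OF ideal_jackknife_measurable _ ideal_jackknife_L2] Cp[OF i] pp[OF i] by simp
  qed
  then have "(\<Sum>i=1..n. expectation (\<lambda>\<omega>. (ideal_jackknife n i \<omega> - ?q * pr i \<omega>)\<^sup>2))
      = overlap_mean n k (\<lambda>d. (real d - (real k)\<^sup>2 / real n) * overlap_cov d)
        - real n * (2 * (?q * (?q * (1 - ?q) * proj_var))) + real n * (?q\<^sup>2 * proj_var)"
    using CC by (simp add: sum.distrib sum_subtractf)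
  also have "\<dots> \<le> ((real k)\<^sup>2 / real n * (1 - ?q) * proj_var + 2 * ?q\<^sup>2 * overlap_cov k)
        - real n * (2 * (?q * (?q * (1 - ?q) * proj_var))) + real n * (?q\<^sup>2 * proj_var)"
    using overlap_cov_bounds(2)[OF kn] by simp
  also have "\<dots> = ?q\<^sup>2 * (real k * proj_var) + 2 * ?q\<^sup>2 * overlap_cov k"
  proof -
    have e: "(real k)\<^sup>2 / real n = real n * ?q\<^sup>2" and k: "real k = real n * ?q" using n by (simp_all add: power2_eq_square)
    \<comment> \<open>All multiples of \<open>N * q\<^sup>2 * P\<close> cancel; what remains has an
      additional factor \<open>q = k / n\<close>.\<close>
    have "N * q\<^sup>2 * (1 - q) * P - N * (2 * (q * (q * (1 - q) * P))) + N * (q\<^sup>2 * P) = q\<^sup>2 * ((N * q) * P)" for N q P :: real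
      by (simp add: algebra_simps power2_eq_square)
    from this[of "real n" ?q proj_var] show ?thesis unfolding e k[symmetric] by linarith
  qed
  also have "\<dots> \<le> ?q\<^sup>2 * overlap_cov k + 2 * ?q\<^sup>2 * overlap_cov k"
    by (intro add_right_mono mult_left_mono overlap_cov_mono_proj) auto
  also have "\<dots> = 3 * ?q\<^sup>2 * overlap_cov k" by (simp add: algebra_simps)
  finally show ?thesis .
qed

end

section \<open>Random subsamples and the jackknife\<close>

text \<open>Preimages under \<open>f\<close> and \<open>g\<close> are members of the two given
  families again. Passing to real functions makes the product formula for expectations applicable to
  data and draws, whose values have different types.\<close>

lemma (in prob_space) indep_rvs_indep_var:
  fixes f :: "'b \<Rightarrow> real" and g :: "'c \<Rightarrow> real"
  assumes ind: "indep_rvs M N X N' X'" and f: "f \<in> borel_measurable N" and g: "g \<in> borel_measurable N'"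
  shows "indep_var borel (\<lambda>\<omega>. f (X \<omega>)) borel (\<lambda>\<omega>. g (X' \<omega>))"
proof -
  have X: "X \<in> measurable M N" and X': "X' \<in> measurable M N'"
    and i: "indep_set {X -` A \<inter> space M |A. A \<in> sets N} {X' -` A \<inter> space M |A. A \<in> sets N'}"
    using ind by (auto simp: indep_rvs_def)
  have fX: "(\<lambda>\<omega>. f (X \<omega>)) \<in> borel_measurable M" and gX: "(\<lambda>\<omega>. g (X' \<omega>)) \<in> borel_measurable M"
    using measurable_compose[OF X f] measurable_compose[OF X' g] by auto
  have st: "Int_stable {u -` A \<inter> space M |A. A \<in> sets borel}" for u :: "'a \<Rightarrow> real"
    unfolding Int_stable_def
  proof (intro ballI)
    fix a b assume "a \<in> {u -` A \<inter> space M |A. A \<in> sets borel}" "b \<in> {u -` A \<inter> space M |A. A \<in> sets borel}"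
    then obtain A B where "A \<in> sets borel" "B \<in> sets borel" "a = u -` A \<inter> space M" "b = u -` B \<inter> space M" by auto
    then show "a \<inter> b \<in> {u -` A \<inter> space M |A. A \<in> sets borel}"
      by (intro CollectI exI[of _ "A \<inter> B"]) auto
  qed
  have pre: "u -` A \<inter> space M \<in> events" if "u \<in> borel_measurable M" "A \<in> sets borel" for u :: "'a \<Rightarrow> real" and A
    using measurable_sets[OF that] .
  have "indep_set {(\<lambda>\<omega>. f (X \<omega>)) -` A \<inter> space M |A. A \<in> sets borel} {(\<lambda>\<omega>. g (X' \<omega>)) -` A \<inter> space M |A. A \<in> sets borel}"
    unfolding indep_sets2_eq
  proof (intro conjI ballI)
    show "{(\<lambda>\<omega>. f (X \<omega>)) -` A \<inter> space M |A. A \<in> sets borel} \<subseteq> events"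
      "{(\<lambda>\<omega>. g (X' \<omega>)) -` A \<inter> space M |A. A \<in> sets borel} \<subseteq> events"
      using measurable_sets[OF fX] measurable_sets[OF gX] by auto
    fix a b assume "a \<in> {(\<lambda>\<omega>. f (X \<omega>)) -` A \<inter> space M |A. A \<in> sets borel}" "b \<in> {(\<lambda>\<omega>. g (X' \<omega>)) -` A \<inter> space M |A. A \<in> sets borel}"
    then obtain A B where A: "A \<in> sets borel" "a = (\<lambda>\<omega>. f (X \<omega>)) -` A \<inter> space M"
      and B: "B \<in> sets borel" "b = (\<lambda>\<omega>. g (X' \<omega>)) -` B \<inter> space M" by auto
    have "a = X -` (f -` A \<inter> space N) \<inter> space M" using A measurable_space[OF X] by auto
    moreover have "b = X' -` (g -` B \<inter> space N') \<inter> space M" using B measurable_space[OF X'] by auto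
    ultimately show "prob (a \<inter> b) = prob a * prob b"
      using indep_setD[OF i] measurable_sets[OF f A(1)] measurable_sets[OF g B(1)] by blast
  qed
  then show ?thesis
    unfolding indep_var_eq using fX gX st by (auto intro: indep_set_sigma_sets)
qed

locale subsampled_kernel = kernel_sample M Z D h k
  for M :: "'w measure" and Z :: "nat \<Rightarrow> 'w \<Rightarrow> real \<times> 'a::euclidean_space" and D h k +
  fixes n B :: nat and S :: "nat \<Rightarrow> nat \<Rightarrow> 'w \<Rightarrow> nat set" and j :: nat
  assumes draws: "uniform_draws M Z n k B S" and stage: "j \<in> {0, 1}"
    and kn: "2 * k \<le> n" and B_pos: "1 \<le> B"
begin

abbreviation "NS \<equiv> nsets {1..n} k"

definition p :: real where "p = 1 / real (n choose k)"

definition hit :: "nat \<Rightarrow> nat set \<Rightarrow> 'w \<Rightarrow> real" where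
  "hit b I \<omega> = of_bool (S j b \<omega> = I)"

lemma kn': "k \<le> n" "n > 0" using kn k_pos by auto

lemma NS: "finite NS" "NS \<noteq> {}" "card NS = n choose k"
  using kn' finite_nsets[of n] by (auto simp: nsets_eq_empty_iff)

lemma p_pos: "p > 0" and card_p: "real (card NS) * p = 1"
  using kn' by (simp_all add: p_def)

lemma S_measurable: "b \<in> {1..B} \<Longrightarrow> S j b \<in> measurable M (count_space UNIV)"
  using draws stage unfolding uniform_draws_def indep_vars_def by auto

lemma hit_measurable: "b \<in> {1..B} \<Longrightarrow> hit b I \<in> borel_measurable M"
  unfolding hit_def[abs_def] by (rule measurable_compose[OF S_measurable]) auto

lemma hit_mean:
  assumes "b \<in> {1..B}" "I \<in> NS"
  shows "expectation (hit b I) = p"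
proof -
  have d: "distr M (count_space UNIV) (S j b) = measure_pmf (pmf_of_set NS)"
    using draws stage assms unfolding uniform_draws_def by auto
  have "expectation (hit b I) = (\<integral>s. of_bool (s = I) \<partial>distr M (count_space UNIV) (S j b))"
    unfolding hit_def using S_measurable[OF assms(1)] by (subst integral_distr) auto
  also have "\<dots> = (\<integral>s. indicator {I} s \<partial>measure_pmf (pmf_of_set NS))"
    unfolding d by (intro Bochner_Integration.integral_cong refl) (auto simp: indicator_def)
  also have "\<dots> = pmf (pmf_of_set NS) I" by (simp add: pmf.rep_eq)
  also have "\<dots> = p" using NS assms(2) by (simp add: p_def)
  finally show ?thesis .
qed

text \<open>The draws are prescribed through their laws, so being a \<open>k\<close>-subset is an
  almost sure property. This is why the identification with the jackknife covariances is almost sure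
  as well.\<close>

lemma S_in_NS: "AE \<omega> in M. \<forall>b\<in>{1..B}. S j b \<omega> \<in> NS"
proof (rule AE_finite_allI)
  fix b assume b: "b \<in> {1..B}"
  have d: "distr M (count_space UNIV) (S j b) = measure_pmf (pmf_of_set NS)"
    using draws stage b unfolding uniform_draws_def by auto
  have "AE s in distr M (count_space UNIV) (S j b). s \<in> NS"
    unfolding d using NS by (simp add: AE_measure_pmf_iff)
  then show "AE \<omega> in M. S j b \<omega> \<in> NS"
    by (rule AE_distrD[OF S_measurable[OF b]])
qed simp

lemma hit_pair:
  assumes b: "b \<in> {1..B}" "b' \<in> {1..B}" and I: "I \<in> NS" "J \<in> NS"
  shows "expectation (\<lambda>\<omega>. hit b I \<omega> * hit b' J \<omega>) = (if b = b' then p * of_bool (I = J) else p\<^sup>2)"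
proof (cases "b = b'")
  case True
  have "(\<lambda>\<omega>. hit b I \<omega> * hit b' J \<omega>) = (\<lambda>\<omega>. of_bool (I = J) * hit b I \<omega>)"
    using True by (auto simp: hit_def fun_eq_iff)
  then show ?thesis using True hit_mean[OF b(1) I(1)] by simp
next
  case False
  define Y where "Y i s = (of_bool (s = (if i = (j, b) then I else J)) :: real)" for i :: "nat \<times> nat" and s :: "nat set"
  have ind: "indep_vars (\<lambda>_. count_space UNIV) (\<lambda>(j, b). S j b) ({0, 1} \<times> {1..B})"
    using draws by (simp add: uniform_draws_def)
  have "indep_vars (\<lambda>_. borel) (\<lambda>i \<omega>. Y i ((\<lambda>(j, b). S j b) i \<omega>)) {(j, b), (j, b')}"
    using stage b by (intro indep_vars_compose2[OF indep_vars_subset[OF ind]]) auto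
  moreover have "integrable M (\<lambda>\<omega>. Y i ((\<lambda>(j, b). S j b) i \<omega>))" if "i \<in> {(j, b), (j, b')}" for i
  proof (rule integrable_const_bound[where B = 1])
    have "(\<lambda>(j, b). S j b) i \<in> measurable M (count_space UNIV)"
      using that b S_measurable by auto
    then show "(\<lambda>\<omega>. Y i ((\<lambda>(j, b). S j b) i \<omega>)) \<in> borel_measurable M"
      by (rule measurable_compose) auto
  qed (auto simp: Y_def)
  ultimately have "expectation (\<lambda>\<omega>. \<Prod>i\<in>{(j, b), (j, b')}. Y i ((\<lambda>(j, b). S j b) i \<omega>))
      = (\<Prod>i\<in>{(j, b), (j, b')}. expectation (\<lambda>\<omega>. Y i ((\<lambda>(j, b). S j b) i \<omega>)))"
    by (intro indep_vars_lebesgue_integral) auto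
  then have "expectation (\<lambda>\<omega>. hit b I \<omega> * hit b' J \<omega>) = expectation (hit b I) * expectation (hit b' J)"
    using False by (simp add: Y_def hit_def[abs_def])
  then show ?thesis using False hit_mean b I by (simp add: power2_eq_square)
qed

text \<open>The multinomial frequency of the subset \<open>I\<close> among the \<open>B\<close>
  draws. Quantities computed from the draws are rewritten as sums over \<open>I\<close> weighted by
  these frequencies, which separates the draws from the data.\<close>

definition phat :: "nat set \<Rightarrow> 'w \<Rightarrow> real" where
  "phat I \<omega> = (\<Sum>b=1..B. hit b I \<omega>) / real B"

lemma hit_bound: "\<bar>hit b I \<omega>\<bar> \<le> 1"
  by (simp add: hit_def)

lemma hit_integrable: "b \<in> {1..B} \<Longrightarrow> integrable M (hit b I)"
  by (rule integrable_const_bound[where B = 1]) (auto intro!: hit_measurable hit_bound)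

lemma hit_prod_integrable: "b \<in> {1..B} \<Longrightarrow> b' \<in> {1..B} \<Longrightarrow> integrable M (\<lambda>\<omega>. hit b I \<omega> * hit b' J \<omega>)"
proof (rule integrable_const_bound[where B = 1])
  show "AE \<omega> in M. norm (hit b I \<omega> * hit b' J \<omega>) \<le> 1" by (simp add: hit_def)
qed (intro borel_measurable_times hit_measurable)

text \<open>The covariance of multinomial frequencies: distinct draws are independent, so only the
  \<open>B\<close> pairs of equal draws contribute.\<close>

lemma phat_covariance:
  assumes I: "I \<in> NS" "J \<in> NS"
  shows "expectation (\<lambda>\<omega>. (phat I \<omega> - p) * (phat J \<omega> - p)) = (p * of_bool (I = J) - p\<^sup>2) / real B"
proof -
  have B: "real B > 0" using B_pos by simp
  have eq: "(phat I \<omega> - p) * (phat J \<omega> - p)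
      = (\<Sum>b=1..B. \<Sum>b'=1..B. hit b I \<omega> * hit b' J \<omega> - p * hit b I \<omega> - p * hit b' J \<omega> + p\<^sup>2) / (real B)\<^sup>2" for \<omega>
  proof -
    have d: "phat K \<omega> - p = (\<Sum>b=1..B. hit b K \<omega> - p) / real B" for K
      using B by (simp add: phat_def sum_subtractf diff_divide_distrib)
    have "(phat I \<omega> - p) * (phat J \<omega> - p) = ((\<Sum>b=1..B. hit b I \<omega> - p) * (\<Sum>b=1..B. hit b J \<omega> - p)) / (real B)\<^sup>2"
      unfolding d by (simp add: power2_eq_square)
    also have "(\<Sum>b=1..B. hit b I \<omega> - p) * (\<Sum>b=1..B. hit b J \<omega> - p)
        = (\<Sum>b=1..B. \<Sum>b'=1..B. hit b I \<omega> * hit b' J \<omega> - p * hit b I \<omega> - p * hit b' J \<omega> + p\<^sup>2)"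
      unfolding sum_product by (intro sum.cong refl) (simp add: algebra_simps power2_eq_square)
    finally show ?thesis .
  qed
  define t where "t b b' \<omega> = hit b I \<omega> * hit b' J \<omega> - p * hit b I \<omega> - p * hit b' J \<omega> + p\<^sup>2" for b b' \<omega>
  have tm: "expectation (t b b') = (if b = b' then p * of_bool (I = J) - p\<^sup>2 else 0)"
    and ti: "integrable M (t b b')" if "b \<in> {1..B}" "b' \<in> {1..B}" for b b'
    unfolding t_def[abs_def] using that hit_integrable hit_prod_integrable hit_mean I hit_pair[OF that I]
    by (simp_all add: prob_space power2_eq_square)
  have "expectation (\<lambda>\<omega>. (phat I \<omega> - p) * (phat J \<omega> - p)) = expectation (\<lambda>\<omega>. \<Sum>b=1..B. \<Sum>b'=1..B. t b b' \<omega>) / (real B)\<^sup>2"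
    unfolding eq t_def by simp
  also have "expectation (\<lambda>\<omega>. \<Sum>b=1..B. \<Sum>b'=1..B. t b b' \<omega>) = (\<Sum>b=1..B. \<Sum>b'=1..B. expectation (t b b'))"
    using ti by (subst Bochner_Integration.integral_sum, intro Bochner_Integration.integrable_sum, blast)
      (intro sum.cong refl Bochner_Integration.integral_sum, blast)
  also have "(\<Sum>b=1..B. \<Sum>b'=1..B. expectation (t b b')) = (\<Sum>b=1..B. \<Sum>b'=1..B. if b = b' then p * of_bool (I = J) - p\<^sup>2 else 0)"
    using tm by (intro sum.cong refl) auto
  also have "\<dots> = real B * (p * of_bool (I = J) - p\<^sup>2)" by simp
  also have "real B * (p * of_bool (I = J) - p\<^sup>2) / (real B)\<^sup>2 = (p * of_bool (I = J) - p\<^sup>2) / real B" using B by (simp add: power2_eq_square)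
  finally show ?thesis .
qed

lemma phat_measurable: "phat I \<in> borel_measurable M"
  unfolding phat_def[abs_def] by (intro borel_measurable_divide borel_measurable_sum hit_measurable) auto

definition data :: "'w \<Rightarrow> nat \<Rightarrow> real \<times> 'a" where
  "data \<omega> = (\<lambda>i\<in>{1..n}. Z i \<omega>)"

lemma data_measurable: "data \<in> measurable M (Pi\<^sub>M {1..n} (\<lambda>_. borel))"
  unfolding data_def[abs_def] using restrict_measurable[of "\<lambda>x. x" "{1..n}"] by auto

lemma phat_indep:
  assumes \<phi>: "\<phi> \<in> borel_measurable (Pi\<^sub>M {1..n} (\<lambda>_. borel))"
  shows "indep_var borel (\<lambda>\<omega>. \<phi> (data \<omega>)) borel (\<lambda>\<omega>. (phat I \<omega> - p) * (phat J \<omega> - p))"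
proof -
  let ?P = "Pi\<^sub>M ({0, 1} \<times> {1..B}) (\<lambda>_. count_space (UNIV :: nat set set))"
  define ph where "ph K s = (\<Sum>b=1..B. of_bool (s (j, b) = K)) / real B" for K and s :: "nat \<times> nat \<Rightarrow> nat set"
  have comp: "(\<lambda>s. of_bool (s (j, b) = K) :: real) \<in> borel_measurable ?P" if "b \<in> {1..B}" for b K
  proof -
    have "(\<lambda>s. s (j, b)) \<in> measurable ?P (count_space UNIV)"
      using that stage by (intro measurable_component_singleton) auto
    then show ?thesis by (rule measurable_compose[where g = "\<lambda>x. of_bool (x = K)"]) auto
  qed
  have m: "(\<lambda>s. (ph I s - p) * (ph J s - p)) \<in> borel_measurable ?P"
    unfolding ph_def by (intro borel_measurable_times borel_measurable_diff borel_measurable_divide borel_measurable_sum borel_measurable_const comp) auto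
  have ph: "ph K (\<lambda>(j, b)\<in>{0, 1} \<times> {1..B}. S j b \<omega>) = phat K \<omega>" for K \<omega>
    unfolding ph_def phat_def hit_def using stage by (intro arg_cong2[where f = "(/)"] sum.cong refl) auto
  have "indep_rvs M (Pi\<^sub>M {1..n} (\<lambda>_. borel)) data ?P (\<lambda>\<omega>. \<lambda>(j, b)\<in>{0, 1} \<times> {1..B}. S j b \<omega>)"
    using draws by (simp add: uniform_draws_def data_def[abs_def])
  from indep_rvs_indep_var[OF this \<phi> m] show ?thesis unfolding ph .
qed

lemma phat_bound: "\<bar>phat I \<omega>\<bar> \<le> 1"
proof -
  have "\<bar>\<Sum>b=1..B. hit b I \<omega>\<bar> \<le> (\<Sum>b=1..B. 1)"
    by (rule order_trans[OF sum_abs]) (intro sum_mono hit_bound)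
  then show ?thesis using B_pos by (simp add: phat_def)
qed

text \<open>Draws and data are independent, so every product of centred frequencies and data
  functions factorises. The diagonal part of the multinomial covariance gives the bound; the part
  with \<open>p\<^sup>2\<close> is minus a multiple of the second moment of the plain sum and is
  dropped.\<close>

lemma subsampling_error:
  fixes \<phi> :: "nat set \<Rightarrow> (nat \<Rightarrow> real \<times> 'a) \<Rightarrow> real"
  assumes \<phi>: "\<And>I. I \<in> NS \<Longrightarrow> \<phi> I \<in> borel_measurable (Pi\<^sub>M {1..n} (\<lambda>_. borel))"
    and L2: "\<And>I. I \<in> NS \<Longrightarrow> integrable M (\<lambda>\<omega>. (\<phi> I (data \<omega>))\<^sup>2)"
  shows "integrable M (\<lambda>\<omega>. (\<Sum>I\<in>NS. (phat I \<omega> - p) * \<phi> I (data \<omega>))\<^sup>2)"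
    and "expectation (\<lambda>\<omega>. (\<Sum>I\<in>NS. (phat I \<omega> - p) * \<phi> I (data \<omega>))\<^sup>2)
      \<le> p / real B * (\<Sum>I\<in>NS. expectation (\<lambda>\<omega>. (\<phi> I (data \<omega>))\<^sup>2))"
proof -
  let ?q = "\<lambda>I \<omega>. \<phi> I (data \<omega>)" and ?x = "\<lambda>I \<omega>. phat I \<omega> - p"
  have q: "?q I \<in> borel_measurable M" if "I \<in> NS" for I
    using measurable_compose[OF data_measurable \<phi>[OF that]] .
  have qq: "integrable M (\<lambda>\<omega>. ?q I \<omega> * ?q J \<omega>)" if "I \<in> NS" "J \<in> NS" for I J
    using that by (intro L2_mult_integrable q L2)
  have xx: "integrable M (\<lambda>\<omega>. ?x I \<omega> * ?x J \<omega>)" for I J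
  proof (rule integrable_const_bound[where B = "(1 + p) * (1 + p)"])
    have "\<bar>?x K \<omega>\<bar> \<le> 1 + p" for K \<omega> using phat_bound[of K \<omega>] p_pos by linarith
    then have "\<bar>?x I \<omega>\<bar> * \<bar>?x J \<omega>\<bar> \<le> (1 + p) * (1 + p)" for \<omega>
      using p_pos by (intro mult_mono) auto
    then show "AE \<omega> in M. norm (?x I \<omega> * ?x J \<omega>) \<le> (1 + p) * (1 + p)" by (simp add: abs_mult)
  qed (intro borel_measurable_times borel_measurable_diff borel_measurable_const phat_measurable)
  have ind: "indep_var borel (\<lambda>\<omega>. ?q I \<omega> * ?q J \<omega>) borel (\<lambda>\<omega>. ?x I \<omega> * ?x J \<omega>)" if "I \<in> NS" "J \<in> NS" for I J
    using phat_indep[of "\<lambda>z. \<phi> I z * \<phi> J z" I J] \<phi> that by simp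
  have fact: "expectation (\<lambda>\<omega>. (?q I \<omega> * ?q J \<omega>) * (?x I \<omega> * ?x J \<omega>)) = expectation (\<lambda>\<omega>. ?q I \<omega> * ?q J \<omega>) * ((p * of_bool (I = J) - p\<^sup>2) / real B)"
    if "I \<in> NS" "J \<in> NS" for I J
    using indep_var_lebesgue_integral[OF ind[OF that] qq[OF that] xx] unfolding phat_covariance[OF that] .
  have int: "integrable M (\<lambda>\<omega>. (?q I \<omega> * ?q J \<omega>) * (?x I \<omega> * ?x J \<omega>))" if "I \<in> NS" "J \<in> NS" for I J
    by (rule indep_var_integrable[OF ind[OF that] qq[OF that] xx])
  have sq: "(\<Sum>I\<in>NS. ?x I \<omega> * ?q I \<omega>)\<^sup>2 = (\<Sum>I\<in>NS. \<Sum>J\<in>NS. (?q I \<omega> * ?q J \<omega>) * (?x I \<omega> * ?x J \<omega>))" for \<omega>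
    by (simp add: power2_eq_square sum_product mult_ac)
  show "integrable M (\<lambda>\<omega>. (\<Sum>I\<in>NS. ?x I \<omega> * ?q I \<omega>)\<^sup>2)"
    unfolding sq by (intro Bochner_Integration.integrable_sum int)
  have "expectation (\<lambda>\<omega>. (\<Sum>I\<in>NS. ?x I \<omega> * ?q I \<omega>)\<^sup>2)
      = (\<Sum>I\<in>NS. \<Sum>J\<in>NS. expectation (\<lambda>\<omega>. ?q I \<omega> * ?q J \<omega>) * ((p * of_bool (I = J) - p\<^sup>2) / real B))"
    unfolding sq using int fact by simp
  also have "\<dots> = (\<Sum>I\<in>NS. \<Sum>J\<in>NS. (if I = J then expectation (\<lambda>\<omega>. (?q I \<omega>)\<^sup>2) * p / real B else 0) - p\<^sup>2 / real B * expectation (\<lambda>\<omega>. ?q I \<omega> * ?q J \<omega>))"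
    by (intro sum.cong refl) (auto simp: power2_eq_square algebra_simps diff_divide_distrib)
  also have "\<dots> = (\<Sum>I\<in>NS. expectation (\<lambda>\<omega>. (?q I \<omega>)\<^sup>2) * p / real B) - p\<^sup>2 / real B * (\<Sum>I\<in>NS. \<Sum>J\<in>NS. expectation (\<lambda>\<omega>. ?q I \<omega> * ?q J \<omega>))"
    using NS by (simp add: sum_subtractf sum_distrib_left)
  also have "(\<Sum>I\<in>NS. \<Sum>J\<in>NS. expectation (\<lambda>\<omega>. ?q I \<omega> * ?q J \<omega>)) = expectation (\<lambda>\<omega>. (\<Sum>I\<in>NS. ?q I \<omega>)\<^sup>2)"
    using qq by (simp add: power2_eq_square sum_product)
  also have "(\<Sum>I\<in>NS. expectation (\<lambda>\<omega>. (?q I \<omega>)\<^sup>2) * p / real B) - p\<^sup>2 / real B * expectation (\<lambda>\<omega>. (\<Sum>I\<in>NS. ?q I \<omega>)\<^sup>2)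
      \<le> p / real B * (\<Sum>I\<in>NS. expectation (\<lambda>\<omega>. (?q I \<omega>)\<^sup>2))"
    by (simp add: sum_distrib_left sum_distrib_right mult_ac)
  finally show "expectation (\<lambda>\<omega>. (\<Sum>I\<in>NS. ?x I \<omega> * ?q I \<omega>)\<^sup>2)
      \<le> p / real B * (\<Sum>I\<in>NS. expectation (\<lambda>\<omega>. (?q I \<omega>)\<^sup>2))" .
qed

end

section \<open>Sampling error of the jackknife covariances\<close>

lemma weighted_square_le:
  fixes w a :: "'i \<Rightarrow> real"
  assumes w: "\<And>i. i \<in> A \<Longrightarrow> 0 \<le> w i" and w1: "(\<Sum>i\<in>A. w i) \<le> 1"
  shows "(\<Sum>i\<in>A. w i * a i)\<^sup>2 \<le> (\<Sum>i\<in>A. w i * (a i)\<^sup>2)"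
proof -
  have "(\<Sum>i\<in>A. w i * a i)\<^sup>2 = (\<Sum>i\<in>A. sqrt (w i) * (sqrt (w i) * a i))\<^sup>2"
    using w by (intro arg_cong[where f = "\<lambda>x. x\<^sup>2"] sum.cong refl) (simp add: mult.assoc[symmetric])
  also have "\<dots> \<le> (\<Sum>i\<in>A. (sqrt (w i))\<^sup>2) * (\<Sum>i\<in>A. (sqrt (w i) * a i)\<^sup>2)"
    by (rule Cauchy_Schwarz_ineq_sum)
  also have "\<dots> = (\<Sum>i\<in>A. w i) * (\<Sum>i\<in>A. w i * (a i)\<^sup>2)"
    using w by (simp add: power_mult_distrib)
  also have "\<dots> \<le> 1 * (\<Sum>i\<in>A. w i * (a i)\<^sup>2)"
    using w w1 by (intro mult_right_mono sum_nonneg) auto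
  finally show ?thesis by simp
qed

text \<open>Covariances do not change under shifts. With the shifts \<open>k / n\<close> and the
  forest mean, the second term becomes a product of two averages that have mean zero over the
  draws.\<close>

lemma emp_cov_shift:
  assumes "B \<ge> 1"
  shows "emp_cov B f g = emp_mean B (\<lambda>b. (f b - s) * (g b - t)) - emp_mean B (\<lambda>b. f b - s) * emp_mean B (\<lambda>b. g b - t)"
proof -
  let ?F = "emp_mean B f" and ?G = "emp_mean B g"
  have B: "real B > 0" using assms by simp
  have F: "(\<Sum>b=1..B. f b) = real B * ?F" and G: "(\<Sum>b=1..B. g b) = real B * ?G"
    using B by (simp_all add: emp_mean_def)
  have "(\<Sum>b=1..B. (f b - ?F) * (g b - ?G)) = (\<Sum>b=1..B. f b * g b - f b * ?G - ?F * g b + ?F * ?G)"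
    by (intro sum.cong refl) (simp add: algebra_simps)
  also have "\<dots> = (\<Sum>b=1..B. f b * g b) - real B * ?F * ?G"
    using F G by (simp add: sum.distrib sum_subtractf sum_distrib_left[symmetric] sum_distrib_right[symmetric] algebra_simps)
  finally have 1: "emp_cov B f g = (\<Sum>b=1..B. f b * g b) / real B - ?F * ?G"
    using B by (simp add: emp_cov_def diff_divide_distrib)
  have "(\<Sum>b=1..B. (f b - s) * (g b - t)) = (\<Sum>b=1..B. f b * g b - f b * t - s * g b + s * t)"
    by (intro sum.cong refl) (simp add: algebra_simps)
  also have "\<dots> = (\<Sum>b=1..B. f b * g b) - real B * ?F * t - s * (real B * ?G) + real B * s * t"
    using F G by (simp add: sum.distrib sum_subtractf sum_distrib_left[symmetric] sum_distrib_right[symmetric] algebra_simps)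
  finally have 2: "emp_mean B (\<lambda>b. (f b - s) * (g b - t)) = (\<Sum>b=1..B. f b * g b) / real B - ?F * t - s * ?G + s * t"
    using B by (simp add: emp_mean_def add_divide_distrib diff_divide_distrib)
  have 3: "emp_mean B (\<lambda>b. f b - s) = ?F - s" "emp_mean B (\<lambda>b. g b - t) = ?G - t"
    using B by (simp_all add: emp_mean_def sum_subtractf diff_divide_distrib)
  show ?thesis unfolding 1 2 3 by (simp add: algebra_simps)
qed

context subsampled_kernel
begin

definition kern :: "nat set \<Rightarrow> (nat \<Rightarrow> real \<times> 'a) \<Rightarrow> real" where
  "kern I z = h (image_mset z (mset_set I))"

lemma kern_data: "I \<in> NS \<Longrightarrow> kern I (data \<omega>) = U I \<omega>"
  unfolding kern_def data_def using U_restrict[of I "{1..n}" "\<lambda>x. x" \<omega>]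
  by (auto simp: nsets_def U_def)

lemma kern_measurable: "I \<in> NS \<Longrightarrow> kern I \<in> borel_measurable (Pi\<^sub>M {1..n} (\<lambda>_. borel))"
  unfolding kern_def[abs_def] by (rule kernel_measurable_subset) (auto simp: nsets_def)

text \<open>The jackknife covariance expressed through the frequencies after centring. It coincides
  with the empirical covariance whenever all draws are \<open>k\<close>-subsets; in this form
  measurability is plain and the pointwise estimates hold at every sample point.\<close>

definition resampled_jackknife :: "nat \<Rightarrow> 'w \<Rightarrow> real" where
  "resampled_jackknife i \<omega> =
     (\<Sum>I\<in>NS. phat I \<omega> * (centred_incl n i I * (U I \<omega> - forest_mean n \<omega>)))
     - (\<Sum>I\<in>NS. phat I \<omega> * centred_incl n i I) * (\<Sum>I\<in>NS. (phat I \<omega> - p) * U I \<omega>)"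

lemma emp_mean_phat:
  assumes "\<forall>b\<in>{1..B}. S j b \<omega> \<in> NS"
  shows "emp_mean B (\<lambda>b. f (S j b \<omega>)) = (\<Sum>I\<in>NS. phat I \<omega> * f I)"
proof -
  have "(\<Sum>b=1..B. f (S j b \<omega>)) = (\<Sum>b=1..B. \<Sum>I\<in>NS. hit b I \<omega> * f I)"
  proof (intro sum.cong refl)
    fix b assume "b \<in> {1..B}"
    then have "S j b \<omega> \<in> NS" using assms by blast
    have "(\<Sum>I\<in>NS. hit b I \<omega> * f I) = (\<Sum>I\<in>NS. if S j b \<omega> = I then f I else 0)"
      by (intro sum.cong refl) (auto simp: hit_def)
    then show "f (S j b \<omega>) = (\<Sum>I\<in>NS. hit b I \<omega> * f I)" using \<open>S j b \<omega> \<in> NS\<close> NS by simp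
  qed
  also have "\<dots> = (\<Sum>I\<in>NS. (\<Sum>b=1..B. hit b I \<omega>) * f I)"
    by (subst sum.swap) (simp add: sum_distrib_right)
  also have "\<dots> = real B * (\<Sum>I\<in>NS. phat I \<omega> * f I)"
    unfolding sum_distrib_left using B_pos by (intro sum.cong refl) (simp add: phat_def)
  finally show ?thesis using B_pos by (simp add: emp_mean_def)
qed

lemma sum_phat:
  assumes "\<forall>b\<in>{1..B}. S j b \<omega> \<in> NS"
  shows "(\<Sum>I\<in>NS. phat I \<omega>) = 1"
  using emp_mean_phat[OF assms, of "\<lambda>_. 1"] B_pos by (simp add: emp_mean_def)

lemma resampled_jackknife_emp_cov:
  assumes S: "\<forall>b\<in>{1..B}. S j b \<omega> \<in> NS"
  shows "emp_cov B (\<lambda>b. of_bool (i \<in> S j b \<omega>)) (\<lambda>b. U (S j b \<omega>) \<omega>) = resampled_jackknife i \<omega>"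
proof -
  let ?F = "forest_mean n \<omega>"
  have "emp_cov B (\<lambda>b. of_bool (i \<in> S j b \<omega>)) (\<lambda>b. U (S j b \<omega>) \<omega>)
     = emp_mean B (\<lambda>b. centred_incl n i (S j b \<omega>) * (U (S j b \<omega>) \<omega> - ?F))
       - emp_mean B (\<lambda>b. centred_incl n i (S j b \<omega>)) * emp_mean B (\<lambda>b. U (S j b \<omega>) \<omega> - ?F)"
    unfolding centred_incl_def by (rule emp_cov_shift[OF B_pos])
  also have "\<dots> = (\<Sum>I\<in>NS. phat I \<omega> * (centred_incl n i I * (U I \<omega> - ?F)))
     - (\<Sum>I\<in>NS. phat I \<omega> * centred_incl n i I) * (\<Sum>I\<in>NS. phat I \<omega> * (U I \<omega> - ?F))"
    using emp_mean_phat[OF S, of "\<lambda>I. centred_incl n i I * (U I \<omega> - ?F)"] emp_mean_phat[OF S, of "centred_incl n i"]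
      emp_mean_phat[OF S, of "\<lambda>I. U I \<omega> - ?F"] by simp
  also have "(\<Sum>I\<in>NS. phat I \<omega> * (U I \<omega> - ?F)) = (\<Sum>I\<in>NS. phat I \<omega> * U I \<omega>) - (\<Sum>I\<in>NS. phat I \<omega>) * ?F"
    by (simp add: right_diff_distrib sum_subtractf sum_distrib_right)
  also have "\<dots> = (\<Sum>I\<in>NS. (phat I \<omega> - p) * U I \<omega>)"
    using sum_phat[OF S] by (simp add: forest_mean_def p_def left_diff_distrib sum_subtractf sum_divide_distrib)
  finally show ?thesis by (simp add: resampled_jackknife_def)
qed

lemma sum_centred_incl_square:
  assumes "I \<in> NS"
  shows "(\<Sum>i=1..n. (centred_incl n i I)\<^sup>2) \<le> real k"
proof -
  let ?q = "real k / real n"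
  have I: "I \<subseteq> {1..n}" "card I = k" using assms by (auto simp: nsets_def)
  have "(\<Sum>i=1..n. of_bool (i \<in> I)) = real k"
    using I by (simp add: of_bool_def sum.If_cases Int_absorb1)
  moreover have "(\<Sum>i=1..n. (centred_incl n i I)\<^sup>2) = (\<Sum>i=1..n. (1 - 2 * ?q) * of_bool (i \<in> I) + ?q\<^sup>2)"
    by (intro sum.cong refl) (auto simp: centred_incl_def power2_eq_square algebra_simps)
  ultimately have "(\<Sum>i=1..n. (centred_incl n i I)\<^sup>2) = (1 - 2 * ?q) * real k + real n * ?q\<^sup>2"
    by (simp only: sum.distrib sum_distrib_left[symmetric]) simp
  also have "real n * ?q\<^sup>2 = ?q * real k" using kn' by (simp add: power2_eq_square)
  also have "(1 - 2 * ?q) * real k + ?q * real k = real k - ?q * real k" by (simp add: algebra_simps)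
  also have "\<dots> \<le> real k" by simp
  finally show ?thesis .
qed

lemma sum_centred_incl:
  assumes "i \<in> {1..n}"
  shows "(\<Sum>I\<in>NS. centred_incl n i I) = 0"
proof -
  have "(\<Sum>I\<in>NS. centred_incl n i I) = (\<Sum>I\<in>NS. of_bool (i \<in> I)) - real (n choose k) * (real k / real n)"
    using NS by (simp add: centred_incl_def sum_subtractf)
  also have "(\<Sum>I\<in>NS. of_bool (i \<in> I)) = real (n choose k) * (real k / real n)"
    using mean_inclusion[OF assms kn'(1)] p_pos by (simp add: field_simps p_def)
  finally show ?thesis by simp
qed

lemma ideal_jackknife_eq:
  assumes "i \<in> {1..n}"
  shows "ideal_jackknife n i \<omega> = (\<Sum>I\<in>NS. p * (centred_incl n i I * (U I \<omega> - forest_mean n \<omega>)))"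
proof -
  have "(\<Sum>I\<in>NS. p * (centred_incl n i I * (U I \<omega> - forest_mean n \<omega>)))
     = p * ((\<Sum>I\<in>NS. centred_incl n i I * U I \<omega>) - (\<Sum>I\<in>NS. centred_incl n i I) * forest_mean n \<omega>)"
    by (simp only: sum_distrib_left[symmetric] right_diff_distrib sum_subtractf sum_distrib_right)
  then show ?thesis using sum_centred_incl[OF assms] by (simp add: ideal_jackknife_def p_def)
qed

definition cross_error :: "nat \<Rightarrow> 'w \<Rightarrow> real" where
  "cross_error i \<omega> = (\<Sum>I\<in>NS. (phat I \<omega> - p) * (centred_incl n i I * (U I \<omega> - forest_mean n \<omega>)))"

definition mean_error :: "'w \<Rightarrow> real" where
  "mean_error \<omega> = (\<Sum>I\<in>NS. (phat I \<omega> - p) * U I \<omega>)"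

lemma resampled_minus_ideal:
  assumes "i \<in> {1..n}"
  shows "resampled_jackknife i \<omega> - ideal_jackknife n i \<omega>
     = cross_error i \<omega> - (\<Sum>I\<in>NS. phat I \<omega> * centred_incl n i I) * mean_error \<omega>"
  unfolding ideal_jackknife_eq[OF assms] resampled_jackknife_def cross_error_def mean_error_def
  by (simp add: left_diff_distrib sum_subtractf)

text \<open>Jensen's inequality with the frequencies as weights, followed by the bound
  \<open>k\<close> for each subset. Because the result is deterministic, the product with
  \<open>mean_error\<close> can be handled through the second moment of \<open>mean_error\<close>
  alone, without joint moments of two sampling errors.\<close>

lemma sum_phat_centred_incl:
  "(\<Sum>i=1..n. (\<Sum>I\<in>NS. phat I \<omega> * centred_incl n i I)\<^sup>2) \<le> real k"
proof -
  have nn: "phat I \<omega> \<ge> 0" for I by (simp add: phat_def hit_def sum_nonneg)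
  \<comment> \<open>At an arbitrary sample point there is only an inequality, since a draw outside
    \<open>NS\<close> is not counted.\<close>
  have le1: "(\<Sum>I\<in>NS. phat I \<omega>) \<le> 1"
  proof -
    have "(\<Sum>I\<in>NS. phat I \<omega>) = (\<Sum>b=1..B. \<Sum>I\<in>NS. hit b I \<omega>) / real B"
      unfolding phat_def sum_divide_distrib[symmetric] by (subst sum.swap) simp
    also have "\<dots> \<le> (\<Sum>b=1..B. 1) / real B"
    proof (intro divide_right_mono sum_mono)
      fix b
      have "(\<Sum>I\<in>NS. hit b I \<omega>) = (\<Sum>I\<in>NS. if S j b \<omega> = I then 1 else 0)"
        by (intro sum.cong refl) (auto simp: hit_def)
      also have "\<dots> \<le> 1" using NS by simp
      finally show "(\<Sum>I\<in>NS. hit b I \<omega>) \<le> 1" .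
    qed simp
    also have "\<dots> = 1" using B_pos by simp
    finally show ?thesis .
  qed
  have "(\<Sum>i=1..n. (\<Sum>I\<in>NS. phat I \<omega> * centred_incl n i I)\<^sup>2)
      \<le> (\<Sum>i=1..n. \<Sum>I\<in>NS. phat I \<omega> * (centred_incl n i I)\<^sup>2)"
    by (intro sum_mono weighted_square_le nn le1)
  also have "\<dots> = (\<Sum>I\<in>NS. phat I \<omega> * (\<Sum>i=1..n. (centred_incl n i I)\<^sup>2))"
    by (subst sum.swap) (simp add: sum_distrib_left)
  also have "\<dots> \<le> (\<Sum>I\<in>NS. phat I \<omega> * real k)"
    by (intro sum_mono mult_left_mono sum_centred_incl_square nn)
  also have "\<dots> \<le> real k"
    using mult_right_mono[OF le1, of "real k"] by (simp add: sum_distrib_right[symmetric])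
  finally show ?thesis .
qed

lemma U_square: "I \<in> NS \<Longrightarrow> expectation (\<lambda>\<omega>. (U I \<omega>)\<^sup>2) = overlap_cov k"
  using overlap_cov[OF index_set_nsets index_set_nsets, of I n I n] by (auto simp: nsets_def power2_eq_square)

lemma mean_error_L2:
  "integrable M (\<lambda>\<omega>. (mean_error \<omega>)\<^sup>2)" "expectation (\<lambda>\<omega>. (mean_error \<omega>)\<^sup>2) \<le> overlap_cov k / real B"
proof -
  have L2: "integrable M (\<lambda>\<omega>. (kern I (data \<omega>))\<^sup>2)" if "I \<in> NS" for I
    using U_L2[OF index_set_nsets[OF that]] by (simp add: kern_data[OF that])
  have eq: "(\<Sum>I\<in>NS. (phat I \<omega> - p) * kern I (data \<omega>)) = mean_error \<omega>" for \<omega>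
    unfolding mean_error_def by (intro sum.cong refl) (simp add: kern_data)
  show "integrable M (\<lambda>\<omega>. (mean_error \<omega>)\<^sup>2)"
    using subsampling_error(1)[of kern, OF kern_measurable L2] unfolding eq .
  have "expectation (\<lambda>\<omega>. (mean_error \<omega>)\<^sup>2) \<le> p / real B * (\<Sum>I\<in>NS. expectation (\<lambda>\<omega>. (kern I (data \<omega>))\<^sup>2))"
    using subsampling_error(2)[of kern, OF kern_measurable L2] unfolding eq .
  also have "(\<Sum>I\<in>NS. expectation (\<lambda>\<omega>. (kern I (data \<omega>))\<^sup>2)) = real (card NS) * overlap_cov k"
    by (simp add: kern_data U_square)
  also have "p / real B * (real (card NS) * overlap_cov k) = (real (card NS) * p) * overlap_cov k / real B" by simp
  finally show "expectation (\<lambda>\<omega>. (mean_error \<omega>)\<^sup>2) \<le> overlap_cov k / real B" unfolding card_p by simp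
qed

definition forest_fun :: "(nat \<Rightarrow> real \<times> 'a) \<Rightarrow> real" where
  "forest_fun z = (\<Sum>I\<in>NS. kern I z) / real (n choose k)"

lemma forest_fun_data: "forest_fun (data \<omega>) = forest_mean n \<omega>"
  unfolding forest_fun_def forest_mean_def by (intro arg_cong2[where f = "(/)"] sum.cong refl kern_data)

lemma forest_fun_measurable: "forest_fun \<in> borel_measurable (Pi\<^sub>M {1..n} (\<lambda>_. borel))"
  unfolding forest_fun_def[abs_def] by (intro borel_measurable_divide borel_measurable_sum kern_measurable) auto

text \<open>Each cross error is a sum of the kind treated in \<open>subsampling_error\<close>.
  Carrying out the sum over \<open>i\<close> inside replaces the squared centred inclusions by at
  most \<open>k\<close>, and subtracting the forest mean only decreases the sum of squares over all
  subsets.\<close>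

lemma cross_error_L2:
  shows "i \<in> {1..n} \<Longrightarrow> integrable M (\<lambda>\<omega>. (cross_error i \<omega>)\<^sup>2)"
    and "(\<Sum>i=1..n. expectation (\<lambda>\<omega>. (cross_error i \<omega>)\<^sup>2)) \<le> real k * overlap_cov k / real B"
proof -
  define \<phi> where "\<phi> i I z = centred_incl n i I * (kern I z - forest_fun z)" for i I z
  have m: "\<phi> i I \<in> borel_measurable (Pi\<^sub>M {1..n} (\<lambda>_. borel))" if "I \<in> NS" for i I
    unfolding \<phi>_def[abs_def] using that
    by (intro borel_measurable_times borel_measurable_diff kern_measurable forest_fun_measurable) auto
  have d: "\<phi> i I (data \<omega>) = centred_incl n i I * (U I \<omega> - forest_mean n \<omega>)" if "I \<in> NS" for i I \<omega>
    using that by (simp add: \<phi>_def kern_data forest_fun_data)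
  have L2d: "integrable M (\<lambda>\<omega>. (U I \<omega> - forest_mean n \<omega>)\<^sup>2)" if "I \<in> NS" for I
    using that by (intro L2_diff_integrable U_measurable U_L2 forest_mean_measurable forest_mean_L2 index_set_nsets)
  have L2: "integrable M (\<lambda>\<omega>. (\<phi> i I (data \<omega>))\<^sup>2)" if "I \<in> NS" for i I
    using L2d[OF that] by (simp add: d[OF that] power_mult_distrib)
  have eq: "(\<Sum>I\<in>NS. (phat I \<omega> - p) * \<phi> i I (data \<omega>)) = cross_error i \<omega>" for i \<omega>
    unfolding cross_error_def by (intro sum.cong refl) (simp add: d)
  show "integrable M (\<lambda>\<omega>. (cross_error i \<omega>)\<^sup>2)" if "i \<in> {1..n}"
    using subsampling_error(1)[of "\<phi> i", OF m L2] unfolding eq .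
  have "(\<Sum>i=1..n. expectation (\<lambda>\<omega>. (cross_error i \<omega>)\<^sup>2))
      \<le> (\<Sum>i=1..n. p / real B * (\<Sum>I\<in>NS. expectation (\<lambda>\<omega>. (\<phi> i I (data \<omega>))\<^sup>2)))"
    using subsampling_error(2)[of "\<phi> i" for i, OF m L2] unfolding eq by (intro sum_mono)
  also have "\<dots> = p / real B * (\<Sum>I\<in>NS. \<Sum>i=1..n. expectation (\<lambda>\<omega>. (\<phi> i I (data \<omega>))\<^sup>2))"
    by (simp only: sum_distrib_left[symmetric]) (subst sum.swap, rule refl)
  finally have 1: "(\<Sum>i=1..n. expectation (\<lambda>\<omega>. (cross_error i \<omega>)\<^sup>2)) \<le> p / real B * (\<Sum>I\<in>NS. \<Sum>i=1..n. expectation (\<lambda>\<omega>. (\<phi> i I (data \<omega>))\<^sup>2))" .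
  have 2: "expectation (\<lambda>\<omega>. \<Sum>I\<in>NS. (U I \<omega> - forest_mean n \<omega>)\<^sup>2) \<le> expectation (\<lambda>\<omega>. \<Sum>I\<in>NS. (U I \<omega>)\<^sup>2)"
  proof (intro integral_mono Bochner_Integration.integrable_sum L2d U_L2 index_set_nsets)
    fix \<omega>
    let ?F = "forest_mean n \<omega>"
    have F: "(\<Sum>I\<in>NS. U I \<omega>) = real (card NS) * ?F" using NS p_pos by (simp add: forest_mean_def p_def)
    have "(\<Sum>I\<in>NS. (U I \<omega> - ?F)\<^sup>2) = (\<Sum>I\<in>NS. (U I \<omega>)\<^sup>2 - 2 * ?F * U I \<omega> + ?F\<^sup>2)"
      by (intro sum.cong refl) (simp add: power2_diff)
    also have "\<dots> = (\<Sum>I\<in>NS. (U I \<omega>)\<^sup>2) - 2 * ?F * (\<Sum>I\<in>NS. U I \<omega>) + real (card NS) * ?F\<^sup>2"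
      by (simp only: sum.distrib sum_subtractf sum_distrib_left[symmetric] sum_constant)
    also have "\<dots> = (\<Sum>I\<in>NS. (U I \<omega>)\<^sup>2) - real (card NS) * ?F\<^sup>2"
      unfolding F by (simp add: power2_eq_square)
    finally show "(\<Sum>I\<in>NS. (U I \<omega> - ?F)\<^sup>2) \<le> (\<Sum>I\<in>NS. (U I \<omega>)\<^sup>2)" by simp
  qed
  have "(\<Sum>I\<in>NS. \<Sum>i=1..n. expectation (\<lambda>\<omega>. (\<phi> i I (data \<omega>))\<^sup>2))
      = (\<Sum>I\<in>NS. (\<Sum>i=1..n. (centred_incl n i I)\<^sup>2) * expectation (\<lambda>\<omega>. (U I \<omega> - forest_mean n \<omega>)\<^sup>2))"
    by (intro sum.cong refl) (simp add: d power_mult_distrib sum_distrib_right)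
  also have "\<dots> \<le> (\<Sum>I\<in>NS. real k * expectation (\<lambda>\<omega>. (U I \<omega> - forest_mean n \<omega>)\<^sup>2))"
    by (intro sum_mono mult_right_mono sum_centred_incl_square integral_nonneg_AE AE_I2) auto
  also have "\<dots> = real k * expectation (\<lambda>\<omega>. \<Sum>I\<in>NS. (U I \<omega> - forest_mean n \<omega>)\<^sup>2)"
    using L2d by (simp add: sum_distrib_left)
  also have "\<dots> \<le> real k * expectation (\<lambda>\<omega>. \<Sum>I\<in>NS. (U I \<omega>)\<^sup>2)"
    by (intro mult_left_mono 2) simp
  also have "expectation (\<lambda>\<omega>. \<Sum>I\<in>NS. (U I \<omega>)\<^sup>2) = real (card NS) * overlap_cov k"
    using U_L2[OF index_set_nsets] by (simp add: U_square)
  finally have "p / real B * (\<Sum>I\<in>NS. \<Sum>i=1..n. expectation (\<lambda>\<omega>. (\<phi> i I (data \<omega>))\<^sup>2))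
      \<le> p / real B * (real k * (real (card NS) * overlap_cov k))"
    using p_pos by (intro mult_left_mono) auto
  also have "\<dots> = (real (card NS) * p) * (real k * overlap_cov k / real B)"
    by simp
  also have "\<dots> = real k * overlap_cov k / real B" unfolding card_p by simp
  finally show "(\<Sum>i=1..n. expectation (\<lambda>\<omega>. (cross_error i \<omega>)\<^sup>2)) \<le> real k * overlap_cov k / real B"
    using 1 by linarith
qed

lemma resampled_jackknife_measurable: "resampled_jackknife i \<in> borel_measurable M"
  unfolding resampled_jackknife_def[abs_def]
  by (intro borel_measurable_diff borel_measurable_times borel_measurable_sum phat_measurable
      U_measurable forest_mean_measurable borel_measurable_const index_set_nsets)

text \<open>The deviation splits into the cross error, the product of the two average errors and the
  error of the ideal jackknife, whose squares receive the weights \<open>4\<close>, \<open>4\<close>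
  and \<open>2\<close>. The two sampling errors thus contribute \<open>4 + 4 = 8\<close> times
  \<open>k / B\<close>, and the last one \<open>2 * 3 = 6\<close> times
  \<open>(k / n)\<^sup>2\<close>.\<close>

lemma resampled_jackknife_error:
  "integrable M (\<lambda>\<omega>. \<Sum>i=1..n. (resampled_jackknife i \<omega> - real k / real n * pr i \<omega>)\<^sup>2)"
  "expectation (\<lambda>\<omega>. \<Sum>i=1..n. (resampled_jackknife i \<omega> - real k / real n * pr i \<omega>)\<^sup>2)
    \<le> (8 * real k / real B + 6 * (real k / real n)\<^sup>2) * overlap_cov k"
proof -
  let ?a = "\<lambda>i \<omega>. (\<Sum>I\<in>NS. phat I \<omega> * centred_incl n i I)"
  define R where "R \<omega> = 4 * (\<Sum>i=1..n. (cross_error i \<omega>)\<^sup>2) + 4 * real k * (mean_error \<omega>)\<^sup>2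
      + 2 * (\<Sum>i=1..n. (ideal_jackknife n i \<omega> - real k / real n * pr i \<omega>)\<^sup>2)" for \<omega>
  let ?d = "\<lambda>i \<omega>. resampled_jackknife i \<omega> - real k / real n * pr i \<omega>"
  have i1: "integrable M (\<lambda>\<omega>. (ideal_jackknife n i \<omega> - real k / real n * pr i \<omega>)\<^sup>2)" if "i \<in> {1..n}" for i
  proof (rule L2_diff_integrable[OF ideal_jackknife_measurable _ ideal_jackknife_L2])
    show "(\<lambda>\<omega>. real k / real n * pr i \<omega>) \<in> borel_measurable M"
      using that by (intro borel_measurable_times borel_measurable_const pr_measurable) auto
    show "integrable M (\<lambda>\<omega>. (real k / real n * pr i \<omega>)\<^sup>2)"
      unfolding power_mult_distrib using that by (intro integrable_mult_right pr_L2) auto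
  qed
  have intR: "integrable M R"
    unfolding R_def[abs_def]
    by (intro Bochner_Integration.integrable_add integrable_mult_right Bochner_Integration.integrable_sum
        cross_error_L2(1) mean_error_L2(1) i1)
  have le: "(\<Sum>i=1..n. (?d i \<omega>)\<^sup>2) \<le> R \<omega>" for \<omega>
  proof -
    have sq: "(a - b + c)\<^sup>2 \<le> 4 * a\<^sup>2 + 4 * b\<^sup>2 + 2 * c\<^sup>2" for a b c :: real
    proof -
      have "4 * a\<^sup>2 + 4 * b\<^sup>2 + 2 * c\<^sup>2 - (a - b + c)\<^sup>2 = 2 * (a + b)\<^sup>2 + (a - b - c)\<^sup>2"
        by (simp add: power2_eq_square algebra_simps)
      moreover have "0 \<le> 2 * (a + b)\<^sup>2 + (a - b - c)\<^sup>2" by simp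
      ultimately show ?thesis by linarith
    qed
    have "(\<Sum>i=1..n. (?d i \<omega>)\<^sup>2) \<le> (\<Sum>i=1..n. 4 * (cross_error i \<omega>)\<^sup>2 + 4 * (?a i \<omega> * mean_error \<omega>)\<^sup>2
        + 2 * (ideal_jackknife n i \<omega> - real k / real n * pr i \<omega>)\<^sup>2)"
    proof (intro sum_mono)
      fix i assume i: "i \<in> {1..n}"
      have eq: "?d i \<omega> = cross_error i \<omega> - ?a i \<omega> * mean_error \<omega> + (ideal_jackknife n i \<omega> - real k / real n * pr i \<omega>)"
        using resampled_minus_ideal[OF i, of \<omega>] by linarith
      show "(?d i \<omega>)\<^sup>2 \<le> 4 * (cross_error i \<omega>)\<^sup>2 + 4 * (?a i \<omega> * mean_error \<omega>)\<^sup>2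
        + 2 * (ideal_jackknife n i \<omega> - real k / real n * pr i \<omega>)\<^sup>2"
        unfolding eq by (rule sq)
    qed
    also have "\<dots> = 4 * (\<Sum>i=1..n. (cross_error i \<omega>)\<^sup>2) + 4 * ((\<Sum>i=1..n. (?a i \<omega>)\<^sup>2) * (mean_error \<omega>)\<^sup>2)
        + 2 * (\<Sum>i=1..n. (ideal_jackknife n i \<omega> - real k / real n * pr i \<omega>)\<^sup>2)"
      by (simp only: sum.distrib sum_distrib_left[symmetric] power_mult_distrib sum_distrib_right[symmetric])
    also have "\<dots> \<le> R \<omega>"
      unfolding R_def using mult_right_mono[OF sum_phat_centred_incl[of \<omega>], of "(mean_error \<omega>)\<^sup>2"] by simp
    finally show ?thesis .
  qed
  show int: "integrable M (\<lambda>\<omega>. \<Sum>i=1..n. (?d i \<omega>)\<^sup>2)"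
  proof (rule Bochner_Integration.integrable_bound[OF intR])
    show "(\<lambda>\<omega>. \<Sum>i=1..n. (?d i \<omega>)\<^sup>2) \<in> borel_measurable M"
      by (intro borel_measurable_sum borel_measurable_power borel_measurable_diff borel_measurable_times
          borel_measurable_const resampled_jackknife_measurable pr_measurable) auto
    have nn: "0 \<le> (\<Sum>i=1..n. (?d i \<omega>)\<^sup>2)" for \<omega> by (rule sum_nonneg) (rule zero_le_power2)
    have "norm (\<Sum>i=1..n. (?d i \<omega>)\<^sup>2) \<le> norm (R \<omega>)" for \<omega>
      unfolding real_norm_def using le[of \<omega>] nn[of \<omega>] by linarith
    then show "AE \<omega> in M. norm (\<Sum>i=1..n. (?d i \<omega>)\<^sup>2) \<le> norm (R \<omega>)" by (rule AE_I2)
  qed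
  have "expectation (\<lambda>\<omega>. \<Sum>i=1..n. (?d i \<omega>)\<^sup>2) \<le> expectation R"
    by (intro integral_mono int intR le)
  also have "expectation R = 4 * (\<Sum>i=1..n. expectation (\<lambda>\<omega>. (cross_error i \<omega>)\<^sup>2)) + 4 * real k * expectation (\<lambda>\<omega>. (mean_error \<omega>)\<^sup>2)
      + 2 * (\<Sum>i=1..n. expectation (\<lambda>\<omega>. (ideal_jackknife n i \<omega> - real k / real n * pr i \<omega>)\<^sup>2))"
  proof -
    define X where "X \<omega> = (\<Sum>i=1..n. (cross_error i \<omega>)\<^sup>2)" for \<omega>
    define W where "W \<omega> = (\<Sum>i=1..n. (ideal_jackknife n i \<omega> - real k / real n * pr i \<omega>)\<^sup>2)" for \<omega>
    have "integrable M X" "integrable M W"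
      unfolding X_def[abs_def] W_def[abs_def] by (intro Bochner_Integration.integrable_sum cross_error_L2(1) i1; assumption)+
    moreover have R: "R = (\<lambda>\<omega>. 4 * X \<omega> + 4 * real k * (mean_error \<omega>)\<^sup>2 + 2 * W \<omega>)"
      by (simp add: fun_eq_iff R_def X_def W_def)
    ultimately have "expectation R = 4 * expectation X + 4 * real k * expectation (\<lambda>\<omega>. (mean_error \<omega>)\<^sup>2) + 2 * expectation W"
      using mean_error_L2(1) unfolding R by simp
    also have "expectation X = (\<Sum>i=1..n. expectation (\<lambda>\<omega>. (cross_error i \<omega>)\<^sup>2))"
      unfolding X_def by (rule Bochner_Integration.integral_sum) (rule cross_error_L2(1))
    also have "expectation W = (\<Sum>i=1..n. expectation (\<lambda>\<omega>. (ideal_jackknife n i \<omega> - real k / real n * pr i \<omega>)\<^sup>2))"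
      unfolding W_def by (rule Bochner_Integration.integral_sum) (rule i1)
    finally show ?thesis .
  qed
  also have "\<dots> \<le> 4 * (real k * overlap_cov k / real B) + 4 * real k * (overlap_cov k / real B) + 2 * (3 * (real k / real n)\<^sup>2 * overlap_cov k)"
    by (intro add_mono mult_left_mono cross_error_L2(2) mean_error_L2(2) ideal_jackknife_pr kn) auto
  also have "\<dots> = (8 * real k / real B + 6 * (real k / real n)\<^sup>2) * overlap_cov k"
    by (simp add: algebra_simps)
  finally show "expectation (\<lambda>\<omega>. \<Sum>i=1..n. (?d i \<omega>)\<^sup>2) \<le> (8 * real k / real B + 6 * (real k / real n)\<^sup>2) * overlap_cov k" .
qed

end

section \<open>Weak convergence from characteristic functions\<close>

text \<open>The frequencies are arbitrary vectors. This makes the class closed under products, and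
  the integral of a member is a finite combination of real and imaginary parts of the characteristic
  function.\<close>

inductive trig_poly :: "('b::real_inner \<Rightarrow> real) \<Rightarrow> bool" where
  cos: "trig_poly (\<lambda>x. cos (s \<bullet> x))"
| sin: "trig_poly (\<lambda>x. sin (s \<bullet> x))"
| add: "trig_poly f \<Longrightarrow> trig_poly g \<Longrightarrow> trig_poly (\<lambda>x. f x + g x)"
| scale: "trig_poly f \<Longrightarrow> trig_poly (\<lambda>x. c * f x)"

lemma trig_poly_const: "trig_poly (\<lambda>x. c)"
  using trig_poly.scale[OF trig_poly.cos[of 0], of c] by simp

lemma trig_poly_diff: "trig_poly f \<Longrightarrow> trig_poly g \<Longrightarrow> trig_poly (\<lambda>x. f x - g x)"
  using trig_poly.add[OF _ trig_poly.scale[of g "-1"]] by simp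

lemma trig_poly_cos_mult: "trig_poly g \<Longrightarrow> trig_poly (\<lambda>x. cos (s \<bullet> x) * g x)"
proof (induction rule: trig_poly.induct)
  case (cos t)
  have "trig_poly (\<lambda>x. (1/2) * (cos ((s - t) \<bullet> x) + cos ((s + t) \<bullet> x)))"
    by (intro trig_poly.intros)
  then show ?case by (simp add: cos_times_cos inner_diff_left inner_add_left)
next
  case (sin t)
  have "trig_poly (\<lambda>x. (1/2) * (sin ((s + t) \<bullet> x) - sin ((s - t) \<bullet> x)))"
    by (intro trig_poly.intros trig_poly_diff)
  then show ?case by (simp add: cos_times_sin inner_diff_left inner_add_left)
next
  case (add f g)
  then show ?case using trig_poly.add[OF add.IH] by (simp add: distrib_left)
next
  case (scale f c)
  then show ?case using trig_poly.scale[OF scale.IH, of c] by (simp add: mult.left_commute)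
qed

lemma trig_poly_sin_mult: "trig_poly g \<Longrightarrow> trig_poly (\<lambda>x. sin (s \<bullet> x) * g x)"
proof (induction rule: trig_poly.induct)
  case (cos t)
  show ?case using trig_poly_cos_mult[OF trig_poly.sin[of s], of t] by (simp add: mult.commute)
next
  case (sin t)
  have "trig_poly (\<lambda>x. (1/2) * (cos ((s - t) \<bullet> x) - cos ((s + t) \<bullet> x)))"
    by (intro trig_poly.intros trig_poly_diff)
  then show ?case by (simp add: sin_times_sin inner_diff_left inner_add_left)
next
  case (add f g)
  then show ?case using trig_poly.add[OF add.IH] by (simp add: distrib_left)
next
  case (scale f c)
  then show ?case using trig_poly.scale[OF scale.IH, of c] by (simp add: mult.left_commute)
qed

lemma trig_poly_mult: "trig_poly f \<Longrightarrow> trig_poly g \<Longrightarrow> trig_poly (\<lambda>x. f x * g x)"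
proof (induction rule: trig_poly.induct)
  case (add f f')
  then show ?case using trig_poly.add by (simp add: distrib_right)
next
  case (scale f c)
  then show ?case using trig_poly.scale[of _ c] by (simp add: mult.assoc)
qed (auto intro: trig_poly_cos_mult trig_poly_sin_mult)

lemma trig_poly_sum: "(\<And>i. i \<in> A \<Longrightarrow> trig_poly (f i)) \<Longrightarrow> trig_poly (\<lambda>x. \<Sum>i\<in>A. f i x)"
  by (induction A rule: infinite_finite_induct) (auto intro: trig_poly_const trig_poly.add)

lemma trig_poly_continuous: "trig_poly f \<Longrightarrow> continuous_on UNIV f"
  by (induction rule: trig_poly.induct) (auto intro!: continuous_intros)

lemma trig_poly_bounded: "trig_poly f \<Longrightarrow> \<exists>K. \<forall>x. \<bar>f x\<bar> \<le> K"
proof (induction rule: trig_poly.induct)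
  case (add f g)
  then obtain K L where "\<bar>f x\<bar> \<le> K" "\<bar>g x\<bar> \<le> L" for x by blast
  then have "\<bar>f x + g x\<bar> \<le> K + L" for x by (meson abs_triangle_ineq add_mono order_trans)
  then show ?case by blast
next
  case (scale f c)
  then obtain K where "\<bar>f x\<bar> \<le> K" for x by blast
  then have "\<bar>c * f x\<bar> \<le> \<bar>c\<bar> * K" for x by (simp add: abs_mult mult_left_mono)
  then show ?case by blast
qed (auto intro!: exI[of _ 1])

text \<open>Linear functions of the argument become combinations of sines, and trigonometric
  polynomials form an algebra.\<close>

lemma trig_poly_polynomial_sin:
  fixes p :: "real ^ 'n \<Rightarrow> real"
  shows "real_polynomial_function p \<Longrightarrow> trig_poly (\<lambda>x. p (\<chi> i. sin (c * x $ i)))"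
proof (induction rule: real_polynomial_function.induct)
  case (linear f)
  interpret f: bounded_linear f by fact
  have eq: "f (\<chi> i. sin (c * x $ i)) = (\<Sum>i\<in>UNIV. f (axis i 1) * sin ((c *\<^sub>R axis i 1) \<bullet> x))" for x :: "real ^ 'n"
  proof -
    have "f (\<chi> i. sin (c * x $ i)) = f (\<Sum>i\<in>UNIV. sin (c * x $ i) *\<^sub>R axis i 1)"
      by (subst basis_expansion[symmetric]) (simp add: scalar_mult_eq_scaleR)
    then show ?thesis by (simp add: f.sum f.scaleR inner_axis' mult.commute)
  qed
  show ?case unfolding eq by (intro trig_poly_sum trig_poly.scale trig_poly.sin)
next
  case (mult f g)
  show ?case by (rule trig_poly_mult[OF mult.IH])
qed (auto intro: trig_poly_const trig_poly.add)

lemma (in prob_space) integrable_bounded_continuous: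
  fixes f :: "'b::topological_space \<Rightarrow> real"
  assumes "continuous_on UNIV f" "\<And>x. \<bar>f x\<bar> \<le> K" "U \<in> borel_measurable M"
  shows "integrable M (\<lambda>\<omega>. f (U \<omega>))"
proof (rule integrable_const_bound[where B = K])
  show "(\<lambda>\<omega>. f (U \<omega>)) \<in> borel_measurable M"
    by (rule measurable_compose[OF assms(3) borel_measurable_continuous_onI[OF assms(1)]])
qed (use assms in simp)

text \<open>Substituting \<open>sin\<close> into a polynomial that approximates \<open>f (L * arcsin u)\<close> on a cube
  yields a trigonometric polynomial that is close to \<open>f\<close> on a large cube and bounded everywhere.\<close>

lemma trig_poly_approx:
  fixes f :: "real ^ 'n \<Rightarrow> real"
  assumes f: "continuous_on UNIV f" and K: "\<And>x. \<bar>f x\<bar> \<le> K" and \<epsilon>: "0 < \<epsilon>" "\<epsilon> \<le> 1" and R: "R > 0"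
  shows "\<exists>q. trig_poly q \<and> (\<forall>x. \<bar>f x - q x\<bar> \<le> \<epsilon> + (2 * K + 1) * (\<Sum>i\<in>UNIV. (x $ i)\<^sup>2) / R\<^sup>2)"
proof -
  \<comment> \<open>Since \<open>1 < pi / 2\<close>, \<open>arcsin\<close> undoes the sine of
    \<open>x $ i / R\<close> whenever \<open>\<bar>x $ i\<bar> \<le> R\<close>; composing
    \<open>g\<close> with these sines recovers \<open>f\<close> on that cube.\<close>
  define g :: "real ^ 'n \<Rightarrow> real" where "g u = f (\<chi> i. R * arcsin (u $ i))" for u
  let ?C = "cbox (\<chi> i. -1) (\<chi> i. 1) :: (real ^ 'n) set"
  have C: "u \<in> ?C \<longleftrightarrow> (\<forall>i. -1 \<le> u $ i \<and> u $ i \<le> 1)" for u by (simp add: mem_box_cart)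
  have "continuous_on ?C (\<lambda>u. \<chi> i. R * arcsin (u $ i))"
    by (intro continuous_on_vec_lambda continuous_on_mult continuous_on_const continuous_on_arcsin
        continuous_on_component) (auto simp: C intro!: continuous_intros)
  then have "continuous_on ?C g"
    unfolding g_def by (rule continuous_on_compose2[OF f]) auto
  then obtain p where p: "real_polynomial_function p" "\<And>u. u \<in> ?C \<Longrightarrow> \<bar>g u - p u\<bar> < \<epsilon>"
    using Stone_Weierstrass_real_polynomial_function[OF compact_cbox _ \<epsilon>(1)] by blast
  define q where "q x = p (\<chi> i. sin ((1 / R) * x $ i))" for x :: "real ^ 'n"
  have q: "trig_poly q" unfolding q_def[abs_def] by (rule trig_poly_polynomial_sin[OF p(1)])
  \<comment> \<open>The vector of sines lies in the unit cube for every \<open>x\<close>, so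
    \<open>q\<close> stays within \<open>\<epsilon>\<close> of a function bounded by
    \<open>K\<close> on the whole space, not only where it approximates \<open>f\<close>.\<close>
  have pq: "\<bar>g (\<chi> i. sin ((1 / R) * x $ i)) - q x\<bar> < \<epsilon>" for x
    unfolding q_def by (rule p(2)) (simp add: C)
  have "\<bar>f x - q x\<bar> \<le> \<epsilon> + (2 * K + 1) * (\<Sum>i\<in>UNIV. (x $ i)\<^sup>2) / R\<^sup>2" for x
  proof (cases "\<forall>i. \<bar>x $ i\<bar> \<le> R")
    case True
    have "R * arcsin (sin ((1 / R) * x $ i)) = x $ i" for i
    proof -
      have "\<bar>(1 / R) * x $ i\<bar> \<le> 1" using True R by (simp add: abs_mult)
      then have "- (pi / 2) \<le> (1 / R) * x $ i" "(1 / R) * x $ i \<le> pi / 2" using pi_gt3 by linarith+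
      then show ?thesis using R by (simp add: arcsin_sin)
    qed
    then have "g (\<chi> i. sin ((1 / R) * x $ i)) = f x" by (simp add: g_def)
    then have "\<bar>f x - q x\<bar> \<le> \<epsilon>" using pq[of x] by simp
    moreover have "0 \<le> (2 * K + 1) * (\<Sum>i\<in>UNIV. (x $ i)\<^sup>2) / R\<^sup>2"
      using K[of x] by (intro divide_nonneg_nonneg mult_nonneg_nonneg sum_nonneg) auto
    ultimately show ?thesis by linarith
  next
    \<comment> \<open>Far out only the crude bound \<open>2 * K + 1\<close> is available. It is paid
      for by the quadratic term, as in Chebyshev's inequality.\<close>
    case False
    then obtain i where i: "\<bar>x $ i\<bar> > R" by (auto simp: not_le)
    have "R\<^sup>2 \<le> (x $ i)\<^sup>2" using power_mono[of R "\<bar>x $ i\<bar>" 2] i R by simp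
    also have "\<dots> \<le> (\<Sum>i\<in>UNIV. (x $ i)\<^sup>2)" by (rule member_le_sum) auto
    finally have "1 \<le> (\<Sum>i\<in>UNIV. (x $ i)\<^sup>2) / R\<^sup>2" using R by (simp add: le_divide_eq)
    moreover have K0: "0 \<le> 2 * K + 1" using K[of x] by linarith
    ultimately have "(2 * K + 1) * 1 \<le> (2 * K + 1) * ((\<Sum>i\<in>UNIV. (x $ i)\<^sup>2) / R\<^sup>2)" by (intro mult_left_mono)
    moreover have "\<bar>g (\<chi> i. sin ((1 / R) * x $ i))\<bar> \<le> K" unfolding g_def by (rule K)
    ultimately show ?thesis using pq[of x] K[of x] \<epsilon> by (simp only: times_divide_eq_right mult_1_right)
  qed
  then show ?thesis using q by blast
qed

lemma (in prob_space) expectation_approx: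
  fixes f q :: "real ^ 'n \<Rightarrow> real"
  assumes f: "continuous_on UNIV f" "\<And>x. \<bar>f x\<bar> \<le> K" and q: "continuous_on UNIV q" "\<And>x. \<bar>q x\<bar> \<le> L"
    and W: "W \<in> borel_measurable M" and int: "integrable M (\<lambda>\<omega>. \<Sum>i\<in>UNIV. (W \<omega> $ i)\<^sup>2)"
    and le: "expectation (\<lambda>\<omega>. \<Sum>i\<in>UNIV. (W \<omega> $ i)\<^sup>2) \<le> C"
    and fq: "\<And>x. \<bar>f x - q x\<bar> \<le> \<epsilon> + c * (\<Sum>i\<in>UNIV. (x $ i)\<^sup>2) / R\<^sup>2" and c: "0 < c"
  shows "\<bar>expectation (\<lambda>\<omega>. f (W \<omega>)) - expectation (\<lambda>\<omega>. q (W \<omega>))\<bar> \<le> \<epsilon> + c * C / R\<^sup>2"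
proof -
  note i = integrable_bounded_continuous[OF f W] integrable_bounded_continuous[OF q W]
  let ?Q = "\<lambda>\<omega>. \<Sum>i\<in>UNIV. (W \<omega> $ i)\<^sup>2"
  have "\<bar>expectation (\<lambda>\<omega>. f (W \<omega>)) - expectation (\<lambda>\<omega>. q (W \<omega>))\<bar> = \<bar>expectation (\<lambda>\<omega>. f (W \<omega>) - q (W \<omega>))\<bar>"
    using i by simp
  also have "\<dots> \<le> expectation (\<lambda>\<omega>. \<bar>f (W \<omega>) - q (W \<omega>)\<bar>)" by (rule integral_abs_bound)
  also have "\<dots> \<le> expectation (\<lambda>\<omega>. \<epsilon> + c * ?Q \<omega> / R\<^sup>2)"
    by (intro integral_mono integrable_abs Bochner_Integration.integrable_diff Bochner_Integration.integrable_add
        integrable_divide_zero integrable_mult_right i int fq) auto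
  also have "\<dots> = \<epsilon> + c * expectation ?Q / R\<^sup>2"
  proof -
    have "integrable M (\<lambda>\<omega>. c * ?Q \<omega> / R\<^sup>2)" using int by (intro integrable_divide_zero integrable_mult_right)
    then have "expectation (\<lambda>\<omega>. \<epsilon> + c * ?Q \<omega> / R\<^sup>2) = \<epsilon> + expectation (\<lambda>\<omega>. c * ?Q \<omega> / R\<^sup>2)"
      by (subst Bochner_Integration.integral_add) (auto simp: prob_space)
    also have "expectation (\<lambda>\<omega>. c * ?Q \<omega> / R\<^sup>2) = c * expectation ?Q / R\<^sup>2"
      by (simp only: integral_divide_zero integral_mult_right_zero)
    finally show ?thesis .
  qed
  also have "\<dots> \<le> \<epsilon> + c * C / R\<^sup>2"
    using le c by (intro add_left_mono divide_right_mono mult_left_mono) auto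
  finally show ?thesis .
qed

text \<open>Characteristic functions give the limits for trigonometric polynomials, and the common
  bound \<open>C\<close> on second moments makes the approximation of a bounded continuous function
  uniform in \<open>n\<close>. The conditions are imposed for large \<open>n\<close> only, because
  the forests are controlled only once \<open>k n\<close> is small against \<open>n\<close>.\<close>

lemma tendsto_in_distribution_char:
  fixes U :: "nat \<Rightarrow> 'w \<Rightarrow> real ^ 'n" and N :: "(real ^ 'n) measure"
  assumes M: "prob_space M" and N: "prob_space N" "sets N = sets borel"
    and U: "\<forall>\<^sub>F n in sequentially. U n \<in> borel_measurable M"
    and char: "\<And>t. (\<lambda>n. \<integral>\<omega>. iexp (t \<bullet> U n \<omega>) \<partial>M) \<longlonglongrightarrow> (\<integral>v. iexp (t \<bullet> v) \<partial>N)"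
    and tight: "\<forall>\<^sub>F n in sequentially. integrable M (\<lambda>\<omega>. \<Sum>i\<in>UNIV. (U n \<omega> $ i)\<^sup>2) \<and> (\<integral>\<omega>. (\<Sum>i\<in>UNIV. (U n \<omega> $ i)\<^sup>2) \<partial>M) \<le> C"
    and tightN: "integrable N (\<lambda>v. \<Sum>i\<in>UNIV. (v $ i)\<^sup>2)" "(\<integral>v. (\<Sum>i\<in>UNIV. (v $ i)\<^sup>2) \<partial>N) \<le> C"
  shows "tendsto_in_distribution M U N"
proof -
  interpret M: prob_space M by fact
  interpret N: prob_space N by fact
  have idN: "(\<lambda>v. v) \<in> borel_measurable N" using N(2) by (simp add: measurable_ident_sets)
  have conv_trig: "(\<lambda>n. M.expectation (\<lambda>\<omega>. q (U n \<omega>))) \<longlonglongrightarrow> N.expectation q" if "trig_poly q" for q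
    using that
  proof (induction rule: trig_poly.induct)
    case (cos s)
    have iM: "\<forall>\<^sub>F n in sequentially. Re (\<integral>\<omega>. iexp (s \<bullet> U n \<omega>) \<partial>M) = M.expectation (\<lambda>\<omega>. cos (s \<bullet> U n \<omega>))"
      using U
    proof eventually_elim
      case (elim n)
      have "integrable M (\<lambda>\<omega>. iexp (s \<bullet> U n \<omega>))" using elim by (intro M.integrable_iexp) auto
      then show ?case by (simp add: Re_exp flip: integral_Re)
    qed
    have "integrable N (\<lambda>v. iexp (s \<bullet> v))" using idN by (intro N.integrable_iexp) auto
    then have "Re (\<integral>v. iexp (s \<bullet> v) \<partial>N) = N.expectation (\<lambda>v. cos (s \<bullet> v))" by (simp add: Re_exp flip: integral_Re)
    then show ?case using Lim_transform_eventually[OF tendsto_Re[OF char[of s]] iM] by simp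
  next
    case (sin s)
    have iM: "\<forall>\<^sub>F n in sequentially. Im (\<integral>\<omega>. iexp (s \<bullet> U n \<omega>) \<partial>M) = M.expectation (\<lambda>\<omega>. sin (s \<bullet> U n \<omega>))"
      using U
    proof eventually_elim
      case (elim n)
      have "integrable M (\<lambda>\<omega>. iexp (s \<bullet> U n \<omega>))" using elim by (intro M.integrable_iexp) auto
      then show ?case by (simp add: Im_exp flip: integral_Im)
    qed
    have "integrable N (\<lambda>v. iexp (s \<bullet> v))" using idN by (intro N.integrable_iexp) auto
    then have "Im (\<integral>v. iexp (s \<bullet> v) \<partial>N) = N.expectation (\<lambda>v. sin (s \<bullet> v))" by (simp add: Im_exp flip: integral_Im)
    then show ?case using Lim_transform_eventually[OF tendsto_Im[OF char[of s]] iM] by simp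
  next
    case (add f g)
    obtain K L where KL: "\<And>x. \<bar>f x\<bar> \<le> K" "\<And>x. \<bar>g x\<bar> \<le> L" using trig_poly_bounded add.hyps by metis
    note c = trig_poly_continuous[OF add.hyps(1)] trig_poly_continuous[OF add.hyps(2)]
    have "\<forall>\<^sub>F n in sequentially. M.expectation (\<lambda>\<omega>. f (U n \<omega>)) + M.expectation (\<lambda>\<omega>. g (U n \<omega>)) = M.expectation (\<lambda>\<omega>. f (U n \<omega>) + g (U n \<omega>))"
      using U
    proof eventually_elim
      case (elim n)
      show ?case
        using M.integrable_bounded_continuous[OF c(1) KL(1) elim] M.integrable_bounded_continuous[OF c(2) KL(2) elim] by simp
    qed
    moreover have "N.expectation (\<lambda>x. f x + g x) = N.expectation f + N.expectation g"
      using N.integrable_bounded_continuous[OF c(1) KL(1) idN] N.integrable_bounded_continuous[OF c(2) KL(2) idN] by simp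
    ultimately show ?case using Lim_transform_eventually[OF tendsto_add[OF add.IH]] by simp
  next
    case (scale f c)
    then show ?case by (simp add: tendsto_mult_left)
  qed
  show ?thesis
    unfolding tendsto_in_distribution_def
  proof (intro allI impI)
    fix f :: "real ^ 'n \<Rightarrow> real"
    assume f: "continuous_on UNIV f" and "bounded (range f)"
    then obtain K where K: "\<And>x. \<bar>f x\<bar> \<le> K" by (auto simp: bounded_iff)
    \<comment> \<open>Raising the bound to at least \<open>1\<close> makes the radius
      \<open>R\<close> below positive.\<close>
    define C' where "C' = max C 1"
    have K0: "2 * K + 1 > 0" and C'0: "C' > 0" using K[of 0] by (auto simp: C'_def)
    have "(\<lambda>n. M.expectation (\<lambda>\<omega>. f (U n \<omega>))) \<longlonglongrightarrow> N.expectation f"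
    proof (rule LIMSEQ_I)
      fix r :: real assume r: "r > 0"
      \<comment> \<open>The radius \<open>R\<close> will make the quadratic error at most
        \<open>\<epsilon>\<close>. Each of the two laws then costs \<open>2 * \<epsilon>\<close>,
        together at most \<open>r / 2\<close>; the other half is left for the trigonometric
        polynomial.\<close>
      define \<epsilon> where "\<epsilon> = min 1 (r / 8)"
      have \<epsilon>: "0 < \<epsilon>" "\<epsilon> \<le> 1" "\<epsilon> \<le> r / 8" using r by (auto simp: \<epsilon>_def)
      define R where "R = sqrt ((2 * K + 1) * C' / \<epsilon>)"
      have R: "R > 0" "R\<^sup>2 = (2 * K + 1) * C' / \<epsilon>" using K0 C'0 \<epsilon> by (simp_all add: R_def)
      obtain q where q: "trig_poly q" "\<And>x. \<bar>f x - q x\<bar> \<le> \<epsilon> + (2 * K + 1) * (\<Sum>i\<in>UNIV. (x $ i)\<^sup>2) / R\<^sup>2"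
        using trig_poly_approx[OF f K \<epsilon>(1,2) R(1)] by blast
      obtain L where L: "\<And>x. \<bar>q x\<bar> \<le> L" using trig_poly_bounded[OF q(1)] by blast
      note cq = trig_poly_continuous[OF q(1)]
      have "(2 * K + 1) * C / R\<^sup>2 \<le> (2 * K + 1) * C' / R\<^sup>2"
        using K0 by (intro divide_right_mono mult_left_mono) (auto simp: C'_def)
      also have "\<dots> = \<epsilon>" using R K0 C'0 \<epsilon> by simp
      finally have RC: "(2 * K + 1) * C / R\<^sup>2 \<le> \<epsilon>" .
      have N': "\<bar>N.expectation f - N.expectation q\<bar> \<le> 2 * \<epsilon>"
        using N.expectation_approx[OF f K cq L idN tightN q(2)] RC K0 by simp
      have "\<forall>\<^sub>F n in sequentially. \<bar>M.expectation (\<lambda>\<omega>. q (U n \<omega>)) - N.expectation q\<bar> < r / 2"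
        using tendstoD[OF conv_trig[OF q(1)], of "r / 2"] r by (simp add: dist_real_def)
      then have "\<forall>\<^sub>F n in sequentially. norm (M.expectation (\<lambda>\<omega>. f (U n \<omega>)) - N.expectation f) < r"
        using U tight
      proof eventually_elim
        case (elim n)
        have "\<bar>M.expectation (\<lambda>\<omega>. f (U n \<omega>)) - M.expectation (\<lambda>\<omega>. q (U n \<omega>))\<bar> \<le> 2 * \<epsilon>"
          using M.expectation_approx[OF f K cq L elim(2) elim(3)[THEN conjunct1] elim(3)[THEN conjunct2] q(2)] RC K0 by simp
        then show ?case using N' elim(1) \<epsilon>(3) r unfolding real_norm_def by linarith
      qed
      then show "\<exists>no. \<forall>n\<ge>no. norm (M.expectation (\<lambda>\<omega>. f (U n \<omega>)) - N.expectation f) < r"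
        by (simp add: eventually_sequentially)
    qed
    moreover have "\<forall>\<^sub>F n in sequentially. M.expectation (\<lambda>\<omega>. f (U n \<omega>)) = (\<integral>v. f v \<partial>distr M borel (U n))"
      using U
    proof eventually_elim
      case (elim n)
      show ?case using elim borel_measurable_continuous_onI[OF f] by (subst integral_distr) auto
    qed
    ultimately show "(\<lambda>n. \<integral>v. f v \<partial>distr M borel (U n)) \<longlonglongrightarrow> (\<integral>v. f v \<partial>N)"
      by (rule Lim_transform_eventually)
  qed
qed

section \<open>The standard normal law on vectors\<close>

lemma lborel_prod_vec:
  fixes g :: "'n::finite \<Rightarrow> real \<Rightarrow> 'b::{real_normed_field,banach,second_countable_topology}"
  assumes g: "\<And>i. integrable lborel (g i)"
  shows "integrable lborel (\<lambda>v :: real ^ 'n. \<Prod>i\<in>UNIV. g i (v $ i))"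
    and "(\<integral>v. (\<Prod>i\<in>UNIV. g i ((v :: real ^ 'n) $ i)) \<partial>lborel) = (\<Prod>i\<in>UNIV. \<integral>x. g i x \<partial>lborel)"
proof -
  let ?B = "Basis :: (real ^ 'n) set"
  let ?P = "Pi\<^sub>M ?B (\<lambda>_. lborel :: real measure)"
  define T where "T f = (\<Sum>b\<in>?B. f b *\<^sub>R b)" for f :: "real ^ 'n \<Rightarrow> real"
  \<comment> \<open>Lebesgue measure on vectors is the image of a product measure indexed by the
    basis, so integrals of products of coordinate functions factorise.\<close>
  have lb: "lborel = distr ?P borel T" unfolding T_def[abs_def] by (rule lborel_eq)
  interpret product_sigma_finite "\<lambda>_ :: real ^ 'n. lborel :: real measure" ..
  have inj: "inj (\<lambda>i :: 'n. axis i (1::real))" by (auto simp: inj_def axis_eq_axis)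
  have B: "?B = range (\<lambda>i :: 'n. axis i (1::real))" by (auto simp: Basis_vec_def)
  define ix where "ix = the_inv (\<lambda>i :: 'n. axis i (1::real))"
  have ix: "ix (axis i 1) = i" for i unfolding ix_def by (rule the_inv_f_f[OF inj])
  have T: "T \<in> measurable ?P borel" unfolding T_def[abs_def] by measurable
  have comp: "T f $ i = f (axis i 1)" for f i
  proof -
    have "T f $ i = (\<Sum>l\<in>UNIV. f (axis l 1) * axis l 1 $ i)"
      unfolding T_def B by (simp add: sum.reindex[OF inj])
    also have "\<dots> = (\<Sum>l\<in>UNIV. if l = i then f (axis l 1) else 0)"
      by (intro sum.cong refl) (auto simp: axis_def)
    finally show ?thesis by simp
  qed
  have prod: "(\<Prod>i\<in>UNIV. g i (T f $ i)) = (\<Prod>b\<in>?B. g (ix b) (f b))" for f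
  proof -
    have "(\<Prod>b\<in>?B. g (ix b) (f b)) = (\<Prod>i\<in>UNIV. g i (f (axis i 1)))"
      unfolding B by (simp add: prod.reindex[OF inj] ix)
    then show ?thesis by (simp only: comp)
  qed
  have gm: "(\<lambda>v :: real ^ 'n. \<Prod>i\<in>UNIV. g i (v $ i)) \<in> borel_measurable borel"
  proof (rule borel_measurable_prod)
    fix i
    have c: "(\<lambda>v :: real ^ 'n. v $ i) \<in> borel_measurable borel"
      by (intro borel_measurable_continuous_onI continuous_intros)
    have "g i \<in> borel_measurable borel" using borel_measurable_integrable[OF g[of i]] by simp
    then show "(\<lambda>v :: real ^ 'n. g i (v $ i)) \<in> borel_measurable borel" by (rule measurable_compose[OF c])
  qed
  have int: "integrable ?P (\<lambda>f. \<Prod>b\<in>?B. g (ix b) (f b))"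
    by (rule product_integrable_prod) (auto simp: g)
  then show "integrable lborel (\<lambda>v :: real ^ 'n. \<Prod>i\<in>UNIV. g i (v $ i))"
    unfolding lb using gm by (subst integrable_distr_eq[OF T]) (auto simp: prod)
  have "(\<integral>v. (\<Prod>i\<in>UNIV. g i ((v :: real ^ 'n) $ i)) \<partial>lborel) = (\<integral>f. (\<Prod>b\<in>?B. g (ix b) (f b)) \<partial>?P)"
    unfolding lb using gm by (subst integral_distr[OF T]) (auto simp: prod)
  also have "\<dots> = (\<Prod>b\<in>?B. \<integral>x. g (ix b) x \<partial>lborel)"
    by (rule product_integral_prod) (auto simp: g)
  also have "\<dots> = (\<Prod>i\<in>UNIV. \<integral>x. g i x \<partial>lborel)"
    unfolding B by (simp add: prod.reindex[OF inj] ix)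
  finally show "(\<integral>v. (\<Prod>i\<in>UNIV. g i ((v :: real ^ 'n) $ i)) \<partial>lborel) = (\<Prod>i\<in>UNIV. \<integral>x. g i x \<partial>lborel)" .
qed

text \<open>The density is a product over the coordinates and is absorbed into the factors. Values
  in a normed field cover both uses: real moments and the complex characteristic function.\<close>

lemma std_normal_vec_integral:
  fixes g :: "'n::finite \<Rightarrow> real \<Rightarrow> 'b::{real_normed_field,banach,second_countable_topology}"
  assumes g: "\<And>i. integrable std_normal_distribution (g i)" and gm: "\<And>i. g i \<in> borel_measurable borel"
  shows "integrable std_normal_vec (\<lambda>v :: real ^ 'n. \<Prod>i\<in>UNIV. g i (v $ i))"
    and "(\<integral>v. (\<Prod>i\<in>UNIV. g i ((v :: real ^ 'n) $ i)) \<partial>std_normal_vec) = (\<Prod>i\<in>UNIV. \<integral>x. g i x \<partial>std_normal_distribution)"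
proof -
  let ?d = "\<lambda>v :: real ^ 'n. \<Prod>i\<in>UNIV. std_normal_density (v $ i)"
  have cm: "(\<lambda>v :: real ^ 'n. v $ i) \<in> borel_measurable borel" for i
    by (intro borel_measurable_continuous_onI continuous_intros)
  have dm: "?d \<in> borel_measurable lborel"
    by (intro borel_measurable_prod) (simp add: measurable_compose[OF cm])
  have vm: "(\<lambda>v :: real ^ 'n. \<Prod>i\<in>UNIV. g i (v $ i)) \<in> borel_measurable lborel"
    by (intro borel_measurable_prod) (simp add: measurable_compose[OF cm gm])
  have i: "integrable lborel (\<lambda>x. std_normal_density x *\<^sub>R g i x)" for i
    using g[of i] gm[of i] by (subst (asm) integrable_density) auto
  have e: "?d v *\<^sub>R (\<Prod>i\<in>UNIV. g i (v $ i)) = (\<Prod>i\<in>UNIV. std_normal_density (v $ i) *\<^sub>R g i (v $ i))" for v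
    by (simp add: scaleR_conv_of_real prod.distrib)
  show "integrable std_normal_vec (\<lambda>v :: real ^ 'n. \<Prod>i\<in>UNIV. g i (v $ i))"
    unfolding std_normal_vec_def using lborel_prod_vec(1)[OF i] vm dm
    by (subst integrable_density) (auto simp: e intro!: prod_nonneg)
  have "(\<integral>v. (\<Prod>i\<in>UNIV. g i ((v :: real ^ 'n) $ i)) \<partial>std_normal_vec) = (\<Prod>i\<in>UNIV. \<integral>x. std_normal_density x *\<^sub>R g i x \<partial>lborel)"
    unfolding std_normal_vec_def using lborel_prod_vec(2)[OF i] vm dm
    by (subst integral_density) (auto simp: e intro!: prod_nonneg)
  also have "\<dots> = (\<Prod>i\<in>UNIV. \<integral>x. g i x \<partial>std_normal_distribution)"
    using gm by (intro prod.cong refl) (subst integral_density, auto)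
  finally show "(\<integral>v. (\<Prod>i\<in>UNIV. g i ((v :: real ^ 'n) $ i)) \<partial>std_normal_vec) = (\<Prod>i\<in>UNIV. \<integral>x. g i x \<partial>std_normal_distribution)" .
qed

lemma sets_std_normal_vec: "sets std_normal_vec = sets borel"
  by (simp add: std_normal_vec_def)

lemma prob_space_std_normal_vec: "prob_space (std_normal_vec :: (real ^ 'n) measure)"
proof -
  interpret S: prob_space std_normal_distribution by (rule prob_space_normal_density) simp
  let ?N = "std_normal_vec :: (real ^ 'n) measure"
  have "integrable std_normal_distribution (\<lambda>x. 1 :: real)" by (rule S.integrable_const)
  note I = std_normal_vec_integral[of "\<lambda>(_ :: 'n) _. 1 :: real", OF this borel_measurable_const]
  have i: "integrable ?N (\<lambda>v. 1 :: real)"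
    using I(1) by (simp only: prod.neutral_const)
  have s1: "S.expectation (\<lambda>x. 1 :: real) = 1"
    by (simp only: lebesgue_integral_const S.prob_space real_scaleR_def mult_1_right)
  have e: "(\<integral>v. (1 :: real) \<partial>?N) = 1"
    using I(2) unfolding s1 prod.neutral_const .
  have fin: "finite_measure ?N"
    using i by (intro finite_measureI) (simp add: integrable_iff_bounded)
  have "emeasure ?N (space ?N) = ennreal (measure ?N (space ?N))"
    by (rule finite_measure.emeasure_eq_measure[OF fin])
  also have "measure ?N (space ?N) = 1"
    using e by (simp only: lebesgue_integral_const real_scaleR_def mult_1_right)
  finally show ?thesis by (intro prob_spaceI) simp
qed

lemma char_std_normal_vec:
  "(\<integral>v. iexp (t \<bullet> v) \<partial>(std_normal_vec :: (real ^ 'n) measure)) = complex_of_real (exp (- (norm t)\<^sup>2 / 2))"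
proof -
  interpret S: prob_space std_normal_distribution by (rule prob_space_normal_density) simp
  have "iexp (t \<bullet> v) = (\<Prod>i\<in>UNIV. iexp (t $ i * v $ i))" for v :: "real ^ 'n"
    by (simp add: inner_vec_def exp_sum[symmetric] sum_distrib_left)
  then have "(\<integral>v. iexp (t \<bullet> v) \<partial>(std_normal_vec :: (real ^ 'n) measure)) = (\<Prod>i\<in>UNIV. \<integral>x. iexp (t $ i * x) \<partial>std_normal_distribution)"
    using std_normal_vec_integral(2)[of "\<lambda>i x. iexp (t $ i * x)"] S.integrable_iexp by simp
  also have "\<dots> = (\<Prod>i\<in>UNIV. complex_of_real (exp (- ((t $ i)\<^sup>2) / 2)))"
    using char_std_normal_distribution by (simp add: char_def fun_eq_iff)
  also have "\<dots> = complex_of_real (exp (\<Sum>i\<in>UNIV. - ((t $ i)\<^sup>2) / 2))"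
    by (simp add: exp_sum)
  also have "(\<Sum>i\<in>UNIV. - ((t $ i)\<^sup>2) / 2) = - (norm t)\<^sup>2 / 2"
    unfolding power2_norm_eq_inner inner_vec_def
    by (simp add: power2_eq_square sum_negf sum_divide_distrib)
  finally show ?thesis .
qed

lemma second_moment_std_normal_vec:
  "integrable (std_normal_vec :: (real ^ 'n) measure) (\<lambda>v. \<Sum>i\<in>UNIV. (v $ i)\<^sup>2)"
proof (rule Bochner_Integration.integrable_sum)
  fix i :: 'n
  interpret S: prob_space std_normal_distribution by (rule prob_space_normal_density) simp
  \<comment> \<open>The square of one coordinate is written as a product over all coordinates whose
    other factors are \<open>1\<close>.\<close>
  define g where "g l x = (if l = i then x\<^sup>2 else 1 :: real)" for l :: 'n and x :: real
  have "(\<Prod>l\<in>UNIV. g l (v $ l)) = (v $ i)\<^sup>2" for v :: "real ^ 'n"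
  proof -
    have "(\<Prod>l\<in>UNIV. g l (v $ l)) = (\<Prod>l\<in>UNIV. if l = i then (v $ l)\<^sup>2 else 1)"
      by (simp add: g_def)
    then show ?thesis by simp
  qed
  moreover have "integrable std_normal_distribution (g l)" "g l \<in> borel_measurable borel" for l
    using integrable_std_normal_distribution_moment[of 2] by (cases "l = i"; simp add: g_def[abs_def])+
  ultimately show "integrable std_normal_vec (\<lambda>v :: real ^ 'n. (v $ i)\<^sup>2)"
    using std_normal_vec_integral(1)[of g] by simp
qed

section \<open>Limit theorems for triangular arrays\<close>

lemma (in prob_space) expectation_abs_le_sqrt:
  fixes X :: "'a \<Rightarrow> real"
  assumes "X \<in> borel_measurable M" "integrable M (\<lambda>x. (X x)\<^sup>2)"
  shows "expectation (\<lambda>x. \<bar>X x\<bar>) \<le> sqrt (expectation (\<lambda>x. (X x)\<^sup>2))"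
  using expectation_square_le[of "\<lambda>x. \<bar>X x\<bar>"] assms by (intro real_le_rsqrt) simp

text \<open>Cauchy-Schwarz, from the nonnegativity of a quadratic polynomial in \<open>s\<close>.
  Upper bounds \<open>a\<close> and \<open>b\<close> stand in place of the exact moments, because
  that is how error estimates are passed on.\<close>

lemma (in prob_space) expectation_mult_le_sqrt:
  fixes X Y :: "'a \<Rightarrow> real"
  assumes X: "X \<in> borel_measurable M" "integrable M (\<lambda>x. (X x)\<^sup>2)" "expectation (\<lambda>x. (X x)\<^sup>2) \<le> a"
    and Y: "Y \<in> borel_measurable M" "integrable M (\<lambda>x. (Y x)\<^sup>2)" "expectation (\<lambda>x. (Y x)\<^sup>2) \<le> b"
  shows "integrable M (\<lambda>x. \<bar>X x * Y x\<bar>)" "expectation (\<lambda>x. \<bar>X x * Y x\<bar>) \<le> sqrt a * sqrt b"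
proof -
  show int: "integrable M (\<lambda>x. \<bar>X x * Y x\<bar>)" using assms by (intro integrable_abs L2_mult_integrable)
  let ?A = "expectation (\<lambda>x. (X x)\<^sup>2)" and ?B = "expectation (\<lambda>x. (Y x)\<^sup>2)" and ?C = "expectation (\<lambda>x. \<bar>X x * Y x\<bar>)"
  have nn: "0 \<le> ?A" "0 \<le> ?B" "0 \<le> ?C" by simp_all
  have q: "2 * ?C * s \<le> ?A * s\<^sup>2 + ?B" for s
  proof -
    have "expectation (\<lambda>x. 2 * s * \<bar>X x * Y x\<bar>) \<le> expectation (\<lambda>x. s\<^sup>2 * (X x)\<^sup>2 + (Y x)\<^sup>2)"
    proof (intro integral_mono)
      fix x
      have "0 \<le> (s * \<bar>X x\<bar> - \<bar>Y x\<bar>)\<^sup>2" by simp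
      then show "2 * s * \<bar>X x * Y x\<bar> \<le> s\<^sup>2 * (X x)\<^sup>2 + (Y x)\<^sup>2"
        by (simp add: power2_diff power_mult_distrib abs_mult algebra_simps)
    qed (use int assms in auto)
    then show ?thesis using assms int by (simp add: algebra_simps)
  qed
  have "?C\<^sup>2 \<le> ?A * ?B"
  proof (cases "?A = 0")
    case True
    have "?C = 0"
    proof (rule ccontr)
      assume "?C \<noteq> 0"
      then have "?C > 0" using nn(3) unfolding less_le by auto
      \<comment> \<open>This value of \<open>s\<close> makes the left side of \<open>q\<close> equal
        to \<open>?B + 1\<close>, while the right side is \<open>?B\<close>.\<close>
      then show False using q[of "(?B + 1) / (2 * ?C)"] True by simp
    qed
    then show ?thesis using True by simp
  next
    case False
    then have A: "?A > 0" using nn(1) unfolding less_le by auto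
    have "2 * ?C * (?C / ?A) \<le> ?A * (?C / ?A)\<^sup>2 + ?B" by (rule q)
    then have "?C\<^sup>2 / ?A \<le> ?B" using A by (simp add: power2_eq_square)
    then show ?thesis using A by (simp add: divide_le_eq mult.commute)
  qed
  then have "?C \<le> sqrt (?A * ?B)" using nn by (intro real_le_rsqrt)
  also have "\<dots> \<le> sqrt a * sqrt b"
    unfolding real_sqrt_mult using X(3) Y(3) nn(1,2) order_trans[OF nn(1) X(3)]
    by (intro mult_mono real_sqrt_le_mono real_sqrt_ge_zero)
  finally show "?C \<le> sqrt a * sqrt b" .
qed

text \<open>A Slutsky lemma for characteristic functions: since \<open>exp (i x) - 1\<close> has
  modulus at most \<open>\<bar>x\<bar>\<close>, they differ by at most the first absolute moment of
  the perturbation, hence by the root of its second moment.\<close>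

lemma (in prob_space) iexp_perturb:
  fixes X R :: "nat \<Rightarrow> 'a \<Rightarrow> real"
  assumes X: "\<forall>\<^sub>F n in sequentially. X n \<in> borel_measurable M"
    and R: "\<forall>\<^sub>F n in sequentially. R n \<in> borel_measurable M \<and> integrable M (\<lambda>\<omega>. (R n \<omega>)\<^sup>2)"
    and R0: "(\<lambda>n. expectation (\<lambda>\<omega>. (R n \<omega>)\<^sup>2)) \<longlonglongrightarrow> 0"
    and lim: "(\<lambda>n. \<integral>\<omega>. iexp (X n \<omega>) \<partial>M) \<longlonglongrightarrow> l"
  shows "(\<lambda>n. \<integral>\<omega>. iexp (X n \<omega> + R n \<omega>) \<partial>M) \<longlonglongrightarrow> l"
proof -
  have "\<forall>\<^sub>F n in sequentially. norm ((\<integral>\<omega>. iexp (X n \<omega> + R n \<omega>) \<partial>M) - (\<integral>\<omega>. iexp (X n \<omega>) \<partial>M))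
      \<le> sqrt (expectation (\<lambda>\<omega>. (R n \<omega>)\<^sup>2))"
    using X R
  proof eventually_elim
    case (elim n)
    have i: "integrable M (\<lambda>\<omega>. iexp (X n \<omega> + R n \<omega>))" "integrable M (\<lambda>\<omega>. iexp (X n \<omega>))"
      using elim by (auto intro!: integrable_iexp)
    have "norm ((\<integral>\<omega>. iexp (X n \<omega> + R n \<omega>) \<partial>M) - (\<integral>\<omega>. iexp (X n \<omega>) \<partial>M))
        = norm (\<integral>\<omega>. iexp (X n \<omega> + R n \<omega>) - iexp (X n \<omega>) \<partial>M)"
      using i by simp
    also have "\<dots> \<le> (\<integral>\<omega>. norm (iexp (X n \<omega> + R n \<omega>) - iexp (X n \<omega>)) \<partial>M)"
      by (rule integral_norm_bound)
    also have "\<dots> \<le> (\<integral>\<omega>. \<bar>R n \<omega>\<bar> \<partial>M)"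
    proof (intro integral_mono)
      show "integrable M (\<lambda>\<omega>. \<bar>R n \<omega>\<bar>)"
        using elim by (intro integrable_abs) (rule square_integrable_imp_integrable, auto)
      fix \<omega>
      have "iexp (X n \<omega> + R n \<omega>) - iexp (X n \<omega>) = iexp (X n \<omega>) * (iexp (R n \<omega>) - 1)"
        by (simp add: algebra_simps exp_add)
      then show "norm (iexp (X n \<omega> + R n \<omega>) - iexp (X n \<omega>)) \<le> \<bar>R n \<omega>\<bar>"
        using iexp_approx1[of "R n \<omega>" 0] by (simp add: norm_mult)
    qed (use i in auto)
    also have "\<dots> \<le> sqrt (expectation (\<lambda>\<omega>. (R n \<omega>)\<^sup>2))"
      using elim by (intro expectation_abs_le_sqrt) auto
    finally show ?case .
  qed
  moreover have "(\<lambda>n. sqrt (expectation (\<lambda>\<omega>. (R n \<omega>)\<^sup>2))) \<longlonglongrightarrow> 0"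
    using tendsto_real_sqrt[OF R0] by simp
  ultimately have "(\<lambda>n. (\<integral>\<omega>. iexp (X n \<omega> + R n \<omega>) \<partial>M) - (\<integral>\<omega>. iexp (X n \<omega>) \<partial>M)) \<longlonglongrightarrow> 0"
    by (rule Lim_null_comparison)
  from tendsto_add[OF this lim] show ?thesis by simp
qed

context iid_sample
begin

text \<open>The characteristic function of the row sum is the \<open>n\<close>-th power of that of
  one summand. Its second-order Taylor error is bounded through the truncated second moment where
  the summand is large, and through \<open>\<delta>\<close> times the variance elsewhere. Comparing
  \<open>n\<close>-th powers of numbers of modulus at most \<open>1\<close> costs a factor
  \<open>n\<close>, which the normalisation of the summands compensates.\<close>

lemma char_row_sum_bound:
  fixes w :: "'e \<Rightarrow> real"
  assumes w: "w \<in> borel_measurable borel" and L2: "integrable M (\<lambda>\<omega>. (w (Z 1 \<omega>))\<^sup>2)"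
    and mean: "expectation (\<lambda>\<omega>. w (Z 1 \<omega>)) = 0" and s: "expectation (\<lambda>\<omega>. (w (Z 1 \<omega>))\<^sup>2) = s"
    and n: "n \<ge> 1" "s / 4 \<le> real n" and \<delta>: "\<delta> > 0"
  shows "norm ((\<integral>\<omega>. iexp ((\<Sum>i=1..n. w (Z i \<omega>)) / sqrt (real n)) \<partial>M) - complex_of_real ((1 + (- s / 2) / real n) ^ n))
    \<le> expectation (\<lambda>\<omega>. (w (Z 1 \<omega>))\<^sup>2 * of_bool (\<bar>w (Z 1 \<omega>)\<bar> > \<delta> * sqrt (real n))) + \<delta> * s / 6"
proof -
  let ?r = "sqrt (real n)"
  have r: "?r > 0" "?r\<^sup>2 = real n" using n by auto
  have s0: "s \<ge> 0" unfolding s[symmetric] by simp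
  define X where "X i \<omega> = w (Z i \<omega>) / ?r" for i \<omega>
  have wm: "(\<lambda>\<omega>. w (Z i \<omega>)) \<in> borel_measurable M" if "i \<ge> 1" for i
    by (rule measurable_compose[OF Z_measurable[OF that] w])
  have Xm: "X i \<in> borel_measurable M" if "i \<ge> 1" for i
    unfolding X_def[abs_def] using wm[OF that] by simp
  have ind: "indep_vars (\<lambda>_. borel) X {1..n}"
    unfolding X_def[abs_def] using w
    by (intro indep_vars_compose2[where Y = "\<lambda>_ z. w z / ?r" and M' = "\<lambda>_. borel"] indep_vars_subset[OF indep_Z]) auto
  define \<phi> where "\<phi> = char (distr M borel (X 1)) 1"
  have "(\<integral>\<omega>. iexp ((\<Sum>i=1..n. w (Z i \<omega>)) / ?r) \<partial>M) = char (distr M borel (\<lambda>\<omega>. \<Sum>i=1..n. X i \<omega>)) 1"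
  proof -
    have "(\<lambda>\<omega>. \<Sum>i=1..n. X i \<omega>) \<in> borel_measurable M" by (intro borel_measurable_sum Xm) auto
    then show ?thesis unfolding char_def by (subst integral_distr) (auto simp: X_def sum_divide_distrib)
  qed
  also have "\<dots> = (\<Prod>i=1..n. char (distr M borel (X i)) 1)" by (rule char_distr_sum[OF ind])
  also have "\<dots> = (\<Prod>i=1..n. \<phi>)"
  proof (intro prod.cong refl)
    fix i assume i: "i \<in> {1..n}"
    have *: "char (distr M borel (X l)) 1 = expectation (\<lambda>\<omega>. iexp (w (Z l \<omega>) / ?r))" if "l \<ge> 1" for l
      unfolding char_def using Xm[OF that] by (subst integral_distr) (auto simp: X_def)
    have "(\<lambda>z. iexp (w z / ?r)) \<in> borel_measurable borel" using w by measurable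
    from identical(1)[OF _ this, of i] show "char (distr M borel (X i)) 1 = \<phi>"
      unfolding \<phi>_def using i * by simp
  qed
  finally have char: "(\<integral>\<omega>. iexp ((\<Sum>i=1..n. w (Z i \<omega>)) / ?r) \<partial>M) = \<phi> ^ n" by simp
  have XL2: "integrable M (\<lambda>\<omega>. (X 1 \<omega>)\<^sup>2)" using L2 by (simp add: X_def power_divide)
  have X1: "integrable M (X 1)" by (rule square_integrable_imp_integrable[OF Xm XL2]) simp
  have X0: "expectation (X 1) = 0" using mean by (simp add: X_def[abs_def])
  have Xs: "expectation (\<lambda>\<omega>. (X 1 \<omega>)\<^sup>2) = s / real n" using s r by (simp add: X_def power_divide)
  have V: "variance (X 1) = s / real n" unfolding X0 diff_0_right by (rule Xs)
  let ?L = "expectation (\<lambda>\<omega>. (w (Z 1 \<omega>))\<^sup>2 * of_bool (\<bar>w (Z 1 \<omega>)\<bar> > \<delta> * ?r))"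
  have Li: "integrable M (\<lambda>\<omega>. (w (Z 1 \<omega>))\<^sup>2 * of_bool (\<bar>w (Z 1 \<omega>)\<bar> > \<delta> * ?r))"
  proof (rule Bochner_Integration.integrable_bound[OF L2])
    show "(\<lambda>\<omega>. (w (Z 1 \<omega>))\<^sup>2 * of_bool (\<bar>w (Z 1 \<omega>)\<bar> > \<delta> * ?r)) \<in> borel_measurable M"
      using wm[of 1] by measurable
  qed (auto intro!: AE_I2)
  have "norm (\<phi> - (1 - 1\<^sup>2 * (s / real n) / 2)) \<le> (1\<^sup>2 / 6) * expectation (\<lambda>x. min (6 * (X 1 x)\<^sup>2) (\<bar>1\<bar> * \<bar>X 1 x\<bar> ^ 3))"
    unfolding \<phi>_def by (rule char_approx3'[OF Xm[OF order_refl] X1 XL2 X0 V refl])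
  also have "expectation (\<lambda>x. min (6 * (X 1 x)\<^sup>2) (\<bar>1\<bar> * \<bar>X 1 x\<bar> ^ 3))
      \<le> expectation (\<lambda>\<omega>. 6 / real n * ((w (Z 1 \<omega>))\<^sup>2 * of_bool (\<bar>w (Z 1 \<omega>)\<bar> > \<delta> * ?r)) + \<delta> * (X 1 \<omega>)\<^sup>2)"
  proof (intro integral_mono)
    show "integrable M (\<lambda>x. min (6 * (X 1 x)\<^sup>2) (\<bar>1\<bar> * \<bar>X 1 x\<bar> ^ 3))"
      by (rule Bochner_Integration.integrable_bound[OF integrable_mult_right[OF XL2, of 6]])
         (use Xm[of 1] in \<open>auto intro!: AE_I2\<close>)
    fix \<omega>
    show "min (6 * (X 1 \<omega>)\<^sup>2) (\<bar>1\<bar> * \<bar>X 1 \<omega>\<bar> ^ 3)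
        \<le> 6 / real n * ((w (Z 1 \<omega>))\<^sup>2 * of_bool (\<bar>w (Z 1 \<omega>)\<bar> > \<delta> * ?r)) + \<delta> * (X 1 \<omega>)\<^sup>2"
    proof (cases "\<bar>w (Z 1 \<omega>)\<bar> > \<delta> * ?r")
      case True
      have "min (6 * (X 1 \<omega>)\<^sup>2) (\<bar>1\<bar> * \<bar>X 1 \<omega>\<bar> ^ 3) \<le> 6 * (X 1 \<omega>)\<^sup>2" by simp
      also have "\<dots> = 6 / real n * (w (Z 1 \<omega>))\<^sup>2" using r by (simp add: X_def power_divide)
      finally show ?thesis using True \<delta> by (simp add: add_increasing2)
    next
      case False
      then have "\<bar>X 1 \<omega>\<bar> \<le> \<delta>" using r by (simp add: X_def divide_le_eq)
      then have "\<bar>X 1 \<omega>\<bar> * (X 1 \<omega>)\<^sup>2 \<le> \<delta> * (X 1 \<omega>)\<^sup>2" by (rule mult_right_mono) simp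
      moreover have "\<bar>X 1 \<omega>\<bar> ^ 3 = \<bar>X 1 \<omega>\<bar> * (X 1 \<omega>)\<^sup>2" by (simp add: power3_eq_cube power2_eq_square abs_mult)
      ultimately show ?thesis using False by (simp add: min.coboundedI2)
    qed
  qed (use Li XL2 in auto)
  also have "\<dots> = 6 / real n * ?L + \<delta> * (s / real n)"
    using Li XL2 Xs by simp
  finally have "norm (\<phi> - (1 - s / real n / 2)) \<le> (?L + \<delta> * s / 6) / real n"
    by (simp add: add_divide_distrib)
  then have a: "norm (\<phi> - complex_of_real (1 + (- s / 2) / real n)) \<le> (?L + \<delta> * s / 6) / real n"
    by (simp add: mult.commute)
  interpret X1: real_distribution "distr M borel (X 1)" by (rule real_distribution_distr[OF Xm]) simp
  \<comment> \<open>The hypothesis \<open>s / 4 \<le> n\<close> enters here: the approximating real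
    number must not fall below \<open>-1\<close>.\<close>
  have b: "norm (complex_of_real (1 + (- s / 2) / real n)) \<le> 1"
  proof -
    have "0 \<le> s / 2 / real n" "s / 2 / real n \<le> 2" using n s0 by (auto simp: field_simps)
    then show ?thesis unfolding norm_of_real by (intro abs_leI) auto
  qed
  have "norm (\<phi> ^ n - complex_of_real (1 + (- s / 2) / real n) ^ n) \<le> real n * norm (\<phi> - complex_of_real (1 + (- s / 2) / real n))"
    using X1.cmod_char_le_1[of 1] b by (intro norm_power_diff) (auto simp: \<phi>_def)
  also have "\<dots> \<le> real n * ((?L + \<delta> * s / 6) / real n)" by (rule mult_left_mono[OF a]) simp
  also have "\<dots> = ?L + \<delta> * s / 6" using n by simp
  finally show ?thesis unfolding char by simp
qed

lemma lindeberg_char: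
  fixes w :: "nat \<Rightarrow> 'e \<Rightarrow> real"
  assumes w: "\<forall>\<^sub>F n in sequentially. w n \<in> borel_measurable borel \<and> integrable M (\<lambda>\<omega>. (w n (Z 1 \<omega>))\<^sup>2)
      \<and> expectation (\<lambda>\<omega>. w n (Z 1 \<omega>)) = 0 \<and> expectation (\<lambda>\<omega>. (w n (Z 1 \<omega>))\<^sup>2) = s"
    and lind: "\<And>\<delta>. \<delta> > 0 \<Longrightarrow> (\<lambda>n. expectation (\<lambda>\<omega>. (w n (Z 1 \<omega>))\<^sup>2 * of_bool (\<bar>w n (Z 1 \<omega>)\<bar> > \<delta> * sqrt (real n)))) \<longlonglongrightarrow> 0"
  shows "(\<lambda>n. \<integral>\<omega>. iexp ((\<Sum>i=1..n. w n (Z i \<omega>)) / sqrt (real n)) \<partial>M) \<longlonglongrightarrow> complex_of_real (exp (- s / 2))"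
proof -
  let ?c = "\<lambda>n. \<integral>\<omega>. iexp ((\<Sum>i=1..n. w n (Z i \<omega>)) / sqrt (real n)) \<partial>M"
  let ?e = "\<lambda>n. complex_of_real ((1 + (- s / 2) / real n) ^ n)"
  obtain n0 where "expectation (\<lambda>\<omega>. (w n0 (Z 1 \<omega>))\<^sup>2) = s" using w by (auto simp: eventually_sequentially)
  then have s0: "s \<ge> 0" by (metis integral_nonneg_AE AE_I2 zero_le_power2)
  have "(\<lambda>n. ?c n - ?e n) \<longlonglongrightarrow> 0"
  proof (rule LIMSEQ_I)
    fix r :: real assume r: "r > 0"
    \<comment> \<open>The added \<open>1\<close> covers \<open>s = 0\<close>; the Taylor term is
      then at most \<open>r / 6\<close>.\<close>
    define \<delta> where "\<delta> = r / (s + 1)"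
    have \<delta>: "\<delta> > 0" "\<delta> * s / 6 < r / 2"
    proof -
      show "\<delta> > 0" using r s0 by (simp add: \<delta>_def)
      have "\<delta> * s \<le> r" using r s0 by (simp add: \<delta>_def field_simps)
      then show "\<delta> * s / 6 < r / 2" using r by simp
    qed
    have "\<forall>\<^sub>F n in sequentially. expectation (\<lambda>\<omega>. (w n (Z 1 \<omega>))\<^sup>2 * of_bool (\<bar>w n (Z 1 \<omega>)\<bar> > \<delta> * sqrt (real n))) < r / 2"
      using order_tendstoD(2)[OF lind[OF \<delta>(1)], of "r / 2"] r by simp
    moreover have "\<forall>\<^sub>F n in sequentially. s / 4 \<le> real n"
      using eventually_ge_at_top[of "nat \<lceil>s / 4\<rceil>"] by eventually_elim linarith
    ultimately have "\<forall>\<^sub>F n in sequentially. norm (?c n - ?e n - 0) < r"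
      using w eventually_ge_at_top[of 1]
    proof eventually_elim
      case (elim n)
      then show ?case using char_row_sum_bound[of "w n" s n \<delta>] \<delta> by simp
    qed
    then show "\<exists>no. \<forall>n\<ge>no. norm (?c n - ?e n - 0) < r" by (simp add: eventually_sequentially)
  qed
  moreover have "?e \<longlonglongrightarrow> complex_of_real (exp (- s / 2))"
    by (rule isCont_tendsto_compose [OF _ tendsto_exp_limit_sequentially]) auto
  ultimately show ?thesis using tendsto_add by fastforce
qed

text \<open>The products need not have a controlled second moment, so both factors are truncated at
  \<open>\<delta> * sqrt n\<close>. The truncated products have second moment at most
  \<open>\<delta>\<^sup>2 * n\<close>, so their average over \<open>n\<close> points has standard
  deviation at most \<open>\<delta>\<close>. The truncation error in mean is at most the sum of the
  two square roots; it is paid twice, for the sample average and for the expectation.\<close>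

lemma mean_product_bound:
  fixes u v :: "'e \<Rightarrow> real"
  assumes u: "u \<in> borel_measurable borel" "integrable M (\<lambda>\<omega>. (u (Z 1 \<omega>))\<^sup>2)" "expectation (\<lambda>\<omega>. (u (Z 1 \<omega>))\<^sup>2) \<le> 1"
    and v: "v \<in> borel_measurable borel" "integrable M (\<lambda>\<omega>. (v (Z 1 \<omega>))\<^sup>2)" "expectation (\<lambda>\<omega>. (v (Z 1 \<omega>))\<^sup>2) \<le> 1"
    and n: "n \<ge> 1" and \<delta>: "\<delta> > 0"
  shows "expectation (\<lambda>\<omega>. \<bar>(\<Sum>i=1..n. u (Z i \<omega>) * v (Z i \<omega>)) / real n - expectation (\<lambda>\<omega>. u (Z 1 \<omega>) * v (Z 1 \<omega>))\<bar>)
    \<le> \<delta> + 2 * (sqrt (expectation (\<lambda>\<omega>. (u (Z 1 \<omega>))\<^sup>2 * of_bool (\<bar>u (Z 1 \<omega>)\<bar> > \<delta> * sqrt (real n))))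
      + sqrt (expectation (\<lambda>\<omega>. (v (Z 1 \<omega>))\<^sup>2 * of_bool (\<bar>v (Z 1 \<omega>)\<bar> > \<delta> * sqrt (real n)))))"
proof -
  let ?r = "sqrt (real n)"
  have r: "?r > 0" "?r\<^sup>2 = real n" using n by auto
  define u' where "u' z = u z * of_bool (\<bar>u z\<bar> \<le> \<delta> * ?r)" for z
  define v' where "v' z = v z * of_bool (\<bar>v z\<bar> \<le> \<delta> * ?r)" for z
  define y where "y z = u' z * v' z" for z
  have um: "u' \<in> borel_measurable borel" and vm: "v' \<in> borel_measurable borel"
    unfolding u'_def[abs_def] v'_def[abs_def] using u(1) v(1) by measurable
  have ym: "y \<in> borel_measurable borel" unfolding y_def[abs_def] using um vm by measurable
  have comp: "(\<lambda>\<omega>. f (Z i \<omega>)) \<in> borel_measurable M" if "f \<in> borel_measurable borel" "i \<ge> 1" for f :: "'e \<Rightarrow> real" and i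
    by (rule measurable_compose[OF Z_measurable[OF that(2)] that(1)])
  let ?Lu = "expectation (\<lambda>\<omega>. (u (Z 1 \<omega>))\<^sup>2 * of_bool (\<bar>u (Z 1 \<omega>)\<bar> > \<delta> * ?r))"
  let ?Lv = "expectation (\<lambda>\<omega>. (v (Z 1 \<omega>))\<^sup>2 * of_bool (\<bar>v (Z 1 \<omega>)\<bar> > \<delta> * ?r))"
  have du: "(u z - u' z)\<^sup>2 = (u z)\<^sup>2 * of_bool (\<bar>u z\<bar> > \<delta> * ?r)" for z by (auto simp: u'_def)
  have dv: "(v z - v' z)\<^sup>2 = (v z)\<^sup>2 * of_bool (\<bar>v z\<bar> > \<delta> * ?r)" for z by (auto simp: v'_def)
  have le2: "integrable M (\<lambda>\<omega>. (f (Z 1 \<omega>))\<^sup>2)" "expectation (\<lambda>\<omega>. (f (Z 1 \<omega>))\<^sup>2) \<le> expectation (\<lambda>\<omega>. (g (Z 1 \<omega>))\<^sup>2)"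
    if "f \<in> borel_measurable borel" "integrable M (\<lambda>\<omega>. (g (Z 1 \<omega>))\<^sup>2)" "\<And>z. (f z)\<^sup>2 \<le> (g z)\<^sup>2" for f g :: "'e \<Rightarrow> real"
  proof -
    show i: "integrable M (\<lambda>\<omega>. (f (Z 1 \<omega>))\<^sup>2)"
      by (rule Bochner_Integration.integrable_bound[OF that(2)]) (use comp[OF that(1), of 1] that(3) in auto)
    show "expectation (\<lambda>\<omega>. (f (Z 1 \<omega>))\<^sup>2) \<le> expectation (\<lambda>\<omega>. (g (Z 1 \<omega>))\<^sup>2)"
      by (intro integral_mono i that(2)) (rule that(3))
  qed
  have u'2: "integrable M (\<lambda>\<omega>. (u' (Z 1 \<omega>))\<^sup>2)" "expectation (\<lambda>\<omega>. (u' (Z 1 \<omega>))\<^sup>2) \<le> 1"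
  proof -
    have le: "(u' z)\<^sup>2 \<le> (u z)\<^sup>2" for z by (simp add: u'_def of_bool_def)
    show "integrable M (\<lambda>\<omega>. (u' (Z 1 \<omega>))\<^sup>2)" by (rule le2(1)[OF um u(2) le])
    show "expectation (\<lambda>\<omega>. (u' (Z 1 \<omega>))\<^sup>2) \<le> 1" by (rule order_trans[OF le2(2)[OF um u(2) le] u(3)])
  qed
  have v'2: "integrable M (\<lambda>\<omega>. (v' (Z 1 \<omega>))\<^sup>2)" "expectation (\<lambda>\<omega>. (v' (Z 1 \<omega>))\<^sup>2) \<le> 1"
  proof -
    have le: "(v' z)\<^sup>2 \<le> (v z)\<^sup>2" for z by (simp add: v'_def of_bool_def)
    show "integrable M (\<lambda>\<omega>. (v' (Z 1 \<omega>))\<^sup>2)" by (rule le2(1)[OF vm v(2) le])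
    show "expectation (\<lambda>\<omega>. (v' (Z 1 \<omega>))\<^sup>2) \<le> 1" by (rule order_trans[OF le2(2)[OF vm v(2) le] v(3)])
  qed
  have udm: "(\<lambda>z. u z - u' z) \<in> borel_measurable borel" and vdm: "(\<lambda>z. v z - v' z) \<in> borel_measurable borel"
    using u(1) v(1) um vm by measurable
  have ud2: "integrable M (\<lambda>\<omega>. (u (Z 1 \<omega>) - u' (Z 1 \<omega>))\<^sup>2)" by (rule le2(1)[OF udm u(2)]) (simp add: du)
  have vd2: "integrable M (\<lambda>\<omega>. (v (Z 1 \<omega>) - v' (Z 1 \<omega>))\<^sup>2)" by (rule le2(1)[OF vdm v(2)]) (simp add: dv)
  have d1: "integrable M (\<lambda>\<omega>. \<bar>u (Z 1 \<omega>) * v (Z 1 \<omega>) - y (Z 1 \<omega>)\<bar>)"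
    "expectation (\<lambda>\<omega>. \<bar>u (Z 1 \<omega>) * v (Z 1 \<omega>) - y (Z 1 \<omega>)\<bar>) \<le> sqrt ?Lu + sqrt ?Lv"
  proof -
    note A = expectation_mult_le_sqrt[OF comp[OF udm] ud2 order_refl comp[OF v(1)] v(2,3)]
    note B = expectation_mult_le_sqrt[OF comp[OF um] u'2 comp[OF vdm] vd2 order_refl]
    \<comment> \<open>Telescoping: one factor is exchanged at a time, and each difference is paired
      with a factor whose second moment is at most \<open>1\<close>.\<close>
    have le: "\<bar>u z * v z - y z\<bar> \<le> \<bar>(u z - u' z) * v z\<bar> + \<bar>u' z * (v z - v' z)\<bar>" for z
    proof -
      have "u z * v z - y z = (u z - u' z) * v z + u' z * (v z - v' z)" by (simp add: y_def algebra_simps)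
      then show ?thesis by (metis abs_triangle_ineq)
    qed
    have S: "integrable M (\<lambda>\<omega>. \<bar>(u (Z 1 \<omega>) - u' (Z 1 \<omega>)) * v (Z 1 \<omega>)\<bar> + \<bar>u' (Z 1 \<omega>) * (v (Z 1 \<omega>) - v' (Z 1 \<omega>))\<bar>)"
      using A(1) B(1) by (intro Bochner_Integration.integrable_add) auto
    show i: "integrable M (\<lambda>\<omega>. \<bar>u (Z 1 \<omega>) * v (Z 1 \<omega>) - y (Z 1 \<omega>)\<bar>)"
    proof (rule Bochner_Integration.integrable_bound[OF S])
      show "(\<lambda>\<omega>. \<bar>u (Z 1 \<omega>) * v (Z 1 \<omega>) - y (Z 1 \<omega>)\<bar>) \<in> borel_measurable M"
        using comp[OF u(1), of 1] comp[OF v(1), of 1] comp[OF ym, of 1] by measurable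
    qed (use le in auto)
    have "expectation (\<lambda>\<omega>. \<bar>u (Z 1 \<omega>) * v (Z 1 \<omega>) - y (Z 1 \<omega>)\<bar>)
        \<le> expectation (\<lambda>\<omega>. \<bar>(u (Z 1 \<omega>) - u' (Z 1 \<omega>)) * v (Z 1 \<omega>)\<bar> + \<bar>u' (Z 1 \<omega>) * (v (Z 1 \<omega>) - v' (Z 1 \<omega>))\<bar>)"
      by (intro integral_mono i S le)
    also have "\<dots> = expectation (\<lambda>\<omega>. \<bar>(u (Z 1 \<omega>) - u' (Z 1 \<omega>)) * v (Z 1 \<omega>)\<bar>) + expectation (\<lambda>\<omega>. \<bar>u' (Z 1 \<omega>) * (v (Z 1 \<omega>) - v' (Z 1 \<omega>))\<bar>)"
      using A(1) B(1) by (intro Bochner_Integration.integral_add) auto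
    also have "\<dots> \<le> sqrt ?Lu + sqrt ?Lv"
      using A(2) B(2) by (simp add: du dv)
    finally show "expectation (\<lambda>\<omega>. \<bar>u (Z 1 \<omega>) * v (Z 1 \<omega>) - y (Z 1 \<omega>)\<bar>) \<le> sqrt ?Lu + sqrt ?Lv" .
  qed
  \<comment> \<open>The truncation bound is used for one factor only, while the other keeps its
    second moment of at most \<open>1\<close>. This gives \<open>\<delta>\<^sup>2 * n\<close> and
    not a multiple of \<open>n\<^sup>2\<close>.\<close>
  have y2: "integrable M (\<lambda>\<omega>. (y (Z 1 \<omega>))\<^sup>2)" "expectation (\<lambda>\<omega>. (y (Z 1 \<omega>))\<^sup>2) \<le> \<delta>\<^sup>2 * real n"
  proof -
    have le: "(y z)\<^sup>2 \<le> (\<delta> * ?r * v' z)\<^sup>2" for z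
    proof -
      have "\<bar>u' z\<bar> \<le> \<delta> * ?r" using \<delta> r by (auto simp: u'_def)
      then have "\<bar>y z\<bar> \<le> \<bar>\<delta> * ?r * v' z\<bar>" using \<delta> r by (simp add: y_def abs_mult mult_right_mono)
      then show ?thesis by (rule abs_le_square_iff[THEN iffD1])
    qed
    have i: "integrable M (\<lambda>\<omega>. (\<delta> * ?r * v' (Z 1 \<omega>))\<^sup>2)" using v'2(1) by (simp add: power_mult_distrib)
    show "integrable M (\<lambda>\<omega>. (y (Z 1 \<omega>))\<^sup>2)" by (rule le2(1)[OF ym i le])
    have "expectation (\<lambda>\<omega>. (y (Z 1 \<omega>))\<^sup>2) \<le> expectation (\<lambda>\<omega>. (\<delta> * ?r * v' (Z 1 \<omega>))\<^sup>2)" by (rule le2(2)[OF ym i le])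
    also have "\<dots> = \<delta>\<^sup>2 * real n * expectation (\<lambda>\<omega>. (v' (Z 1 \<omega>))\<^sup>2)" using r by (simp add: power_mult_distrib)
    also have "\<dots> \<le> \<delta>\<^sup>2 * real n * 1" using v'2(2) by (intro mult_left_mono) auto
    finally show "expectation (\<lambda>\<omega>. (y (Z 1 \<omega>))\<^sup>2) \<le> \<delta>\<^sup>2 * real n" by simp
  qed
  define m where "m = expectation (\<lambda>\<omega>. y (Z 1 \<omega>))"
  have ysq: "(\<lambda>z. (y z)\<^sup>2) \<in> borel_measurable borel" using ym by measurable
  have yi2: "integrable M (\<lambda>\<omega>. (y (Z i \<omega>))\<^sup>2)" and yv: "expectation (\<lambda>\<omega>. (y (Z i \<omega>))\<^sup>2) = expectation (\<lambda>\<omega>. (y (Z 1 \<omega>))\<^sup>2)"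
    and yi: "integrable M (\<lambda>\<omega>. y (Z i \<omega>))" and ye: "expectation (\<lambda>\<omega>. y (Z i \<omega>)) = m" if "i \<ge> 1" for i
  proof -
    show 1: "integrable M (\<lambda>\<omega>. (y (Z i \<omega>))\<^sup>2)" using identical(2)[OF that ysq] y2(1) by simp
    show "expectation (\<lambda>\<omega>. (y (Z i \<omega>))\<^sup>2) = expectation (\<lambda>\<omega>. (y (Z 1 \<omega>))\<^sup>2)" using identical(1)[OF that ysq] by simp
    show "integrable M (\<lambda>\<omega>. y (Z i \<omega>))" by (rule square_integrable_imp_integrable[OF comp[OF ym that] 1])
    show "expectation (\<lambda>\<omega>. y (Z i \<omega>)) = m" unfolding m_def by (rule identical(1)[OF that ym])
  qed
  define Yb where "Yb \<omega> = (\<Sum>i=1..n. y (Z i \<omega>)) / real n - m" for \<omega>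
  have Ybsum: "Yb \<omega> = (\<Sum>i=1..n. (1 / real n) * (y (Z i \<omega>) - m))" for \<omega>
    using n by (simp add: Yb_def sum_subtractf sum_divide_distrib[symmetric] diff_divide_distrib)
  have cm: "(\<lambda>\<omega>. y (Z i \<omega>) - m) \<in> borel_measurable M" "integrable M (\<lambda>\<omega>. (y (Z i \<omega>) - m)\<^sup>2)" if "i \<ge> 1" for i
    using comp[OF ym that] yi2[OF that] by (auto intro!: L2_diff_integrable)
  have Ybm: "Yb \<in> borel_measurable M"
    unfolding Yb_def[abs_def] using comp[OF ym] by (intro borel_measurable_diff borel_measurable_divide borel_measurable_sum) auto
  have Yb2: "integrable M (\<lambda>\<omega>. (Yb \<omega>)\<^sup>2)"
    unfolding Ybsum by (rule L2_sum_integrable) (use cm in auto)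
  have cov: "expectation (\<lambda>\<omega>. (y (Z i \<omega>) - m) * (y (Z l \<omega>) - m)) \<le> (if i = l then \<delta>\<^sup>2 * real n else 0)" if il: "i \<ge> 1" "l \<ge> 1" for i l
  proof (cases "i = l")
    case True
    have "expectation (\<lambda>\<omega>. (y (Z i \<omega>) - m) * (y (Z i \<omega>) - m)) = expectation (\<lambda>\<omega>. (y (Z i \<omega>))\<^sup>2) - m\<^sup>2"
      using variance_eq[OF yi[OF il(1)] yi2[OF il(1)]] ye[OF il(1)] by (simp add: power2_eq_square)
    also have "\<dots> \<le> \<delta>\<^sup>2 * real n" using yv[OF il(1)] y2(2) zero_le_power2[of m] by linarith
    finally show ?thesis using True by simp
  next
    case False
    have iv: "indep_vars (\<lambda>_. borel) (\<lambda>j \<omega>. (\<lambda>z. y z - m) (Z j \<omega>)) {i, l}"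
      by (intro indep_vars_compose2[OF indep_vars_subset[OF indep_Z]]) (use il ym in auto)
    have "expectation (\<lambda>\<omega>. \<Prod>j\<in>{i, l}. (y (Z j \<omega>) - m)) = (\<Prod>j\<in>{i, l}. expectation (\<lambda>\<omega>. y (Z j \<omega>) - m))"
      by (rule indep_vars_lebesgue_integral) (use iv il yi in auto)
    then show ?thesis using False il yi ye by (simp add: prob_space)
  qed
  have "expectation (\<lambda>\<omega>. (Yb \<omega>)\<^sup>2) = expectation (\<lambda>\<omega>. (\<Sum>i=1..n. (1 / real n) * (y (Z i \<omega>) - m)) * (\<Sum>i=1..n. (1 / real n) * (y (Z i \<omega>) - m)))"
    by (simp add: Ybsum power2_eq_square)
  also have "\<dots> = (\<Sum>i=1..n. \<Sum>l=1..n. (1 / real n) * (1 / real n) * expectation (\<lambda>\<omega>. (y (Z i \<omega>) - m) * (y (Z l \<omega>) - m)))"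
    by (rule L2_sum_product) (use cm in auto)
  also have "\<dots> \<le> (\<Sum>i=1..n. \<Sum>l=1..n. (1 / real n) * (1 / real n) * (if i = l then \<delta>\<^sup>2 * real n else 0))"
    by (intro sum_mono mult_left_mono cov) auto
  also have "\<dots> = \<delta>\<^sup>2"
  proof -
    have "(\<Sum>i=1..n. \<Sum>l=1..n. (1 / real n) * (1 / real n) * (if i = l then \<delta>\<^sup>2 * real n else 0))
        = (\<Sum>i=1..n. \<Sum>l=1..n. if i = l then \<delta>\<^sup>2 / real n else 0)"
      using n by (intro sum.cong refl) auto
    then show ?thesis using n by simp
  qed
  finally have "sqrt (expectation (\<lambda>\<omega>. (Yb \<omega>)\<^sup>2)) \<le> sqrt (\<delta>\<^sup>2)" by (rule real_sqrt_le_mono)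
  also have "sqrt (\<delta>\<^sup>2) = \<delta>" using \<delta> by simp
  finally have Yb1: "expectation (\<lambda>\<omega>. \<bar>Yb \<omega>\<bar>) \<le> \<delta>"
    using expectation_abs_le_sqrt[OF Ybm Yb2] by linarith
  let ?\<rho> = "expectation (\<lambda>\<omega>. u (Z 1 \<omega>) * v (Z 1 \<omega>))"
  define d where "d z = \<bar>u z * v z - y z\<bar>" for z
  have dm: "d \<in> borel_measurable borel" unfolding d_def[abs_def] using u(1) v(1) ym by measurable
  have di: "integrable M (\<lambda>\<omega>. d (Z i \<omega>))" and de: "expectation (\<lambda>\<omega>. d (Z i \<omega>)) \<le> sqrt ?Lu + sqrt ?Lv" if "i \<ge> 1" for i
    using identical[OF that dm] d1 by (simp_all add: d_def)
  have \<rho>m: "\<bar>m - ?\<rho>\<bar> \<le> sqrt ?Lu + sqrt ?Lv"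
  proof -
    have uv: "integrable M (\<lambda>\<omega>. u (Z 1 \<omega>) * v (Z 1 \<omega>))"
      using u v by (intro L2_mult_integrable comp) auto
    have "\<bar>m - ?\<rho>\<bar> = \<bar>expectation (\<lambda>\<omega>. u (Z 1 \<omega>) * v (Z 1 \<omega>) - y (Z 1 \<omega>))\<bar>"
      unfolding m_def using uv yi[of 1] by simp
    also have "\<dots> \<le> expectation (\<lambda>\<omega>. \<bar>u (Z 1 \<omega>) * v (Z 1 \<omega>) - y (Z 1 \<omega>)\<bar>)" by (rule integral_abs_bound)
    finally show ?thesis using d1(2) by simp
  qed
  have bound: "\<bar>(\<Sum>i=1..n. u (Z i \<omega>) * v (Z i \<omega>)) / real n - ?\<rho>\<bar> \<le> (\<Sum>i=1..n. (1 / real n) * d (Z i \<omega>)) + \<bar>Yb \<omega>\<bar> + (sqrt ?Lu + sqrt ?Lv)" for \<omega>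
  proof -
    have "(\<Sum>i=1..n. u (Z i \<omega>) * v (Z i \<omega>)) / real n - ?\<rho> = (\<Sum>i=1..n. (1 / real n) * (u (Z i \<omega>) * v (Z i \<omega>) - y (Z i \<omega>))) + Yb \<omega> + (m - ?\<rho>)"
      by (simp add: Yb_def sum_subtractf sum_divide_distrib[symmetric] diff_divide_distrib)
    also have "\<bar>\<dots>\<bar> \<le> \<bar>\<Sum>i=1..n. (1 / real n) * (u (Z i \<omega>) * v (Z i \<omega>) - y (Z i \<omega>))\<bar> + \<bar>Yb \<omega>\<bar> + \<bar>m - ?\<rho>\<bar>" by linarith
    also have "\<bar>\<Sum>i=1..n. (1 / real n) * (u (Z i \<omega>) * v (Z i \<omega>) - y (Z i \<omega>))\<bar> \<le> (\<Sum>i=1..n. (1 / real n) * d (Z i \<omega>))"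
      by (rule order_trans[OF sum_abs]) (simp add: d_def abs_mult)
    finally show ?thesis using \<rho>m by linarith
  qed
  have Si: "integrable M (\<lambda>\<omega>. (\<Sum>i=1..n. (1 / real n) * d (Z i \<omega>)) + \<bar>Yb \<omega>\<bar> + (sqrt ?Lu + sqrt ?Lv))"
    using di square_integrable_imp_integrable[OF Ybm Yb2]
    by (intro Bochner_Integration.integrable_add Bochner_Integration.integrable_sum integrable_mult_right integrable_abs) auto
  have "expectation (\<lambda>\<omega>. \<bar>(\<Sum>i=1..n. u (Z i \<omega>) * v (Z i \<omega>)) / real n - ?\<rho>\<bar>)
      \<le> expectation (\<lambda>\<omega>. (\<Sum>i=1..n. (1 / real n) * d (Z i \<omega>)) + \<bar>Yb \<omega>\<bar> + (sqrt ?Lu + sqrt ?Lv))"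
  proof (rule integral_mono[OF _ Si bound])
    have "integrable M (\<lambda>\<omega>. u (Z i \<omega>) * v (Z i \<omega>))" if "i \<ge> 1" for i
    proof -
      have "(\<lambda>z. u z * v z) \<in> borel_measurable borel" using u(1) v(1) by measurable
      from identical(2)[OF that this] show ?thesis using u v by (simp add: L2_mult_integrable comp)
    qed
    then show "integrable M (\<lambda>\<omega>. \<bar>(\<Sum>i=1..n. u (Z i \<omega>) * v (Z i \<omega>)) / real n - ?\<rho>\<bar>)"
      by (intro integrable_abs Bochner_Integration.integrable_diff integrable_divide_zero Bochner_Integration.integrable_sum) auto
  qed
  also have "\<dots> = (\<Sum>i=1..n. (1 / real n) * expectation (\<lambda>\<omega>. d (Z i \<omega>))) + expectation (\<lambda>\<omega>. \<bar>Yb \<omega>\<bar>) + (sqrt ?Lu + sqrt ?Lv)"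
  proof -
    define A where "A \<omega> = (\<Sum>i=1..n. (1 / real n) * d (Z i \<omega>))" for \<omega>
    define c where "c = sqrt ?Lu + sqrt ?Lv"
    have A: "integrable M A"
      unfolding A_def[abs_def] using di by (intro Bochner_Integration.integrable_sum integrable_mult_right) auto
    have eA: "expectation A = (\<Sum>i=1..n. (1 / real n) * expectation (\<lambda>\<omega>. d (Z i \<omega>)))"
      unfolding A_def using di by (subst Bochner_Integration.integral_sum) auto
    have Y: "integrable M (\<lambda>\<omega>. \<bar>Yb \<omega>\<bar>)" by (intro integrable_abs square_integrable_imp_integrable[OF Ybm Yb2])
    have "expectation (\<lambda>\<omega>. A \<omega> + \<bar>Yb \<omega>\<bar> + c) = expectation A + expectation (\<lambda>\<omega>. \<bar>Yb \<omega>\<bar>) + c"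
      using A Y by (simp add: prob_space)
    then show ?thesis unfolding eA unfolding A_def c_def .
  qed
  also have "\<dots> \<le> (\<Sum>i=1..n. (1 / real n) * (sqrt ?Lu + sqrt ?Lv)) + \<delta> + (sqrt ?Lu + sqrt ?Lv)"
    using Yb1 by (intro add_mono sum_mono mult_left_mono de) auto
  also have "\<dots> = \<delta> + 2 * (sqrt ?Lu + sqrt ?Lv)" using n by simp
  finally show ?thesis .
qed

lemma mean_product_lln:
  fixes u v :: "nat \<Rightarrow> 'e \<Rightarrow> real"
  assumes u: "\<forall>\<^sub>F n in sequentially. u n \<in> borel_measurable borel \<and> integrable M (\<lambda>\<omega>. (u n (Z 1 \<omega>))\<^sup>2) \<and> expectation (\<lambda>\<omega>. (u n (Z 1 \<omega>))\<^sup>2) \<le> 1"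
    and v: "\<forall>\<^sub>F n in sequentially. v n \<in> borel_measurable borel \<and> integrable M (\<lambda>\<omega>. (v n (Z 1 \<omega>))\<^sup>2) \<and> expectation (\<lambda>\<omega>. (v n (Z 1 \<omega>))\<^sup>2) \<le> 1"
    and lu: "\<And>\<delta>. \<delta> > 0 \<Longrightarrow> (\<lambda>n. expectation (\<lambda>\<omega>. (u n (Z 1 \<omega>))\<^sup>2 * of_bool (\<bar>u n (Z 1 \<omega>)\<bar> > \<delta> * sqrt (real n)))) \<longlonglongrightarrow> 0"
    and lv: "\<And>\<delta>. \<delta> > 0 \<Longrightarrow> (\<lambda>n. expectation (\<lambda>\<omega>. (v n (Z 1 \<omega>))\<^sup>2 * of_bool (\<bar>v n (Z 1 \<omega>)\<bar> > \<delta> * sqrt (real n)))) \<longlonglongrightarrow> 0"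
  shows "(\<lambda>n. expectation (\<lambda>\<omega>. \<bar>(\<Sum>i=1..n. u n (Z i \<omega>) * v n (Z i \<omega>)) / real n - expectation (\<lambda>\<omega>. u n (Z 1 \<omega>) * v n (Z 1 \<omega>))\<bar>)) \<longlonglongrightarrow> 0"
proof (rule LIMSEQ_I)
  fix r :: real assume r: "r > 0"
  define \<delta> where "\<delta> = r / 2"
  have \<delta>: "\<delta> > 0" using r by (simp add: \<delta>_def)
  let ?L = "\<lambda>w n. sqrt (expectation (\<lambda>\<omega>. (w n (Z 1 \<omega>))\<^sup>2 * of_bool (\<bar>w n (Z 1 \<omega>)\<bar> > \<delta> * sqrt (real n))))"
  have "(\<lambda>n. \<delta> + 2 * (?L u n + ?L v n)) \<longlonglongrightarrow> \<delta> + 2 * (sqrt 0 + sqrt 0)"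
    by (intro tendsto_intros lu lv \<delta>)
  then have "\<forall>\<^sub>F n in sequentially. \<delta> + 2 * (?L u n + ?L v n) < r"
    by (rule order_tendstoD) (use r in \<open>simp add: \<delta>_def\<close>)
  then have "\<forall>\<^sub>F n in sequentially. norm (expectation (\<lambda>\<omega>. \<bar>(\<Sum>i=1..n. u n (Z i \<omega>) * v n (Z i \<omega>)) / real n - expectation (\<lambda>\<omega>. u n (Z 1 \<omega>) * v n (Z 1 \<omega>))\<bar>) - 0) < r"
    using u v eventually_ge_at_top[of 1]
  proof eventually_elim
    case (elim n)
    have "expectation (\<lambda>\<omega>. \<bar>(\<Sum>i=1..n. u n (Z i \<omega>) * v n (Z i \<omega>)) / real n - expectation (\<lambda>\<omega>. u n (Z 1 \<omega>) * v n (Z 1 \<omega>))\<bar>) \<le> \<delta> + 2 * (?L u n + ?L v n)"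
      using elim \<delta> by (intro mean_product_bound) auto
    then show ?case using elim(1) by simp
  qed
  then show "\<exists>no. \<forall>n\<ge>no. norm (expectation (\<lambda>\<omega>. \<bar>(\<Sum>i=1..n. u n (Z i \<omega>) * v n (Z i \<omega>)) / real n - expectation (\<lambda>\<omega>. u n (Z 1 \<omega>) * v n (Z 1 \<omega>))\<bar>) - 0) < r"
    by (simp add: eventually_sequentially)
qed

end

section \<open>Two-dimensional covariance matrices\<close>

lemma matrix_2_eq_iff:
  fixes A B :: "real ^ 2 ^ 2"
  shows "A = B \<longleftrightarrow> A $ 1 $ 1 = B $ 1 $ 1 \<and> A $ 1 $ 2 = B $ 1 $ 2 \<and> A $ 2 $ 1 = B $ 2 $ 1 \<and> A $ 2 $ 2 = B $ 2 $ 2"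
  by (auto simp: vec_eq_iff forall_2)

lemma matrix_mult_2:
  fixes A B :: "real ^ 2 ^ 2"
  shows "(A ** B) $ i $ j = A $ i $ 1 * B $ 1 $ j + A $ i $ 2 * B $ 2 $ j"
  by (simp add: matrix_matrix_mult_def sum_2)

lemma quadratic_form_2:
  fixes A :: "real ^ 2 ^ 2"
  assumes "A $ 1 $ 2 = A $ 2 $ 1"
  shows "v \<bullet> (A *v v) = A $ 1 $ 1 * (v $ 1)\<^sup>2 + 2 * A $ 1 $ 2 * v $ 1 * v $ 2 + A $ 2 $ 2 * (v $ 2)\<^sup>2"
  using assms by (simp add: inner_vec_def matrix_vector_mult_def sum_2 power2_eq_square algebra_simps)

lemma pos_semidef_2:
  fixes A :: "real ^ 2 ^ 2"
  shows "pos_semidef A \<longleftrightarrow> A $ 1 $ 2 = A $ 2 $ 1 \<and> 0 \<le> A $ 1 $ 1 \<and> 0 \<le> A $ 2 $ 2 \<and> (A $ 1 $ 2)\<^sup>2 \<le> A $ 1 $ 1 * A $ 2 $ 2"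
    (is "?L \<longleftrightarrow> ?R")
proof
  assume L: ?L
  then have "transpose A $ 2 $ 1 = A $ 2 $ 1" by (simp only: pos_semidef_def)
  then have s: "A $ 1 $ 2 = A $ 2 $ 1" by (simp add: transpose_def)
  have q: "0 \<le> A $ 1 $ 1 * x\<^sup>2 + 2 * A $ 1 $ 2 * x * y + A $ 2 $ 2 * y\<^sup>2" for x y
  proof -
    have "0 \<le> vector [x, y] \<bullet> (A *v vector [x, y])" using L unfolding pos_semidef_def by blast
    then show ?thesis unfolding quadratic_form_2[OF s] by simp
  qed
  have a: "0 \<le> A $ 1 $ 1" and c: "0 \<le> A $ 2 $ 2" using q[of 1 0] q[of 0 1] by simp_all
  have "(A $ 1 $ 2)\<^sup>2 \<le> A $ 1 $ 1 * A $ 2 $ 2"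
  proof (cases "A $ 1 $ 1 = 0")
    case True
    have "A $ 1 $ 2 = 0"
    proof (rule ccontr)
      assume b: "A $ 1 $ 2 \<noteq> 0"
      \<comment> \<open>With this first coordinate and second coordinate \<open>1\<close> the form
        takes the value \<open>-1\<close>.\<close>
      show False using q[of "- (A $ 2 $ 2 + 1) / (2 * A $ 1 $ 2)" 1] True b by simp
    qed
    then show ?thesis using True by simp
  next
    case False
    then have a': "A $ 1 $ 1 > 0" using a by simp
    \<comment> \<open>The test vector with coordinates \<open>- A $ 1 $ 2\<close> and
      \<open>A $ 1 $ 1\<close> gives \<open>A $ 1 $ 1\<close> times the determinant.\<close>
    have "0 \<le> A $ 1 $ 1 * (A $ 1 $ 1 * A $ 2 $ 2 - (A $ 1 $ 2)\<^sup>2)"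
      using q[of "- A $ 1 $ 2" "A $ 1 $ 1"] by (simp add: power2_eq_square algebra_simps)
    then show ?thesis using a' by (simp add: zero_le_mult_iff)
  qed
  then show ?R using s a c by simp
next
  assume R: ?R
  then have R4: "(A $ 1 $ 2)\<^sup>2 \<le> A $ 1 $ 1 * A $ 2 $ 2" by blast
  have "0 \<le> A $ 1 $ 1 * x\<^sup>2 + 2 * A $ 1 $ 2 * x * y + A $ 2 $ 2 * y\<^sup>2" for x y
  proof (cases "A $ 1 $ 1 = 0")
    case True
    then have "A $ 1 $ 2 = 0" using R by simp
    then show ?thesis using True R by simp
  next
    case False
    then have a: "A $ 1 $ 1 > 0" using R by auto
    have "0 \<le> (A $ 1 $ 1 * x + A $ 1 $ 2 * y)\<^sup>2 + (A $ 1 $ 1 * A $ 2 $ 2 - (A $ 1 $ 2)\<^sup>2) * y\<^sup>2"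
      using R4 by (intro add_nonneg_nonneg mult_nonneg_nonneg) simp_all
    also have "\<dots> = A $ 1 $ 1 * (A $ 1 $ 1 * x\<^sup>2 + 2 * A $ 1 $ 2 * x * y + A $ 2 $ 2 * y\<^sup>2)"
      by (simp add: power2_eq_square algebra_simps)
    finally show ?thesis using a by (simp add: zero_le_mult_iff)
  qed
  moreover have "transpose A = A" using R by (simp add: matrix_2_eq_iff transpose_def)
  ultimately show ?L using R by (simp add: pos_semidef_def quadratic_form_2)
qed

text \<open>By Cayley--Hamilton, a positive semidefinite square root \<open>R\<close> of \<open>A\<close> satisfies
  \<open>tr R * R = A + det R * I\<close> with \<open>det R = sqrt (det A)\<close> and
  \<open>(tr R)\<^sup>2 = tr A + 2 * det R\<close>, which determines it.\<close>

lemma mat_sqrt_2: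
  fixes A :: "real ^ 2 ^ 2"
  assumes A: "pos_semidef A" and det: "0 < A $ 1 $ 1 * A $ 2 $ 2 - (A $ 1 $ 2)\<^sup>2"
  shows "pos_semidef (mat_sqrt A) \<and> mat_sqrt A ** mat_sqrt A = A"
proof -
  define a b c where "a = A $ 1 $ 1" and "b = A $ 1 $ 2" and "c = A $ 2 $ 2"
  have A': "A $ 2 $ 1 = b" "0 \<le> a" "0 \<le> c" "b\<^sup>2 < a * c"
    using A det by (auto simp: pos_semidef_2 a_def b_def c_def)
  define d where "d = sqrt (a * c - b\<^sup>2)"
  have d: "0 < d" "d\<^sup>2 = a * c - b\<^sup>2" using A' by (simp_all add: d_def)
  define \<tau> where "\<tau> = sqrt (a + c + 2 * d)"
  have \<tau>: "0 < \<tau>" "\<tau>\<^sup>2 = a + c + 2 * d" using A' d by (simp_all add: \<tau>_def)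
  define R :: "real ^ 2 ^ 2" where "R = vector [vector [(a + d) / \<tau>, b / \<tau>], vector [b / \<tau>, (c + d) / \<tau>]]"
  have Rc: "R $ 1 $ 1 = (a + d) / \<tau>" "R $ 1 $ 2 = b / \<tau>" "R $ 2 $ 1 = b / \<tau>" "R $ 2 $ 2 = (c + d) / \<tau>"
    by (simp_all add: R_def)
  have R1: "pos_semidef R"
  proof -
    have "b\<^sup>2 \<le> (a + d) * (c + d)" using A' d by (simp add: algebra_simps add_increasing2)
    then have "b\<^sup>2 / \<tau>\<^sup>2 \<le> (a + d) * (c + d) / \<tau>\<^sup>2" by (rule divide_right_mono) simp
    then show ?thesis using A' d \<tau> by (simp add: pos_semidef_2 Rc power_divide power2_eq_square)
  qed
  have R2: "R ** R = A"
  proof -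
    have "(a + d) * (a + d) + b * b = a * \<tau>\<^sup>2" "(a + d) * b + b * (c + d) = b * \<tau>\<^sup>2"
      "b * (a + d) + (c + d) * b = b * \<tau>\<^sup>2" "b * b + (c + d) * (c + d) = c * \<tau>\<^sup>2"
      unfolding \<tau>(2) using d(2) by (simp_all add: power2_eq_square algebra_simps)
    then show ?thesis
      using \<tau>(1) A' unfolding matrix_2_eq_iff matrix_mult_2 Rc a_def[symmetric] b_def[symmetric] c_def[symmetric]
      by (simp add: add_divide_distrib[symmetric] power2_eq_square)
  qed
  \<comment> \<open>\<open>mat_sqrt\<close> is a definite description, so uniqueness is part of the
    claim. Semidefiniteness of \<open>S\<close> enters by fixing the signs of its determinant and
    its trace, which are known up to squares.\<close>
  have uniq: "S = R" if S: "pos_semidef S" "S ** S = A" for S :: "real ^ 2 ^ 2"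
  proof -
    define x y z where "x = S $ 1 $ 1" and "y = S $ 1 $ 2" and "z = S $ 2 $ 2"
    have S': "S $ 2 $ 1 = y" "0 \<le> x" "0 \<le> z" "y\<^sup>2 \<le> x * z"
      using S(1) by (auto simp: pos_semidef_2 x_def y_def z_def)
    have e: "x\<^sup>2 + y\<^sup>2 = a" "x * y + y * z = b" "y\<^sup>2 + z\<^sup>2 = c"
      using S(2) S'(1) unfolding matrix_2_eq_iff matrix_mult_2
      by (simp_all add: x_def y_def z_def a_def b_def c_def power2_eq_square)
    have "(x * z - y\<^sup>2)\<^sup>2 = d\<^sup>2" unfolding d(2) e[symmetric] by (simp add: power2_eq_square algebra_simps)
    then have xd: "x * z - y\<^sup>2 = d" using S' d(1) by (simp add: power2_eq_iff_nonneg)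
    have "(x + z)\<^sup>2 = \<tau>\<^sup>2" unfolding \<tau>(2) xd[symmetric] e[symmetric] by (simp add: power2_eq_square algebra_simps)
    then have xt: "x + z = \<tau>" using S' \<tau>(1) by (simp add: power2_eq_iff_nonneg)
    have "x * \<tau> = a + d" "y * \<tau> = b" "z * \<tau> = c + d"
      unfolding xt[symmetric] xd[symmetric] e[symmetric] by (simp_all add: power2_eq_square algebra_simps)
    then show ?thesis
      using \<tau>(1) S'(1) unfolding matrix_2_eq_iff Rc x_def[symmetric] y_def[symmetric] z_def[symmetric]
      by (simp add: field_simps)
  qed
  have "mat_sqrt A = R"
    unfolding mat_sqrt_def using R1 R2 uniq by (intro the_equality conjI) blast+
  then show ?thesis using R1 R2 by (simp only:)
qed

lemma matrix_inv_inverse: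
  fixes A :: "real ^ 'n ^ 'n"
  assumes "invertible A"
  shows "A ** matrix_inv A = mat 1" "matrix_inv A ** A = mat 1"
proof -
  have "A ** matrix_inv A = mat 1 \<and> matrix_inv A ** A = mat 1"
    using assms unfolding matrix_inv_def invertible_def by (rule someI_ex)
  then show "A ** matrix_inv A = mat 1" "matrix_inv A ** A = mat 1" by auto
qed

lemma matrix_inv_eqI:
  fixes A :: "real ^ 'n ^ 'n"
  assumes "A ** J = mat 1" "J ** A = mat 1"
  shows "matrix_inv A = J"
proof -
  have "invertible A" using assms by (auto simp: invertible_def)
  then have "J ** (A ** matrix_inv A) = J" by (simp add: matrix_inv_inverse)
  then show ?thesis using assms by (simp add: matrix_mul_assoc)
qed

text \<open>The witness is the inverse root applied to \<open>t\<close>. It carries a linear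
  functional of the standardised vector back to the original vector, and the variance of that
  functional under \<open>A\<close> is the squared norm of \<open>t\<close>. Both follow from the
  symmetry of the root, without its explicit form.\<close>

lemma inverse_mat_sqrt_2:
  fixes A :: "real ^ 2 ^ 2" and t :: "real ^ 2"
  assumes A: "pos_semidef A" and det: "0 < A $ 1 $ 1 * A $ 2 $ 2 - (A $ 1 $ 2)\<^sup>2"
  obtains a where "a \<bullet> (A *v a) = (norm t)\<^sup>2" "\<And>v. t \<bullet> (matrix_inv (mat_sqrt A) *v v) = a \<bullet> v"
proof -
  let ?R = "mat_sqrt A"
  have R: "pos_semidef ?R" "?R ** ?R = A" using mat_sqrt_2[OF A det] by auto
  have sym: "transpose ?R = ?R" using R(1) by (simp add: pos_semidef_def)
  have "det (?R ** ?R) = det ?R * det ?R" by (rule det_mul)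
  then have "det A = det ?R * det ?R" unfolding R(2) .
  moreover have "A $ 2 $ 1 = A $ 1 $ 2" using A by (simp add: pos_semidef_2)
  then have "det A > 0" using det by (simp add: det_2 power2_eq_square)
  ultimately have "det ?R \<noteq> 0" by auto
  then have inv: "invertible ?R" by (simp add: invertible_det_nz)
  have RG: "?R ** matrix_inv ?R = mat 1" by (rule matrix_inv_inverse(1)[OF inv])
  have dot: "(?R *v x) \<bullet> y = x \<bullet> (?R *v y)" for x y :: "real ^ 2"
    using dot_lmul_matrix[of x ?R y] by (simp add: transpose_matrix_vector[symmetric] sym)
  define a where "a = matrix_inv ?R *v t"
  have Ra: "?R *v a = t" by (simp add: a_def matrix_vector_mul_assoc RG)
  show ?thesis
  proof
    have "a \<bullet> (A *v a) = a \<bullet> (?R *v (?R *v a))" by (simp add: matrix_vector_mul_assoc R(2))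
    also have "\<dots> = t \<bullet> t" by (simp only: dot[symmetric] Ra)
    finally show "a \<bullet> (A *v a) = (norm t)\<^sup>2" by (simp add: power2_norm_eq_inner)
    fix v
    have "t \<bullet> (matrix_inv ?R *v v) = (?R *v a) \<bullet> (matrix_inv ?R *v v)" by (simp add: Ra)
    also have "\<dots> = a \<bullet> v" by (simp add: dot matrix_vector_mul_assoc RG)
    finally show "t \<bullet> (matrix_inv ?R *v v) = a \<bullet> v" .
  qed
qed

definition cov_mat :: "real \<Rightarrow> real \<Rightarrow> real \<Rightarrow> real ^ 2 ^ 2" where
  "cov_mat \<sigma>\<^sub>0 \<sigma>\<^sub>1 \<rho> = vector [vector [\<sigma>\<^sub>0\<^sup>2, \<rho> * \<sigma>\<^sub>0 * \<sigma>\<^sub>1], vector [\<rho> * \<sigma>\<^sub>0 * \<sigma>\<^sub>1, \<sigma>\<^sub>1\<^sup>2]]"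

lemma cov_mat_nth [simp]:
  "cov_mat s t \<rho> $ 1 $ 1 = s\<^sup>2" "cov_mat s t \<rho> $ 1 $ 2 = \<rho> * s * t"
  "cov_mat s t \<rho> $ 2 $ 1 = \<rho> * s * t" "cov_mat s t \<rho> $ 2 $ 2 = t\<^sup>2"
  by (simp_all add: cov_mat_def)

lemma cov_mat_det:
  assumes "0 < s" "0 < t" "\<bar>\<rho>\<bar> < 1"
  shows "0 < cov_mat s t \<rho> $ 1 $ 1 * cov_mat s t \<rho> $ 2 $ 2 - (cov_mat s t \<rho> $ 1 $ 2)\<^sup>2"
proof -
  have "\<rho>\<^sup>2 < 1" using assms(3) by (simp add: abs_square_less_1)
  then have "0 < s\<^sup>2 * t\<^sup>2 * (1 - \<rho>\<^sup>2)" using assms by simp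
  then show ?thesis by (simp add: power_mult_distrib algebra_simps)
qed

lemma cov_mat_pos_semidef:
  assumes "0 < s" "0 < t" "\<bar>\<rho>\<bar> < 1"
  shows "pos_semidef (cov_mat s t \<rho>)"
  using cov_mat_det[OF assms] by (simp add: pos_semidef_2)

lemma cov_mat_invertible:
  assumes "0 < s" "0 < t" "\<bar>\<rho>\<bar> < 1"
  shows "invertible (cov_mat s t \<rho>)"
proof -
  have "det (cov_mat s t \<rho>) = cov_mat s t \<rho> $ 1 $ 1 * cov_mat s t \<rho> $ 2 $ 2 - (cov_mat s t \<rho> $ 1 $ 2)\<^sup>2"
    by (simp add: det_2 power2_eq_square)
  then have "det (cov_mat s t \<rho>) \<noteq> 0" using cov_mat_det[OF assms] by linarith
  then show ?thesis by (simp add: invertible_det_nz)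
qed

lemma cov_mat_quadratic:
  "a \<bullet> (cov_mat s t \<rho> *v a) = (a $ 1 * s)\<^sup>2 + 2 * \<rho> * (a $ 1 * s) * (a $ 2 * t) + (a $ 2 * t)\<^sup>2"
  by (simp add: quadratic_form_2 power_mult_distrib power2_eq_square)

text \<open>\<open>1 - r\<close> bounds the smallest eigenvalue of the correlation matrix from
  below. This keeps the Cramer-Wold coefficients bounded although they depend on the sample
  size.\<close>

lemma correlation_form_bound:
  fixes x y \<rho> r :: real
  assumes "\<bar>\<rho>\<bar> \<le> r"
  shows "(1 - r) * (x\<^sup>2 + y\<^sup>2) \<le> x\<^sup>2 + 2 * \<rho> * x * y + y\<^sup>2"
proof -
  have "2 * (\<bar>x\<bar> * \<bar>y\<bar>) \<le> x\<^sup>2 + y\<^sup>2" using sum_squares_bound[of "\<bar>x\<bar>" "\<bar>y\<bar>"] by simp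
  then have "r * (2 * (\<bar>x\<bar> * \<bar>y\<bar>)) \<le> r * (x\<^sup>2 + y\<^sup>2)" using assms by (intro mult_left_mono) auto
  moreover have "\<bar>2 * \<rho> * x * y\<bar> \<le> r * (2 * (\<bar>x\<bar> * \<bar>y\<bar>))"
    using mult_right_mono[OF assms, of "2 * (\<bar>x\<bar> * \<bar>y\<bar>)"] by (simp add: abs_mult mult_ac)
  ultimately show ?thesis by (simp add: left_diff_distrib)
qed

lemma norm_matrix_2_le:
  fixes A :: "real ^ 2 ^ 2"
  shows "norm A \<le> \<bar>A $ 1 $ 1\<bar> + \<bar>A $ 1 $ 2\<bar> + \<bar>A $ 2 $ 1\<bar> + \<bar>A $ 2 $ 2\<bar>"
proof -
  have "norm A \<le> (\<Sum>i\<in>UNIV. norm (A $ i))"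
    unfolding norm_vec_def by (rule L2_set_le_sum) simp
  also have "\<dots> \<le> (\<Sum>i\<in>UNIV. \<Sum>j\<in>UNIV. \<bar>A $ i $ j\<bar>)"
    by (intro sum_mono norm_le_l1_cart)
  finally show ?thesis by (simp add: sum_2)
qed

text \<open>In units of \<open>s\<close> and \<open>t\<close> the error of the matrix quotient is controlled by the errors of the
  entries; rescaling costs the ratio of the two scales.\<close>

lemma dist_cov_mat_quotient:
  fixes S :: "real ^ 2 ^ 2"
  assumes st: "0 < s" "0 < t" and \<rho>: "\<bar>\<rho>\<bar> \<le> r" "r < 1" and K: "1 \<le> K" "s / t \<le> K" "t / s \<le> K"
  shows "dist (matrix_inv (cov_mat s t \<rho>) ** S) (mat 1)
    \<le> 2 * K / (1 - r\<^sup>2) * (\<bar>S $ 1 $ 1 / s\<^sup>2 - 1\<bar> + \<bar>S $ 1 $ 2 / (s * t) - \<rho>\<bar> + \<bar>S $ 2 $ 1 / (s * t) - \<rho>\<bar> + \<bar>S $ 2 $ 2 / t\<^sup>2 - 1\<bar>)"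
proof -
  let ?A = "cov_mat s t \<rho>"
  define q where "q = 1 / (1 - \<rho>\<^sup>2)"
  have r0: "0 \<le> r" using \<rho> by linarith
  have "\<rho>\<^sup>2 \<le> r\<^sup>2" using power_mono[OF \<rho>(1), of 2] by simp
  moreover have r1: "r\<^sup>2 < 1" using \<rho>(2) r0 by (simp add: abs_square_less_1)
  ultimately have q: "0 < q" "q \<le> 1 / (1 - r\<^sup>2)" and \<rho>1: "1 - \<rho>\<^sup>2 \<noteq> 0" by (auto simp: q_def intro!: divide_left_mono)
  have \<rho>': "\<bar>\<rho>\<bar> < 1" using \<rho> by linarith
  \<comment> \<open>The explicit inverse; \<open>q\<close> is the reciprocal of the determinant of
    the correlation matrix.\<close>
  define J :: "real ^ 2 ^ 2" where "J = vector [vector [q / s\<^sup>2, - \<rho> * q / (s * t)], vector [- \<rho> * q / (s * t), q / t\<^sup>2]]"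
  have qq: "q - \<rho>\<^sup>2 * q = 1" using \<rho>1 by (simp add: q_def diff_divide_distrib[symmetric])
  have Jc: "J $ 1 $ 1 = q / s\<^sup>2" "J $ 1 $ 2 = - \<rho> * q / (s * t)" "J $ 2 $ 1 = - \<rho> * q / (s * t)" "J $ 2 $ 2 = q / t\<^sup>2"
    by (simp_all add: J_def)
  have id: "(mat 1 :: real ^ 2 ^ 2) $ 1 $ 1 = 1" "(mat 1 :: real ^ 2 ^ 2) $ 1 $ 2 = 0"
    "(mat 1 :: real ^ 2 ^ 2) $ 2 $ 1 = 0" "(mat 1 :: real ^ 2 ^ 2) $ 2 $ 2 = 1"
    by (simp_all add: mat_def)
  have "?A ** J = mat 1"
    using st qq unfolding matrix_2_eq_iff matrix_mult_2 Jc id by (simp add: power2_eq_square mult_ac)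
  moreover have "J ** ?A = mat 1"
    using st qq unfolding matrix_2_eq_iff matrix_mult_2 Jc id by (simp add: power2_eq_square mult_ac)
  ultimately have J: "matrix_inv ?A = J" by (rule matrix_inv_eqI)
  define e11 e12 e21 e22 where "e11 = S $ 1 $ 1 / s\<^sup>2 - 1" and "e12 = S $ 1 $ 2 / (s * t) - \<rho>"
    and "e21 = S $ 2 $ 1 / (s * t) - \<rho>" and "e22 = S $ 2 $ 2 / t\<^sup>2 - 1"
  have Sc: "S $ 1 $ 1 = s\<^sup>2 * (e11 + 1)" "S $ 1 $ 2 = s * t * (e12 + \<rho>)" "S $ 2 $ 1 = s * t * (e21 + \<rho>)" "S $ 2 $ 2 = t\<^sup>2 * (e22 + 1)"
    using st by (simp_all add: e11_def e12_def e21_def e22_def)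
  let ?D = "J ** S - mat 1"
  have D11: "?D $ 1 $ 1 = q * (e11 - \<rho> * e21)"
  proof -
    have "(J ** S) $ 1 $ 1 = q * (e11 + 1) - \<rho> * q * (e21 + \<rho>)"
      unfolding matrix_mult_2 Jc Sc using st by simp
    then show ?thesis using qq by (simp add: id algebra_simps power2_eq_square)
  qed
  have D12: "?D $ 1 $ 2 = t / s * (q * (e12 - \<rho> * e22))"
  proof -
    have "(J ** S) $ 1 $ 2 = t / s * (q * (e12 + \<rho>) - \<rho> * q * (e22 + 1))"
      unfolding matrix_mult_2 Jc Sc using st by (simp add: power2_eq_square field_simps)
    then show ?thesis by (simp add: id algebra_simps)
  qed
  have D21: "?D $ 2 $ 1 = s / t * (q * (e21 - \<rho> * e11))"
  proof -
    have "(J ** S) $ 2 $ 1 = s / t * (q * (e21 + \<rho>) - \<rho> * q * (e11 + 1))"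
      unfolding matrix_mult_2 Jc Sc using st by (simp add: power2_eq_square field_simps)
    then show ?thesis by (simp add: id algebra_simps)
  qed
  have D22: "?D $ 2 $ 2 = q * (e22 - \<rho> * e12)"
  proof -
    have "(J ** S) $ 2 $ 2 = q * (e22 + 1) - \<rho> * q * (e12 + \<rho>)"
      unfolding matrix_mult_2 Jc Sc using st by simp
    then show ?thesis using qq by (simp add: id algebra_simps power2_eq_square)
  qed
  \<comment> \<open>Here \<open>u\<close> is \<open>1\<close> for the diagonal entries and a ratio
    of the two scales for the off-diagonal ones.\<close>
  have b: "\<bar>u * (q * (x - \<rho> * y))\<bar> \<le> K / (1 - r\<^sup>2) * (\<bar>x\<bar> + \<bar>y\<bar>)" if "0 \<le> u" "u \<le> K" for u x y
  proof -
    have "\<bar>\<rho> * y\<bar> \<le> 1 * \<bar>y\<bar>" unfolding abs_mult using \<rho>' by (intro mult_right_mono) auto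
    then have "\<bar>x - \<rho> * y\<bar> \<le> \<bar>x\<bar> + \<bar>y\<bar>" by linarith
    then have "u * (q * \<bar>x - \<rho> * y\<bar>) \<le> K * (1 / (1 - r\<^sup>2) * (\<bar>x\<bar> + \<bar>y\<bar>))"
      using that q K r1 by (intro mult_mono mult_nonneg_nonneg) auto
    moreover have "\<bar>u * (q * (x - \<rho> * y))\<bar> = u * (q * \<bar>x - \<rho> * y\<bar>)"
      using that q by (simp only: abs_mult abs_of_nonneg abs_of_pos)
    moreover have "K * (1 / (1 - r\<^sup>2) * (\<bar>x\<bar> + \<bar>y\<bar>)) = K / (1 - r\<^sup>2) * (\<bar>x\<bar> + \<bar>y\<bar>)" by simp
    ultimately show ?thesis by linarith
  qed
  define c where "c = K / (1 - r\<^sup>2)"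
  have "dist (matrix_inv ?A ** S) (mat 1) \<le> \<bar>?D $ 1 $ 1\<bar> + \<bar>?D $ 1 $ 2\<bar> + \<bar>?D $ 2 $ 1\<bar> + \<bar>?D $ 2 $ 2\<bar>"
    unfolding dist_norm J by (rule norm_matrix_2_le)
  also have "\<dots> \<le> c * (\<bar>e11\<bar> + \<bar>e21\<bar>) + c * (\<bar>e12\<bar> + \<bar>e22\<bar>) + c * (\<bar>e21\<bar> + \<bar>e11\<bar>) + c * (\<bar>e22\<bar> + \<bar>e12\<bar>)"
  proof -
    have ts: "0 \<le> t / s" "0 \<le> s / t" using st by simp_all
    have "\<bar>q * (e11 - \<rho> * e21)\<bar> \<le> c * (\<bar>e11\<bar> + \<bar>e21\<bar>)" "\<bar>q * (e22 - \<rho> * e12)\<bar> \<le> c * (\<bar>e22\<bar> + \<bar>e12\<bar>)"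
      using b[of 1 e11 e21] b[of 1 e22 e12] K(1) by (simp_all only: c_def mult_1 zero_le_one)
    then show ?thesis
      unfolding D11 D12 D21 D22 c_def by (intro add_mono b ts K(2,3)) auto
  qed
  \<comment> \<open>Each of the four errors occurs in two entries of the difference, hence the
    factor \<open>2\<close>.\<close>
  also have "\<dots> = 2 * K / (1 - r\<^sup>2) * (\<bar>e11\<bar> + \<bar>e12\<bar> + \<bar>e21\<bar> + \<bar>e22\<bar>)"
  proof -
    have "2 * K / (1 - r\<^sup>2) = 2 * c" by (simp add: c_def)
    then show ?thesis by (simp only:) (simp add: algebra_simps)
  qed
  finally show ?thesis by (simp only: e11_def e12_def e21_def e22_def)
qed

section \<open>Joint limit of two linearised statistics\<close>

lemma vector_2_eq: "(vector [a, b] :: real ^ 2) = a *\<^sub>R axis 1 1 + b *\<^sub>R axis 2 1"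
  by (simp add: vec_eq_iff forall_2 axis_def)

lemma inner_vector_2: "(a :: real ^ 2) \<bullet> vector [x, y] = a $ 1 * x + a $ 2 * y"
  by (simp add: inner_vec_def sum_2)

lemma pair_matrix_measurable:
  fixes A :: "real ^ 2 ^ 2" and f g :: "'w \<Rightarrow> real"
  assumes "f \<in> borel_measurable M" "g \<in> borel_measurable M"
  shows "(\<lambda>\<omega>. A *v vector [f \<omega>, g \<omega>]) \<in> borel_measurable M"
proof (rule measurable_compose[where g = "\<lambda>v. A *v v"])
  show "(\<lambda>\<omega>. vector [f \<omega>, g \<omega>] :: real ^ 2) \<in> borel_measurable M"
    unfolding vector_2_eq using assms by (intro borel_measurable_add borel_measurable_scaleR) auto
  show "(*v) A \<in> borel_measurable borel"
    by (intro borel_measurable_continuous_onI linear_continuous_on matrix_vector_mul_bounded_linear)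
qed

text \<open>If the sum exceeds \<open>d\<close> in absolute value, the term of larger absolute value
  exceeds \<open>d / 2\<close>, and its double dominates the sum.\<close>

lemma truncated_square_add:
  fixes x y :: real
  shows "(x + y)\<^sup>2 * of_bool (\<bar>x + y\<bar> > d) \<le> 4 * (x\<^sup>2 * of_bool (\<bar>x\<bar> > d / 2)) + 4 * (y\<^sup>2 * of_bool (\<bar>y\<bar> > d / 2))"
proof (cases "\<bar>x + y\<bar> > d")
  case True
  show ?thesis
  proof (cases "\<bar>x\<bar> \<le> \<bar>y\<bar>")
    case le: True
    have y: "\<bar>y\<bar> > d / 2" using True le by linarith
    have "\<bar>x + y\<bar> \<le> \<bar>2 * y\<bar>" using le by linarith
    then have "(x + y)\<^sup>2 \<le> 4 * y\<^sup>2" using abs_le_square_iff[of "x + y" "2 * y"] by (simp add: power_mult_distrib)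
    then show ?thesis using True y by (simp add: add_increasing)
  next
    case le: False
    have x: "\<bar>x\<bar> > d / 2" using True le by linarith
    have "\<bar>x + y\<bar> \<le> \<bar>2 * x\<bar>" using le by linarith
    then have "(x + y)\<^sup>2 \<le> 4 * x\<^sup>2" using abs_le_square_iff[of "x + y" "2 * x"] by (simp add: power_mult_distrib)
    then show ?thesis using True x by (simp add: add_increasing2)
  qed
qed simp

lemma truncated_square_scale:
  fixes b u :: real
  assumes "\<bar>b\<bar> \<le> \<beta>" "0 < \<beta>"
  shows "(b * u)\<^sup>2 * of_bool (\<bar>b * u\<bar> > d) \<le> \<beta>\<^sup>2 * (u\<^sup>2 * of_bool (\<bar>u\<bar> > d / \<beta>))"
proof (cases "\<bar>b * u\<bar> > d")
  case True
  have le: "\<bar>b * u\<bar> \<le> \<beta> * \<bar>u\<bar>" unfolding abs_mult using assms by (intro mult_right_mono) auto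
  then have u: "\<bar>u\<bar> > d / \<beta>" using True assms by (simp add: divide_less_eq mult.commute)
  have "(b * u)\<^sup>2 \<le> (\<beta> * u)\<^sup>2" using le assms by (intro abs_le_square_iff[THEN iffD1]) (simp add: abs_mult)
  then show ?thesis using True u by (simp add: power_mult_distrib)
qed simp

text \<open>Cauchy-Schwarz is applied twice, first in the sum over \<open>I\<close> and then in the
  expectation. The three error terms come from expanding the inner product of two perturbed vectors
  whose unperturbed versions have mean squared length at most \<open>1\<close>. The lemma serves the
  jackknife vectors and, with a one-element \<open>I\<close>, products of scalar statistics.\<close>

lemma (in prob_space) expectation_inner_perturb:
  fixes c1 c2 p1 p2 :: "nat \<Rightarrow> 'a \<Rightarrow> real"
  assumes m: "\<And>i. i \<in> I \<Longrightarrow> c1 i \<in> borel_measurable M" "\<And>i. i \<in> I \<Longrightarrow> c2 i \<in> borel_measurable M"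
      "\<And>i. i \<in> I \<Longrightarrow> p1 i \<in> borel_measurable M" "\<And>i. i \<in> I \<Longrightarrow> p2 i \<in> borel_measurable M"
    and s1: "integrable M (\<lambda>\<omega>. \<Sum>i\<in>I. (c1 i \<omega> - p1 i \<omega>)\<^sup>2)" "expectation (\<lambda>\<omega>. \<Sum>i\<in>I. (c1 i \<omega> - p1 i \<omega>)\<^sup>2) \<le> \<epsilon>1"
    and s2: "integrable M (\<lambda>\<omega>. \<Sum>i\<in>I. (c2 i \<omega> - p2 i \<omega>)\<^sup>2)" "expectation (\<lambda>\<omega>. \<Sum>i\<in>I. (c2 i \<omega> - p2 i \<omega>)\<^sup>2) \<le> \<epsilon>2"
    and p1: "integrable M (\<lambda>\<omega>. \<Sum>i\<in>I. (p1 i \<omega>)\<^sup>2)" "expectation (\<lambda>\<omega>. \<Sum>i\<in>I. (p1 i \<omega>)\<^sup>2) \<le> 1"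
    and p2: "integrable M (\<lambda>\<omega>. \<Sum>i\<in>I. (p2 i \<omega>)\<^sup>2)" "expectation (\<lambda>\<omega>. \<Sum>i\<in>I. (p2 i \<omega>)\<^sup>2) \<le> 1"
  shows "integrable M (\<lambda>\<omega>. \<bar>(\<Sum>i\<in>I. c1 i \<omega> * c2 i \<omega>) - (\<Sum>i\<in>I. p1 i \<omega> * p2 i \<omega>)\<bar>)"
    and "expectation (\<lambda>\<omega>. \<bar>(\<Sum>i\<in>I. c1 i \<omega> * c2 i \<omega>) - (\<Sum>i\<in>I. p1 i \<omega> * p2 i \<omega>)\<bar>) \<le> sqrt \<epsilon>1 + sqrt \<epsilon>2 + sqrt \<epsilon>1 * sqrt \<epsilon>2"
proof -
  define N where "N f \<omega> = sqrt (\<Sum>i\<in>I. (f i \<omega>)\<^sup>2)" for f :: "nat \<Rightarrow> 'a \<Rightarrow> real" and \<omega>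
  define s1' where "s1' i \<omega> = c1 i \<omega> - p1 i \<omega>" for i \<omega>
  define s2' where "s2' i \<omega> = c2 i \<omega> - p2 i \<omega>" for i \<omega>
  have Nsq: "(N f \<omega>)\<^sup>2 = (\<Sum>i\<in>I. (f i \<omega>)\<^sup>2)" for f \<omega> by (simp add: N_def sum_nonneg)
  have Nm: "N f \<in> borel_measurable M" if "\<And>i. i \<in> I \<Longrightarrow> f i \<in> borel_measurable M" for f
    unfolding N_def[abs_def]
    by (rule measurable_compose[where g = sqrt, OF _ borel_measurable_continuous_onI])
       (use that in \<open>auto intro!: borel_measurable_sum borel_measurable_power continuous_intros\<close>)
  have sm: "s1' i \<in> borel_measurable M" "s2' i \<in> borel_measurable M" if "i \<in> I" for i
    unfolding s1'_def[abs_def] s2'_def[abs_def] using m that by (auto intro!: borel_measurable_diff)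
  have CS: "\<bar>\<Sum>i\<in>I. f i \<omega> * g i \<omega>\<bar> \<le> \<bar>N f \<omega> * N g \<omega>\<bar>" for f g \<omega>
  proof -
    have "(\<Sum>i\<in>I. f i \<omega> * g i \<omega>)\<^sup>2 \<le> (N f \<omega> * N g \<omega>)\<^sup>2"
      using Cauchy_Schwarz_ineq_sum[of "\<lambda>i. f i \<omega>" "\<lambda>i. g i \<omega>" I] by (simp add: power_mult_distrib Nsq)
    then show ?thesis by (rule abs_le_square_iff[THEN iffD2])
  qed
  note Ns1 = Nm[of s1', OF sm(1)] and Ns2 = Nm[of s2', OF sm(2)] and Np1 = Nm[of p1, OF m(3)] and Np2 = Nm[of p2, OF m(4)]
  have i1: "integrable M (\<lambda>\<omega>. (N s1' \<omega>)\<^sup>2)" "expectation (\<lambda>\<omega>. (N s1' \<omega>)\<^sup>2) \<le> \<epsilon>1" using s1 by (simp_all add: Nsq s1'_def)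
  have i2: "integrable M (\<lambda>\<omega>. (N s2' \<omega>)\<^sup>2)" "expectation (\<lambda>\<omega>. (N s2' \<omega>)\<^sup>2) \<le> \<epsilon>2" using s2 by (simp_all add: Nsq s2'_def)
  have j1: "integrable M (\<lambda>\<omega>. (N p1 \<omega>)\<^sup>2)" "expectation (\<lambda>\<omega>. (N p1 \<omega>)\<^sup>2) \<le> 1" using p1 by (simp_all add: Nsq)
  have j2: "integrable M (\<lambda>\<omega>. (N p2 \<omega>)\<^sup>2)" "expectation (\<lambda>\<omega>. (N p2 \<omega>)\<^sup>2) \<le> 1" using p2 by (simp_all add: Nsq)
  note A = expectation_mult_le_sqrt[OF Ns1 i1 Np2 j2]
  note B = expectation_mult_le_sqrt[OF Np1 j1 Ns2 i2]
  note C = expectation_mult_le_sqrt[OF Ns1 i1 Ns2 i2]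
  let ?R = "\<lambda>\<omega>. \<bar>N s1' \<omega> * N p2 \<omega>\<bar> + \<bar>N p1 \<omega> * N s2' \<omega>\<bar> + \<bar>N s1' \<omega> * N s2' \<omega>\<bar>"
  have R: "integrable M ?R" using A(1) B(1) C(1) by (intro Bochner_Integration.integrable_add)
  let ?D = "\<lambda>\<omega>. \<bar>(\<Sum>i\<in>I. c1 i \<omega> * c2 i \<omega>) - (\<Sum>i\<in>I. p1 i \<omega> * p2 i \<omega>)\<bar>"
  have le: "?D \<omega> \<le> ?R \<omega>" for \<omega>
  proof -
    have "c1 i \<omega> * c2 i \<omega> = p1 i \<omega> * p2 i \<omega> + s1' i \<omega> * p2 i \<omega> + p1 i \<omega> * s2' i \<omega> + s1' i \<omega> * s2' i \<omega>" for i
      by (simp add: s1'_def s2'_def algebra_simps)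
    then have "(\<Sum>i\<in>I. c1 i \<omega> * c2 i \<omega>) - (\<Sum>i\<in>I. p1 i \<omega> * p2 i \<omega>)
        = (\<Sum>i\<in>I. s1' i \<omega> * p2 i \<omega>) + (\<Sum>i\<in>I. p1 i \<omega> * s2' i \<omega>) + (\<Sum>i\<in>I. s1' i \<omega> * s2' i \<omega>)"
      by (simp add: sum.distrib)
    then show ?thesis using CS[of s1' \<omega> p2] CS[of p1 \<omega> s2'] CS[of s1' \<omega> s2'] by linarith
  qed
  show int: "integrable M ?D"
  proof (rule Bochner_Integration.integrable_bound[OF R])
    show "?D \<in> borel_measurable M" using m by (intro borel_measurable_abs borel_measurable_diff borel_measurable_sum borel_measurable_times)
    have "norm (?D \<omega>) \<le> norm (?R \<omega>)" for \<omega> using le[of \<omega>] unfolding real_norm_def by linarith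
    then show "AE \<omega> in M. norm (?D \<omega>) \<le> norm (?R \<omega>)" by (rule AE_I2)
  qed
  have "expectation ?D \<le> expectation ?R" by (intro integral_mono int R le)
  also have "\<dots> = expectation (\<lambda>\<omega>. \<bar>N s1' \<omega> * N p2 \<omega>\<bar>) + expectation (\<lambda>\<omega>. \<bar>N p1 \<omega> * N s2' \<omega>\<bar>) + expectation (\<lambda>\<omega>. \<bar>N s1' \<omega> * N s2' \<omega>\<bar>)"
    using A(1) B(1) C(1) by (simp only: Bochner_Integration.integral_add Bochner_Integration.integrable_add)
  also have "\<dots> \<le> sqrt \<epsilon>1 + sqrt \<epsilon>2 + sqrt \<epsilon>1 * sqrt \<epsilon>2" using A(2) B(2) C(2) by simp
  finally show "expectation ?D \<le> sqrt \<epsilon>1 + sqrt \<epsilon>2 + sqrt \<epsilon>1 * sqrt \<epsilon>2" .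
qed

section \<open>Joint central limit theorem for standardised scores\<close>

context iid_sample
begin

definition std_score :: "nat \<Rightarrow> ('e \<Rightarrow> real) \<Rightarrow> bool" where
  "std_score n u \<longleftrightarrow> u \<in> borel_measurable borel \<and> integrable M (\<lambda>\<omega>. (u (Z 1 \<omega>))\<^sup>2)
     \<and> expectation (\<lambda>\<omega>. u (Z 1 \<omega>)) = 0 \<and> expectation (\<lambda>\<omega>. (u (Z 1 \<omega>))\<^sup>2) = 1"

definition lindeberg_cond :: "(nat \<Rightarrow> 'e \<Rightarrow> real) \<Rightarrow> bool" where
  "lindeberg_cond u \<longleftrightarrow> (\<forall>\<delta>>0. (\<lambda>n. expectation (\<lambda>\<omega>. (u n (Z 1 \<omega>))\<^sup>2 * of_bool (\<bar>u n (Z 1 \<omega>)\<bar> > \<delta> * sqrt (real n)))) \<longlonglongrightarrow> 0)"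

lemma score_measurable: "u \<in> borel_measurable borel \<Longrightarrow> i \<ge> 1 \<Longrightarrow> (\<lambda>\<omega>. u (Z i \<omega>)) \<in> borel_measurable M"
  by (rule measurable_compose[OF Z_measurable])

lemma truncated_integrable:
  fixes u :: "'e \<Rightarrow> real"
  assumes "u \<in> borel_measurable borel" "integrable M (\<lambda>\<omega>. (u (Z 1 \<omega>))\<^sup>2)"
  shows "integrable M (\<lambda>\<omega>. (u (Z 1 \<omega>))\<^sup>2 * of_bool (\<bar>u (Z 1 \<omega>)\<bar> > d))"
proof (rule Bochner_Integration.integrable_bound[OF assms(2)])
  show "(\<lambda>\<omega>. (u (Z 1 \<omega>))\<^sup>2 * of_bool (\<bar>u (Z 1 \<omega>)\<bar> > d)) \<in> borel_measurable M"
    using score_measurable[OF assms(1), of 1] by measurable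
qed (auto intro!: AE_I2)

lemma score_L2:
  assumes "std_score n u" "i \<ge> 1"
  shows "(\<lambda>\<omega>. u (Z i \<omega>)) \<in> borel_measurable M" "integrable M (\<lambda>\<omega>. (u (Z i \<omega>))\<^sup>2)" "expectation (\<lambda>\<omega>. (u (Z i \<omega>))\<^sup>2) = 1"
proof -
  have u: "u \<in> borel_measurable borel" "integrable M (\<lambda>\<omega>. (u (Z 1 \<omega>))\<^sup>2)" "expectation (\<lambda>\<omega>. (u (Z 1 \<omega>))\<^sup>2) = 1"
    using assms(1) unfolding std_score_def by blast+
  have sq: "(\<lambda>z. (u z)\<^sup>2) \<in> borel_measurable borel" using u(1) by measurable
  show "(\<lambda>\<omega>. u (Z i \<omega>)) \<in> borel_measurable M" by (rule score_measurable[OF u(1) assms(2)])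
  show "integrable M (\<lambda>\<omega>. (u (Z i \<omega>))\<^sup>2)" unfolding identical(2)[OF assms(2) sq] by (rule u(2))
  show "expectation (\<lambda>\<omega>. (u (Z i \<omega>))\<^sup>2) = 1" unfolding identical(1)[OF assms(2) sq] by (rule u(3))
qed

definition score_mean :: "nat \<Rightarrow> ('e \<Rightarrow> real) \<Rightarrow> 'w \<Rightarrow> real" where
  "score_mean n u \<omega> = (\<Sum>i=1..n. u (Z i \<omega>)) / sqrt (real n)"

lemma score_mean_eq: "score_mean n u \<omega> = (\<Sum>i=1..n. (1 / sqrt (real n)) * u (Z i \<omega>))"
  by (simp add: score_mean_def sum_divide_distrib)

lemma score_mean_L2:
  assumes "std_score n u"
  shows "score_mean n u \<in> borel_measurable M" "integrable M (\<lambda>\<omega>. (score_mean n u \<omega>)\<^sup>2)"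
proof -
  show "score_mean n u \<in> borel_measurable M"
    unfolding score_mean_def[abs_def] using score_L2(1)[OF assms] by (intro borel_measurable_divide borel_measurable_sum) auto
  show "integrable M (\<lambda>\<omega>. (score_mean n u \<omega>)\<^sup>2)"
    unfolding score_mean_eq using score_L2(1,2)[OF assms] by (intro L2_sum_integrable) auto
qed

lemma std_score_truncated:
  assumes "std_score n u"
  shows "integrable M (\<lambda>\<omega>. (u (Z 1 \<omega>))\<^sup>2 * of_bool (\<bar>u (Z 1 \<omega>)\<bar> > d))"
  by (rule truncated_integrable) (use assms in \<open>unfold std_score_def, blast\<close>)+

text \<open>The coefficients vary with \<open>n\<close> because the correlation of the scores need
  not converge; the last hypothesis keeps the variance of the combined score equal to
  \<open>s\<close> all the same. Boundedness of the coefficients preserves the Lindeberg condition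
  and makes the remainders of \<open>f\<close> and \<open>g\<close> negligible, so that
  \<open>lindeberg_char\<close> and \<open>iexp_perturb\<close> apply.\<close>

lemma pair_char:
  fixes u v :: "nat \<Rightarrow> 'e \<Rightarrow> real" and f g :: "nat \<Rightarrow> 'w \<Rightarrow> real" and b c :: "nat \<Rightarrow> real"
  assumes u: "\<forall>\<^sub>F n in sequentially. std_score n (u n)" and v: "\<forall>\<^sub>F n in sequentially. std_score n (v n)"
    and lu: "lindeberg_cond u" and lv: "lindeberg_cond v"
    and fm: "\<forall>\<^sub>F n in sequentially. f n \<in> borel_measurable M \<and> integrable M (\<lambda>\<omega>. (f n \<omega>)\<^sup>2)"
    and gm: "\<forall>\<^sub>F n in sequentially. g n \<in> borel_measurable M \<and> integrable M (\<lambda>\<omega>. (g n \<omega>)\<^sup>2)"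
    and fu: "(\<lambda>n. expectation (\<lambda>\<omega>. (f n \<omega> - (\<Sum>i=1..n. u n (Z i \<omega>)) / sqrt (real n))\<^sup>2)) \<longlonglongrightarrow> 0"
    and gv: "(\<lambda>n. expectation (\<lambda>\<omega>. (g n \<omega> - (\<Sum>i=1..n. v n (Z i \<omega>)) / sqrt (real n))\<^sup>2)) \<longlonglongrightarrow> 0"
    and \<beta>: "0 < \<beta>" "\<forall>\<^sub>F n in sequentially. \<bar>b n\<bar> \<le> \<beta> \<and> \<bar>c n\<bar> \<le> \<beta>"
    and q: "\<forall>\<^sub>F n in sequentially. (b n)\<^sup>2 + 2 * expectation (\<lambda>\<omega>. u n (Z 1 \<omega>) * v n (Z 1 \<omega>)) * b n * c n + (c n)\<^sup>2 = s"
  shows "(\<lambda>n. \<integral>\<omega>. iexp (b n * f n \<omega> + c n * g n \<omega>) \<partial>M) \<longlonglongrightarrow> complex_of_real (exp (- s / 2))"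
proof -
  define w where "w n z = b n * u n z + c n * v n z" for n z
  define X where "X n \<omega> = (\<Sum>i=1..n. w n (Z i \<omega>)) / sqrt (real n)" for n \<omega>
  define Ru where "Ru n \<omega> = f n \<omega> - (\<Sum>i=1..n. u n (Z i \<omega>)) / sqrt (real n)" for n \<omega>
  define Rv where "Rv n \<omega> = g n \<omega> - (\<Sum>i=1..n. v n (Z i \<omega>)) / sqrt (real n)" for n \<omega>
  define R where "R n \<omega> = b n * Ru n \<omega> + c n * Rv n \<omega>" for n \<omega>
  have wprop: "w n \<in> borel_measurable borel \<and> integrable M (\<lambda>\<omega>. (w n (Z 1 \<omega>))\<^sup>2)
      \<and> expectation (\<lambda>\<omega>. w n (Z 1 \<omega>)) = 0 \<and> expectation (\<lambda>\<omega>. (w n (Z 1 \<omega>))\<^sup>2) = s"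
    if un: "std_score n (u n)" and vn: "std_score n (v n)"
      and qn: "(b n)\<^sup>2 + 2 * expectation (\<lambda>\<omega>. u n (Z 1 \<omega>) * v n (Z 1 \<omega>)) * b n * c n + (c n)\<^sup>2 = s" for n
  proof -
    have um: "u n \<in> borel_measurable borel" "v n \<in> borel_measurable borel" using un vn by (auto simp: std_score_def)
    have u2: "integrable M (\<lambda>\<omega>. (u n (Z 1 \<omega>))\<^sup>2)" "integrable M (\<lambda>\<omega>. (v n (Z 1 \<omega>))\<^sup>2)" using un vn by (auto simp: std_score_def)
    have uv: "integrable M (\<lambda>\<omega>. u n (Z 1 \<omega>) * v n (Z 1 \<omega>))"
      using um u2 by (intro L2_mult_integrable score_measurable) auto
    have u1: "integrable M (\<lambda>\<omega>. u n (Z 1 \<omega>))" "integrable M (\<lambda>\<omega>. v n (Z 1 \<omega>))"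
      by (rule square_integrable_imp_integrable[OF score_measurable[OF um(1) order_refl] u2(1)])
         (rule square_integrable_imp_integrable[OF score_measurable[OF um(2) order_refl] u2(2)])
    have sq: "(w n z)\<^sup>2 = (b n)\<^sup>2 * (u n z)\<^sup>2 + (2 * b n * c n) * (u n z * v n z) + (c n)\<^sup>2 * (v n z)\<^sup>2" for z
      by (simp add: w_def power2_eq_square algebra_simps)
    have i: "integrable M (\<lambda>\<omega>. (w n (Z 1 \<omega>))\<^sup>2)"
      unfolding sq by (intro Bochner_Integration.integrable_add integrable_mult_right u2 uv)
    have "expectation (\<lambda>\<omega>. (w n (Z 1 \<omega>))\<^sup>2) = (b n)\<^sup>2 * expectation (\<lambda>\<omega>. (u n (Z 1 \<omega>))\<^sup>2) + (2 * b n * c n) * expectation (\<lambda>\<omega>. u n (Z 1 \<omega>) * v n (Z 1 \<omega>)) + (c n)\<^sup>2 * expectation (\<lambda>\<omega>. (v n (Z 1 \<omega>))\<^sup>2)"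
      unfolding sq using u2 uv by simp
    also have "\<dots> = s" using un vn qn[symmetric] by (simp add: std_score_def)
    finally have "expectation (\<lambda>\<omega>. (w n (Z 1 \<omega>))\<^sup>2) = s" .
    moreover have "expectation (\<lambda>\<omega>. w n (Z 1 \<omega>)) = 0"
      unfolding w_def using u1 un vn by (simp add: std_score_def)
    moreover have "w n \<in> borel_measurable borel" unfolding w_def[abs_def] using um by measurable
    ultimately show ?thesis using i by blast
  qed
  have wev: "\<forall>\<^sub>F n in sequentially. w n \<in> borel_measurable borel \<and> integrable M (\<lambda>\<omega>. (w n (Z 1 \<omega>))\<^sup>2)
      \<and> expectation (\<lambda>\<omega>. w n (Z 1 \<omega>)) = 0 \<and> expectation (\<lambda>\<omega>. (w n (Z 1 \<omega>))\<^sup>2) = s"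
    using u v q by eventually_elim (rule wprop)
  have lind: "(\<lambda>n. expectation (\<lambda>\<omega>. (w n (Z 1 \<omega>))\<^sup>2 * of_bool (\<bar>w n (Z 1 \<omega>)\<bar> > \<delta> * sqrt (real n)))) \<longlonglongrightarrow> 0"
    if \<delta>: "\<delta> > 0" for \<delta>
  proof -
    \<comment> \<open>One half of the threshold is what the larger of the two summands must exceed,
      and \<open>\<beta>\<close> accounts for its coefficient.\<close>
    define \<eta> where "\<eta> = \<delta> / 2 / \<beta>"
    have \<eta>: "\<eta> > 0" using \<delta> \<beta> by (simp add: \<eta>_def)
    let ?L = "\<lambda>w d n. expectation (\<lambda>\<omega>. (w n (Z 1 \<omega>))\<^sup>2 * of_bool (\<bar>w n (Z 1 \<omega>)\<bar> > d * sqrt (real n)))"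
    have "(\<lambda>n. 4 * (\<beta>\<^sup>2 * ?L u \<eta> n) + 4 * (\<beta>\<^sup>2 * ?L v \<eta> n)) \<longlonglongrightarrow> 4 * (\<beta>\<^sup>2 * 0) + 4 * (\<beta>\<^sup>2 * 0)"
      by (intro tendsto_intros lu[unfolded lindeberg_cond_def, rule_format, OF \<eta>] lv[unfolded lindeberg_cond_def, rule_format, OF \<eta>])
    then have lim: "(\<lambda>n. 4 * (\<beta>\<^sup>2 * ?L u \<eta> n) + 4 * (\<beta>\<^sup>2 * ?L v \<eta> n)) \<longlonglongrightarrow> 0" by simp
    have "\<forall>\<^sub>F n in sequentially. norm (?L w \<delta> n) \<le> 4 * (\<beta>\<^sup>2 * ?L u \<eta> n) + 4 * (\<beta>\<^sup>2 * ?L v \<eta> n)"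
      using u v wev \<beta>(2)
    proof eventually_elim
      case (elim n)
      let ?d = "\<delta> * sqrt (real n)"
      have ti: "integrable M (\<lambda>\<omega>. (u n (Z 1 \<omega>))\<^sup>2 * of_bool (\<bar>u n (Z 1 \<omega>)\<bar> > \<eta> * sqrt (real n)))"
        "integrable M (\<lambda>\<omega>. (v n (Z 1 \<omega>))\<^sup>2 * of_bool (\<bar>v n (Z 1 \<omega>)\<bar> > \<eta> * sqrt (real n)))"
        by (rule std_score_truncated[OF elim(1)], rule std_score_truncated[OF elim(2)])
      have "?L w \<delta> n \<le> expectation (\<lambda>\<omega>. 4 * (\<beta>\<^sup>2 * ((u n (Z 1 \<omega>))\<^sup>2 * of_bool (\<bar>u n (Z 1 \<omega>)\<bar> > \<eta> * sqrt (real n))))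
          + 4 * (\<beta>\<^sup>2 * ((v n (Z 1 \<omega>))\<^sup>2 * of_bool (\<bar>v n (Z 1 \<omega>)\<bar> > \<eta> * sqrt (real n)))))"
      proof (intro integral_mono Bochner_Integration.integrable_add integrable_mult_right ti)
        show "integrable M (\<lambda>\<omega>. (w n (Z 1 \<omega>))\<^sup>2 * of_bool (\<bar>w n (Z 1 \<omega>)\<bar> > ?d))"
          using elim(3) by (intro truncated_integrable) auto
        fix \<omega>
        have d: "?d / 2 / \<beta> = \<eta> * sqrt (real n)" by (simp add: \<eta>_def)
        show "(w n (Z 1 \<omega>))\<^sup>2 * of_bool (\<bar>w n (Z 1 \<omega>)\<bar> > ?d)
          \<le> 4 * (\<beta>\<^sup>2 * ((u n (Z 1 \<omega>))\<^sup>2 * of_bool (\<bar>u n (Z 1 \<omega>)\<bar> > \<eta> * sqrt (real n))))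
          + 4 * (\<beta>\<^sup>2 * ((v n (Z 1 \<omega>))\<^sup>2 * of_bool (\<bar>v n (Z 1 \<omega>)\<bar> > \<eta> * sqrt (real n))))"
          using truncated_square_add[of "b n * u n (Z 1 \<omega>)" "c n * v n (Z 1 \<omega>)" ?d]
            truncated_square_scale[of "b n" \<beta> "u n (Z 1 \<omega>)" "?d / 2"] truncated_square_scale[of "c n" \<beta> "v n (Z 1 \<omega>)" "?d / 2"]
            elim(4) \<beta>(1) unfolding d w_def by linarith
      qed
      also have "\<dots> = 4 * (\<beta>\<^sup>2 * ?L u \<eta> n) + 4 * (\<beta>\<^sup>2 * ?L v \<eta> n)"
        using ti by simp
      finally show ?case by simp
    qed
    then show ?thesis using lim by (rule Lim_null_comparison)
  qed
  have limX: "(\<lambda>n. \<integral>\<omega>. iexp (X n \<omega>) \<partial>M) \<longlonglongrightarrow> complex_of_real (exp (- s / 2))"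
    unfolding X_def by (rule lindeberg_char[OF wev lind])
  have Xm: "\<forall>\<^sub>F n in sequentially. X n \<in> borel_measurable M"
    using wev
  proof eventually_elim
    case (elim n)
    then show ?case unfolding X_def[abs_def]
      by (intro borel_measurable_divide borel_measurable_sum score_measurable) auto
  qed
  have Rm: "\<forall>\<^sub>F n in sequentially. Ru n \<in> borel_measurable M \<and> integrable M (\<lambda>\<omega>. (Ru n \<omega>)\<^sup>2) \<and> Rv n \<in> borel_measurable M \<and> integrable M (\<lambda>\<omega>. (Rv n \<omega>)\<^sup>2)"
    using u v fm gm
  proof eventually_elim
    case (elim n)
    note S = score_mean_L2[unfolded score_mean_def[abs_def]]
    show ?case unfolding Ru_def[abs_def] Rv_def[abs_def]
      using S[OF elim(1)] S[OF elim(2)] elim(3,4) by (intro conjI borel_measurable_diff L2_diff_integrable) auto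
  qed
  have Rmi: "\<forall>\<^sub>F n in sequentially. R n \<in> borel_measurable M \<and> integrable M (\<lambda>\<omega>. (R n \<omega>)\<^sup>2)"
    using Rm
  proof eventually_elim
    case (elim n)
    have "integrable M (\<lambda>\<omega>. (\<Sum>i\<in>{0::nat, 1}. (if i = 0 then b n else c n) * (if i = 0 then Ru n else Rv n) \<omega>)\<^sup>2)"
      using elim by (intro L2_sum_integrable) auto
    moreover have "R n \<in> borel_measurable M" unfolding R_def[abs_def] using elim by (intro borel_measurable_add borel_measurable_times) auto
    ultimately show ?case by (simp add: R_def)
  qed
  have R0: "(\<lambda>n. expectation (\<lambda>\<omega>. (R n \<omega>)\<^sup>2)) \<longlonglongrightarrow> 0"
  proof -
    let ?b = "\<lambda>n. 2 * \<beta>\<^sup>2 * expectation (\<lambda>\<omega>. (Ru n \<omega>)\<^sup>2) + 2 * \<beta>\<^sup>2 * expectation (\<lambda>\<omega>. (Rv n \<omega>)\<^sup>2)"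
    have "?b \<longlonglongrightarrow> 2 * \<beta>\<^sup>2 * 0 + 2 * \<beta>\<^sup>2 * 0"
      unfolding Ru_def Rv_def by (intro tendsto_intros fu gv)
    then have lim: "?b \<longlonglongrightarrow> 0" by simp
    have "\<forall>\<^sub>F n in sequentially. norm (expectation (\<lambda>\<omega>. (R n \<omega>)\<^sup>2)) \<le> ?b n"
      using Rm Rmi \<beta>(2)
    proof eventually_elim
      case (elim n)
      have "expectation (\<lambda>\<omega>. (R n \<omega>)\<^sup>2) \<le> expectation (\<lambda>\<omega>. 2 * \<beta>\<^sup>2 * (Ru n \<omega>)\<^sup>2 + 2 * \<beta>\<^sup>2 * (Rv n \<omega>)\<^sup>2)"
      proof (intro integral_mono Bochner_Integration.integrable_add integrable_mult_right)
        fix \<omega>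
        have "(R n \<omega>)\<^sup>2 \<le> 2 * (b n * Ru n \<omega>)\<^sup>2 + 2 * (c n * Rv n \<omega>)\<^sup>2"
        proof -
          have "0 \<le> (b n * Ru n \<omega> - c n * Rv n \<omega>)\<^sup>2" by simp
          then show ?thesis unfolding R_def by (simp add: power2_diff power2_sum)
        qed
        moreover have "(b n * Ru n \<omega>)\<^sup>2 \<le> \<beta>\<^sup>2 * (Ru n \<omega>)\<^sup>2" "(c n * Rv n \<omega>)\<^sup>2 \<le> \<beta>\<^sup>2 * (Rv n \<omega>)\<^sup>2"
          unfolding power_mult_distrib using elim(3) power_mono[of "\<bar>b n\<bar>" \<beta> 2] power_mono[of "\<bar>c n\<bar>" \<beta> 2]
          by (auto intro!: mult_right_mono)
        ultimately show "(R n \<omega>)\<^sup>2 \<le> 2 * \<beta>\<^sup>2 * (Ru n \<omega>)\<^sup>2 + 2 * \<beta>\<^sup>2 * (Rv n \<omega>)\<^sup>2" by linarith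
      qed (use elim in auto)
      also have "\<dots> = ?b n" using elim(1) by simp
      finally show ?case by simp
    qed
    then show ?thesis using lim by (rule Lim_null_comparison)
  qed
  have "b n * f n \<omega> + c n * g n \<omega> = X n \<omega> + R n \<omega>" for n \<omega>
  proof -
    have "(\<Sum>i=1..n. w n (Z i \<omega>)) = b n * (\<Sum>i=1..n. u n (Z i \<omega>)) + c n * (\<Sum>i=1..n. v n (Z i \<omega>))"
      unfolding w_def sum.distrib sum_distrib_left ..
    then show ?thesis unfolding X_def R_def Ru_def Rv_def by (simp add: add_divide_distrib right_diff_distrib)
  qed
  then show ?thesis using iexp_perturb[OF Xm Rmi R0 limX] by simp
qed


end

context iid_sample
begin

text \<open>A Cramer-Wold argument. By \<open>inverse_mat_sqrt_2\<close> a functional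
  \<open>t\<close> of the standardised vector is a combination of \<open>f n\<close> and
  \<open>g n\<close> whose variance form is the squared norm of \<open>t\<close>; by
  \<open>correlation_form_bound\<close> its coefficients are bounded. This is exactly the input of
  \<open>pair_char\<close>, and no convergence of \<open>\<rho>\<close> or \<open>\<Sigma>\<close>
  is involved.\<close>

lemma pair_clt:
  fixes u v :: "nat \<Rightarrow> 'e \<Rightarrow> real" and f g :: "nat \<Rightarrow> 'w \<Rightarrow> real" and \<sigma> \<tau> \<rho> :: "nat \<Rightarrow> real"
  assumes u: "\<forall>\<^sub>F n in sequentially. std_score n (u n)" and v: "\<forall>\<^sub>F n in sequentially. std_score n (v n)"
    and lu: "lindeberg_cond u" and lv: "lindeberg_cond v"
    and fm: "\<forall>\<^sub>F n in sequentially. f n \<in> borel_measurable M \<and> integrable M (\<lambda>\<omega>. (f n \<omega>)\<^sup>2) \<and> expectation (\<lambda>\<omega>. (f n \<omega>)\<^sup>2) \<le> 2"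
    and gm: "\<forall>\<^sub>F n in sequentially. g n \<in> borel_measurable M \<and> integrable M (\<lambda>\<omega>. (g n \<omega>)\<^sup>2) \<and> expectation (\<lambda>\<omega>. (g n \<omega>)\<^sup>2) \<le> 2"
    and fu: "(\<lambda>n. expectation (\<lambda>\<omega>. (f n \<omega> - (\<Sum>i=1..n. u n (Z i \<omega>)) / sqrt (real n))\<^sup>2)) \<longlonglongrightarrow> 0"
    and gv: "(\<lambda>n. expectation (\<lambda>\<omega>. (g n \<omega> - (\<Sum>i=1..n. v n (Z i \<omega>)) / sqrt (real n))\<^sup>2)) \<longlonglongrightarrow> 0"
    and \<rho>: "\<And>n. \<rho> n = expectation (\<lambda>\<omega>. u n (Z 1 \<omega>) * v n (Z 1 \<omega>))"
    and r: "r < 1" "\<forall>\<^sub>F n in sequentially. \<bar>\<rho> n\<bar> \<le> r"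
    and \<sigma>: "\<forall>\<^sub>F n in sequentially. 0 < \<sigma> n \<and> 0 < \<tau> n"
    and \<Sigma>: "\<forall>\<^sub>F n in sequentially. \<Sigma> n = cov_mat (\<sigma> n) (\<tau> n) (\<rho> n)"
  shows "tendsto_in_distribution M
     (\<lambda>n \<omega>. matrix_inv (mat_sqrt (\<Sigma> n)) *v vector [\<sigma> n * f n \<omega>, \<tau> n * g n \<omega>]) std_normal_vec"
proof -
  let ?U = "\<lambda>n \<omega>. matrix_inv (mat_sqrt (\<Sigma> n)) *v vector [\<sigma> n * f n \<omega>, \<tau> n * g n \<omega>]"
  define G where "G n \<longleftrightarrow> \<bar>\<rho> n\<bar> \<le> r \<and> 0 < \<sigma> n \<and> 0 < \<tau> n \<and> \<Sigma> n = cov_mat (\<sigma> n) (\<tau> n) (\<rho> n)" for n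
  \<comment> \<open>The summand \<open>1\<close> in the bounds keeps them positive for
    \<open>t = 0\<close>.\<close>
  define P where "P n t b c \<longleftrightarrow> b\<^sup>2 + 2 * \<rho> n * b * c + c\<^sup>2 = (norm t)\<^sup>2 \<and> \<bar>b\<bar> \<le> norm t / sqrt (1 - r) + 1 \<and> \<bar>c\<bar> \<le> norm t / sqrt (1 - r) + 1
      \<and> (\<forall>\<omega>. t \<bullet> ?U n \<omega> = b * f n \<omega> + c * g n \<omega>)" for n t b c
  have good: "\<forall>\<^sub>F n in sequentially. G n"
    using r(2) \<sigma> \<Sigma> unfolding G_def by eventually_elim blast
  have coef: "\<exists>b c. P n t b c" if "G n" for n t
  proof -
    have g: "\<bar>\<rho> n\<bar> \<le> r" "\<bar>\<rho> n\<bar> < 1" "0 < \<sigma> n" "0 < \<tau> n" "\<Sigma> n = cov_mat (\<sigma> n) (\<tau> n) (\<rho> n)" using that r(1) unfolding G_def by auto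
    obtain a where a: "a \<bullet> (\<Sigma> n *v a) = (norm t)\<^sup>2" "\<And>v. t \<bullet> (matrix_inv (mat_sqrt (\<Sigma> n)) *v v) = a \<bullet> v"
      using inverse_mat_sqrt_2[OF cov_mat_pos_semidef[OF g(3,4,2)] cov_mat_det[OF g(3,4,2)], of t] unfolding g(5) by blast
    define b c where "b = a $ 1 * \<sigma> n" and "c = a $ 2 * \<tau> n"
    have e: "b\<^sup>2 + 2 * \<rho> n * b * c + c\<^sup>2 = (norm t)\<^sup>2"
      using a(1) unfolding g(5) cov_mat_quadratic by (simp add: b_def c_def)
    have le: "(1 - r) * (b\<^sup>2 + c\<^sup>2) \<le> (norm t)\<^sup>2" using correlation_form_bound[OF g(1), of b c] e by simp
    have bd: "\<bar>x\<bar> \<le> norm t / sqrt (1 - r) + 1" if "(1 - r) * x\<^sup>2 \<le> (norm t)\<^sup>2" for x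
    proof -
      have "x\<^sup>2 \<le> (norm t / sqrt (1 - r))\<^sup>2" using that r(1) by (simp add: power_divide le_divide_eq mult.commute)
      then have "\<bar>x\<bar> \<le> \<bar>norm t / sqrt (1 - r)\<bar>" by (rule abs_le_square_iff[THEN iffD2])
      also have "\<bar>norm t / sqrt (1 - r)\<bar> = norm t / sqrt (1 - r)" using r(1) by simp
      finally show ?thesis by simp
    qed
    have sq: "(1 - r) * b\<^sup>2 \<le> (norm t)\<^sup>2" "(1 - r) * c\<^sup>2 \<le> (norm t)\<^sup>2"
    proof -
      have "0 \<le> (1 - r) * b\<^sup>2" "0 \<le> (1 - r) * c\<^sup>2" using r(1) by simp_all
      then show "(1 - r) * b\<^sup>2 \<le> (norm t)\<^sup>2" "(1 - r) * c\<^sup>2 \<le> (norm t)\<^sup>2" using le unfolding distrib_left by linarith+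
    qed
    have inn: "t \<bullet> ?U n \<omega> = b * f n \<omega> + c * g n \<omega>" for \<omega>
      unfolding a(2) inner_vector_2 by (simp add: b_def c_def)
    have "P n t b c" unfolding P_def by (intro conjI allI e bd[OF sq(1)] bd[OF sq(2)] inn)
    then show ?thesis by (intro exI)
  qed
  show ?thesis
  proof (rule tendsto_in_distribution_char[OF prob_space_axioms prob_space_std_normal_vec sets_std_normal_vec])
    show "\<forall>\<^sub>F n in sequentially. ?U n \<in> borel_measurable M"
      using fm gm by eventually_elim (intro pair_matrix_measurable borel_measurable_times, auto)
    show "(\<lambda>n. \<integral>\<omega>. iexp (t \<bullet> ?U n \<omega>) \<partial>M) \<longlonglongrightarrow> (\<integral>v. iexp (t \<bullet> v) \<partial>std_normal_vec)" for t
    proof -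
      let ?\<beta> = "norm t / sqrt (1 - r) + 1"
      have \<beta>: "0 < ?\<beta>" using r(1) by (simp add: add_nonneg_pos)
      \<comment> \<open>Nothing is required of the coefficients at the finitely many indices where
        \<open>G\<close> fails.\<close>
      have "\<forall>n. \<exists>b c. G n \<longrightarrow> P n t b c" using coef by blast
      then obtain b where "\<forall>n. \<exists>c. G n \<longrightarrow> P n t (b n) c" by (rule choice[THEN exE])
      then obtain c where "\<forall>n. G n \<longrightarrow> P n t (b n) (c n)" by (rule choice[THEN exE])
      then have P: "P n t (b n) (c n)" if "G n" for n using that by (elim allE[of _ n] mp)
      have bc: "(b n)\<^sup>2 + 2 * \<rho> n * b n * c n + (c n)\<^sup>2 = (norm t)\<^sup>2" "\<bar>b n\<bar> \<le> ?\<beta>" "\<bar>c n\<bar> \<le> ?\<beta>"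
        "t \<bullet> ?U n \<omega> = b n * f n \<omega> + c n * g n \<omega>" if "G n" for n \<omega>
        by (rule P[OF that, unfolded P_def, THEN conjunct1] P[OF that, unfolded P_def, THEN conjunct2, THEN conjunct1]
            P[OF that, unfolded P_def, THEN conjunct2, THEN conjunct2, THEN conjunct1]
            P[OF that, unfolded P_def, THEN conjunct2, THEN conjunct2, THEN conjunct2, THEN spec])+
      have "(\<lambda>n. \<integral>\<omega>. iexp (b n * f n \<omega> + c n * g n \<omega>) \<partial>M) \<longlonglongrightarrow> complex_of_real (exp (- (norm t)\<^sup>2 / 2))"
      proof (rule pair_char[OF u v lu lv _ _ fu gv \<beta>])
        show "\<forall>\<^sub>F n in sequentially. f n \<in> borel_measurable M \<and> integrable M (\<lambda>\<omega>. (f n \<omega>)\<^sup>2)"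
          using fm by eventually_elim blast
        show "\<forall>\<^sub>F n in sequentially. g n \<in> borel_measurable M \<and> integrable M (\<lambda>\<omega>. (g n \<omega>)\<^sup>2)"
          using gm by eventually_elim blast
        show "\<forall>\<^sub>F n in sequentially. \<bar>b n\<bar> \<le> ?\<beta> \<and> \<bar>c n\<bar> \<le> ?\<beta>"
          using good by eventually_elim (intro conjI bc)
        show "\<forall>\<^sub>F n in sequentially. (b n)\<^sup>2 + 2 * expectation (\<lambda>\<omega>. u n (Z 1 \<omega>) * v n (Z 1 \<omega>)) * b n * c n + (c n)\<^sup>2 = (norm t)\<^sup>2"
          unfolding \<rho>[symmetric] using good by eventually_elim (rule bc(1))
      qed
      moreover have "\<forall>\<^sub>F n in sequentially. (\<integral>\<omega>. iexp (b n * f n \<omega> + c n * g n \<omega>) \<partial>M) = (\<integral>\<omega>. iexp (t \<bullet> ?U n \<omega>) \<partial>M)"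
        using good
      proof eventually_elim
        case (elim n)
        then show ?case by (simp only: bc(4))
      qed
      ultimately show ?thesis unfolding char_std_normal_vec by (rule Lim_transform_eventually)
    qed
    \<comment> \<open>For a basis vector \<open>t\<close> both coefficients are at most
      \<open>1 / sqrt (1 - r) + 1\<close>, so each of the two coordinates has second moment at most
      eight times the square of this number. The maximum taken below gives one constant for the
      statistics and the normal law.\<close>
    let ?C = "2 * (4 * (1 / sqrt (1 - r) + 1)\<^sup>2 * 2)"
    let ?N = "std_normal_vec :: (real ^ 2) measure"
    show "\<forall>\<^sub>F n in sequentially. integrable M (\<lambda>\<omega>. \<Sum>i\<in>UNIV. (?U n \<omega> $ i)\<^sup>2)
        \<and> expectation (\<lambda>\<omega>. \<Sum>i\<in>UNIV. (?U n \<omega> $ i)\<^sup>2) \<le> max ?C (\<integral>v. (\<Sum>i\<in>UNIV. (v $ i)\<^sup>2) \<partial>?N)"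
      using good fm gm
    proof eventually_elim
      case (elim n)
      have comp: "integrable M (\<lambda>\<omega>. (?U n \<omega> $ i)\<^sup>2) \<and> expectation (\<lambda>\<omega>. (?U n \<omega> $ i)\<^sup>2) \<le> 4 * (1 / sqrt (1 - r) + 1)\<^sup>2 * 2" for i :: 2
      proof -
        let ?\<beta> = "1 / sqrt (1 - r) + 1"
        have nt: "norm (axis i (1::real) :: real ^ 2) = 1" by simp
        obtain b c where bc: "\<bar>b\<bar> \<le> ?\<beta>" "\<bar>c\<bar> \<le> ?\<beta>" "\<And>\<omega>. axis i 1 \<bullet> ?U n \<omega> = b * f n \<omega> + c * g n \<omega>"
          proof -
          obtain b c where P: "P n (axis i 1) b c" using coef[OF elim(1), of "axis i 1"] by (elim exE)
          have "\<bar>b\<bar> \<le> ?\<beta>" "\<bar>c\<bar> \<le> ?\<beta>" "axis i 1 \<bullet> ?U n \<omega> = b * f n \<omega> + c * g n \<omega>" for \<omega>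
            by (rule P[unfolded P_def nt, THEN conjunct2, THEN conjunct1]
                P[unfolded P_def, THEN conjunct2, THEN conjunct2, THEN conjunct1, unfolded nt]
                P[unfolded P_def, THEN conjunct2, THEN conjunct2, THEN conjunct2, THEN spec])+
          then show thesis by (rule that)
        qed
        have Ui: "?U n \<omega> $ i = b * f n \<omega> + c * g n \<omega>" for \<omega>
          unfolding bc(3)[symmetric] by (simp add: inner_axis')
        have b2: "b\<^sup>2 \<le> ?\<beta>\<^sup>2" "c\<^sup>2 \<le> ?\<beta>\<^sup>2" using power_mono[OF bc(1), of 2] power_mono[OF bc(2), of 2] by simp_all
        have le: "(b * f n \<omega> + c * g n \<omega>)\<^sup>2 \<le> 2 * ?\<beta>\<^sup>2 * (f n \<omega>)\<^sup>2 + 2 * ?\<beta>\<^sup>2 * (g n \<omega>)\<^sup>2" for \<omega>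
        proof -
          have "0 \<le> (b * f n \<omega> - c * g n \<omega>)\<^sup>2" by simp
          then have "(b * f n \<omega> + c * g n \<omega>)\<^sup>2 \<le> 2 * (b\<^sup>2 * (f n \<omega>)\<^sup>2) + 2 * (c\<^sup>2 * (g n \<omega>)\<^sup>2)"
            by (simp add: power2_diff power2_sum power_mult_distrib)
          moreover have "b\<^sup>2 * (f n \<omega>)\<^sup>2 \<le> ?\<beta>\<^sup>2 * (f n \<omega>)\<^sup>2" "c\<^sup>2 * (g n \<omega>)\<^sup>2 \<le> ?\<beta>\<^sup>2 * (g n \<omega>)\<^sup>2"
            using b2 by (auto intro!: mult_right_mono)
          ultimately show ?thesis by linarith
        qed
        have S: "integrable M (\<lambda>\<omega>. 2 * ?\<beta>\<^sup>2 * (f n \<omega>)\<^sup>2 + 2 * ?\<beta>\<^sup>2 * (g n \<omega>)\<^sup>2)"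
          using elim by (intro Bochner_Integration.integrable_add integrable_mult_right) auto
        have i: "integrable M (\<lambda>\<omega>. (b * f n \<omega> + c * g n \<omega>)\<^sup>2)"
        proof (rule Bochner_Integration.integrable_bound[OF S])
          show "(\<lambda>\<omega>. (b * f n \<omega> + c * g n \<omega>)\<^sup>2) \<in> borel_measurable M"
            using elim by (intro borel_measurable_power borel_measurable_add borel_measurable_times) auto
          have "norm ((b * f n \<omega> + c * g n \<omega>)\<^sup>2) \<le> norm (2 * ?\<beta>\<^sup>2 * (f n \<omega>)\<^sup>2 + 2 * ?\<beta>\<^sup>2 * (g n \<omega>)\<^sup>2)" for \<omega>
            using le[of \<omega>] zero_le_power2[of "b * f n \<omega> + c * g n \<omega>"] unfolding real_norm_def by linarith
          then show "AE \<omega> in M. norm ((b * f n \<omega> + c * g n \<omega>)\<^sup>2) \<le> norm (2 * ?\<beta>\<^sup>2 * (f n \<omega>)\<^sup>2 + 2 * ?\<beta>\<^sup>2 * (g n \<omega>)\<^sup>2)" by (rule AE_I2)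
        qed
        have "expectation (\<lambda>\<omega>. (b * f n \<omega> + c * g n \<omega>)\<^sup>2) \<le> expectation (\<lambda>\<omega>. 2 * ?\<beta>\<^sup>2 * (f n \<omega>)\<^sup>2 + 2 * ?\<beta>\<^sup>2 * (g n \<omega>)\<^sup>2)"
          by (intro integral_mono i S le)
        also have "\<dots> = 2 * ?\<beta>\<^sup>2 * expectation (\<lambda>\<omega>. (f n \<omega>)\<^sup>2) + 2 * ?\<beta>\<^sup>2 * expectation (\<lambda>\<omega>. (g n \<omega>)\<^sup>2)"
          using elim by simp
        also have "\<dots> \<le> 2 * ?\<beta>\<^sup>2 * 2 + 2 * ?\<beta>\<^sup>2 * 2"
          using elim by (intro add_mono mult_left_mono) auto
        finally show ?thesis using i unfolding Ui by simp
      qed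
      have "expectation (\<lambda>\<omega>. \<Sum>i\<in>UNIV. (?U n \<omega> $ i)\<^sup>2) = (\<Sum>i\<in>UNIV. expectation (\<lambda>\<omega>. (?U n \<omega> $ i)\<^sup>2))"
        by (intro Bochner_Integration.integral_sum comp[THEN conjunct1])
      also have "\<dots> \<le> (\<Sum>i\<in>(UNIV :: 2 set). 4 * (1 / sqrt (1 - r) + 1)\<^sup>2 * 2)"
        by (intro sum_mono comp[THEN conjunct2])
      also have "\<dots> = ?C" by (simp add: sum_2)
      finally show ?case by (intro conjI Bochner_Integration.integrable_sum comp[THEN conjunct1]) (rule max.coboundedI1)
    qed
    show "integrable ?N (\<lambda>v. \<Sum>i\<in>UNIV. (v $ i)\<^sup>2)" by (rule second_moment_std_normal_vec)
    show "(\<integral>v. (\<Sum>i\<in>UNIV. (v $ i)\<^sup>2) \<partial>?N) \<le> max ?C (\<integral>v. (\<Sum>i\<in>UNIV. (v $ i)\<^sup>2) \<partial>?N)" by simp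
  qed
qed

end

section \<open>Second moments and quadratic forms of statistics close to scores\<close>

context iid_sample
begin

lemma score_product:
  fixes u v :: "'e \<Rightarrow> real"
  assumes u: "std_score n u" and v: "std_score n v" and il: "i \<ge> 1" "l \<ge> 1"
  shows "expectation (\<lambda>\<omega>. u (Z i \<omega>) * v (Z l \<omega>)) = (if i = l then expectation (\<lambda>\<omega>. u (Z 1 \<omega>) * v (Z 1 \<omega>)) else 0)"
proof (cases "i = l")
  case True
  have "(\<lambda>z. u z * v z) \<in> borel_measurable borel" using u v unfolding std_score_def by auto
  from identical(1)[OF il(2) this] show ?thesis using True by simp
next
  case False
  have m: "u \<in> borel_measurable borel" "v \<in> borel_measurable borel" using u v unfolding std_score_def by blast+
  have "indep_vars (\<lambda>_. borel) (\<lambda>j \<omega>. (if j = i then u else v) (Z j \<omega>)) {i, l}"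
    using m by (intro indep_vars_compose2[OF indep_vars_subset[OF indep_Z]]) (use il in auto)
  moreover have "integrable M (\<lambda>\<omega>. (if j = i then u else v) (Z j \<omega>))" if "j \<in> {i, l}" for j
  proof -
    have j: "j \<ge> 1" using that il by blast
    show ?thesis
      using square_integrable_imp_integrable[OF score_L2(1)[OF u j] score_L2(2)[OF u j]]
        square_integrable_imp_integrable[OF score_L2(1)[OF v j] score_L2(2)[OF v j]] by (cases "j = i") simp_all
  qed
  ultimately have "expectation (\<lambda>\<omega>. \<Prod>j\<in>{i, l}. (if j = i then u else v) (Z j \<omega>))
      = (\<Prod>j\<in>{i, l}. expectation (\<lambda>\<omega>. (if j = i then u else v) (Z j \<omega>)))"
    by (intro indep_vars_lebesgue_integral) auto
  moreover have "expectation (\<lambda>\<omega>. u (Z i \<omega>)) = 0"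
    using identical(1)[OF il(1) m(1)] u unfolding std_score_def by simp
  ultimately show ?thesis using False by simp
qed

lemma score_mean_product:
  assumes u: "std_score n u" and v: "std_score n v" and n: "n \<ge> 1"
  shows "expectation (\<lambda>\<omega>. score_mean n u \<omega> * score_mean n v \<omega>) = expectation (\<lambda>\<omega>. u (Z 1 \<omega>) * v (Z 1 \<omega>))"
proof -
  let ?c = "1 / sqrt (real n)" and ?e = "expectation (\<lambda>\<omega>. u (Z 1 \<omega>) * v (Z 1 \<omega>))"
  have cc: "?c * ?c = 1 / real n" by simp
  have "expectation (\<lambda>\<omega>. score_mean n u \<omega> * score_mean n v \<omega>)
      = (\<Sum>i\<in>{1..n}. \<Sum>l\<in>{1..n}. ?c * ?c * expectation (\<lambda>\<omega>. u (Z i \<omega>) * v (Z l \<omega>)))"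
    unfolding score_mean_eq by (rule L2_sum_product) (use score_L2(1,2)[OF u] score_L2(1,2)[OF v] in auto)
  also have "\<dots> = (\<Sum>i\<in>{1..n}. \<Sum>l\<in>{1..n}. if i = l then ?e / real n else 0)"
    unfolding cc by (intro sum.cong refl) (subst score_product[OF u v], auto)
  also have "\<dots> = ?e" using n by simp
  finally show ?thesis .
qed

lemma expectation_product_score_mean:
  assumes u: "std_score n u" and v: "std_score n v" and n: "n \<ge> 1"
    and f: "f \<in> borel_measurable M" "integrable M (\<lambda>\<omega>. (f \<omega>)\<^sup>2)" and g: "g \<in> borel_measurable M" "integrable M (\<lambda>\<omega>. (g \<omega>)\<^sup>2)"
  shows "\<bar>expectation (\<lambda>\<omega>. f \<omega> * g \<omega>) - expectation (\<lambda>\<omega>. u (Z 1 \<omega>) * v (Z 1 \<omega>))\<bar>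
    \<le> sqrt (expectation (\<lambda>\<omega>. (f \<omega> - score_mean n u \<omega>)\<^sup>2)) + sqrt (expectation (\<lambda>\<omega>. (g \<omega> - score_mean n v \<omega>)\<^sup>2))
      + sqrt (expectation (\<lambda>\<omega>. (f \<omega> - score_mean n u \<omega>)\<^sup>2)) * sqrt (expectation (\<lambda>\<omega>. (g \<omega> - score_mean n v \<omega>)\<^sup>2))" (is "_ \<le> ?R")
proof -
  have sq: "expectation (\<lambda>\<omega>. (score_mean n w \<omega>)\<^sup>2) = 1" if "std_score n w" for w
    using score_mean_product[OF that that n] that unfolding std_score_def by (simp add: power2_eq_square)
  have fg: "integrable M (\<lambda>\<omega>. f \<omega> * g \<omega>)" "integrable M (\<lambda>\<omega>. score_mean n u \<omega> * score_mean n v \<omega>)"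
    using f g score_mean_L2[OF u] score_mean_L2[OF v] by (auto intro!: L2_mult_integrable)
  have "\<bar>expectation (\<lambda>\<omega>. f \<omega> * g \<omega>) - expectation (\<lambda>\<omega>. score_mean n u \<omega> * score_mean n v \<omega>)\<bar>
      = \<bar>expectation (\<lambda>\<omega>. f \<omega> * g \<omega> - score_mean n u \<omega> * score_mean n v \<omega>)\<bar>" using fg by simp
  also have "\<dots> \<le> expectation (\<lambda>\<omega>. \<bar>f \<omega> * g \<omega> - score_mean n u \<omega> * score_mean n v \<omega>\<bar>)"
    by (rule integral_abs_bound)
  \<comment> \<open>Sums over a single index bring the scalar products into the form treated by
    \<open>expectation_inner_perturb\<close>.\<close>
  also have "\<dots> = expectation (\<lambda>\<omega>. \<bar>(\<Sum>i\<in>{0::nat}. f \<omega> * g \<omega>) - (\<Sum>i\<in>{0::nat}. score_mean n u \<omega> * score_mean n v \<omega>)\<bar>)" by simp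
  also have "\<dots> \<le> ?R"
    by (rule expectation_inner_perturb(2))
       (use f g score_mean_L2[OF u] score_mean_L2[OF v] sq[OF u] sq[OF v] in \<open>auto intro!: L2_diff_integrable\<close>)
  finally show ?thesis unfolding score_mean_product[OF u v n] .
qed

text \<open>Mean square closeness to the score sums transfers mixed moments. With
  \<open>v = u\<close> it shows that standardised statistics have second moment tending to
  \<open>1\<close>; with two different scores it relates their correlation to that of the
  scores.\<close>

lemma product_moment_limit:
  fixes u v :: "nat \<Rightarrow> 'e \<Rightarrow> real" and f g :: "nat \<Rightarrow> 'w \<Rightarrow> real"
  assumes u: "\<forall>\<^sub>F n in sequentially. std_score n (u n)" and v: "\<forall>\<^sub>F n in sequentially. std_score n (v n)"
    and fm: "\<forall>\<^sub>F n in sequentially. f n \<in> borel_measurable M \<and> integrable M (\<lambda>\<omega>. (f n \<omega>)\<^sup>2)"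
    and gm: "\<forall>\<^sub>F n in sequentially. g n \<in> borel_measurable M \<and> integrable M (\<lambda>\<omega>. (g n \<omega>)\<^sup>2)"
    and fu: "(\<lambda>n. expectation (\<lambda>\<omega>. (f n \<omega> - score_mean n (u n) \<omega>)\<^sup>2)) \<longlonglongrightarrow> 0"
    and gv: "(\<lambda>n. expectation (\<lambda>\<omega>. (g n \<omega> - score_mean n (v n) \<omega>)\<^sup>2)) \<longlonglongrightarrow> 0"
  shows "(\<lambda>n. expectation (\<lambda>\<omega>. f n \<omega> * g n \<omega>) - expectation (\<lambda>\<omega>. u n (Z 1 \<omega>) * v n (Z 1 \<omega>))) \<longlonglongrightarrow> 0"
proof -
  let ?a = "\<lambda>n. expectation (\<lambda>\<omega>. (f n \<omega> - score_mean n (u n) \<omega>)\<^sup>2)" and ?b = "\<lambda>n. expectation (\<lambda>\<omega>. (g n \<omega> - score_mean n (v n) \<omega>)\<^sup>2)"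
  have "(\<lambda>n. sqrt (?a n) + sqrt (?b n) + sqrt (?a n) * sqrt (?b n)) \<longlonglongrightarrow> sqrt 0 + sqrt 0 + sqrt 0 * sqrt 0"
    by (intro tendsto_intros fu gv)
  then have lim: "(\<lambda>n. sqrt (?a n) + sqrt (?b n) + sqrt (?a n) * sqrt (?b n)) \<longlonglongrightarrow> 0" by simp
  have "\<forall>\<^sub>F n in sequentially. norm (expectation (\<lambda>\<omega>. f n \<omega> * g n \<omega>) - expectation (\<lambda>\<omega>. u n (Z 1 \<omega>) * v n (Z 1 \<omega>)))
      \<le> sqrt (?a n) + sqrt (?b n) + sqrt (?a n) * sqrt (?b n)"
    using u v fm gm eventually_ge_at_top[of 1]
  proof eventually_elim
    case (elim n)
    show ?case unfolding real_norm_def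
      by (rule expectation_product_score_mean[OF elim(1,2,5)]) (use elim(3,4) in blast)+
  qed
  then show ?thesis using lim by (rule Lim_null_comparison)
qed

text \<open>The vectors \<open>C n\<close> and \<open>E n\<close> are close to those with entries
  \<open>u n (Z i) / sqrt n\<close> and \<open>v n (Z i) / sqrt n\<close>, whose inner product is an
  average of \<open>n\<close> independent products, so the weak law applies. Convergence is stated
  in mean, so that the entries of the matrix can be added up before Markov's inequality is applied
  once.\<close>

lemma quadratic_consistent:
  fixes u v :: "nat \<Rightarrow> 'e \<Rightarrow> real" and C E :: "nat \<Rightarrow> nat \<Rightarrow> 'w \<Rightarrow> real"
  assumes u: "\<forall>\<^sub>F n in sequentially. std_score n (u n)" and v: "\<forall>\<^sub>F n in sequentially. std_score n (v n)"
    and lu: "lindeberg_cond u" and lv: "lindeberg_cond v"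
    and Cm: "\<forall>\<^sub>F n in sequentially. (\<forall>i\<in>{1..n}. C n i \<in> borel_measurable M)
      \<and> integrable M (\<lambda>\<omega>. \<Sum>i=1..n. (C n i \<omega> - u n (Z i \<omega>) / sqrt (real n))\<^sup>2)"
    and Em: "\<forall>\<^sub>F n in sequentially. (\<forall>i\<in>{1..n}. E n i \<in> borel_measurable M)
      \<and> integrable M (\<lambda>\<omega>. \<Sum>i=1..n. (E n i \<omega> - v n (Z i \<omega>) / sqrt (real n))\<^sup>2)"
    and Cu: "(\<lambda>n. expectation (\<lambda>\<omega>. \<Sum>i=1..n. (C n i \<omega> - u n (Z i \<omega>) / sqrt (real n))\<^sup>2)) \<longlonglongrightarrow> 0"
    and Ev: "(\<lambda>n. expectation (\<lambda>\<omega>. \<Sum>i=1..n. (E n i \<omega> - v n (Z i \<omega>) / sqrt (real n))\<^sup>2)) \<longlonglongrightarrow> 0"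
  shows "\<forall>\<^sub>F n in sequentially. integrable M (\<lambda>\<omega>. \<bar>(\<Sum>i=1..n. C n i \<omega> * E n i \<omega>) - expectation (\<lambda>\<omega>. u n (Z 1 \<omega>) * v n (Z 1 \<omega>))\<bar>)"
    and "(\<lambda>n. expectation (\<lambda>\<omega>. \<bar>(\<Sum>i=1..n. C n i \<omega> * E n i \<omega>) - expectation (\<lambda>\<omega>. u n (Z 1 \<omega>) * v n (Z 1 \<omega>))\<bar>)) \<longlonglongrightarrow> 0"
proof -
  let ?e = "\<lambda>n. expectation (\<lambda>\<omega>. u n (Z 1 \<omega>) * v n (Z 1 \<omega>))"
  let ?a = "\<lambda>n. expectation (\<lambda>\<omega>. \<Sum>i=1..n. (C n i \<omega> - u n (Z i \<omega>) / sqrt (real n))\<^sup>2)"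
  let ?b = "\<lambda>n. expectation (\<lambda>\<omega>. \<Sum>i=1..n. (E n i \<omega> - v n (Z i \<omega>) / sqrt (real n))\<^sup>2)"
  let ?l = "\<lambda>n. expectation (\<lambda>\<omega>. \<bar>(\<Sum>i=1..n. u n (Z i \<omega>) * v n (Z i \<omega>)) / real n - ?e n\<bar>)"
  have lln: "?l \<longlonglongrightarrow> 0"
  proof (rule mean_product_lln)
    show "\<forall>\<^sub>F n in sequentially. u n \<in> borel_measurable borel \<and> integrable M (\<lambda>\<omega>. (u n (Z 1 \<omega>))\<^sup>2) \<and> expectation (\<lambda>\<omega>. (u n (Z 1 \<omega>))\<^sup>2) \<le> 1"
      using u by eventually_elim (unfold std_score_def, simp)
    show "\<forall>\<^sub>F n in sequentially. v n \<in> borel_measurable borel \<and> integrable M (\<lambda>\<omega>. (v n (Z 1 \<omega>))\<^sup>2) \<and> expectation (\<lambda>\<omega>. (v n (Z 1 \<omega>))\<^sup>2) \<le> 1"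
      using v by eventually_elim (unfold std_score_def, simp)
  qed (use lu lv in \<open>unfold lindeberg_cond_def, blast+\<close>)
  have "(\<lambda>n. sqrt (?a n) + sqrt (?b n) + sqrt (?a n) * sqrt (?b n) + ?l n) \<longlonglongrightarrow> sqrt 0 + sqrt 0 + sqrt 0 * sqrt 0 + 0"
    by (intro tendsto_intros Cu Ev lln)
  then have lim: "(\<lambda>n. sqrt (?a n) + sqrt (?b n) + sqrt (?a n) * sqrt (?b n) + ?l n) \<longlonglongrightarrow> 0" by simp
  have main: "\<forall>\<^sub>F n in sequentially. integrable M (\<lambda>\<omega>. \<bar>(\<Sum>i=1..n. C n i \<omega> * E n i \<omega>) - ?e n\<bar>)
      \<and> expectation (\<lambda>\<omega>. \<bar>(\<Sum>i=1..n. C n i \<omega> * E n i \<omega>) - ?e n\<bar>) \<le> sqrt (?a n) + sqrt (?b n) + sqrt (?a n) * sqrt (?b n) + ?l n"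
    using u v Cm Em eventually_ge_at_top[of 1]
  proof eventually_elim
    case (elim n)
    have n: "real n > 0" using elim(5) by simp
    have sqm: "integrable M (\<lambda>\<omega>. \<Sum>i=1..n. (w (Z i \<omega>) / sqrt (real n))\<^sup>2)" "expectation (\<lambda>\<omega>. \<Sum>i=1..n. (w (Z i \<omega>) / sqrt (real n))\<^sup>2) \<le> 1"
      "i \<in> {1..n} \<Longrightarrow> (\<lambda>\<omega>. w (Z i \<omega>) / sqrt (real n)) \<in> borel_measurable M"
      if w: "std_score n w" for w :: "'e \<Rightarrow> real" and i
    proof -
      have e: "(w (Z i \<omega>) / sqrt (real n))\<^sup>2 = (1 / real n) * (w (Z i \<omega>))\<^sup>2" for i \<omega> by (simp add: power_divide)
      show "integrable M (\<lambda>\<omega>. \<Sum>i=1..n. (w (Z i \<omega>) / sqrt (real n))\<^sup>2)"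
        unfolding e using score_L2(2)[OF w] by (intro Bochner_Integration.integrable_sum integrable_mult_right) auto
      have "expectation (\<lambda>\<omega>. \<Sum>i=1..n. (w (Z i \<omega>) / sqrt (real n))\<^sup>2) = (\<Sum>i=1..n. (1 / real n) * expectation (\<lambda>\<omega>. (w (Z i \<omega>))\<^sup>2))"
        unfolding e using score_L2(2)[OF w] by (subst Bochner_Integration.integral_sum) auto
      also have "\<dots> = (\<Sum>i=1..n. 1 / real n)" by (rule sum.cong) (use score_L2(3)[OF w] in auto)
      finally show "expectation (\<lambda>\<omega>. \<Sum>i=1..n. (w (Z i \<omega>) / sqrt (real n))\<^sup>2) \<le> 1" using n by simp
      show "i \<in> {1..n} \<Longrightarrow> (\<lambda>\<omega>. w (Z i \<omega>) / sqrt (real n)) \<in> borel_measurable M"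
        using score_L2(1)[OF w, of i] by (intro borel_measurable_divide) auto
    qed
    let ?P = "\<lambda>\<omega>. \<Sum>i=1..n. (u n (Z i \<omega>) / sqrt (real n)) * (v n (Z i \<omega>) / sqrt (real n))"
    have P: "?P \<omega> = (\<Sum>i=1..n. u n (Z i \<omega>) * v n (Z i \<omega>)) / real n" for \<omega>
      using n by (simp add: sum_divide_distrib)
    note c = expectation_inner_perturb[of "{1..n}" "C n" "E n" "\<lambda>i \<omega>. u n (Z i \<omega>) / sqrt (real n)" "\<lambda>i \<omega>. v n (Z i \<omega>) / sqrt (real n)",
      OF _ _ sqm(3)[OF elim(1)] sqm(3)[OF elim(2)] conjunct2[OF elim(3)] order_refl conjunct2[OF elim(4)] order_refl
        sqm(1,2)[OF elim(1)] sqm(1,2)[OF elim(2)]]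
    have Cmeas: "\<And>i. i \<in> {1..n} \<Longrightarrow> C n i \<in> borel_measurable M" "\<And>i. i \<in> {1..n} \<Longrightarrow> E n i \<in> borel_measurable M" using elim(3,4) by blast+
    have D: "integrable M (\<lambda>\<omega>. \<bar>(\<Sum>i=1..n. C n i \<omega> * E n i \<omega>) - ?P \<omega>\<bar>)"
      by (rule c(1), (erule Cmeas | assumption)+)
    have D2: "expectation (\<lambda>\<omega>. \<bar>(\<Sum>i=1..n. C n i \<omega> * E n i \<omega>) - ?P \<omega>\<bar>) \<le> sqrt (?a n) + sqrt (?b n) + sqrt (?a n) * sqrt (?b n)"
      by (rule c(2), (erule Cmeas | assumption)+)
    have L: "integrable M (\<lambda>\<omega>. \<bar>?P \<omega> - ?e n\<bar>)"
    proof (intro integrable_abs Bochner_Integration.integrable_diff Bochner_Integration.integrable_sum integrable_const)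
      fix i assume i: "i \<in> {1..n}"
      then have i1: "i \<ge> 1" by simp
      have "integrable M (\<lambda>\<omega>. (1 / real n) * (u n (Z i \<omega>) * v n (Z i \<omega>)))"
        by (intro integrable_mult_right L2_mult_integrable score_L2[OF elim(1) i1] score_L2[OF elim(2) i1])
      then show "integrable M (\<lambda>\<omega>. (u n (Z i \<omega>) / sqrt (real n)) * (v n (Z i \<omega>) / sqrt (real n)))" using n by simp
    qed
    have S: "integrable M (\<lambda>\<omega>. \<bar>(\<Sum>i=1..n. C n i \<omega> * E n i \<omega>) - ?P \<omega>\<bar> + \<bar>?P \<omega> - ?e n\<bar>)"
      by (intro Bochner_Integration.integrable_add D L)
    have le: "\<bar>(\<Sum>i=1..n. C n i \<omega> * E n i \<omega>) - ?e n\<bar> \<le> \<bar>(\<Sum>i=1..n. C n i \<omega> * E n i \<omega>) - ?P \<omega>\<bar> + \<bar>?P \<omega> - ?e n\<bar>" for \<omega>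
      by linarith
    have I: "integrable M (\<lambda>\<omega>. \<bar>(\<Sum>i=1..n. C n i \<omega> * E n i \<omega>) - ?e n\<bar>)"
    proof (rule Bochner_Integration.integrable_bound[OF S])
      show "(\<lambda>\<omega>. \<bar>(\<Sum>i=1..n. C n i \<omega> * E n i \<omega>) - ?e n\<bar>) \<in> borel_measurable M"
        using Cmeas by (intro borel_measurable_abs borel_measurable_diff borel_measurable_sum borel_measurable_times) auto
      have "norm \<bar>(\<Sum>i=1..n. C n i \<omega> * E n i \<omega>) - ?e n\<bar> \<le> norm (\<bar>(\<Sum>i=1..n. C n i \<omega> * E n i \<omega>) - ?P \<omega>\<bar> + \<bar>?P \<omega> - ?e n\<bar>)" for \<omega>
        using le[of \<omega>] unfolding real_norm_def by linarith
      then show "AE \<omega> in M. norm \<bar>(\<Sum>i=1..n. C n i \<omega> * E n i \<omega>) - ?e n\<bar> \<le> norm (\<bar>(\<Sum>i=1..n. C n i \<omega> * E n i \<omega>) - ?P \<omega>\<bar> + \<bar>?P \<omega> - ?e n\<bar>)"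
        by (rule AE_I2)
    qed
    have "expectation (\<lambda>\<omega>. \<bar>(\<Sum>i=1..n. C n i \<omega> * E n i \<omega>) - ?e n\<bar>)
        \<le> expectation (\<lambda>\<omega>. \<bar>(\<Sum>i=1..n. C n i \<omega> * E n i \<omega>) - ?P \<omega>\<bar> + \<bar>?P \<omega> - ?e n\<bar>)"
      by (intro integral_mono I S le)
    also have "\<dots> = expectation (\<lambda>\<omega>. \<bar>(\<Sum>i=1..n. C n i \<omega> * E n i \<omega>) - ?P \<omega>\<bar>) + expectation (\<lambda>\<omega>. \<bar>?P \<omega> - ?e n\<bar>)"
      by (rule Bochner_Integration.integral_add[OF D L])
    also have "expectation (\<lambda>\<omega>. \<bar>?P \<omega> - ?e n\<bar>) = ?l n" unfolding P ..
    finally show ?case using I D2 by linarith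
  qed
  show "\<forall>\<^sub>F n in sequentially. integrable M (\<lambda>\<omega>. \<bar>(\<Sum>i=1..n. C n i \<omega> * E n i \<omega>) - ?e n\<bar>)"
    using main by eventually_elim blast
  have "\<forall>\<^sub>F n in sequentially. norm (expectation (\<lambda>\<omega>. \<bar>(\<Sum>i=1..n. C n i \<omega> * E n i \<omega>) - ?e n\<bar>)) \<le> sqrt (?a n) + sqrt (?b n) + sqrt (?a n) * sqrt (?b n) + ?l n"
    using main by eventually_elim (simp add: integral_nonneg_AE)
  then show "(\<lambda>n. expectation (\<lambda>\<omega>. \<bar>(\<Sum>i=1..n. C n i \<omega> * E n i \<omega>) - ?e n\<bar>)) \<longlonglongrightarrow> 0"
    using lim by (rule Lim_null_comparison)
qed

end

section \<open>Joint limit with estimated covariance matrix\<close>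

lemma tendsto_in_distribution_cong:
  fixes N :: "'b::topological_space measure"
  assumes "tendsto_in_distribution M U N" "\<forall>\<^sub>F n in sequentially. U n = U' n"
  shows "tendsto_in_distribution M U' N"
  unfolding tendsto_in_distribution_def
proof (intro allI impI)
  fix f :: "'b \<Rightarrow> real"
  assume "continuous_on UNIV f" "bounded (range f)"
  then have "(\<lambda>n. \<integral>v. f v \<partial>distr M borel (U n)) \<longlonglongrightarrow> (\<integral>v. f v \<partial>N)"
    using assms(1) unfolding tendsto_in_distribution_def by blast
  moreover have "\<forall>\<^sub>F n in sequentially. (\<integral>v. f v \<partial>distr M borel (U n)) = (\<integral>v. f v \<partial>distr M borel (U' n))"
    using assms(2) by eventually_elim (simp only:)
  ultimately show "(\<lambda>n. \<integral>v. f v \<partial>distr M borel (U' n)) \<longlonglongrightarrow> (\<integral>v. f v \<partial>N)" by (rule Lim_transform_eventually)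
qed

lemma pos_semidef_mat_1: "pos_semidef (mat 1 :: real ^ 'n ^ 'n)"
  by (simp add: pos_semidef_def transpose_mat)

lemma invertible_mat_1: "invertible (mat 1 :: real ^ 'n ^ 'n)"
  by (simp add: invertible_def exI[of _ "mat 1"])

context iid_sample
begin

text \<open>Transfers nondegeneracy from the forests to their projections. The value
  \<open>(1 + r) / 2\<close> lies strictly between \<open>r\<close> and \<open>1\<close> and leaves
  room for the vanishing errors.\<close>

lemma correlation_bounded:
  fixes \<rho> a b e :: "nat \<Rightarrow> real"
  assumes r: "r < 1" and le: "\<forall>\<^sub>F n in sequentially. \<bar>e n\<bar> \<le> r * sqrt (a n * b n)"
    and e: "(\<lambda>n. e n - \<rho> n) \<longlonglongrightarrow> 0" and a: "a \<longlonglongrightarrow> 1" and b: "b \<longlonglongrightarrow> 1"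
  shows "\<forall>\<^sub>F n in sequentially. \<bar>\<rho> n\<bar> \<le> (1 + r) / 2"
proof -
  have "(\<lambda>n. r * sqrt (a n * b n) + \<bar>e n - \<rho> n\<bar>) \<longlonglongrightarrow> r * sqrt (1 * 1) + \<bar>0\<bar>"
    by (intro tendsto_intros a b e)
  then have "\<forall>\<^sub>F n in sequentially. r * sqrt (a n * b n) + \<bar>e n - \<rho> n\<bar> < (1 + r) / 2"
    by (rule order_tendstoD) (use r in simp)
  then show ?thesis using le by eventually_elim linarith
qed

text \<open>Markov's inequality for a dominating sequence \<open>L\<close>, which carries the
  measurability. Almost sure domination is enough, as is appropriate for an estimator that is
  identified only almost surely.\<close>

lemma tendsto_in_prob_Markov:
  fixes V :: "nat \<Rightarrow> 'w \<Rightarrow> 'b::metric_space"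
  assumes le: "\<forall>\<^sub>F n in sequentially. integrable M (L n) \<and> (AE \<omega> in M. dist (V n \<omega>) c \<le> L n \<omega>)"
    and L0: "(\<lambda>n. expectation (L n)) \<longlonglongrightarrow> 0"
  shows "tendsto_in_prob M V c"
  unfolding tendsto_in_prob_def
proof (intro allI impI)
  fix \<epsilon> :: real assume \<epsilon>: "\<epsilon> > 0"
  have "\<forall>\<^sub>F n in sequentially. norm (measure M {\<omega> \<in> space M. dist (V n \<omega>) c > \<epsilon>}) \<le> expectation (L n) / \<epsilon>"
    using le
  proof eventually_elim
    case (elim n)
    have [measurable]: "L n \<in> borel_measurable M" using elim by auto
    have "AE \<omega> in M. 0 \<le> L n \<omega>" using conjunct2[OF elim] by eventually_elim (rule order_trans[OF zero_le_dist])
    then have M: "measure M {\<omega> \<in> space M. L n \<omega> \<ge> \<epsilon>} \<le> expectation (L n) / \<epsilon>"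
      using integral_Markov_inequality_measure[of M "L n" "{}" \<epsilon>] elim \<epsilon> by simp
    have "measure M {\<omega> \<in> space M. dist (V n \<omega>) c > \<epsilon>} \<le> measure M {\<omega> \<in> space M. L n \<omega> \<ge> \<epsilon>}"
    proof (rule finite_measure_mono_AE)
      show "AE \<omega> in M. \<omega> \<in> {\<omega> \<in> space M. dist (V n \<omega>) c > \<epsilon>} \<longrightarrow> \<omega> \<in> {\<omega> \<in> space M. L n \<omega> \<ge> \<epsilon>}"
        using conjunct2[OF elim] by eventually_elim auto
    qed measurable
    with M show ?case by (simp add: measure_nonneg)
  qed
  moreover have "(\<lambda>n. expectation (L n) / \<epsilon>) \<longlonglongrightarrow> 0" using tendsto_divide[OF L0 tendsto_const[of \<epsilon>]] \<epsilon> by simp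
  ultimately show "(\<lambda>n. measure M {\<omega> \<in> space M. dist (V n \<omega>) c > \<epsilon>}) \<longlonglongrightarrow> 0" by (rule Lim_null_comparison)
qed

text \<open>The probabilistic core, detached from trees: \<open>F\<close> and \<open>G\<close> are
  statistics close to sums of scores, \<open>C\<close> and \<open>E\<close> their jackknife vectors
  in units of \<open>\<sigma>\<close> and \<open>\<tau>\<close>, and \<open>A\<close> is the
  estimator, described by its entries up to null sets.\<close>

theorem paired_limit:
  fixes u v :: "nat \<Rightarrow> 'e \<Rightarrow> real" and F G :: "nat \<Rightarrow> 'w \<Rightarrow> real" and C E :: "nat \<Rightarrow> nat \<Rightarrow> 'w \<Rightarrow> real"
    and \<sigma> \<tau> :: "nat \<Rightarrow> real" and A :: "nat \<Rightarrow> 'w \<Rightarrow> real ^ 2 ^ 2"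
  assumes u: "\<forall>\<^sub>F n in sequentially. std_score n (u n)" and v: "\<forall>\<^sub>F n in sequentially. std_score n (v n)"
    and lu: "lindeberg_cond u" and lv: "lindeberg_cond v"
    and \<sigma>: "\<forall>\<^sub>F n in sequentially. 0 < \<sigma> n" and \<tau>: "\<forall>\<^sub>F n in sequentially. 0 < \<tau> n"
    and ratio: "(\<lambda>n. \<sigma> n / \<tau> n) \<longlonglongrightarrow> c" "0 < c"
    and fm: "\<forall>\<^sub>F n in sequentially. F n \<in> borel_measurable M \<and> integrable M (\<lambda>\<omega>. (F n \<omega>)\<^sup>2)"
    and gm: "\<forall>\<^sub>F n in sequentially. G n \<in> borel_measurable M \<and> integrable M (\<lambda>\<omega>. (G n \<omega>)\<^sup>2)"
    and fu: "(\<lambda>n. expectation (\<lambda>\<omega>. (F n \<omega> / \<sigma> n - score_mean n (u n) \<omega>)\<^sup>2)) \<longlonglongrightarrow> 0"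
    and gv: "(\<lambda>n. expectation (\<lambda>\<omega>. (G n \<omega> / \<tau> n - score_mean n (v n) \<omega>)\<^sup>2)) \<longlonglongrightarrow> 0"
    and nondeg: "r < 1" "\<forall>\<^sub>F n in sequentially. \<bar>expectation (\<lambda>\<omega>. F n \<omega> * G n \<omega>)\<bar>
        \<le> r * sqrt (expectation (\<lambda>\<omega>. (F n \<omega>)\<^sup>2) * expectation (\<lambda>\<omega>. (G n \<omega>)\<^sup>2))"
    and Cm: "\<forall>\<^sub>F n in sequentially. (\<forall>i\<in>{1..n}. C n i \<in> borel_measurable M)
      \<and> integrable M (\<lambda>\<omega>. \<Sum>i=1..n. (C n i \<omega> - u n (Z i \<omega>) / sqrt (real n))\<^sup>2)"
    and Em: "\<forall>\<^sub>F n in sequentially. (\<forall>i\<in>{1..n}. E n i \<in> borel_measurable M)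
      \<and> integrable M (\<lambda>\<omega>. \<Sum>i=1..n. (E n i \<omega> - v n (Z i \<omega>) / sqrt (real n))\<^sup>2)"
    and Cu: "(\<lambda>n. expectation (\<lambda>\<omega>. \<Sum>i=1..n. (C n i \<omega> - u n (Z i \<omega>) / sqrt (real n))\<^sup>2)) \<longlonglongrightarrow> 0"
    and Ev: "(\<lambda>n. expectation (\<lambda>\<omega>. \<Sum>i=1..n. (E n i \<omega> - v n (Z i \<omega>) / sqrt (real n))\<^sup>2)) \<longlonglongrightarrow> 0"
    and A: "\<forall>\<^sub>F n in sequentially. AE \<omega> in M.
        A n \<omega> $ 1 $ 1 = (\<sigma> n)\<^sup>2 * (\<Sum>i=1..n. C n i \<omega> * C n i \<omega>) \<and> A n \<omega> $ 1 $ 2 = \<sigma> n * \<tau> n * (\<Sum>i=1..n. C n i \<omega> * E n i \<omega>) \<and>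
        A n \<omega> $ 2 $ 1 = \<sigma> n * \<tau> n * (\<Sum>i=1..n. C n i \<omega> * E n i \<omega>) \<and> A n \<omega> $ 2 $ 2 = (\<tau> n)\<^sup>2 * (\<Sum>i=1..n. E n i \<omega> * E n i \<omega>)"
  shows "\<exists>\<Sigma> :: nat \<Rightarrow> real ^ 2 ^ 2. (\<forall>n. pos_semidef (\<Sigma> n) \<and> invertible (\<Sigma> n)) \<and>
      tendsto_in_distribution M (\<lambda>n \<omega>. matrix_inv (mat_sqrt (\<Sigma> n)) *v vector [F n \<omega>, G n \<omega>]) std_normal_vec \<and>
      tendsto_in_prob M (\<lambda>n \<omega>. matrix_inv (\<Sigma> n) ** A n \<omega>) (mat 1)"
proof -
  define f where "f n \<omega> = F n \<omega> / \<sigma> n" for n \<omega>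
  define g where "g n \<omega> = G n \<omega> / \<tau> n" for n \<omega>
  define \<rho> where "\<rho> n = expectation (\<lambda>\<omega>. u n (Z 1 \<omega>) * v n (Z 1 \<omega>))" for n
  define r' where "r' = (1 + r) / 2"
  have r': "r' < 1" using nondeg(1) by (simp add: r'_def)
  have fm': "\<forall>\<^sub>F n in sequentially. f n \<in> borel_measurable M \<and> integrable M (\<lambda>\<omega>. (f n \<omega>)\<^sup>2)"
    using fm by eventually_elim (unfold f_def[abs_def], auto simp: power_divide)
  have gm': "\<forall>\<^sub>F n in sequentially. g n \<in> borel_measurable M \<and> integrable M (\<lambda>\<omega>. (g n \<omega>)\<^sup>2)"
    using gm by eventually_elim (unfold g_def[abs_def], auto simp: power_divide)
  note fu' = fu[folded f_def] and gv' = gv[folded g_def]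
  have one: "\<forall>\<^sub>F n in sequentially. expectation (\<lambda>\<omega>. w n (Z 1 \<omega>) * w n (Z 1 \<omega>)) = 1"
    if "\<forall>\<^sub>F n in sequentially. std_score n (w n)" for w
    using that by eventually_elim (unfold std_score_def power2_eq_square, blast)
  have sq: "(\<lambda>n. expectation (\<lambda>\<omega>. (y n \<omega>)\<^sup>2)) \<longlonglongrightarrow> 1"
    if w: "\<forall>\<^sub>F n in sequentially. std_score n (w n)"
      and ym: "\<forall>\<^sub>F n in sequentially. y n \<in> borel_measurable M \<and> integrable M (\<lambda>\<omega>. (y n \<omega>)\<^sup>2)"
      and yw: "(\<lambda>n. expectation (\<lambda>\<omega>. (y n \<omega> - score_mean n (w n) \<omega>)\<^sup>2)) \<longlonglongrightarrow> 0" for w y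
  proof -
    have "(\<lambda>n. expectation (\<lambda>\<omega>. y n \<omega> * y n \<omega>) - expectation (\<lambda>\<omega>. w n (Z 1 \<omega>) * w n (Z 1 \<omega>))) \<longlonglongrightarrow> 0"
      by (rule product_moment_limit[OF w w ym ym yw yw])
    then have "(\<lambda>n. expectation (\<lambda>\<omega>. y n \<omega> * y n \<omega>) - 1) \<longlonglongrightarrow> 0"
      by (rule Lim_transform_eventually) (use one[OF w] in \<open>eventually_elim, simp only:\<close>)
    then have "(\<lambda>n. expectation (\<lambda>\<omega>. y n \<omega> * y n \<omega>)) \<longlonglongrightarrow> 1" by (rule LIM_zero_cancel)
    then show ?thesis unfolding power2_eq_square .
  qed
  note f1 = sq[OF u fm' fu'] and g1 = sq[OF v gm' gv']
  have \<rho>r: "\<forall>\<^sub>F n in sequentially. \<bar>\<rho> n\<bar> \<le> r'"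
    unfolding r'_def
  proof (rule correlation_bounded[OF nondeg(1) _ _ f1 g1])
    show "(\<lambda>n. expectation (\<lambda>\<omega>. f n \<omega> * g n \<omega>) - \<rho> n) \<longlonglongrightarrow> 0"
      unfolding \<rho>_def by (rule product_moment_limit[OF u v fm' gm' fu' gv'])
    show "\<forall>\<^sub>F n in sequentially. \<bar>expectation (\<lambda>\<omega>. f n \<omega> * g n \<omega>)\<bar> \<le> r * sqrt (expectation (\<lambda>\<omega>. (f n \<omega>)\<^sup>2) * expectation (\<lambda>\<omega>. (g n \<omega>)\<^sup>2))"
      using nondeg(2) \<sigma> \<tau>
    proof eventually_elim
      case (elim n)
      have e: "expectation (\<lambda>\<omega>. f n \<omega> * g n \<omega>) = expectation (\<lambda>\<omega>. F n \<omega> * G n \<omega>) / (\<sigma> n * \<tau> n)"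
        by (simp add: f_def g_def)
      have "expectation (\<lambda>\<omega>. (f n \<omega>)\<^sup>2) * expectation (\<lambda>\<omega>. (g n \<omega>)\<^sup>2)
          = expectation (\<lambda>\<omega>. (F n \<omega>)\<^sup>2) * expectation (\<lambda>\<omega>. (G n \<omega>)\<^sup>2) / (\<sigma> n * \<tau> n)\<^sup>2"
        by (simp add: f_def g_def power_divide power_mult_distrib)
      then have s: "sqrt (expectation (\<lambda>\<omega>. (f n \<omega>)\<^sup>2) * expectation (\<lambda>\<omega>. (g n \<omega>)\<^sup>2))
          = sqrt (expectation (\<lambda>\<omega>. (F n \<omega>)\<^sup>2) * expectation (\<lambda>\<omega>. (G n \<omega>)\<^sup>2)) / (\<sigma> n * \<tau> n)"
        using elim(2,3) by (simp only: real_sqrt_divide real_sqrt_abs) simp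
      have "\<bar>expectation (\<lambda>\<omega>. f n \<omega> * g n \<omega>)\<bar> = \<bar>expectation (\<lambda>\<omega>. F n \<omega> * G n \<omega>)\<bar> / (\<sigma> n * \<tau> n)"
        unfolding e abs_divide using elim(2,3) by simp
      also have "\<dots> \<le> (r * sqrt (expectation (\<lambda>\<omega>. (F n \<omega>)\<^sup>2) * expectation (\<lambda>\<omega>. (G n \<omega>)\<^sup>2))) / (\<sigma> n * \<tau> n)"
        using elim(2,3) by (intro divide_right_mono elim(1)) simp
      finally show ?case unfolding s by simp
    qed
  qed
  have good: "\<forall>\<^sub>F n in sequentially. 0 < \<sigma> n \<and> 0 < \<tau> n \<and> \<bar>\<rho> n\<bar> \<le> r'"
    using \<sigma> \<tau> \<rho>r by eventually_elim (intro conjI)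
  \<comment> \<open>The identity matrix is the default at the finitely many indices where the
    standardisation fails; with it \<open>\<Sigma> n\<close> is positive semidefinite and invertible
    for every \<open>n\<close>.\<close>
  define \<Sigma> where "\<Sigma> n = (if 0 < \<sigma> n \<and> 0 < \<tau> n \<and> \<bar>\<rho> n\<bar> \<le> r' then cov_mat (\<sigma> n) (\<tau> n) (\<rho> n) else mat 1)" for n
  have \<Sigma>: "\<forall>\<^sub>F n in sequentially. \<Sigma> n = cov_mat (\<sigma> n) (\<tau> n) (\<rho> n)"
    using good by eventually_elim (simp add: \<Sigma>_def)
  have "pos_semidef (\<Sigma> n) \<and> invertible (\<Sigma> n)" for n
  proof (cases "0 < \<sigma> n \<and> 0 < \<tau> n \<and> \<bar>\<rho> n\<bar> \<le> r'")
    case True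
    then have h: "0 < \<sigma> n" "0 < \<tau> n" "\<bar>\<rho> n\<bar> < 1" using r' by auto
    show ?thesis unfolding \<Sigma>_def if_P[OF True] using cov_mat_pos_semidef[OF h] cov_mat_invertible[OF h] ..
  next
    case False
    show ?thesis unfolding \<Sigma>_def if_not_P[OF False] using pos_semidef_mat_1 invertible_mat_1 ..
  qed
  moreover have "tendsto_in_distribution M (\<lambda>n \<omega>. matrix_inv (mat_sqrt (\<Sigma> n)) *v vector [F n \<omega>, G n \<omega>]) std_normal_vec"
  proof (rule tendsto_in_distribution_cong[OF pair_clt[OF u v lu lv _ _ _ _ \<rho>_def r' \<rho>r _ \<Sigma>]])
    have two: "\<forall>\<^sub>F n in sequentially. expectation (\<lambda>\<omega>. (f n \<omega>)\<^sup>2) < 2" "\<forall>\<^sub>F n in sequentially. expectation (\<lambda>\<omega>. (g n \<omega>)\<^sup>2) < 2"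
      using order_tendstoD(2)[OF f1, of 2] order_tendstoD(2)[OF g1, of 2] by simp_all
    show "\<forall>\<^sub>F n in sequentially. f n \<in> borel_measurable M \<and> integrable M (\<lambda>\<omega>. (f n \<omega>)\<^sup>2) \<and> expectation (\<lambda>\<omega>. (f n \<omega>)\<^sup>2) \<le> 2"
      using fm' two(1) by eventually_elim simp
    show "\<forall>\<^sub>F n in sequentially. g n \<in> borel_measurable M \<and> integrable M (\<lambda>\<omega>. (g n \<omega>)\<^sup>2) \<and> expectation (\<lambda>\<omega>. (g n \<omega>)\<^sup>2) \<le> 2"
      using gm' two(2) by eventually_elim simp
    show "(\<lambda>n. expectation (\<lambda>\<omega>. (f n \<omega> - (\<Sum>i=1..n. u n (Z i \<omega>)) / sqrt (real n))\<^sup>2)) \<longlonglongrightarrow> 0"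
      using fu' unfolding score_mean_def .
    show "(\<lambda>n. expectation (\<lambda>\<omega>. (g n \<omega> - (\<Sum>i=1..n. v n (Z i \<omega>)) / sqrt (real n))\<^sup>2)) \<longlonglongrightarrow> 0"
      using gv' unfolding score_mean_def .
    show "\<forall>\<^sub>F n in sequentially. 0 < \<sigma> n \<and> 0 < \<tau> n" using \<sigma> \<tau> by eventually_elim (rule conjI)
    show "\<forall>\<^sub>F n in sequentially. (\<lambda>\<omega>. matrix_inv (mat_sqrt (\<Sigma> n)) *v vector [\<sigma> n * f n \<omega>, \<tau> n * g n \<omega>])
        = (\<lambda>\<omega>. matrix_inv (mat_sqrt (\<Sigma> n)) *v vector [F n \<omega>, G n \<omega>])"
      using \<sigma> \<tau> by eventually_elim (simp add: f_def g_def)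
  qed
  moreover have "tendsto_in_prob M (\<lambda>n \<omega>. matrix_inv (\<Sigma> n) ** A n \<omega>) (mat 1)"
  proof -
    \<comment> \<open>Eventually each ratio of the scales is below its limit plus \<open>1\<close>.
      The sum of these two bounds is a common bound, and it is at least \<open>1\<close>.\<close>
    define K where "K = c + 1 + (1 / c + 1)"
    have K1: "1 \<le> K" using ratio(2) by (simp add: K_def)
    have "(\<lambda>n. inverse (\<sigma> n / \<tau> n)) \<longlonglongrightarrow> inverse c" using ratio by (intro tendsto_inverse) auto
    then have rc: "(\<lambda>n. \<tau> n / \<sigma> n) \<longlonglongrightarrow> 1 / c" by (simp add: inverse_eq_divide)
    have "\<forall>\<^sub>F n in sequentially. \<sigma> n / \<tau> n < c + 1" "\<forall>\<^sub>F n in sequentially. \<tau> n / \<sigma> n < 1 / c + 1"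
      using order_tendstoD(2)[OF ratio(1), of "c + 1"] order_tendstoD(2)[OF rc, of "1 / c + 1"] by simp_all
    then have K: "\<forall>\<^sub>F n in sequentially. \<sigma> n / \<tau> n \<le> K \<and> \<tau> n / \<sigma> n \<le> K"
    proof eventually_elim
      case (elim n)
      have "0 < 1 / c" using ratio(2) by simp
      then show ?case using elim ratio(2) unfolding K_def by linarith
    qed
    \<comment> \<open>The bound of \<open>dist_cov_mat_quotient\<close>, with the second moments of
      the scores in place of their value \<open>1\<close>, since this is the form in which
      \<open>quadratic_consistent\<close> delivers the errors.\<close>
    define L where "L n \<omega> = 2 * K / (1 - r'\<^sup>2) * (\<bar>(\<Sum>i=1..n. C n i \<omega> * C n i \<omega>) - expectation (\<lambda>\<omega>. u n (Z 1 \<omega>) * u n (Z 1 \<omega>))\<bar>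
      + \<bar>(\<Sum>i=1..n. C n i \<omega> * E n i \<omega>) - \<rho> n\<bar> + \<bar>(\<Sum>i=1..n. C n i \<omega> * E n i \<omega>) - \<rho> n\<bar>
      + \<bar>(\<Sum>i=1..n. E n i \<omega> * E n i \<omega>) - expectation (\<lambda>\<omega>. v n (Z 1 \<omega>) * v n (Z 1 \<omega>))\<bar>)" for n \<omega>
    note q1 = quadratic_consistent[OF u u lu lu Cm Cm Cu Cu]
    note q2 = quadratic_consistent[OF u v lu lv Cm Em Cu Ev, folded \<rho>_def]
    note q3 = quadratic_consistent[OF v v lv lv Em Em Ev Ev]
    show ?thesis
    proof (rule tendsto_in_prob_Markov[where L = L])
      show "\<forall>\<^sub>F n in sequentially. integrable M (L n) \<and> (AE \<omega> in M. dist (matrix_inv (\<Sigma> n) ** A n \<omega>) (mat 1) \<le> L n \<omega>)"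
        using good \<Sigma> K one[OF u] one[OF v] q1(1) q2(1) q3(1) A
      proof eventually_elim
        case (elim n)
        have \<sigma>\<tau>: "0 < \<sigma> n" "0 < \<tau> n" "\<bar>\<rho> n\<bar> \<le> r'" using elim(1) by blast+
        note ratioK = conjunct1[OF elim(3)] conjunct2[OF elim(3)] and sig = elim(2) and ones = elim(4,5)
        have "integrable M (L n)" unfolding L_def[abs_def]
          by (intro integrable_mult_right Bochner_Integration.integrable_add elim(6-8))
        moreover have "AE \<omega> in M. dist (matrix_inv (\<Sigma> n) ** A n \<omega>) (mat 1) \<le> L n \<omega>"
          using elim(9)
        proof eventually_elim
          case (elim \<omega>)
          show ?case
            using dist_cov_mat_quotient[OF \<sigma>\<tau> r' K1, of "A n \<omega>"] \<sigma>\<tau> ratioK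
            unfolding L_def ones sig by (simp add: elim)
        qed
        ultimately show ?case ..
      qed
      let ?q1 = "\<lambda>n. expectation (\<lambda>\<omega>. \<bar>(\<Sum>i=1..n. C n i \<omega> * C n i \<omega>) - expectation (\<lambda>\<omega>. u n (Z 1 \<omega>) * u n (Z 1 \<omega>))\<bar>)"
      let ?q2 = "\<lambda>n. expectation (\<lambda>\<omega>. \<bar>(\<Sum>i=1..n. C n i \<omega> * E n i \<omega>) - \<rho> n\<bar>)"
      let ?q3 = "\<lambda>n. expectation (\<lambda>\<omega>. \<bar>(\<Sum>i=1..n. E n i \<omega> * E n i \<omega>) - expectation (\<lambda>\<omega>. v n (Z 1 \<omega>) * v n (Z 1 \<omega>))\<bar>)"
      have "(\<lambda>n. 2 * K / (1 - r'\<^sup>2) * (?q1 n + ?q2 n + ?q2 n + ?q3 n)) \<longlonglongrightarrow> 2 * K / (1 - r'\<^sup>2) * (0 + 0 + 0 + 0)"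
        by (intro tendsto_intros q1(2) q2(2) q3(2))
      then have "(\<lambda>n. 2 * K / (1 - r'\<^sup>2) * (?q1 n + ?q2 n + ?q2 n + ?q3 n)) \<longlonglongrightarrow> 0" by simp
      moreover have "\<forall>\<^sub>F n in sequentially. 2 * K / (1 - r'\<^sup>2) * (?q1 n + ?q2 n + ?q2 n + ?q3 n) = expectation (L n)"
        using q1(1) q2(1) q3(1)
      proof eventually_elim
        case (elim n)
        show ?case unfolding L_def[abs_def]
          by (simp only: integral_mult_right_zero Bochner_Integration.integral_add Bochner_Integration.integrable_add elim)
      qed
      ultimately show "(\<lambda>n. expectation (L n)) \<longlonglongrightarrow> 0" by (rule Lim_transform_eventually)
    qed
  qed
  ultimately show ?thesis by blast
qed

end

section \<open>Boosted forests\<close>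

context subsampled_kernel
begin

lemma std_score_proj:
  assumes "proj_var > 0"
  shows "std_score n (\<lambda>z. proj z / sqrt proj_var)"
proof -
  have s: "(proj (Z 1 \<omega>) / sqrt proj_var)\<^sup>2 = (pr 1 \<omega>)\<^sup>2 / proj_var" for \<omega>
    using assms by (simp add: pr_def power_divide)
  have "integrable M (\<lambda>\<omega>. (pr 1 \<omega>)\<^sup>2 / proj_var)" using pr_L2[of 1] by simp
  moreover have "expectation (\<lambda>\<omega>. (pr 1 \<omega>)\<^sup>2 / proj_var) = 1" using assms pr_square[of 1] by simp
  moreover have "expectation (\<lambda>\<omega>. proj (Z 1 \<omega>) / sqrt proj_var) = 0"
    using pr_centred[of 1] unfolding pr_def[abs_def] by simp
  ultimately show ?thesis unfolding std_score_def s using proj_measurable by (intro conjI borel_measurable_divide) auto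
qed

text \<open>The standard deviation of \<open>hajek n\<close>, the unit in which the errors of one
  stage are measured.\<close>

definition scale :: real where
  "scale = real k * sqrt (proj_var / real n)"

lemma scale_pos: "proj_var > 0 \<Longrightarrow> scale > 0"
  using k_pos kn' by (simp add: scale_def)

lemma scale_square: "scale\<^sup>2 = (real k)\<^sup>2 * proj_var / real n"
  using proj_var_nonneg by (simp add: scale_def power_mult_distrib)

lemma pr_over_scale:
  assumes "proj_var > 0"
  shows "real k / real n * pr i \<omega> / scale = proj (Z i \<omega>) / sqrt proj_var / sqrt (real n)"
proof -
  have "real n = sqrt (real n) * sqrt (real n)" by simp
  then have "real k / real n / scale = 1 / sqrt proj_var / sqrt (real n)"
    using assms k_pos kn' unfolding scale_def by (simp add: real_sqrt_divide field_simps)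
  then show ?thesis by (simp add: pr_def mult.commute[of _ "proj (Z i \<omega>)"] divide_inverse mult.assoc)
qed

lemma hajek_over_scale:
  assumes "proj_var > 0"
  shows "hajek n \<omega> / scale = score_mean n (\<lambda>z. proj z / sqrt proj_var) \<omega>"
  unfolding hajek_def score_mean_def sum_divide_distrib pr_over_scale[OF assms] ..

text \<open>In units of the squared scale every error bound becomes a simple factor times
  \<open>overlap_cov k / (k * proj_var)\<close>. The hypothesis on the limit of the reciprocal keeps
  this quotient bounded, so only the factor has to vanish.\<close>

lemma overlap_over_scale:
  assumes "proj_var > 0"
  shows "c * overlap_cov k / scale\<^sup>2 = c * real n / real k * (overlap_cov k / (real k * proj_var))"
  using assms k_pos kn' unfolding scale_square by (simp add: power2_eq_square field_simps)

lemma forest_mean_score: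
  assumes pos: "proj_var > 0"
  shows "expectation (\<lambda>\<omega>. (forest_mean n \<omega> / scale - score_mean n (\<lambda>z. proj z / sqrt proj_var) \<omega>)\<^sup>2)
    \<le> real k / real n * (overlap_cov k / (real k * proj_var))"
proof -
  have "expectation (\<lambda>\<omega>. (forest_mean n \<omega> / scale - score_mean n (\<lambda>z. proj z / sqrt proj_var) \<omega>)\<^sup>2)
      = expectation (\<lambda>\<omega>. (forest_mean n \<omega> - hajek n \<omega>)\<^sup>2) / scale\<^sup>2"
    unfolding hajek_over_scale[OF pos, symmetric] diff_divide_distrib[symmetric] power_divide by simp
  also have "\<dots> \<le> (real k / real n)\<^sup>2 * overlap_cov k / scale\<^sup>2"
    by (intro divide_right_mono forest_mean_hajek[OF kn]) simp
  also have "\<dots> = real k / real n * (overlap_cov k / (real k * proj_var))"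
    unfolding overlap_over_scale[OF pos] using k_pos kn' by (simp add: power2_eq_square field_simps)
  finally show ?thesis .
qed

lemma forest_mean_centred: "expectation (forest_mean n) = 0"
proof -
  have "integrable M (U I)" if "I \<in> NS" for I
    using square_integrable_imp_integrable[OF U_measurable U_L2] index_set_nsets[OF that] by blast
  then have "expectation (forest_mean n) = (\<Sum>I\<in>NS. expectation (U I)) / real (n choose k)"
    unfolding forest_mean_def[abs_def] by (simp add: Bochner_Integration.integral_sum)
  also have "\<dots> = 0" using U_centred index_set_nsets by (simp add: sum.neutral)
  finally show ?thesis .
qed

text \<open>The factor \<open>n / k\<close> contributed by the scale turns the sampling error
  \<open>k / B\<close> into \<open>n / B\<close>. This is where the number of draws has to outgrow
  the sample size.\<close>

lemma resampled_jackknife_score: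
  assumes pos: "proj_var > 0"
  shows "integrable M (\<lambda>\<omega>. \<Sum>i=1..n. (resampled_jackknife i \<omega> / scale - proj (Z i \<omega>) / sqrt proj_var / sqrt (real n))\<^sup>2)"
    and "expectation (\<lambda>\<omega>. \<Sum>i=1..n. (resampled_jackknife i \<omega> / scale - proj (Z i \<omega>) / sqrt proj_var / sqrt (real n))\<^sup>2)
      \<le> (8 * (real n / real B) + 6 * (real k / real n)) * (overlap_cov k / (real k * proj_var))"
proof -
  have e: "(\<Sum>i=1..n. (resampled_jackknife i \<omega> / scale - proj (Z i \<omega>) / sqrt proj_var / sqrt (real n))\<^sup>2)
      = (\<Sum>i=1..n. (resampled_jackknife i \<omega> - real k / real n * pr i \<omega>)\<^sup>2) / scale\<^sup>2" for \<omega>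
    unfolding pr_over_scale[OF pos, symmetric] diff_divide_distrib[symmetric] power_divide sum_divide_distrib ..
  show "integrable M (\<lambda>\<omega>. \<Sum>i=1..n. (resampled_jackknife i \<omega> / scale - proj (Z i \<omega>) / sqrt proj_var / sqrt (real n))\<^sup>2)"
    unfolding e using resampled_jackknife_error(1) by simp
  have "expectation (\<lambda>\<omega>. \<Sum>i=1..n. (resampled_jackknife i \<omega> / scale - proj (Z i \<omega>) / sqrt proj_var / sqrt (real n))\<^sup>2)
      = expectation (\<lambda>\<omega>. \<Sum>i=1..n. (resampled_jackknife i \<omega> - real k / real n * pr i \<omega>)\<^sup>2) / scale\<^sup>2"
    unfolding e by simp
  also have "\<dots> \<le> (8 * real k / real B + 6 * (real k / real n)\<^sup>2) * overlap_cov k / scale\<^sup>2"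
    by (intro divide_right_mono resampled_jackknife_error(2)) simp
  also have "\<dots> = (8 * (real n / real B) + 6 * (real k / real n)) * (overlap_cov k / (real k * proj_var))"
  proof -
    have "(8 * real k / real B + 6 * (real k / real n)\<^sup>2) * real n / real k = 8 * (real n / real B) + 6 * (real k / real n)"
      using k_pos kn' B_pos by (simp add: power2_eq_square field_simps)
    then show ?thesis unfolding overlap_over_scale[OF pos] by simp
  qed
  finally show "expectation (\<lambda>\<omega>. \<Sum>i=1..n. (resampled_jackknife i \<omega> / scale - proj (Z i \<omega>) / sqrt proj_var / sqrt (real n))\<^sup>2)
      \<le> (8 * (real n / real B) + 6 * (real k / real n)) * (overlap_cov k / (real k * proj_var))" .
qed

end

locale boosted_forest = iid_sample M Z D
  for M :: "'w measure" and Z :: "nat \<Rightarrow> 'w \<Rightarrow> real \<times> 'a::euclidean_space" and D +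
  fixes T :: "'a tree_fun" and x :: 'a and k B :: "nat \<Rightarrow> nat"
    and w :: "nat \<Rightarrow> nat \<Rightarrow> nat set \<Rightarrow> 'w \<Rightarrow> real" and S :: "nat \<Rightarrow> nat \<Rightarrow> nat \<Rightarrow> 'w \<Rightarrow> nat set"
  assumes tree: "measurable_tree T"
    and size: "n \<ge> 1 \<Longrightarrow> 1 \<le> k n \<and> k n \<le> n"
    and weights: "n \<ge> 1 \<Longrightarrow> forest_weights M Z n (k n) (B n) (\<lambda>j. w j n)"
    and draws: "n \<ge> 1 \<Longrightarrow> uniform_draws M Z n (k n) (B n) (\<lambda>j. S j n)"
    and centred: "j \<in> {0, 1} \<Longrightarrow> n \<ge> 1 \<Longrightarrow>
      expec M (\<lambda>\<omega>. tree_on T x (\<lambda>i. stage_data M T k w Z j n i \<omega>) {1..k n}) = 0"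
    and fourth_moment: "j \<in> {0, 1} \<Longrightarrow> n \<ge> 1 \<Longrightarrow>
      integrable M (\<lambda>\<omega>. tree_on T x (\<lambda>i. stage_data M T k w Z j n i \<omega>) {1..k n} ^ 4)"
begin

abbreviation V :: "nat \<Rightarrow> nat \<Rightarrow> nat \<Rightarrow> 'w \<Rightarrow> real \<times> 'a" where
  "V \<equiv> stage_data M T k w Z"

text \<open>The function subtracted in the second stage is an expectation and hence not random, so a
  noise-free residual is a fixed map of a single data point. Absorbing this map into the kernel
  makes the second stage a forest on the original independent sample, with a kernel that varies with
  \<open>n\<close>.\<close>

definition stage_map :: "nat \<Rightarrow> nat \<Rightarrow> real \<times> 'a \<Rightarrow> real \<times> 'a" where
  "stage_map j n z = (if j = 0 then z else residual (mean_Fhat0 M T k w Z n) z)"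

definition kernel :: "nat \<Rightarrow> nat \<Rightarrow> (real \<times> 'a) multiset \<Rightarrow> real" where
  "kernel j n ms = T x (image_mset (stage_map j n) ms)"

lemma V_stage_map: "V j n i \<omega> = stage_map j n (Z i \<omega>)"
  by (simp add: stage_data_def stage_map_def)

lemma tree_on_kernel: "tree_on T x (\<lambda>i. V j n i \<omega>) I = kernel j n {#Z i \<omega>. i \<in># mset_set I#}"
  by (simp add: tree_on_def kernel_def V_stage_map multiset.map_comp comp_def)

lemma tree_composition_measurable:
  fixes m :: nat
  assumes f: "f \<in> borel_measurable N" and g: "\<And>i. i \<in> {1..m} \<Longrightarrow> g i \<in> borel_measurable N"
  shows "(\<lambda>y. T (f y) {#g i y. i \<in># mset_set {1..m}#}) \<in> borel_measurable N"
proof -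
  have "(\<lambda>y. (f y, \<lambda>i\<in>{1..m}. g i y)) \<in> measurable N (borel \<Otimes>\<^sub>M Pi\<^sub>M {1..m} (\<lambda>_. borel))"
    by (intro measurable_Pair f measurable_restrict g)
  from measurable_compose[OF this tree[unfolded measurable_tree_def, rule_format, of m]]
  have "(\<lambda>y. T (f y) (image_mset (\<lambda>i\<in>{1..m}. g i y) (mset_set {1..m}))) \<in> borel_measurable N" by simp
  moreover have "image_mset (\<lambda>i\<in>{1..m}. g i y) (mset_set {1..m}) = image_mset (\<lambda>i. g i y) (mset_set {1..m})" for y
    by (rule image_mset_cong) simp
  ultimately show ?thesis by simp
qed

lemma weight_measurable:
  assumes "n \<ge> 1" "I \<in> nsets {1..n} (k n)"
  shows "w 0 n I \<in> borel_measurable M"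
proof -
  have "indep_vars (\<lambda>_. borel) (\<lambda>(j, I). w j n I) ({0, 1} \<times> nsets {1..n} (k n))"
    using weights[OF assms(1)] unfolding forest_weights_def by blast
  then have "\<forall>p\<in>{0, 1} \<times> nsets {1..n} (k n). (case p of (j, I) \<Rightarrow> w j n I) \<in> borel_measurable M"
    unfolding indep_vars_def by blast
  from bspec[OF this, of "(0, I)"] show ?thesis using assms(2) by simp
qed

text \<open>Needed for the measurability of the second-stage kernel. The weighted forest is jointly
  measurable in the evaluation point and the sample point, and integrating out the latter preserves
  measurability in the former.\<close>

lemma mean_Fhat0_measurable:
  assumes n: "n \<ge> 1"
  shows "mean_Fhat0 M T k w Z n \<in> borel_measurable borel"
proof -
  have "(\<lambda>(u, \<omega>). Fhat0 T k w Z n u \<omega>) \<in> borel_measurable (borel \<Otimes>\<^sub>M M)"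
    unfolding Fhat0_def weighted_forest_def split_beta'
  proof (intro borel_measurable_divide borel_measurable_sum borel_measurable_times borel_measurable_const)
    fix I assume I: "I \<in> nsets {1..n} (k n)"
    show "(\<lambda>p. w 0 n I (snd p)) \<in> borel_measurable (borel \<Otimes>\<^sub>M M)"
      by (rule measurable_compose[OF measurable_snd weight_measurable[OF n I]])
    have I': "finite I" "card I = k n" "I \<subseteq> {1..n}" using I by (auto simp: nsets_def)
    \<comment> \<open>\<open>measurable_tree\<close> speaks of data indexed by an initial segment,
      so the subset is enumerated.\<close>
    then obtain b where b: "bij_betw b {1..k n} I" by (metis finite_same_card_bij card_atLeastAtMost diff_Suc_1 finite_atLeastAtMost)
    have "tree_on T u (\<lambda>i. Z i \<omega>) I = T u {#Z (b i) \<omega>. i \<in># mset_set {1..k n}#}" for u \<omega>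
    proof -
      have "mset_set I = image_mset b (mset_set {1..k n})"
        using b by (simp add: image_mset_mset_set bij_betw_def)
      then show ?thesis by (simp add: tree_on_def multiset.map_comp comp_def)
    qed
    moreover have "(\<lambda>p. T (fst p) {#Z (b i) (snd p). i \<in># mset_set {1..k n}#}) \<in> borel_measurable (borel \<Otimes>\<^sub>M M)"
    proof (rule tree_composition_measurable[OF measurable_fst])
      fix i assume "i \<in> {1..k n}"
      then have "b i \<in> {1..n}" using bij_betwE[OF b] I'(3) by blast
      then have "b i \<ge> 1" by simp
      then show "(\<lambda>p. Z (b i) (snd p)) \<in> borel_measurable (borel \<Otimes>\<^sub>M M)"
        by (intro measurable_compose[OF measurable_snd Z_measurable])
    qed
    ultimately show "(\<lambda>p. tree_on T (fst p) (\<lambda>i. Z i (snd p)) I) \<in> borel_measurable (borel \<Otimes>\<^sub>M M)" by simp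
  qed
  then show ?thesis unfolding mean_Fhat0_def[abs_def] expec_def by (rule borel_measurable_lebesgue_integral)
qed

lemma stage_map_measurable:
  assumes n: "n \<ge> 1"
  shows "stage_map j n \<in> borel_measurable borel"
proof (cases "j = 0")
  case True
  then show ?thesis unfolding stage_map_def[abs_def] by simp
next
  case False
  have s: "(snd :: real \<times> 'a \<Rightarrow> 'a) \<in> borel_measurable borel" "(fst :: real \<times> 'a \<Rightarrow> real) \<in> borel_measurable borel"
    by (auto intro!: borel_measurable_continuous_onI continuous_intros)
  have "(\<lambda>z. (fst z - mean_Fhat0 M T k w Z n (snd z), snd z)) \<in> borel_measurable borel"
    by (intro borel_measurable_Pair borel_measurable_diff s measurable_compose[OF s(1) mean_Fhat0_measurable[OF n]])
  then show ?thesis using False unfolding stage_map_def[abs_def] residual_def by simp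
qed

lemma kernel_measurable:
  assumes n: "n \<ge> 1"
  shows "(\<lambda>z. kernel j n (image_mset z (mset_set {1..k n}))) \<in> borel_measurable (Pi\<^sub>M {1..k n} (\<lambda>_. borel))"
proof -
  have "(\<lambda>z. T x {#stage_map j n (z i). i \<in># mset_set {1..k n}#}) \<in> borel_measurable (Pi\<^sub>M {1..k n} (\<lambda>_. borel))"
  proof (rule tree_composition_measurable[OF borel_measurable_const])
    fix i assume i: "i \<in> {1..k n}"
    have "(\<lambda>z. z i) \<in> measurable (Pi\<^sub>M {1..k n} (\<lambda>_. borel :: (real \<times> 'a) measure)) borel"
      using i by (rule measurable_component_singleton)
    then show "(\<lambda>z. stage_map j n (z i)) \<in> borel_measurable (Pi\<^sub>M {1..k n} (\<lambda>_. borel))"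
      by (rule measurable_compose[OF _ stage_map_measurable[OF n]])
  qed
  then show ?thesis by (simp add: kernel_def multiset.map_comp comp_def)
qed

lemma kernel_sample_stage:
  assumes j: "j \<in> {0, 1}" and n: "n \<ge> 1"
  shows "kernel_sample M Z D (kernel j n) (k n)"
proof -
  let ?X = "\<lambda>\<omega>. kernel j n {#Z i \<omega>. i \<in># mset_set {1..k n}#}"
  have Xm: "?X \<in> borel_measurable M"
  proof -
    have "(\<lambda>\<omega>. T x {#stage_map j n (Z i \<omega>). i \<in># mset_set {1..k n}#}) \<in> borel_measurable M"
      by (intro tree_composition_measurable borel_measurable_const measurable_compose[OF Z_measurable stage_map_measurable[OF n]]) simp
    then show ?thesis by (simp add: kernel_def multiset.map_comp comp_def)
  qed
  have i4: "integrable M (\<lambda>\<omega>. 1 + ?X \<omega> ^ 4)"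
    using fourth_moment[OF j n] unfolding tree_on_kernel by simp
  have "integrable M (\<lambda>\<omega>. (?X \<omega>)\<^sup>2)"
  proof (rule Bochner_Integration.integrable_bound[OF i4])
    \<comment> \<open>This inequality extracts the second moment from the fourth.\<close>
    have "y\<^sup>2 \<le> 1 + y ^ 4" for y :: real
    proof -
      have "0 \<le> (y\<^sup>2 - 1)\<^sup>2 + y\<^sup>2" by simp
      then show ?thesis by (simp add: power2_diff power_mult[symmetric])
    qed
    then have "norm ((?X \<omega>)\<^sup>2) \<le> norm (1 + ?X \<omega> ^ 4)" for \<omega> by simp
    then show "AE \<omega> in M. norm ((?X \<omega>)\<^sup>2) \<le> norm (1 + ?X \<omega> ^ 4)" by (rule AE_I2)
  qed (use Xm in measurable)
  moreover have "expectation ?X = 0" using centred[OF j n] unfolding tree_on_kernel expec_def .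
  ultimately show ?thesis
    by (intro kernel_sample.intro kernel_sample_axioms.intro iid_sample_axioms kernel_measurable[OF n])
       (use size[OF n] in auto)
qed

definition zeta :: "nat \<Rightarrow> nat \<Rightarrow> real" where
  "zeta j n = zeta_one M T x (k n) (V j n)"

definition score :: "nat \<Rightarrow> nat \<Rightarrow> real \<times> 'a \<Rightarrow> real" where
  "score j n z = tree_proj M T x (k n) (V j n) (stage_map j n z) / sqrt (zeta j n)"

definition forest_sd :: "nat \<Rightarrow> nat \<Rightarrow> real" where
  "forest_sd j n = real (k n) * sqrt (zeta j n / real n)"

text \<open>The reciprocal of the ratio whose limit is assumed to be nonzero; it therefore
  converges, and vanishing factors times it still vanish.\<close>

definition zeta_quot :: "nat \<Rightarrow> nat \<Rightarrow> real" where
  "zeta_quot j n = zeta_full M T x (k n) (V j n) / (real (k n) * zeta j n)"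

text \<open>The dictionary between the notions of the statement, which are phrased with residual
  data, and those of the kernel on the original data. Since kernel and projection are centred,
  variances become second moments.\<close>

lemma stage_translation:
  assumes j: "j \<in> {0, 1}" and n: "n \<ge> 1"
  shows "tree_proj M T x (k n) (V j n) (stage_map j n z) = kernel_sample.proj M Z (kernel j n) (k n) z" (is ?P)
    and "zeta j n = kernel_sample.proj_var M Z (kernel j n) (k n)" (is ?Q)
    and "zeta_full M T x (k n) (V j n) = kernel_sample.overlap_cov M Z (kernel j n) (k n) (k n)" (is ?R)
    and "Ftilde M T k w Z j n x = kernel_sample.forest_mean Z (kernel j n) (k n) n" (is ?S)
proof -
  interpret K: kernel_sample M Z D "kernel j n" "k n" by (rule kernel_sample_stage[OF j n])
  have P: "tree_proj M T x (k n) (V j n) (stage_map j n z) = K.proj z" for z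
    by (simp add: tree_proj_def K.proj_def expec_def kernel_def V_stage_map multiset.map_comp comp_def)
  show ?P by (rule P)
  have pr: "tree_proj M T x (k n) (V j n) (V j n 1 \<omega>) = K.pr 1 \<omega>" for \<omega>
    unfolding V_stage_map P K.pr_def ..
  have "expectation (\<lambda>\<omega>. K.pr 1 \<omega>) = 0" using K.pr_centred[of 1] by simp
  then show ?Q
    unfolding zeta_def zeta_one_def cov_def expec_def pr K.proj_var_def by (simp add: power2_eq_square)
  have U: "tree_on T x (\<lambda>i. V j n i \<omega>) I = K.U I \<omega>" for I \<omega> unfolding tree_on_kernel K.U_def ..
  have "expectation (\<lambda>\<omega>. K.U {1..k n} \<omega>) = 0" using K.U_centred[OF K.index_set_1k] by simp
  then have "zeta_full M T x (k n) (V j n) = expectation (\<lambda>\<omega>. K.U {1..k n} \<omega> * K.U {1..k n} \<omega>)"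
    unfolding zeta_full_def cov_def expec_def U by simp
  also have "\<dots> = K.overlap_cov (k n)"
    using K.overlap_cov[OF K.index_set_1k K.index_set_1k] by simp
  finally show ?R .
  show ?S unfolding Ftilde_def[abs_def] full_forest_def U K.forest_mean_def[abs_def] ..
qed

lemma subsampled_kernel_stage:
  assumes j: "j \<in> {0, 1}" and n: "n \<ge> 1" and kn: "2 * k n \<le> n" and B: "1 \<le> B n"
  shows "subsampled_kernel M Z D (kernel j n) (k n) n (B n) (\<lambda>j. S j n) j"
  by (intro subsampled_kernel.intro subsampled_kernel_axioms.intro kernel_sample_stage[OF j n] draws[OF n] j kn B)

text \<open>Everything that the limit theorem needs from one stage at a fixed \<open>n\<close>. The
  jackknife vector is hidden behind an existential, so that the two stages, which are instances of
  the same locale with different kernels, can be treated side by side.\<close>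

lemma stage_forest:
  assumes j: "j \<in> {0, 1}" and n: "n \<ge> 1" and kn: "2 * k n \<le> n" and B: "1 \<le> B n" and pos: "zeta j n > 0"
  shows "std_score n (score j n)" "forest_sd j n > 0"
    "Ftilde M T k w Z j n x \<in> borel_measurable M" "integrable M (\<lambda>\<omega>. (Ftilde M T k w Z j n x \<omega>)\<^sup>2)"
    "expectation (Ftilde M T k w Z j n x) = 0"
    "expectation (\<lambda>\<omega>. (Ftilde M T k w Z j n x \<omega> / forest_sd j n - score_mean n (score j n) \<omega>)\<^sup>2)
      \<le> real (k n) / real n * zeta_quot j n"
    "\<exists>C. (\<forall>i\<in>{1..n}. C i \<in> borel_measurable M)
      \<and> integrable M (\<lambda>\<omega>. \<Sum>i=1..n. (C i \<omega> - score j n (Z i \<omega>) / sqrt (real n))\<^sup>2)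
      \<and> expectation (\<lambda>\<omega>. \<Sum>i=1..n. (C i \<omega> - score j n (Z i \<omega>) / sqrt (real n))\<^sup>2)
        \<le> (8 * (real n / real (B n)) + 6 * (real (k n) / real n)) * zeta_quot j n
      \<and> (AE \<omega> in M. \<forall>i\<in>{1..n}. jackknife_cov T x (B n) (\<lambda>b. S j n b \<omega>) (\<lambda>i. V j n i \<omega>) i = forest_sd j n * C i \<omega>)"
proof -
  interpret K: subsampled_kernel M Z D "kernel j n" "k n" n "B n" "\<lambda>j. S j n" j
    by (rule subsampled_kernel_stage[OF j n kn B])
  note tr = stage_translation[OF j n]
  have pos': "K.proj_var > 0" using pos unfolding tr .
  have sc: "score j n = (\<lambda>z. K.proj z / sqrt K.proj_var)" unfolding score_def[abs_def] tr ..
  have sd: "forest_sd j n = K.scale" unfolding forest_sd_def K.scale_def tr ..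
  have zq: "zeta_quot j n = K.overlap_cov (k n) / (real (k n) * K.proj_var)" unfolding zeta_quot_def tr ..
  show "std_score n (score j n)" unfolding sc by (rule K.std_score_proj[OF pos'])
  show sdp: "forest_sd j n > 0" unfolding sd by (rule K.scale_pos[OF pos'])
  show "Ftilde M T k w Z j n x \<in> borel_measurable M" unfolding tr(4) by (rule K.forest_mean_measurable)
  show "integrable M (\<lambda>\<omega>. (Ftilde M T k w Z j n x \<omega>)\<^sup>2)" unfolding tr(4) by (rule K.forest_mean_L2)
  show "expectation (Ftilde M T k w Z j n x) = 0" unfolding tr(4) by (rule K.forest_mean_centred)
  show "expectation (\<lambda>\<omega>. (Ftilde M T k w Z j n x \<omega> / forest_sd j n - score_mean n (score j n) \<omega>)\<^sup>2)
      \<le> real (k n) / real n * zeta_quot j n"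
    unfolding tr(4) sc sd zq by (rule K.forest_mean_score[OF pos'])
  show "\<exists>C. (\<forall>i\<in>{1..n}. C i \<in> borel_measurable M)
      \<and> integrable M (\<lambda>\<omega>. \<Sum>i=1..n. (C i \<omega> - score j n (Z i \<omega>) / sqrt (real n))\<^sup>2)
      \<and> expectation (\<lambda>\<omega>. \<Sum>i=1..n. (C i \<omega> - score j n (Z i \<omega>) / sqrt (real n))\<^sup>2)
        \<le> (8 * (real n / real (B n)) + 6 * (real (k n) / real n)) * zeta_quot j n
      \<and> (AE \<omega> in M. \<forall>i\<in>{1..n}. jackknife_cov T x (B n) (\<lambda>b. S j n b \<omega>) (\<lambda>i. V j n i \<omega>) i = forest_sd j n * C i \<omega>)"
  proof (intro exI[of _ "\<lambda>i \<omega>. K.resampled_jackknife i \<omega> / forest_sd j n"] conjI ballI)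
    show "(\<lambda>\<omega>. K.resampled_jackknife i \<omega> / forest_sd j n) \<in> borel_measurable M" for i
      by (intro borel_measurable_divide K.resampled_jackknife_measurable borel_measurable_const)
    show "integrable M (\<lambda>\<omega>. \<Sum>i=1..n. (K.resampled_jackknife i \<omega> / forest_sd j n - score j n (Z i \<omega>) / sqrt (real n))\<^sup>2)"
      unfolding sc sd by (rule K.resampled_jackknife_score(1)[OF pos'])
    show "expectation (\<lambda>\<omega>. \<Sum>i=1..n. (K.resampled_jackknife i \<omega> / forest_sd j n - score j n (Z i \<omega>) / sqrt (real n))\<^sup>2)
        \<le> (8 * (real n / real (B n)) + 6 * (real (k n) / real n)) * zeta_quot j n"
      unfolding sc sd zq by (rule K.resampled_jackknife_score(2)[OF pos'])
    show "AE \<omega> in M. \<forall>i\<in>{1..n}. jackknife_cov T x (B n) (\<lambda>b. S j n b \<omega>) (\<lambda>i. V j n i \<omega>) i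
        = forest_sd j n * (K.resampled_jackknife i \<omega> / forest_sd j n)"
      using K.S_in_NS
    proof eventually_elim
      case (elim \<omega>)
      have "jackknife_cov T x (B n) (\<lambda>b. S j n b \<omega>) (\<lambda>i. V j n i \<omega>) i = K.resampled_jackknife i \<omega>" for i
        using K.resampled_jackknife_emp_cov[OF elim, of i] unfolding jackknife_cov_def tree_on_kernel K.U_def .
      then show ?case using sdp by simp
    qed
  qed
qed

end

lemma jackknife_matrix_nth:
  "jackknife_matrix T x n B S z $ 1 $ 1 = (\<Sum>i=1..n. jackknife_cov T x B (S 0) (z 0) i * jackknife_cov T x B (S 0) (z 0) i)"
  "jackknife_matrix T x n B S z $ 1 $ 2 = (\<Sum>i=1..n. jackknife_cov T x B (S 0) (z 0) i * jackknife_cov T x B (S 1) (z 1) i)"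
  "jackknife_matrix T x n B S z $ 2 $ 1 = (\<Sum>i=1..n. jackknife_cov T x B (S 0) (z 0) i * jackknife_cov T x B (S 1) (z 1) i)"
  "jackknife_matrix T x n B S z $ 2 $ 2 = (\<Sum>i=1..n. jackknife_cov T x B (S 1) (z 1) i * jackknife_cov T x B (S 1) (z 1) i)"
  by (simp_all add: jackknife_matrix_def outer_def Let_def sum_component mult.commute)

context boosted_forest
begin

text \<open>Dividing by the standard deviation turns the threshold
  \<open>\<delta> * sqrt (n * zeta)\<close> into \<open>\<delta> * sqrt n\<close> and moves the
  factor \<open>1 / zeta\<close> into the squared score.\<close>

lemma score_lindeberg:
  assumes pos: "\<And>n. n \<ge> 1 \<Longrightarrow> zeta j n > 0"
    and lind: "\<And>\<delta>. \<delta> > 0 \<Longrightarrow> (\<lambda>n. 1 / zeta j n * expec M (\<lambda>\<omega>. (tree_proj M T x (k n) (V j n) (V j n 1 \<omega>))\<^sup>2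
          * of_bool (\<bar>tree_proj M T x (k n) (V j n) (V j n 1 \<omega>)\<bar> > \<delta> * sqrt (real n * zeta j n)))) \<longlonglongrightarrow> 0"
  shows "lindeberg_cond (score j)"
  unfolding lindeberg_cond_def
proof (intro allI impI)
  fix \<delta> :: real assume "\<delta> > 0"
  from lind[OF this] show "(\<lambda>n. expectation (\<lambda>\<omega>. (score j n (Z 1 \<omega>))\<^sup>2 * of_bool (\<bar>score j n (Z 1 \<omega>)\<bar> > \<delta> * sqrt (real n)))) \<longlonglongrightarrow> 0"
  proof (rule Lim_transform_eventually)
    show "\<forall>\<^sub>F n in sequentially. 1 / zeta j n * expec M (\<lambda>\<omega>. (tree_proj M T x (k n) (V j n) (V j n 1 \<omega>))\<^sup>2
          * of_bool (\<bar>tree_proj M T x (k n) (V j n) (V j n 1 \<omega>)\<bar> > \<delta> * sqrt (real n * zeta j n)))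
        = expectation (\<lambda>\<omega>. (score j n (Z 1 \<omega>))\<^sup>2 * of_bool (\<bar>score j n (Z 1 \<omega>)\<bar> > \<delta> * sqrt (real n)))"
      using eventually_ge_at_top[of 1]
    proof eventually_elim
      case (elim n)
      define t where "t \<omega> = tree_proj M T x (k n) (V j n) (V j n 1 \<omega>)" for \<omega>
      have z: "zeta j n > 0" by (rule pos[OF elim])
      have s: "score j n (Z 1 \<omega>) = t \<omega> / sqrt (zeta j n)" for \<omega>
        unfolding score_def t_def V_stage_map ..
      have "(score j n (Z 1 \<omega>))\<^sup>2 * of_bool (\<bar>score j n (Z 1 \<omega>)\<bar> > \<delta> * sqrt (real n))
          = 1 / zeta j n * ((t \<omega>)\<^sup>2 * of_bool (\<bar>t \<omega>\<bar> > \<delta> * sqrt (real n * zeta j n)))" for \<omega>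
        unfolding s using z by (simp add: power_divide abs_divide less_divide_eq real_sqrt_mult mult.assoc)
      then show ?case unfolding expec_def t_def[symmetric] by simp
    qed
  qed
qed

lemma forest_sd_ratio:
  assumes pos: "\<And>j n. j \<in> {0, 1} \<Longrightarrow> n \<ge> 1 \<Longrightarrow> zeta j n > 0" and lim: "(\<lambda>n. zeta 0 n / zeta 1 n) \<longlonglongrightarrow> c"
  shows "(\<lambda>n. forest_sd 0 n / forest_sd 1 n) \<longlonglongrightarrow> sqrt c"
proof (rule Lim_transform_eventually[OF tendsto_real_sqrt[OF lim]])
  show "\<forall>\<^sub>F n in sequentially. sqrt (zeta 0 n / zeta 1 n) = forest_sd 0 n / forest_sd 1 n"
    using eventually_ge_at_top[of 1]
  proof eventually_elim
    case (elim n)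
    have "real (k n) > 0" "real n > 0" using size[OF elim] elim by auto
    then show ?case by (simp add: forest_sd_def real_sqrt_divide)
  qed
qed

lemma zeta_quot_tendsto:
  assumes "(\<lambda>n. real (k n) * zeta j n / zeta_full M T x (k n) (V j n)) \<longlonglongrightarrow> c" "c \<noteq> 0"
  shows "zeta_quot j \<longlonglongrightarrow> inverse c"
proof -
  have "(\<lambda>n. inverse (real (k n) * zeta j n / zeta_full M T x (k n) (V j n))) \<longlonglongrightarrow> inverse c"
    by (rule tendsto_inverse[OF assms])
  then show ?thesis by (simp add: zeta_quot_def[abs_def])
qed

end

text \<open>If the two forests were proportional, the standardised pair would lie on a line through
  the origin for every choice of \<open>\<Sigma> n\<close>, and such laws cannot converge to the
  normal law of the plane. The hypothesis \<open>nondegenerate\<close> excludes this by keeping the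
  correlation away from \<open>1\<close> and \<open>-1\<close>.\<close>

theorem theorem3:
  fixes M :: "'w measure"
    and D :: "(real \<times> 'a::euclidean_space) measure"
    and Y :: "nat \<Rightarrow> 'w \<Rightarrow> real"
    and X :: "nat \<Rightarrow> 'w \<Rightarrow> 'a"
    and Z :: "nat \<Rightarrow> 'w \<Rightarrow> real \<times> 'a"
    and T :: "'a tree_fun"
    and x :: 'a
    and k B :: "nat \<Rightarrow> nat"
    and w :: "nat \<Rightarrow> nat \<Rightarrow> nat set \<Rightarrow> 'w \<Rightarrow> real"
    and S :: "nat \<Rightarrow> nat \<Rightarrow> nat \<Rightarrow> 'w \<Rightarrow> nat set"
    and V :: "nat \<Rightarrow> nat \<Rightarrow> nat \<Rightarrow> 'w \<Rightarrow> real \<times> 'a"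
    and \<zeta>\<^sub>1 \<zeta>\<^sub>k :: "nat \<Rightarrow> nat \<Rightarrow> real"
    and T\<^sub>1 :: "nat \<Rightarrow> nat \<Rightarrow> real \<times> 'a \<Rightarrow> real"
    and F :: "nat \<Rightarrow> nat \<Rightarrow> 'w \<Rightarrow> real"
    and \<Sigma>\<^sub>I\<^sub>J :: "nat \<Rightarrow> 'w \<Rightarrow> real ^ 2 ^ 2"
  defines "Z \<equiv> \<lambda>i \<omega>. (Y i \<omega>, X i \<omega>)"
    and "V \<equiv> stage_data M T k w Z"
    and "\<zeta>\<^sub>1 \<equiv> \<lambda>j n. zeta_one M T x (k n) (V j n)"
    and "\<zeta>\<^sub>k \<equiv> \<lambda>j n. zeta_full M T x (k n) (V j n)"
    and "T\<^sub>1 \<equiv> \<lambda>j n. tree_proj M T x (k n) (V j n)"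
    and "F \<equiv> \<lambda>j n. Ftilde M T k w Z j n x"
    and "\<Sigma>\<^sub>I\<^sub>J \<equiv> \<lambda>n \<omega>. jackknife_matrix T x n (B n) (\<lambda>j b. S j n b \<omega>) (\<lambda>j i. V j n i \<omega>)"
  assumes prob: "prob_space M"
    and data_indep: "prob_space.indep_vars M (\<lambda>_. borel) Z {1..}"
    and data_distr: "\<forall>i\<ge>1. distr M borel (Z i) = D"
    and tree: "measurable_tree T"
    and size: "\<forall>n\<ge>1. 1 \<le> k n \<and> k n \<le> n"
    and weights: "\<forall>n\<ge>1. forest_weights M Z n (k n) (B n) (\<lambda>j. w j n)"
    and draws: "\<forall>n\<ge>1. uniform_draws M Z n (k n) (B n) (\<lambda>j. S j n)"
    and zeta_pos: "\<forall>j\<in>{0, 1}. \<forall>n\<ge>1. \<zeta>\<^sub>1 j n > 0"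
    and centred: "\<forall>j\<in>{0, 1}. \<forall>n\<ge>1. expec M (\<lambda>\<omega>. tree_on T x (\<lambda>i. V j n i \<omega>) {1..k n}) = 0"
    and fourth_moment: "\<exists>C. \<forall>j\<in>{0, 1}. \<forall>n\<ge>1. \<forall>u.
          integrable M (\<lambda>\<omega>. tree_on T u (\<lambda>i. V j n i \<omega>) {1..k n} ^ 4) \<and>
          expec M (\<lambda>\<omega>. tree_on T u (\<lambda>i. V j n i \<omega>) {1..k n} ^ 4) \<le> C"
    and zeta_ratio: "\<exists>c>0. (\<lambda>n. \<zeta>\<^sub>1 0 n / \<zeta>\<^sub>1 1 n) \<longlonglongrightarrow> c"
    and residual_var: "\<forall>\<^sub>F n in sequentially.
          integrable M (\<lambda>\<omega>. (Fhat1 T k w Z n x \<omega>)\<^sup>2) \<and> var M (Fhat1 T k w Z n x) > 0"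
    and residual_negligible: "tendsto_in_prob M
          (\<lambda>n \<omega>. (Fhat1 T k w Z n x \<omega> - Fcheck1 M T k w Z n x \<omega>)
                  / sqrt (var M (Fhat1 T k w Z n x))) 0"
    and lindeberg: "\<forall>j\<in>{0, 1}. \<forall>\<delta>>0.
          (\<lambda>n. 1 / \<zeta>\<^sub>1 j n * expec M (\<lambda>\<omega>. (T\<^sub>1 j n (V j n 1 \<omega>))\<^sup>2
                  * of_bool (\<bar>T\<^sub>1 j n (V j n 1 \<omega>)\<bar> > \<delta> * sqrt (real n * \<zeta>\<^sub>1 j n)))) \<longlonglongrightarrow> 0"
    and k_lim: "filterlim k at_top sequentially"
    and B_lim: "filterlim B at_top sequentially"
    and k_over_n: "(\<lambda>n. real (k n) / real n) \<longlonglongrightarrow> 0"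
    and n_over_B: "(\<lambda>n. real n / real (B n)) \<longlonglongrightarrow> 0"
    and zeta_k_ratio: "\<forall>j\<in>{0, 1}. \<exists>c. c \<noteq> 0 \<and> (\<lambda>n. real (k n) * \<zeta>\<^sub>1 j n / \<zeta>\<^sub>k j n) \<longlonglongrightarrow> c"
    and nondegenerate: "\<exists>r<1. \<forall>\<^sub>F n in sequentially.
          \<bar>cov M (F 0 n) (F 1 n)\<bar> \<le> r * sqrt (var M (F 0 n) * var M (F 1 n))"
  shows "\<exists>\<Sigma> :: nat \<Rightarrow> real ^ 2 ^ 2.
      (\<forall>n. pos_semidef (\<Sigma> n) \<and> invertible (\<Sigma> n)) \<and>
      tendsto_in_distribution M
        (\<lambda>n \<omega>. matrix_inv (mat_sqrt (\<Sigma> n)) *v vector [F 0 n \<omega>, F 1 n \<omega>]) std_normal_vec \<and>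
      tendsto_in_prob M (\<lambda>n \<omega>. matrix_inv (\<Sigma> n) ** \<Sigma>\<^sub>I\<^sub>J n \<omega>) (mat 1)"
proof -
  interpret prob_space M by (rule prob)
  interpret boosted_forest M Z D T x k B w S
  proof (intro boosted_forest.intro iid_sample.intro iid_sample_axioms.intro boosted_forest_axioms.intro prob data_indep tree)
    show "distr M borel (Z i) = D" if "i \<ge> 1" for i using data_distr that by blast
    show "1 \<le> k n \<and> k n \<le> n" if "n \<ge> 1" for n using size that by blast
    show "forest_weights M Z n (k n) (B n) (\<lambda>j. w j n)" if "n \<ge> 1" for n using weights that by blast
    show "uniform_draws M Z n (k n) (B n) (\<lambda>j. S j n)" if "n \<ge> 1" for n using draws that by blast
    show "expec M (\<lambda>\<omega>. tree_on T x (\<lambda>i. stage_data M T k w Z j n i \<omega>) {1..k n}) = 0" if "j \<in> {0, 1}" "n \<ge> 1" for j n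
      using centred that unfolding V_def by blast
    show "integrable M (\<lambda>\<omega>. tree_on T x (\<lambda>i. stage_data M T k w Z j n i \<omega>) {1..k n} ^ 4)" if "j \<in> {0, 1}" "n \<ge> 1" for j n
      using fourth_moment that unfolding V_def by blast
  qed
  have zeta: "\<zeta>\<^sub>1 j n = zeta j n" for j n unfolding \<zeta>\<^sub>1_def zeta_def V_def ..
  have pos: "zeta j n > 0" if "j \<in> {0, 1}" "n \<ge> 1" for j n using zeta_pos that unfolding zeta by blast
  have j: "(0::nat) \<in> {0, 1}" "(1::nat) \<in> {0, 1}" by simp_all
  \<comment> \<open>The overlap estimates require \<open>2 * k n \<le> n\<close>, which holds
    eventually because \<open>k n / n\<close> tends to \<open>0\<close>.\<close>
  have large: "\<forall>\<^sub>F n in sequentially. n \<ge> 1 \<and> 2 * k n \<le> n \<and> 1 \<le> B n"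
  proof -
    have "\<forall>\<^sub>F n in sequentially. real (k n) / real n < 1 / 2" by (rule order_tendstoD(2)[OF k_over_n]) simp
    moreover have "\<forall>\<^sub>F n in sequentially. 1 \<le> B n" using B_lim unfolding filterlim_at_top by blast
    ultimately show ?thesis using eventually_ge_at_top[of 1]
    proof eventually_elim
      case (elim n)
      then show ?case by (simp add: divide_less_eq)
    qed
  qed
  have quot: "\<exists>c. zeta_quot j \<longlonglongrightarrow> c" if j: "j \<in> {0, 1}" for j
  proof -
    obtain c where c: "c \<noteq> 0" "(\<lambda>n. real (k n) * \<zeta>\<^sub>1 j n / \<zeta>\<^sub>k j n) \<longlonglongrightarrow> c" using zeta_k_ratio j by blast
    show ?thesis using zeta_quot_tendsto[OF c(2)[unfolded zeta \<zeta>\<^sub>k_def V_def] c(1)] by (rule exI)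
  qed
  have score: "\<forall>\<^sub>F n in sequentially. std_score n (score j n)" "\<forall>\<^sub>F n in sequentially. 0 < forest_sd j n"
    "\<forall>\<^sub>F n in sequentially. F j n \<in> borel_measurable M \<and> integrable M (\<lambda>\<omega>. (F j n \<omega>)\<^sup>2)"
    "\<forall>\<^sub>F n in sequentially. expectation (F j n) = 0"
    "(\<lambda>n. expectation (\<lambda>\<omega>. (F j n \<omega> / forest_sd j n - score_mean n (score j n) \<omega>)\<^sup>2)) \<longlonglongrightarrow> 0"
    "lindeberg_cond (score j)" if j: "j \<in> {0, 1}" for j
  proof -
    have st: "\<forall>\<^sub>F n in sequentially. std_score n (score j n) \<and> 0 < forest_sd j n \<and> F j n \<in> borel_measurable M
        \<and> integrable M (\<lambda>\<omega>. (F j n \<omega>)\<^sup>2) \<and> expectation (F j n) = 0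
        \<and> expectation (\<lambda>\<omega>. (F j n \<omega> / forest_sd j n - score_mean n (score j n) \<omega>)\<^sup>2) \<le> real (k n) / real n * zeta_quot j n"
      using large
    proof eventually_elim
      case (elim n)
      then have h: "n \<ge> 1" "2 * k n \<le> n" "1 \<le> B n" by blast+
      show ?case unfolding F_def by (intro conjI stage_forest(1-6)[OF j h pos[OF j h(1)]])
    qed
    show "\<forall>\<^sub>F n in sequentially. std_score n (score j n)" using st by eventually_elim blast
    show "\<forall>\<^sub>F n in sequentially. 0 < forest_sd j n" using st by eventually_elim blast
    show "\<forall>\<^sub>F n in sequentially. F j n \<in> borel_measurable M \<and> integrable M (\<lambda>\<omega>. (F j n \<omega>)\<^sup>2)" using st by eventually_elim blast
    show "\<forall>\<^sub>F n in sequentially. expectation (F j n) = 0" using st by eventually_elim blast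
    obtain c where c: "zeta_quot j \<longlonglongrightarrow> c" using quot[OF j] by blast
    have "(\<lambda>n. real (k n) / real n * zeta_quot j n) \<longlonglongrightarrow> 0 * c" by (intro tendsto_intros k_over_n c)
    then have lim: "(\<lambda>n. real (k n) / real n * zeta_quot j n) \<longlonglongrightarrow> 0" by simp
    show "(\<lambda>n. expectation (\<lambda>\<omega>. (F j n \<omega> / forest_sd j n - score_mean n (score j n) \<omega>)\<^sup>2)) \<longlonglongrightarrow> 0"
      by (rule Lim_null_comparison[OF _ lim]) (use st in \<open>eventually_elim, simp\<close>)
    show "lindeberg_cond (score j)"
    proof (rule score_lindeberg[OF pos[OF j]])
      fix \<delta> :: real assume "\<delta> > 0"
      then show "(\<lambda>n. 1 / zeta j n * expec M (\<lambda>\<omega>. (tree_proj M T x (k n) (stage_data M T k w Z j n) (stage_data M T k w Z j n 1 \<omega>))\<^sup>2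
          * of_bool (\<bar>tree_proj M T x (k n) (stage_data M T k w Z j n) (stage_data M T k w Z j n 1 \<omega>)\<bar> > \<delta> * sqrt (real n * zeta j n)))) \<longlonglongrightarrow> 0"
        using lindeberg j unfolding zeta T\<^sub>1_def V_def by blast
    qed
  qed
  \<comment> \<open>The guard makes the existence claim true for every \<open>n\<close>, so that a
    whole sequence of jackknife vectors can be chosen.\<close>
  have ex: "\<forall>n. \<exists>C. n \<ge> 1 \<and> 2 * k n \<le> n \<and> 1 \<le> B n \<longrightarrow> (\<forall>i\<in>{1..n}. C i \<in> borel_measurable M)
      \<and> integrable M (\<lambda>\<omega>. \<Sum>i=1..n. (C i \<omega> - score j n (Z i \<omega>) / sqrt (real n))\<^sup>2)
      \<and> expectation (\<lambda>\<omega>. \<Sum>i=1..n. (C i \<omega> - score j n (Z i \<omega>) / sqrt (real n))\<^sup>2)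
        \<le> (8 * (real n / real (B n)) + 6 * (real (k n) / real n)) * zeta_quot j n
      \<and> (AE \<omega> in M. \<forall>i\<in>{1..n}. jackknife_cov T x (B n) (\<lambda>b. S j n b \<omega>) (\<lambda>i. V j n i \<omega>) i = forest_sd j n * C i \<omega>)"
    (is "\<forall>n. \<exists>C. ?h n \<longrightarrow> ?Q n C") if j: "j \<in> {0, 1}" for j
  proof
    fix n
    show "\<exists>C. ?h n \<longrightarrow> ?Q n C"
    proof (cases "?h n")
    case True
    then have h: "n \<ge> 1" "2 * k n \<le> n" "1 \<le> B n" by blast+
    from stage_forest(7)[OF j h pos[OF j h(1)]] obtain C where "?Q n C" unfolding V_def by (elim exE)
    then show ?thesis by (intro exI impI)
  next
    case False
    then show ?thesis by (intro exI impI) (erule notE)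
    qed
  qed
  define R where "R j C \<longleftrightarrow> (\<forall>\<^sub>F n in sequentially. (\<forall>i\<in>{1..n}. C n i \<in> borel_measurable M)
        \<and> integrable M (\<lambda>\<omega>. \<Sum>i=1..n. (C n i \<omega> - score j n (Z i \<omega>) / sqrt (real n))\<^sup>2))
      \<and> (\<lambda>n. expectation (\<lambda>\<omega>. \<Sum>i=1..n. (C n i \<omega> - score j n (Z i \<omega>) / sqrt (real n))\<^sup>2)) \<longlonglongrightarrow> 0
      \<and> (\<forall>\<^sub>F n in sequentially. AE \<omega> in M. \<forall>i\<in>{1..n}.
          jackknife_cov T x (B n) (\<lambda>b. S j n b \<omega>) (\<lambda>i. V j n i \<omega>) i = forest_sd j n * C n i \<omega>)" for j C
  have jk: "\<exists>C. R j C" if j: "j \<in> {0, 1}" for j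
  proof -
    from choice[OF ex[OF j]] obtain C where C: "\<forall>n. n \<ge> 1 \<and> 2 * k n \<le> n \<and> 1 \<le> B n \<longrightarrow> (\<forall>i\<in>{1..n}. C n i \<in> borel_measurable M)
      \<and> integrable M (\<lambda>\<omega>. \<Sum>i=1..n. (C n i \<omega> - score j n (Z i \<omega>) / sqrt (real n))\<^sup>2)
      \<and> expectation (\<lambda>\<omega>. \<Sum>i=1..n. (C n i \<omega> - score j n (Z i \<omega>) / sqrt (real n))\<^sup>2)
        \<le> (8 * (real n / real (B n)) + 6 * (real (k n) / real n)) * zeta_quot j n
      \<and> (AE \<omega> in M. \<forall>i\<in>{1..n}. jackknife_cov T x (B n) (\<lambda>b. S j n b \<omega>) (\<lambda>i. V j n i \<omega>) i = forest_sd j n * C n i \<omega>)"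
      by (elim exE)
    have Ce: "\<forall>\<^sub>F n in sequentially. (\<forall>i\<in>{1..n}. C n i \<in> borel_measurable M)
      \<and> integrable M (\<lambda>\<omega>. \<Sum>i=1..n. (C n i \<omega> - score j n (Z i \<omega>) / sqrt (real n))\<^sup>2)
      \<and> expectation (\<lambda>\<omega>. \<Sum>i=1..n. (C n i \<omega> - score j n (Z i \<omega>) / sqrt (real n))\<^sup>2)
        \<le> (8 * (real n / real (B n)) + 6 * (real (k n) / real n)) * zeta_quot j n
      \<and> (AE \<omega> in M. \<forall>i\<in>{1..n}. jackknife_cov T x (B n) (\<lambda>b. S j n b \<omega>) (\<lambda>i. V j n i \<omega>) i = forest_sd j n * C n i \<omega>)"
      using large by eventually_elim (rule C[rule_format])
    obtain c where c: "zeta_quot j \<longlonglongrightarrow> c" using quot[OF j] by blast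
    have "(\<lambda>n. (8 * (real n / real (B n)) + 6 * (real (k n) / real n)) * zeta_quot j n) \<longlonglongrightarrow> (8 * 0 + 6 * 0) * c"
      by (intro tendsto_intros k_over_n n_over_B c)
    then have lim: "(\<lambda>n. (8 * (real n / real (B n)) + 6 * (real (k n) / real n)) * zeta_quot j n) \<longlonglongrightarrow> 0" by simp
    have "R j C"
      unfolding R_def
    proof (intro conjI)
      show "\<forall>\<^sub>F n in sequentially. (\<forall>i\<in>{1..n}. C n i \<in> borel_measurable M)
        \<and> integrable M (\<lambda>\<omega>. \<Sum>i=1..n. (C n i \<omega> - score j n (Z i \<omega>) / sqrt (real n))\<^sup>2)"
        using Ce by eventually_elim (elim conjE, intro conjI)
      show "\<forall>\<^sub>F n in sequentially. AE \<omega> in M. \<forall>i\<in>{1..n}.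
          jackknife_cov T x (B n) (\<lambda>b. S j n b \<omega>) (\<lambda>i. V j n i \<omega>) i = forest_sd j n * C n i \<omega>"
        using Ce by eventually_elim (elim conjE)
      have "\<forall>\<^sub>F n in sequentially. norm (expectation (\<lambda>\<omega>. \<Sum>i=1..n. (C n i \<omega> - score j n (Z i \<omega>) / sqrt (real n))\<^sup>2))
          \<le> (8 * (real n / real (B n)) + 6 * (real (k n) / real n)) * zeta_quot j n"
        using Ce by eventually_elim (simp add: integral_nonneg_AE sum_nonneg)
      then show "(\<lambda>n. expectation (\<lambda>\<omega>. \<Sum>i=1..n. (C n i \<omega> - score j n (Z i \<omega>) / sqrt (real n))\<^sup>2)) \<longlonglongrightarrow> 0"
        using lim by (rule Lim_null_comparison)
    qed
    then show ?thesis by (rule exI[of _ C])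
  qed
  obtain C0 C1 where R: "R 0 C0" "R 1 C1" using jk[OF j(1)] jk[OF j(2)] by blast
  note C0 = R(1)[unfolded R_def, THEN conjunct1] R(1)[unfolded R_def, THEN conjunct2, THEN conjunct1]
    R(1)[unfolded R_def, THEN conjunct2, THEN conjunct2]
  note C1 = R(2)[unfolded R_def, THEN conjunct1] R(2)[unfolded R_def, THEN conjunct2, THEN conjunct1]
    R(2)[unfolded R_def, THEN conjunct2, THEN conjunct2]
  obtain c where c: "c > 0" "(\<lambda>n. zeta 0 n / zeta 1 n) \<longlonglongrightarrow> c" using zeta_ratio unfolding zeta by blast
  obtain r where r: "r < 1" "\<forall>\<^sub>F n in sequentially. \<bar>cov M (F 0 n) (F 1 n)\<bar> \<le> r * sqrt (var M (F 0 n) * var M (F 1 n))"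
    using nondegenerate by blast
  show ?thesis
  proof (rule paired_limit[OF score(1)[OF j(1)] score(1)[OF j(2)] score(6)[OF j(1)] score(6)[OF j(2)]
        score(2)[OF j(1)] score(2)[OF j(2)] forest_sd_ratio[OF pos c(2)] _ score(3)[OF j(1)] score(3)[OF j(2)]
        score(5)[OF j(1)] score(5)[OF j(2)] r(1) _ C0(1) C1(1) C0(2) C1(2)])
    show "0 < sqrt c" using c(1) by simp
    \<comment> \<open>Both forests are centred for large \<open>n\<close>, so their covariances are
      plain mixed moments.\<close>
    show "\<forall>\<^sub>F n in sequentially. \<bar>expectation (\<lambda>\<omega>. F 0 n \<omega> * F 1 n \<omega>)\<bar>
        \<le> r * sqrt (expectation (\<lambda>\<omega>. (F 0 n \<omega>)\<^sup>2) * expectation (\<lambda>\<omega>. (F 1 n \<omega>)\<^sup>2))"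
      using r(2) score(4)[OF j(1)] score(4)[OF j(2)]
      by eventually_elim (simp add: cov_def expec_def power2_eq_square)
    show "\<forall>\<^sub>F n in sequentially. AE \<omega> in M.
        \<Sigma>\<^sub>I\<^sub>J n \<omega> $ 1 $ 1 = (forest_sd 0 n)\<^sup>2 * (\<Sum>i=1..n. C0 n i \<omega> * C0 n i \<omega>) \<and>
        \<Sigma>\<^sub>I\<^sub>J n \<omega> $ 1 $ 2 = forest_sd 0 n * forest_sd 1 n * (\<Sum>i=1..n. C0 n i \<omega> * C1 n i \<omega>) \<and>
        \<Sigma>\<^sub>I\<^sub>J n \<omega> $ 2 $ 1 = forest_sd 0 n * forest_sd 1 n * (\<Sum>i=1..n. C0 n i \<omega> * C1 n i \<omega>) \<and>
        \<Sigma>\<^sub>I\<^sub>J n \<omega> $ 2 $ 2 = (forest_sd 1 n)\<^sup>2 * (\<Sum>i=1..n. C1 n i \<omega> * C1 n i \<omega>)"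
      using C0(3) C1(3)
    proof eventually_elim
      case (elim n)
      \<comment> \<open>Each jackknife covariance is the standard deviation of its stage times a
        standardised entry, so both factors leave the sum.\<close>
      have pull: "(\<Sum>i=1..n. f i * g i) = a * b * (\<Sum>i=1..n. p i * q i)"
        if "\<forall>i\<in>{1..n}. f i = a * p i" "\<forall>i\<in>{1..n}. g i = b * q i" for a b :: real and f g p q
        unfolding sum_distrib_left by (rule sum.cong) (use that in \<open>simp_all add: mult_ac\<close>)
      show ?case using elim
      proof eventually_elim
        case (elim \<omega>)
        show ?case unfolding \<Sigma>\<^sub>I\<^sub>J_def jackknife_matrix_nth power2_eq_square
          by (intro conjI pull elim)
      qed
    qed
  qed
qed

end
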